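(* Let $\epsilon_0$ be a real number such that $\frac{\sqrt5-1}{2}<\epsilon_0<1$ and let $F:\,]-\infty,1[\,\to\mathbb R$ be a measurable function such that for all real $x,y$ with $0<x<y<\epsilon_0$, $$2F(U_1)+2F(U_2)-F(U_3)+2F(U_4)+2F(U_5)-F(U_6)+2F(U_7)+2F(U_8)-F(U_9)=E_3(x,y),$$ where each $U_i$ is evaluated at $(x,y)$. - If $F$ is continuous at $0$, then there exists $a\in\mathbb R$ such that $F=\mathrm{Li}_3+a\left(\mathcal L_3-\tfrac29\mathrm{Li}_3(1)\right)$ on $]-\infty,1[$. - If $F$ is differentiable at $0$, then $F=\mathrm{Li}_3$ on $]-\infty,1[$.
   Context: The functions $U_i$ are $$U_1=x,\quad U_2=y,\quad U_3=\frac{x}{y},\quad U_4=\frac{1-y}{1-x},\quad U_5=\frac{x(1-y)}{y(1-x)},\quad U_6=xy,$$ $$U_7=\frac{x(1-y)}{x-1},\quad U_8=\frac{1-y}{y(x-1)},\quad U_9=\frac{x(1-y)^2}{y(1-x)^2},$$ and $$E_3(x,y)=2\,\mathrm{Li}_3(1)-\log(y)^2\log\left(\frac{1-y}{1-x}\right)+\frac{\pi^2}{3}\log(y)+\frac13\log(y)^3 .$$ $\mathrm{Li}_n$ is the $n$-th polylogarithm, $\mathrm{Li}_n(z)=\sum_{k\ge1}z^k/k^n$ for $|z|<1$, analytically continued (real-valued) to $]-\infty,1[$; $\mathrm{Li}_1(z)=-\log(1-z)$ and $\mathrm{Li}_3(1)=\sum_{k\ge1}1/k^3$. The function $\mathcal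 L_3$ is the single-valued version of the trilogarithm, $$\mathcal L_3(z)=\mathrm{Re}\left(\mathrm{Li}_3(z)-\log|z|\,\mathrm{Li}_2(z)+\tfrac13(\log|z|)^2\,\mathrm{Li}_1(z)\right),$$ extended by continuity with $\mathcal L_3(0)=0$; here it is restricted to $]-\infty,1[$. *)

theory Defs
  imports "HOL-Complex_Analysis.Complex_Analysis"
begin

definition slit_plane :: "complex set" where
  "slit_plane = - (complex_of_real ` {1..})"

(* z^k / k^n summed over k >= 1 *)
definition polylog_series :: "nat \<Rightarrow> complex \<Rightarrow> complex" where
  "polylog_series n z = (\<Sum>k. z ^ Suc k / of_nat (Suc k) ^ n)"

(* The analytic continuation of the series to the slit plane. Existence and uniqueness are
   proved below; the values on the cut [1, \<infinity>) are unspecified. *)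
definition polylog :: "nat \<Rightarrow> complex \<Rightarrow> complex" where
  "polylog n = (SOME f. f holomorphic_on slit_plane \<and> (\<forall>z\<in>ball 0 1. f z = polylog_series n z))"

(* On ]-\<infinity>, 1[ the continuation is real-valued (polylog_of_real below). *)
definition Li :: "nat \<Rightarrow> real \<Rightarrow> real" where
  "Li n x = Re (polylog n (complex_of_real x))"

(* Li_3(1), which lies on the cut and is therefore given by its own series *)
definition Li3_one :: real where
  "Li3_one = (\<Sum>k. 1 / real (Suc k) ^ 3)"

(* meaningful on the slit plane only *)
definition L3 :: "complex \<Rightarrow> real" where
  "L3 z = (if z = 0 then 0 else
     Re (polylog 3 z - of_real (ln (cmod z)) * polylog 2 z
         + 1 / 3 * of_real (ln (cmod z)) ^ 2 * polylog 1 z))"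

definition U1 :: "real \<Rightarrow> real \<Rightarrow> real" where "U1 x y = x"
definition U2 :: "real \<Rightarrow> real \<Rightarrow> real" where "U2 x y = y"
definition U3 :: "real \<Rightarrow> real \<Rightarrow> real" where "U3 x y = x / y"
definition U4 :: "real \<Rightarrow> real \<Rightarrow> real" where "U4 x y = (1 - y) / (1 - x)"
definition U5 :: "real \<Rightarrow> real \<Rightarrow> real" where "U5 x y = (x * (1 - y)) / (y * (1 - x))"
definition U6 :: "real \<Rightarrow> real \<Rightarrow> real" where "U6 x y = x * y"
definition U7 :: "real \<Rightarrow> real \<Rightarrow> real" where "U7 x y = (x * (1 - y)) / (x - 1)"
definition U8 :: "real \<Rightarrow> real \<Rightarrow> real" where "U8 x y = (1 - y) / (y * (x - 1))"
definition U9 :: "real \<Rightarrow> real \<Rightarrow> real" where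
  "U9 x y = (x * (1 - y) ^ 2) / (y * (1 - x) ^ 2)"

definition E3 :: "real \<Rightarrow> real \<Rightarrow> real" where
  "E3 x y = 2 * Li3_one - (ln y) ^ 2 * ln ((1 - y) / (1 - x)) + pi ^ 2 / 3 * ln y + 1 / 3 * (ln y) ^ 3"


subsection \<open>The polylogarithms are well-defined\<close>

lemma open_slit_plane: "open slit_plane"
  unfolding slit_plane_def
  by (intro open_Compl closed_injective_linear_image linear_of_real)
     (auto intro: inj_of_real)

lemma one_notin_slit_plane: "1 \<notin> slit_plane"
  unfolding slit_plane_def by (auto intro!: image_eqI[of _ _ 1])

lemma ball_subset_slit_plane: "ball 0 1 \<subseteq> slit_plane"
  unfolding slit_plane_def by auto

lemma starlike_slit_plane: "starlike slit_plane"
  unfolding starlike_def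
proof (intro bexI ballI subsetI)
  show "(0::complex) \<in> slit_plane" using ball_subset_slit_plane by auto
next
  fix z w :: complex assume z: "z \<in> slit_plane" and w: "w \<in> closed_segment 0 z"
  then obtain u where u: "0 \<le> u" "u \<le> 1" "w = of_real u * z"
    by (auto simp: in_segment scaleR_conv_of_real)
  show "w \<in> slit_plane"
  proof (rule ccontr)
    assume "w \<notin> slit_plane"
    then obtain r where r: "r \<ge> 1" "w = of_real r" by (auto simp: slit_plane_def)
    with u have "u > 0" by (cases "u = 0") auto
    with u r have "z = of_real (r / u)" by (simp add: field_simps)
    moreover have "r / u \<in> {1..}" using r u \<open>u > 0\<close> by (simp add: field_simps)
    ultimately show False using z unfolding slit_plane_def by blast
  qed
qed

lemma connected_slit_plane: "connected slit_plane"
  by (rule starlike_imp_connected[OF starlike_slit_plane])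

lemma polylog_series_summable:
  assumes "cmod z < 1"
  shows "summable (\<lambda>k. z ^ Suc k / of_nat (Suc k) ^ n)"
proof (rule summable_comparison_test)
  show "\<exists>N. \<forall>k\<ge>N. norm (z ^ Suc k / of_nat (Suc k) ^ n) \<le> cmod z ^ Suc k"
  proof (intro exI allI impI)
    fix k :: nat
    have "(1::real) \<le> real (Suc k) ^ n" by (rule one_le_power) simp
    moreover have "norm (z ^ Suc k / of_nat (Suc k) ^ n) = cmod z ^ Suc k / real (Suc k) ^ n"
      by (simp only: norm_divide norm_power norm_of_nat)
    moreover have "cmod z ^ Suc k \<ge> 0" by simp
    ultimately show "norm (z ^ Suc k / of_nat (Suc k) ^ n) \<le> cmod z ^ Suc k"
      by (metis div_by_1 divide_left_mono zero_less_one mult.commute mult_1 order_less_le_trans)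
  qed
  show "summable (\<lambda>k. cmod z ^ Suc k)"
    using assms by (subst summable_Suc_iff) (simp add: summable_geometric)
qed

lemma polylog_series_power_series:
  assumes "cmod z < 1"
  shows "(\<lambda>k. (if k = 0 then 0 else 1 / of_nat k ^ n) * z ^ k) sums polylog_series n z"
proof -
  have "(\<lambda>k. z ^ Suc k / of_nat (Suc k) ^ n) sums polylog_series n z"
    using summable_sums[OF polylog_series_summable[OF assms, of n]]
    by (simp only: polylog_series_def)
  then have "(\<lambda>k. (if Suc k = 0 then 0 else 1 / of_nat (Suc k) ^ n) * z ^ Suc k)
      sums polylog_series n z"
    by (simp only: nat.distinct if_False times_divide_eq_left mult_1)
  then show ?thesis by (subst (asm) sums_Suc_iff) simp
qed

lemma polylog_series_0_right: "polylog_series n 0 = 0"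
  by (simp add: polylog_series_def)

lemma polylog_series_0_left:
  assumes "cmod z < 1"
  shows "polylog_series 0 z = z / (1 - z)"
proof -
  have "(\<lambda>k. z * z ^ k) sums (z * (1 / (1 - z)))"
    by (intro sums_mult geometric_sums) (use assms in simp)
  then show ?thesis by (simp add: polylog_series_def sums_iff)
qed

lemma polylog_series_has_field_derivative:
  assumes z: "cmod z < 1" "z \<noteq> 0"
  shows "(polylog_series (Suc n) has_field_derivative polylog_series n z / z) (at z)"
proof -
  define c where "c n k = (if k = 0 then 0 else 1 / of_nat k ^ n :: complex)" for n k :: nat
  have s: "(\<lambda>k. c n k * w ^ k) sums polylog_series n w" if "cmod w < 1" for n w
    using polylog_series_power_series[OF that] by (simp only: c_def)
  have d: "((\<lambda>w. \<Sum>k. c (Suc n) k * w ^ k) has_field_derivative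
             (\<Sum>k. diffs (c (Suc n)) k * z ^ k)) (at z)"
    by (rule termdiffs_strong'[where K = 1]) (use s z sums_summable in blast)+
  have "(\<lambda>k. c n (Suc k) * z ^ Suc k) sums polylog_series n z"
    using s[OF z(1), of n] by (subst sums_Suc_iff) (simp add: c_def)
  then have "(\<lambda>k. c n (Suc k) * z ^ Suc k / z) sums (polylog_series n z / z)"
    by (rule sums_divide)
  moreover have "c n (Suc k) * z ^ Suc k / z = diffs (c (Suc n)) k * z ^ k" for k
  proof -
    have "(of_nat (Suc k) :: complex) \<noteq> 0" by (rule of_nat_neq_0)
    then show ?thesis using z(2)
      by (simp add: c_def diffs_def del: of_nat_Suc)
  qed
  ultimately have "(\<Sum>k. diffs (c (Suc n)) k * z ^ k) = polylog_series n z / z"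
    by (simp add: sums_iff)
  with d have "((\<lambda>w. \<Sum>k. c (Suc n) k * w ^ k) has_field_derivative
                 polylog_series n z / z) (at z)" by simp
  then show ?thesis
    by (rule has_field_derivative_transform_within_open[where S = "ball 0 1"])
       (use z s in \<open>auto simp: sums_iff\<close>)
qed

lemma continuous_on_polylog_series: "continuous_on (ball 0 1) (polylog_series n)"
proof -
  have "isCont (\<lambda>w. \<Sum>k. (if k = 0 then 0 else 1 / of_nat k ^ n) * w ^ k) z"
    if "cmod z < 1" for z :: complex
    by (rule DERIV_isCont, rule termdiffs_strong'[where K = 1])
       (use that polylog_series_power_series sums_summable in blast)+
  then have "continuous_on (ball 0 1)
      (\<lambda>w::complex. \<Sum>k. (if k = 0 then 0 else 1 / of_nat k ^ n) * w ^ k)"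
    by (intro continuous_at_imp_continuous_on ballI) simp
  then show ?thesis
    by (rule continuous_on_eq) (use polylog_series_power_series in \<open>auto simp: sums_iff\<close>)
qed

lemma polylog_exists:
  "\<exists>f. f holomorphic_on slit_plane \<and> (\<forall>z\<in>ball 0 1. f z = polylog_series n z)"
proof (induction n)
  case 0
  have "(\<lambda>z. z / (1 - z)) holomorphic_on slit_plane"
    using one_notin_slit_plane by (auto intro!: holomorphic_intros)
  then show ?case by (intro exI[of _ "\<lambda>z. z / (1 - z)"]) (auto simp: polylog_series_0_left)
next
  case (Suc n)
  then obtain f where f: "f holomorphic_on slit_plane"
    and fs: "\<And>z. cmod z < 1 \<Longrightarrow> f z = polylog_series n z" by auto
  have f0: "f 0 = 0" by (simp add: fs polylog_series_0_right)
  define g where "g z = (if z = 0 then deriv f 0 else f z / z)" for z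
  have g: "g holomorphic_on slit_plane"
    by (rule pole_theorem_open_0[OF f open_slit_plane, of 0]) (auto simp: g_def f0)
  obtain h where h: "\<And>z. z \<in> slit_plane \<Longrightarrow> (h has_field_derivative g z) (at z)"
    using holomorphic_starlike_primitive[OF holomorphic_on_imp_continuous_on[OF g]
        starlike_slit_plane open_slit_plane finite.emptyI]
      holomorphic_on_imp_differentiable_at[OF g open_slit_plane] by auto
  have hb: "(h has_field_derivative g z) (at z)" if "z \<in> ball 0 1" for z
    using h that ball_subset_slit_plane by auto
  have cont: "continuous_on (ball 0 1) (\<lambda>z. h z - polylog_series (Suc n) z)"
    by (intro continuous_intros continuous_on_polylog_series continuous_at_imp_continuous_on ballI)
       (use hb DERIV_isCont in blast)
  have der: "\<forall>z\<in>ball 0 1 - {0}. DERIV (\<lambda>z. h z - polylog_series (Suc n) z) z :> 0"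
  proof
    fix z :: complex assume z: "z \<in> ball 0 1 - {0}"
    have "DERIV (\<lambda>z. h z - polylog_series (Suc n) z) z :> g z - polylog_series n z / z"
      by (intro DERIV_diff hb polylog_series_has_field_derivative) (use z in auto)
    moreover have "g z = polylog_series n z / z" using z by (simp add: g_def fs)
    ultimately show "DERIV (\<lambda>z. h z - polylog_series (Suc n) z) z :> 0" by simp
  qed
  obtain c where c: "\<And>z. z \<in> ball 0 1 \<Longrightarrow> h z - polylog_series (Suc n) z = c"
    using DERIV_zero_connected_constant[OF connected_ball open_ball _ cont der] by auto
  show ?case
  proof (intro exI conjI ballI)
    show "(\<lambda>z. h z - c) holomorphic_on slit_plane"
      by (intro holomorphic_intros)
         (use h in \<open>auto simp: holomorphic_on_open[OF open_slit_plane]\<close>)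
    show "h z - c = polylog_series (Suc n) z" if "z \<in> ball 0 1" for z
      using c[OF that] by (simp add: algebra_simps)
  qed
qed

lemma polylog_holomorphic: "polylog n holomorphic_on slit_plane"
  and polylog_eq_series: "cmod z < 1 \<Longrightarrow> polylog n z = polylog_series n z"
  using someI_ex[OF polylog_exists[of n]] by (auto simp: polylog_def)

lemma polylog_unique:
  assumes f: "f holomorphic_on slit_plane" "\<And>z. cmod z < 1 \<Longrightarrow> f z = polylog_series n z"
    and z: "z \<in> slit_plane"
  shows "f z = polylog n z"
  by (rule analytic_continuation_open[where s = "ball 0 1" and s' = slit_plane])
     (use assms ball_subset_slit_plane open_slit_plane connected_slit_plane
        polylog_holomorphic in \<open>auto simp: polylog_eq_series\<close>)

lemma polylog_1:
  assumes "z \<in> slit_plane"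
  shows "polylog 1 z = - Ln (1 - z)"
proof (rule polylog_unique[OF _ _ assms, symmetric])
  have "1 - w \<notin> \<real>\<^sub>\<le>\<^sub>0" if "w \<in> slit_plane" for w
  proof
    assume "1 - w \<in> \<real>\<^sub>\<le>\<^sub>0"
    then obtain r where "1 - w = of_real r" "r \<le> 0" by (auto elim: nonpos_Reals_cases)
    then have "w = of_real (1 - r)" "1 - r \<in> {1..}" by (auto simp: algebra_simps)
    then show False using that unfolding slit_plane_def by blast
  qed
  then show "(\<lambda>z. - Ln (1 - z)) holomorphic_on slit_plane"
    by (auto intro!: holomorphic_intros)
  show "- Ln (1 - w) = polylog_series 1 w" if "cmod w < 1" for w
  proof -
    have "(\<lambda>k. - (- (w ^ k) / of_nat k)) sums - Ln (1 - w)"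
      using Ln_series'[of "- w"] that by (intro sums_minus) simp
    moreover have "- (- (w ^ k) / of_nat k) = (if k = 0 then 0 else 1 / of_nat k ^ 1) * w ^ k" for k
      by simp
    ultimately have "(\<lambda>k. (if k = 0 then 0 else 1 / of_nat k ^ 1) * w ^ k) sums - Ln (1 - w)"
      by (simp only:)
    then show ?thesis
      using polylog_series_power_series[OF that, of 1] sums_unique2 by blast
  qed
qed

lemma cnj_slit_plane: "cnj ` slit_plane = slit_plane"
proof -
  have "cnj z \<in> slit_plane" if "z \<in> slit_plane" for z
    using that by (auto simp: slit_plane_def complex_eq_iff image_iff)
  then show ?thesis by (auto simp: image_iff) (metis complex_cnj_cnj)
qed

lemma polylog_cnj:
  assumes "z \<in> slit_plane"
  shows "cnj (polylog n (cnj z)) = polylog n z"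
proof -
  have "(cnj \<circ> polylog n \<circ> cnj) z = polylog n z"
  proof (rule polylog_unique[OF _ _ assms])
    show "cnj \<circ> polylog n \<circ> cnj holomorphic_on slit_plane"
      by (intro holomorphic_on_compose_cnj_cnj)
         (simp_all add: cnj_slit_plane polylog_holomorphic open_slit_plane)
    show "(cnj \<circ> polylog n \<circ> cnj) w = polylog_series n w" if "cmod w < 1" for w
    proof -
      have "(\<lambda>k. cnj (cnj w ^ Suc k / of_nat (Suc k) ^ n)) sums cnj (polylog_series n (cnj w))"
        unfolding sums_cnj polylog_series_def
        by (rule summable_sums, rule polylog_series_summable) (use that in simp)
      then have "(\<lambda>k. w ^ Suc k / of_nat (Suc k) ^ n) sums cnj (polylog_series n (cnj w))"
        by (simp only: complex_cnj_divide complex_cnj_power complex_cnj_cnj complex_cnj_of_nat)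
      then have "cnj (polylog_series n (cnj w)) = polylog_series n w"
        unfolding polylog_series_def by (rule sums_unique)
      then show ?thesis using that by (simp add: polylog_eq_series)
    qed
  qed
  then show ?thesis by simp
qed

lemma polylog_of_real:
  assumes "x < 1"
  shows "polylog n (of_real x) = of_real (Li n x)"
proof -
  have "complex_of_real x \<in> slit_plane" using assms by (auto simp: slit_plane_def)
  from polylog_cnj[OF this, of n] have "cnj (polylog n (of_real x)) = polylog n (of_real x)" by simp
  then have "polylog n (of_real x) \<in> \<real>" by (simp add: Reals_cnj_iff)
  then show ?thesis by (simp add: Li_def)
qed

end

theory Submission
  imports Defs "HOL-Real_Asymp.Real_Asymp"
begin

text \<open>
  \<^bold>\<open>Why the theorem is true.\<close> The Spence-Kummer equation is linear, and Li 3 satisfies it with the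
  right-hand side E3 (spence_kummer). So everything is a statement about the solutions \<open>G = F - Li 3\<close>
  of the homogeneous equation that are measurable and continuous at 0: they are the multiples of
  \<open>L3 - 2/9 Li3_one\<close> (kummer.solution).

  Everything becomes transparent in the coordinates \<open>t = (1 - y) / (1 - x)\<close>, \<open>y\<close>, with
  \<open>w = t + y - 1\<close>. The nine arguments are then \<open>w/t, y, w/(ty), t, w/y, wy/t, -w, -t/y, wt/y\<close>,
  on the domain \<open>0 < y < eps0\<close>, \<open>0 < t < 1 < t + y\<close>; apart from \<open>-t/y\<close> they are symmetric in
  \<open>t\<close> and \<open>y\<close>.

  \<^emph>\<open>Regularity.\<close> Fixing one of \<open>t, y\<close> at a value \<open>z\<close> and letting the other one, \<open>s\<close>, vary expresses
  \<open>G z\<close> through values of \<open>G\<close> at points that move with \<open>s\<close>. Averaging over \<open>s\<close> turns measurability into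
  continuity (measurable_solution_isCont) and then, after integration by parts against a primitive of \<open>G\<close>,
  each order of differentiability into the next one (smooth_step). Near 0 the same averaging shows that all
  derivatives \<open>(z d/dz)^k G\<close> obey the same bound \<open>O(z^sigma)\<close> as \<open>G - G 0\<close> (near_step).

  \<^emph>\<open>Two relations for\<close> \<open>P = z G'(z)\<close>. Moving \<open>(t, y)\<close> along a ray through the origin does not change
  \<open>t/y\<close>; differentiation along the ray gives a seven-point relation with rational coefficients (ray_form_log_deriv).
  Letting \<open>w\<close> tend to 0 gives a relation between \<open>G y\<close>, \<open>G (1 - y)\<close>, \<open>G (1 - 1/y)\<close> and \<open>G 0\<close>, whose
  derivative is inversion_log_deriv.

  \<^emph>\<open>Asymptotics.\<close> In the corner \<open>t = 1 - d\<close>, \<open>y = d + w\<close> with \<open>w\<close> of the order of \<open>d^2\<close>, the ray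
  relation reads \<open>d^2 D^2P(w/d) - 2d DP(w) + P(wd) = A(w) + w B(d) + error\<close> with \<open>D = z d/dz\<close>. After
  division by \<open>wd\<close> every term depends on one of \<open>w/d\<close>, \<open>w\<close>, \<open>d\<close>, \<open>wd\<close>, up to powers of \<open>d\<close>; multiplicative
  differences remove all but the last one, and a contraction \<open>2f(2X) - f(X)\<close> remains. Hence the third
  differences of \<open>P(z)/z\<close> are small, and \<open>P(z)/z = alpha ln^2 z + beta ln z + gamma + o(1)\<close> (corner_expansion).

  \<^emph>\<open>Rigidity.\<close> The function \<open>P0 = 3 z L3'(z)\<close> satisfies both relations and behaves like \<open>z ln^2 z\<close>.
  So \<open>R = P - alpha P0\<close> satisfies both relations and \<open>R(z)/z = beta ln z + gamma + o(1)\<close>. Three degenerations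
  of the ray relation now suffice: \<open>w = 0\<close> shows that \<open>R(y) + R(1 - y)\<close> is constant, the corner \<open>w = ry\<close>
  yields a linear differential equation that determines \<open>R'\<close> up to \<open>beta\<close>, and \<open>t = 1\<close> together with the
  inversion shows that the constant is 0; then \<open>R\<close> would be strictly monotone with the same value at 0 and at 1/2
  unless \<open>beta = 0\<close>, so \<open>R = 0\<close> on \<open>]0, 1[\<close>. The ray relation then determines \<open>R(-w)\<close> for \<open>w < eps0\<close>, and the
  inversion for \<open>w > (1 - eps0)/eps0\<close>. These ranges exhaust the negative axis because
  \<open>eps0^2 + eps0 > 1\<close>: this is where the golden ratio enters.

  \<^emph>\<open>Conclusion.\<close> Thus \<open>G = c + 3 alpha L3\<close>, and the three-term relations for \<open>G\<close> and for \<open>L3\<close> give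
  \<open>c = -(2/9)(3 alpha) Li3_one\<close>. Since \<open>L3(z)\<close> behaves like \<open>(z ln^2 z)/3\<close>, it is not differentiable at 0, so
  differentiability forces \<open>alpha = 0\<close>.
\<close>

section \<open>Functions smooth in the logarithmic derivative\<close>

text \<open>
  The operator \<open>z d/dz\<close> is natural here because the relations are invariant under scaling of small arguments:
  it preserves bounds by powers of \<open>z\<close>, which \<open>d/dz\<close> does not. The class \<open>W\<close> carries such a bound for
  the function and for all derivatives up to order \<open>k\<close>; \<open>W = UNIV\<close> gives plain smoothness. The second variable is
  a parameter that is integrated out; functions of one variable use the parameter set \<open>{0}\<close>.
\<close>
primrec log_smooth :: "nat \<Rightarrow> real set \<Rightarrow> real set \<Rightarrow> (real \<Rightarrow> real \<Rightarrow> real) set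
    \<Rightarrow> (real \<Rightarrow> real \<Rightarrow> real) \<Rightarrow> bool" where
  "log_smooth 0 Z S W f \<longleftrightarrow> continuous_on (Z \<times> S) (\<lambda>(z, s). f z s) \<and> f \<in> W"
| "log_smooth (Suc k) Z S W f \<longleftrightarrow> continuous_on (Z \<times> S) (\<lambda>(z, s). f z s) \<and> f \<in> W \<and>
     (\<exists>f'. (\<forall>z\<in>Z. \<forall>s\<in>S. ((\<lambda>z. f z s) has_real_derivative f' z s / z) (at z)) \<and> log_smooth k Z S W f')"

text \<open>
  What a class of bounds must satisfy for sums and multiples to inherit it. Membership depends only on the values on
  \<open>Z \<times> S\<close>, so that formulas may be rewritten there.
\<close>
definition linear_class :: "real set \<Rightarrow> real set \<Rightarrow> (real \<Rightarrow> real \<Rightarrow> real) set \<Rightarrow> bool" where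
  "linear_class Z S W \<longleftrightarrow> (\<forall>f\<in>W. \<forall>g. (\<forall>z\<in>Z. \<forall>s\<in>S. g z s = f z s) \<longrightarrow> g \<in> W)
     \<and> (\<forall>f\<in>W. \<forall>g\<in>W. (\<lambda>z s. f z s + g z s) \<in> W) \<and> (\<lambda>z s. 0) \<in> W
     \<and> (\<forall>f\<in>W. \<forall>c. (\<lambda>z s. c * f z s) \<in> W)"

definition big_O :: "real set \<Rightarrow> real set \<Rightarrow> (real \<Rightarrow> real) \<Rightarrow> (real \<Rightarrow> real \<Rightarrow> real) set" where
  "big_O Z S \<beta> = {f. \<exists>C. \<forall>z\<in>Z. \<forall>s\<in>S. \<bar>f z s\<bar> \<le> C * \<beta> z}"

lemma ObI: "(\<And>z s. z \<in> Z \<Longrightarrow> s \<in> S \<Longrightarrow> \<bar>f z s\<bar> \<le> C * \<beta> z) \<Longrightarrow> f \<in> big_O Z S \<beta>"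
  unfolding big_O_def by blast

lemma linear_class_UNIV [simp]: "linear_class Z S UNIV" by (simp add: linear_class_def)

lemma linear_class_Ob: "linear_class Z S (big_O Z S \<beta>)"
  unfolding linear_class_def
proof (intro conjI ballI allI impI)
  fix f g assume "f \<in> big_O Z S \<beta>" "\<forall>z\<in>Z. \<forall>s\<in>S. g z s = f z s"
  then show "g \<in> big_O Z S \<beta>" by (simp add: big_O_def)
next
  fix f g assume "f \<in> big_O Z S \<beta>" "g \<in> big_O Z S \<beta>"
  then obtain C D where C: "\<forall>z\<in>Z. \<forall>s\<in>S. \<bar>f z s\<bar> \<le> C * \<beta> z" and D: "\<forall>z\<in>Z. \<forall>s\<in>S. \<bar>g z s\<bar> \<le> D * \<beta> z"
    by (auto simp: big_O_def)
  show "(\<lambda>z s. f z s + g z s) \<in> big_O Z S \<beta>"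
    by (rule ObI[where C = "C + D"]) (use C D in \<open>force simp: distrib_right intro: order.trans[OF abs_triangle_ineq] add_mono\<close>)
next
  show "(\<lambda>z s. 0) \<in> big_O Z S \<beta>" by (rule ObI[where C = 0]) simp
next
  fix f and c :: real assume "f \<in> big_O Z S \<beta>"
  then obtain C where C: "\<forall>z\<in>Z. \<forall>s\<in>S. \<bar>f z s\<bar> \<le> C * \<beta> z" by (auto simp: big_O_def)
  show "(\<lambda>z s. c * f z s) \<in> big_O Z S \<beta>"
    by (rule ObI[where C = "\<bar>c\<bar> * C"]) (use C in \<open>simp add: abs_mult mult.assoc mult_left_mono\<close>)
qed

lemma big_O_mult: "f \<in> big_O Z S \<beta> \<Longrightarrow> g \<in> big_O Z S \<gamma> \<Longrightarrow> (\<lambda>z s. f z s * g z s) \<in> big_O Z S (\<lambda>z. \<beta> z * \<gamma> z)"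
proof -
  assume "f \<in> big_O Z S \<beta>" "g \<in> big_O Z S \<gamma>"
  then obtain C D where C: "\<forall>z\<in>Z. \<forall>s\<in>S. \<bar>f z s\<bar> \<le> C * \<beta> z" and D: "\<forall>z\<in>Z. \<forall>s\<in>S. \<bar>g z s\<bar> \<le> D * \<gamma> z"
    by (auto simp: big_O_def)
  show ?thesis
  proof (rule ObI[where C = "C * D"])
    fix z s assume "z \<in> Z" "s \<in> S"
    then have "\<bar>f z s\<bar> * \<bar>g z s\<bar> \<le> (C * \<beta> z) * (D * \<gamma> z)"
      using C D by (intro mult_mono) (auto intro: order.trans[OF abs_ge_zero])
    then show "\<bar>f z s * g z s\<bar> \<le> C * D * (\<beta> z * \<gamma> z)" by (simp add: abs_mult mult_ac)
  qed
qed

lemma big_O_mono: "f \<in> big_O Z S \<beta> \<Longrightarrow> (\<And>z. z \<in> Z \<Longrightarrow> \<bar>\<beta> z\<bar> \<le> K * \<gamma> z) \<Longrightarrow> f \<in> big_O Z S \<gamma>"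
proof -
  assume "f \<in> big_O Z S \<beta>" and b: "\<And>z. z \<in> Z \<Longrightarrow> \<bar>\<beta> z\<bar> \<le> K * \<gamma> z"
  then obtain C where C: "\<forall>z\<in>Z. \<forall>s\<in>S. \<bar>f z s\<bar> \<le> C * \<beta> z" by (auto simp: big_O_def)
  show ?thesis
  proof (rule ObI[where C = "\<bar>C\<bar> * K"])
    fix z s assume z: "z \<in> Z" "s \<in> S"
    have "C * \<beta> z \<le> \<bar>C\<bar> * \<bar>\<beta> z\<bar>" by (metis abs_ge_self abs_mult)
    also have "\<dots> \<le> \<bar>C\<bar> * (K * \<gamma> z)" using b[OF z(1)] by (intro mult_left_mono) auto
    finally show "\<bar>f z s\<bar> \<le> \<bar>C\<bar> * K * \<gamma> z" using C z by (force simp: mult.assoc)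
  qed
qed

lemma linear_class_cong: "linear_class Z S W \<Longrightarrow> f \<in> W \<Longrightarrow> (\<And>z s. z \<in> Z \<Longrightarrow> s \<in> S \<Longrightarrow> g z s = f z s) \<Longrightarrow> g \<in> W"
  unfolding linear_class_def by blast
lemma linear_class_add: "linear_class Z S W \<Longrightarrow> f \<in> W \<Longrightarrow> g \<in> W \<Longrightarrow> (\<lambda>z s. f z s + g z s) \<in> W"
  unfolding linear_class_def by blast
lemma linear_class_zero: "linear_class Z S W \<Longrightarrow> (\<lambda>z s. 0) \<in> W"
  unfolding linear_class_def by blast
lemma linear_class_scale: "linear_class Z S W \<Longrightarrow> f \<in> W \<Longrightarrow> (\<lambda>z s. c * f z s) \<in> W"
  unfolding linear_class_def by blast

lemma log_smooth_base: "log_smooth k Z S W f \<Longrightarrow> continuous_on (Z \<times> S) (\<lambda>(z, s). f z s) \<and> f \<in> W"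
  by (cases k) auto

lemma log_smooth_Suc_ex:
  assumes "log_smooth (Suc k) Z S W f"
  shows "\<exists>f'. (\<forall>z\<in>Z. \<forall>s\<in>S. ((\<lambda>z. f z s) has_real_derivative f' z s / z) (at z)) \<and> log_smooth k Z S W f'
    \<and> continuous_on (Z \<times> S) (\<lambda>(z, s). f z s) \<and> f \<in> W"
  using assms by auto

lemma log_smooth_SucD: "log_smooth (Suc k) Z S W f \<Longrightarrow> log_smooth k Z S W f"
proof (induction k arbitrary: f)
  case 0 then show ?case by simp
next
  case (Suc k)
  from log_smooth_Suc_ex[OF Suc.prems] obtain f' where f': "\<forall>z\<in>Z. \<forall>s\<in>S. ((\<lambda>z. f z s) has_real_derivative f' z s / z) (at z)"
    "log_smooth (Suc k) Z S W f'" "continuous_on (Z \<times> S) (\<lambda>(z, s). f z s)" "f \<in> W" by (elim exE conjE) (rule that)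
  show ?case using f' Suc.IH[OF f'(2)] unfolding log_smooth.simps(2)[of k] by (intro conjI exI[of _ f'])
qed

lemma log_smooth_le: "log_smooth n Z S W f \<Longrightarrow> k \<le> n \<Longrightarrow> log_smooth k Z S W f"
  proof (induction n)
  case 0 then show ?case by simp
next
  case (Suc n) then show ?case using log_smooth_SucD[of n Z S W f] by (cases "k = Suc n") (auto simp del: log_smooth.simps)
qed

lemma log_smooth_SucI:
  assumes "continuous_on (Z \<times> S) (\<lambda>(z, s). f z s)" "f \<in> W"
    "\<And>z s. z \<in> Z \<Longrightarrow> s \<in> S \<Longrightarrow> ((\<lambda>z. f z s) has_real_derivative f' z s / z) (at z)"
    "log_smooth k Z S W f'"
  shows "log_smooth (Suc k) Z S W f"
  using assms by auto

lemma log_smooth_cong: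
  assumes "log_smooth k Z S W f" "linear_class Z S W" "open Z" "\<And>z s. z \<in> Z \<Longrightarrow> s \<in> S \<Longrightarrow> g z s = f z s"
  shows "log_smooth k Z S W g"
proof -
  have c: "continuous_on (Z \<times> S) (\<lambda>(z, s). g z s)" "g \<in> W"
    subgoal by (rule continuous_on_eq[OF conjunct1[OF log_smooth_base[OF assms(1)]]]) (use assms(4) in auto)
    subgoal by (rule linear_class_cong[OF assms(2) conjunct2[OF log_smooth_base[OF assms(1)]] assms(4)])
    done
  show ?thesis
  proof (cases k)
    case 0 then show ?thesis using c by simp
  next
    case (Suc m)
    from assms(1) Suc have "log_smooth (Suc m) Z S W f" by simp
    from log_smooth_Suc_ex[OF this] obtain f' where f': "\<forall>z\<in>Z. \<forall>s\<in>S. ((\<lambda>z. f z s) has_real_derivative f' z s / z) (at z)"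
      "log_smooth m Z S W f'" by (elim exE conjE) (rule that)
    have "((\<lambda>z. g z s) has_real_derivative f' z s / z) (at z)" if "z \<in> Z" "s \<in> S" for z s
      by (rule has_field_derivative_transform_within_open[OF f'(1)[rule_format, OF that] assms(3) that(1)]) (use assms(4) that in auto)
    then show ?thesis using c f' Suc by auto
  qed
qed

lemma log_smooth_mono_set:
  assumes "log_smooth k Z S W f" "Z' \<subseteq> Z" "S' \<subseteq> S" "W \<subseteq> W'"
  shows "log_smooth k Z' S' W' f"
  using assms(1)
proof (induction k arbitrary: f)
  case 0
  then show ?case using assms(2-4) by (auto intro: continuous_on_subset)
next
  case (Suc k)
  from log_smooth_Suc_ex[OF Suc.prems] obtain f' where f': "\<forall>z\<in>Z. \<forall>s\<in>S. ((\<lambda>z. f z s) has_real_derivative f' z s / z) (at z)"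
      "log_smooth k Z S W f'" "continuous_on (Z \<times> S) (\<lambda>(z, s). f z s)" "f \<in> W" by (elim exE conjE) (rule that)
  show ?case
    proof (rule log_smooth_SucI[OF continuous_on_subset[OF f'(3)] _ _ Suc.IH[OF f'(2)]])
    show "((\<lambda>z. f z s) has_real_derivative f' z s / z) (at z)" if "z \<in> Z'" "s \<in> S'" for z s
      using f'(1) that assms by blast
  qed (use assms f' in auto)
qed

lemma log_smooth_add:
  assumes "log_smooth k Z S W f" "log_smooth k Z S W g" "linear_class Z S W"
  shows "log_smooth k Z S W (\<lambda>z s. f z s + g z s)"
  using assms(1,2)
proof (induction k arbitrary: f g)
  case 0
  then show ?case using linear_class_add[OF assms(3)] by (auto simp: split_def intro!: continuous_on_add)
next
  case (Suc k)
  from log_smooth_Suc_ex[OF Suc.prems(1)] obtain f' where f': "\<forall>z\<in>Z. \<forall>s\<in>S. ((\<lambda>z. f z s) has_real_derivative f' z s / z) (at z)"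
      "log_smooth k Z S W f'" "continuous_on (Z \<times> S) (\<lambda>(z, s). f z s)" "f \<in> W" by (elim exE conjE) (rule that)
  from log_smooth_Suc_ex[OF Suc.prems(2)] obtain g' where g': "\<forall>z\<in>Z. \<forall>s\<in>S. ((\<lambda>z. g z s) has_real_derivative g' z s / z) (at z)"
      "log_smooth k Z S W g'" "continuous_on (Z \<times> S) (\<lambda>(z, s). g z s)" "g \<in> W" by (elim exE conjE) (rule that)
  show ?case
  proof (rule log_smooth_SucI[OF _ _ _ Suc.IH[OF f'(2) g'(2)]])
    show "continuous_on (Z \<times> S) (\<lambda>(z, s). f z s + g z s)"
      using f'(3) g'(3) by (auto simp: split_def intro: continuous_on_add)
    show "(\<lambda>z s. f z s + g z s) \<in> W" by (rule linear_class_add[OF assms(3) f'(4) g'(4)])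
    show "((\<lambda>z. f z s + g z s) has_real_derivative (f' z s + g' z s) / z) (at z)" if "z \<in> Z" "s \<in> S" for z s
      unfolding add_divide_distrib by (rule DERIV_add[OF f'(1)[rule_format, OF that] g'(1)[rule_format, OF that]])
  qed
qed

lemma log_smooth_mult:
  assumes "log_smooth k Z S W1 f" "log_smooth k Z S W2 g" "linear_class Z S W"
    and W: "\<And>f g. f \<in> W1 \<Longrightarrow> g \<in> W2 \<Longrightarrow> (\<lambda>z s. f z s * g z s) \<in> W"
  shows "log_smooth k Z S W (\<lambda>z s. f z s * g z s)"
  using assms(1,2)
proof (induction k arbitrary: f g)
  case 0
  then show ?case using W by (auto simp: split_def intro!: continuous_on_mult)
next
  case (Suc k)
  from log_smooth_Suc_ex[OF Suc.prems(1)] obtain f' where f': "\<forall>z\<in>Z. \<forall>s\<in>S. ((\<lambda>z. f z s) has_real_derivative f' z s / z) (at z)"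
      "log_smooth k Z S W1 f'" "continuous_on (Z \<times> S) (\<lambda>(z, s). f z s)" "f \<in> W1" by (elim exE conjE) (rule that)
  from log_smooth_Suc_ex[OF Suc.prems(2)] obtain g' where g': "\<forall>z\<in>Z. \<forall>s\<in>S. ((\<lambda>z. g z s) has_real_derivative g' z s / z) (at z)"
      "log_smooth k Z S W2 g'" "continuous_on (Z \<times> S) (\<lambda>(z, s). g z s)" "g \<in> W2" by (elim exE conjE) (rule that)
  show ?case
  proof (rule log_smooth_SucI[OF _ _ _ log_smooth_add[OF Suc.IH[OF f'(2) log_smooth_SucD[OF Suc.prems(2)]] Suc.IH[OF log_smooth_SucD[OF Suc.prems(1)] g'(2)] assms(3)]])
    show "continuous_on (Z \<times> S) (\<lambda>(z, s). f z s * g z s)"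
      using f'(3) g'(3) by (auto simp: split_def intro: continuous_on_mult)
    show "(\<lambda>z s. f z s * g z s) \<in> W" by (rule W[OF f'(4) g'(4)])
    show "((\<lambda>z. f z s * g z s) has_real_derivative (f' z s * g z s + f z s * g' z s) / z) (at z)" if "z \<in> Z" "s \<in> S" for z s
      using DERIV_mult[OF f'(1)[rule_format, OF that] g'(1)[rule_format, OF that]] by (simp add: add_divide_distrib algebra_simps)
  qed
qed

lemma log_smooth_param:
  assumes "continuous_on S g" "(\<lambda>z s. g s) \<in> W" "linear_class Z S W"
  shows "log_smooth k Z S W (\<lambda>z s. g s)"
proof -
  have c: "continuous_on (Z \<times> S) (\<lambda>(z, s). g s)"
    unfolding split_def by (rule continuous_on_compose2[OF assms(1)]) (auto intro!: continuous_intros)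
  have z: "log_smooth k Z S W (\<lambda>z s. 0)" for k
    by (induction k) (use linear_class_zero[OF assms(3)] in \<open>auto intro!: exI[of _ "\<lambda>z s. 0"]\<close>)
  show ?thesis
    by (cases k) (use c z assms in \<open>auto intro!: exI[of _ "\<lambda>z s. 0"]\<close>)
qed

lemma log_smooth_const: "(\<lambda>z s. c) \<in> W \<Longrightarrow> linear_class Z S W \<Longrightarrow> log_smooth k Z S W (\<lambda>z s. c)"
  by (rule log_smooth_param) auto

lemma log_smooth_id:
  assumes "(\<lambda>z s. z) \<in> W" "0 \<notin> Z"
  shows "log_smooth k Z S W (\<lambda>z s. z)"
proof (induction k)
  case 0 then show ?case using assms by (auto simp: split_def intro!: continuous_intros)
next
  case (Suc k)
  show ?case
  proof (rule log_smooth_SucI[OF _ assms(1) _ Suc.IH])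
    show "continuous_on (Z \<times> S) (\<lambda>(z, s). z)" by (auto simp: split_def intro!: continuous_intros)
    show "((\<lambda>z. z) has_real_derivative z / z) (at z)" if "z \<in> Z" for z
    proof -
      have "z \<noteq> 0" using that assms(2) by auto
      then show ?thesis by simp
    qed
  qed
qed

lemma log_smooth_scale:
  assumes "log_smooth k Z S W f" "linear_class Z S W"
  shows "log_smooth k Z S W (\<lambda>z s. c * f z s)"
  using assms(1)
proof (induction k arbitrary: f)
  case 0
  then show ?case using linear_class_scale[OF assms(2)] by (auto simp: split_def intro!: continuous_intros)
next
  case (Suc k)
  from log_smooth_Suc_ex[OF Suc.prems(1)] obtain f' where f': "\<forall>z\<in>Z. \<forall>s\<in>S. ((\<lambda>z. f z s) has_real_derivative f' z s / z) (at z)"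
      "log_smooth k Z S W f'" "continuous_on (Z \<times> S) (\<lambda>(z, s). f z s)" "f \<in> W" by (elim exE conjE) (rule that)
  show ?case
  proof (rule log_smooth_SucI[OF _ _ _ Suc.IH[OF f'(2)]])
    show "continuous_on (Z \<times> S) (\<lambda>(z, s). c * f z s)"
      using f'(3) by (auto simp: split_def intro!: continuous_intros)
    show "(\<lambda>z s. c * f z s) \<in> W" by (rule linear_class_scale[OF assms(2) f'(4)])
    show "((\<lambda>z. c * f z s) has_real_derivative (c * f' z s) / z) (at z)" if "z \<in> Z" "s \<in> S" for z s
      using DERIV_cmult[OF f'(1)[rule_format, OF that], of c] by simp
  qed
qed

lemma log_smooth_diff:
  assumes "log_smooth k Z S W f" "log_smooth k Z S W g" "linear_class Z S W"
  shows "log_smooth k Z S W (\<lambda>z s. f z s - g z s)"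
  using log_smooth_add[OF assms(1) log_smooth_scale[OF assms(2,3), of "-1"] assms(3)] by simp

definition algebra_class :: "real set \<Rightarrow> real set \<Rightarrow> (real \<Rightarrow> real \<Rightarrow> real) set \<Rightarrow> bool" where
  "algebra_class Z S W \<longleftrightarrow> linear_class Z S W \<and> (\<forall>f\<in>W. \<forall>g\<in>W. (\<lambda>z s. f z s * g z s) \<in> W) \<and> (\<forall>c. (\<lambda>z s. c) \<in> W)"

lemma algebra_class_adm: "algebra_class Z S W \<Longrightarrow> linear_class Z S W" by (simp add: algebra_class_def)

lemma algebra_class_UNIV [simp]: "algebra_class Z S UNIV" by (simp add: algebra_class_def)

lemma algebra_class_Ob: "algebra_class Z S (big_O Z S (\<lambda>z. 1))"
  unfolding algebra_class_def
proof (intro conjI ballI allI)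
  show "linear_class Z S (big_O Z S (\<lambda>z. 1))" by (rule linear_class_Ob)
  show "(\<lambda>z s. f z s * g z s) \<in> big_O Z S (\<lambda>z. 1)" if "f \<in> big_O Z S (\<lambda>z. 1)" "g \<in> big_O Z S (\<lambda>z. 1)" for f g
    using big_O_mult[OF that] by simp
  show "(\<lambda>z s. c) \<in> big_O Z S (\<lambda>z. 1)" for c by (rule ObI[where C = "\<bar>c\<bar>"]) simp
qed

lemma log_smooth_alg_mult: "log_smooth k Z S W f \<Longrightarrow> log_smooth k Z S W g \<Longrightarrow> algebra_class Z S W \<Longrightarrow> log_smooth k Z S W (\<lambda>z s. f z s * g z s)"
  by (rule log_smooth_mult) (auto simp: algebra_class_def)

lemma log_smooth_alg_const: "algebra_class Z S W \<Longrightarrow> log_smooth k Z S W (\<lambda>z s. c)"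
  by (rule log_smooth_const) (auto simp: algebra_class_def)

lemma log_smooth_inverse:
  assumes "log_smooth k Z S W f" "algebra_class Z S W" "(\<lambda>z s. 1 / f z s) \<in> W"
    and nz: "\<And>z s. z \<in> Z \<Longrightarrow> s \<in> S \<Longrightarrow> f z s \<noteq> 0"
  shows "log_smooth k Z S W (\<lambda>z s. 1 / f z s)"
proof -
  have c: "continuous_on (Z \<times> S) (\<lambda>(z, s). 1 / f z s)"
    using log_smooth_base[OF assms(1)] nz by (auto simp: split_def intro!: continuous_intros)
  show ?thesis using assms(1)
  proof (induction k)
    case 0 show ?case using c assms by simp
  next
    case (Suc k)
    from log_smooth_Suc_ex[OF Suc.prems(1)] obtain f' where f': "\<forall>z\<in>Z. \<forall>s\<in>S. ((\<lambda>z. f z s) has_real_derivative f' z s / z) (at z)"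
      "log_smooth k Z S W f'" by (elim exE conjE) (rule that)
    note I = Suc.IH[OF log_smooth_SucD[OF Suc.prems(1)]]
    show ?case
    proof (rule log_smooth_SucI[OF c assms(3) _ log_smooth_scale[OF log_smooth_alg_mult[OF f'(2) log_smooth_alg_mult[OF I I assms(2)] assms(2)] algebra_class_adm[OF assms(2)], of "-1"]])
      fix z s assume zs: "z \<in> Z" "s \<in> S"
      show "((\<lambda>z. 1 / f z s) has_real_derivative - 1 * (f' z s * (1 / f z s * (1 / f z s))) / z) (at z)"
        by (rule derivative_eq_intros f'(1)[rule_format, OF zs] refl nz[OF zs])+ (use nz[OF zs] in simp)
    qed
  qed
qed

lemma log_smooth_divide:
  assumes "log_smooth k Z S W g" "log_smooth k Z S W f" "algebra_class Z S W" "(\<lambda>z s. 1 / f z s) \<in> W"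
    and "\<And>z s. z \<in> Z \<Longrightarrow> s \<in> S \<Longrightarrow> f z s \<noteq> 0"
  shows "log_smooth k Z S W (\<lambda>z s. g z s / f z s)"
  using log_smooth_alg_mult[OF assms(1) log_smooth_inverse[OF assms(2-5)] assms(3)] by simp

text \<open>
  Chain rule: \<open>\<mu>\<close> is the logarithmic derivative \<open>z \<phi>' / \<phi>\<close>, so \<open>z d/dz\<close> of \<open>g \<circ> \<phi>\<close> is
  \<open>\<mu>\<close> times \<open>v g'(v)\<close> at \<open>v = \<phi>\<close>, and the induction stays within functions of the same shape.
\<close>
lemma log_smooth_compose:
  assumes "log_smooth k Y {0} WY (\<lambda>v _. g v)" "0 \<notin> Y"
    and phi: "\<And>z s. z \<in> Z \<Longrightarrow> s \<in> S \<Longrightarrow> \<phi> z s \<in> Y"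
      "continuous_on (Z \<times> S) (\<lambda>(z, s). \<phi> z s)"
      "\<And>z s. z \<in> Z \<Longrightarrow> s \<in> S \<Longrightarrow> ((\<lambda>z. \<phi> z s) has_real_derivative \<phi> z s * \<mu> z s / z) (at z)"
    and mu: "log_smooth k Z S W1 \<mu>" and W: "linear_class Z S W"
      "\<And>g. g \<in> WY \<Longrightarrow> (\<lambda>z s. g (\<phi> z s) 0) \<in> W"
      "\<And>f m. f \<in> W \<Longrightarrow> m \<in> W1 \<Longrightarrow> (\<lambda>z s. f z s * m z s) \<in> W"
  shows "log_smooth k Z S W (\<lambda>z s. g (\<phi> z s))"
proof -
  have c: "continuous_on (Z \<times> S) (\<lambda>(z, s). g (\<phi> z s) 0)"
    if "continuous_on (Y \<times> {0}) (\<lambda>(v, u). g v u)" for g :: "real \<Rightarrow> real \<Rightarrow> real"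
  proof -
    have "continuous_on (Z \<times> S) ((\<lambda>(v, u). g v u) \<circ> (\<lambda>x. (\<phi> (fst x) (snd x), 0)))"
    proof (rule continuous_on_compose)
      show "continuous_on (Z \<times> S) (\<lambda>x. (\<phi> (fst x) (snd x), 0))"
        using phi(2) by (auto simp: split_def intro!: continuous_on_Pair)
      show "continuous_on ((\<lambda>x. (\<phi> (fst x) (snd x), 0)) ` (Z \<times> S)) (\<lambda>(v, u). g v u)"
        by (rule continuous_on_subset[OF that]) (use phi(1) in auto)
    qed
    then show ?thesis by (simp add: o_def split_def)
  qed
  have "log_smooth k Z S W (\<lambda>z s. G (\<phi> z s) 0)" if "log_smooth k Y {0} WY G" for G
    using that mu
  proof (induction k arbitrary: G)
    case 0
    then show ?case using c W(2) by auto
  next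
    case (Suc k)
    from log_smooth_Suc_ex[OF Suc.prems(1)] obtain G' where G': "\<forall>z\<in>Y. \<forall>s\<in>{0}. ((\<lambda>z. G z s) has_real_derivative G' z s / z) (at z)"
      "log_smooth k Y {0} WY G'" "continuous_on (Y \<times> {0}) (\<lambda>(z, s). G z s)" "G \<in> WY" by (elim exE conjE) (rule that)
    note mu' = log_smooth_SucD[OF Suc.prems(2)]
    show ?case
    proof (rule log_smooth_SucI[OF c[OF G'(3)] W(2)[OF G'(4)] _ log_smooth_mult[OF Suc.IH[OF G'(2) mu'] mu' W(1) W(3)]])
      fix z s assume zs: "z \<in> Z" "s \<in> S"
      have nz: "\<phi> z s \<noteq> 0" using phi(1)[OF zs] assms(2) by auto
      have "((\<lambda>z. G (\<phi> z s) 0) has_real_derivative (\<phi> z s * \<mu> z s / z) * (G' (\<phi> z s) 0 / \<phi> z s)) (at z)"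
        using DERIV_chain2[OF G'(1)[rule_format, OF phi(1)[OF zs], of 0] phi(3)[OF zs]] by (simp add: mult.commute)
      then show "((\<lambda>z. G (\<phi> z s) 0) has_real_derivative G' (\<phi> z s) 0 * \<mu> z s / z) (at z)"
        using nz by (simp add: field_simps)
    qed auto
  qed
  from this[OF assms(1)] show ?thesis .
qed

lemma log_smooth_integral:
  fixes f :: "real \<Rightarrow> real \<Rightarrow> real"
  assumes "log_smooth k Z {a..b} W f" "open Z" "0 \<notin> Z"
    and W: "\<And>f. f \<in> W \<Longrightarrow> continuous_on (Z \<times> {a..b}) (\<lambda>(z, s). f z s) \<Longrightarrow> (\<lambda>z _. integral {a..b} (f z)) \<in> W'"
  shows "log_smooth k Z {0} W' (\<lambda>z _. integral {a..b} (f z))"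
proof -
  have c: "continuous_on (Z \<times> {0}) (\<lambda>(z, s). integral {a..b} (f z))"
    if "continuous_on (Z \<times> {a..b}) (\<lambda>(z, s). f z s)" for f :: "real \<Rightarrow> real \<Rightarrow> real"
  proof -
    have "continuous_on Z (\<lambda>z. integral {a..b} (f z))"
      using integral_continuous_on_param[of Z a b f] that by simp
    then have "continuous_on (Z \<times> {0}) (\<lambda>x. integral {a..b} (f (fst x)))"
      by (rule continuous_on_compose2) (auto intro!: continuous_intros)
    then show ?thesis by (simp add: split_def)
  qed
  show ?thesis using assms(1)
  proof (induction k arbitrary: f)
    case 0
    then show ?case using c W by auto
  next
    case (Suc k)
    from log_smooth_Suc_ex[OF Suc.prems(1)] obtain f' where f': "\<forall>z\<in>Z. \<forall>s\<in>{a..b}. ((\<lambda>z. f z s) has_real_derivative f' z s / z) (at z)"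
      "log_smooth k Z {a..b} W f'" "continuous_on (Z \<times> {a..b}) (\<lambda>(z, s). f z s)" "f \<in> W" by (elim exE conjE) (rule that)
    show ?case
    proof (rule log_smooth_SucI[OF c[OF f'(3)] W[OF f'(4) f'(3)] _ Suc.IH[OF f'(2)]])
      fix z :: real and s :: real assume z: "z \<in> Z"
      then obtain e where e: "e > 0" "ball z e \<subseteq> Z" using assms(2) openE by blast
      have nz: "x \<noteq> 0" if "x \<in> ball z e" for x using that e assms(3) by blast
      have ct: "continuous_on {a..b} (f x)" if "x \<in> ball z e" for x
      proof -
        have "continuous_on {a..b} (\<lambda>s. (\<lambda>(z, s). f z s) (x, s))"
          by (rule continuous_on_compose2[OF f'(3)]) (use that e in \<open>auto intro!: continuous_intros\<close>)
        then show ?thesis by simp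
      qed
      have "((\<lambda>z. integral (cbox a b) (f z)) has_field_derivative integral (cbox a b) (\<lambda>s. f' z s / z)) (at z within ball z e)"
      proof (rule leibniz_rule_field_derivative)
        show "((\<lambda>x. f x t) has_field_derivative f' x t / x) (at x within ball z e)" if "x \<in> ball z e" "t \<in> cbox a b" for x t
          using f'(1)[rule_format, of x t] that subsetD[OF e(2) that(1)] by (auto simp: cbox_interval intro: has_field_derivative_at_within)
        show "f x integrable_on cbox a b" if "x \<in> ball z e" for x
          using ct[OF that] by (simp add: cbox_interval integrable_continuous_interval)
        have "continuous_on (ball z e \<times> {a..b}) (\<lambda>x. (\<lambda>(z, s). f' z s) x / fst x)"
          by (rule continuous_on_divide[OF continuous_on_subset[OF conjunct1[OF log_smooth_base[OF f'(2)]]]]) (use e nz in \<open>auto intro!: continuous_intros\<close>)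
        then show "continuous_on (ball z e \<times> cbox a b) (\<lambda>(x, t). f' x t / x)"
          by (simp add: split_def cbox_interval)
      qed (use e in auto)
      then have "((\<lambda>z. integral {a..b} (f z)) has_field_derivative integral {a..b} (\<lambda>s. f' z s / z)) (at z)"
        using e by (simp add: cbox_interval at_within_open[OF _ open_ball])
      moreover have "integral {a..b} (\<lambda>s. f' z s / z) = integral {a..b} (f' z) / z"
        using integral_mult_left[of "{a..b}" "f' z" "1 / z"] by simp
      ultimately show "((\<lambda>z. integral {a..b} (f z)) has_real_derivative integral {a..b} (f' z) / z) (at z)" by simp
    qed
  qed
qed

lemma log_smooth_slice:
  assumes "log_smooth k Z S W f" "s0 \<in> S" and W: "\<And>f. f \<in> W \<Longrightarrow> (\<lambda>z _. f z s0) \<in> W'"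
  shows "log_smooth k Z {0} W' (\<lambda>z _. f z s0)"
proof -
  have c: "continuous_on (Z \<times> {0}) (\<lambda>(z, s). f z s0)"
    if "continuous_on (Z \<times> S) (\<lambda>(z, s). f z s)" for f :: "real \<Rightarrow> real \<Rightarrow> real"
  proof -
    have "continuous_on (Z \<times> {0}) (\<lambda>x. (\<lambda>(z, s). f z s) (fst x, s0))"
      by (rule continuous_on_compose2[OF that]) (use assms(2) in \<open>auto intro!: continuous_intros\<close>)
    then show ?thesis by (simp add: split_def)
  qed
  show ?thesis using assms(1)
  proof (induction k arbitrary: f)
    case 0 then show ?case using c W by auto
  next
    case (Suc k)
    from log_smooth_Suc_ex[OF Suc.prems(1)] obtain f' where f': "\<forall>z\<in>Z. \<forall>s\<in>S. ((\<lambda>z. f z s) has_real_derivative f' z s / z) (at z)"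
      "log_smooth k Z S W f'" "continuous_on (Z \<times> S) (\<lambda>(z, s). f z s)" "f \<in> W" by (elim exE conjE) (rule that)
    show ?case
      by (rule log_smooth_SucI[OF c[OF f'(3)] W[OF f'(4)] f'(1)[rule_format] Suc.IH[OF f'(2)]]) (use assms in auto)
  qed
qed

text \<open>
  The integrand is \<open>\<kappa>\<close> times the derivative of \<open>\<Gamma> \<circ> \<phi>\<close>, because \<open>\<kappa>\<close> is the reciprocal of \<open>\<phi>'\<close>.
  The right-hand side involves only the primitive \<open>\<Gamma>\<close>, which has one derivative more than \<open>G\<close>.
\<close>
lemma integral_by_parts_family:
  fixes \<phi> :: "real \<Rightarrow> real"
  assumes "a \<le> b"
    and "\<And>v. v \<in> Y \<Longrightarrow> (\<Gamma> has_real_derivative G v) (at v)"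
    and "\<And>s. s \<in> {a..b} \<Longrightarrow> \<phi> s \<in> Y"
    and "\<And>s. s \<in> {a..b} \<Longrightarrow> (\<phi> has_real_derivative \<phi>s s) (at s)"
    and "\<And>s. s \<in> {a..b} \<Longrightarrow> \<phi>s s * \<kappa> s = 1"
    and "\<And>s. s \<in> {a..b} \<Longrightarrow> (\<kappa> has_real_derivative \<kappa>s s) (at s)"
    and "continuous_on {a..b} \<kappa>s"
  shows "integral {a..b} (\<lambda>s. G (\<phi> s)) = \<Gamma> (\<phi> b) * \<kappa> b - \<Gamma> (\<phi> a) * \<kappa> a - integral {a..b} (\<lambda>s. \<Gamma> (\<phi> s) * \<kappa>s s)"
proof -
  have d: "((\<lambda>s. \<Gamma> (\<phi> s) * \<kappa> s) has_real_derivative G (\<phi> s) + \<Gamma> (\<phi> s) * \<kappa>s s) (at s)" if "s \<in> {a..b}" for s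
  proof -
    have "((\<lambda>s. \<Gamma> (\<phi> s)) has_real_derivative G (\<phi> s) * \<phi>s s) (at s)"
      by (rule DERIV_chain2[OF assms(2)[OF assms(3)[OF that]] assms(4)[OF that]])
    from DERIV_mult[OF this assms(6)[OF that]] show ?thesis
      by (simp add: mult.assoc assms(5)[OF that] mult.commute[of "\<kappa>s s"])
  qed
  have 1: "((\<lambda>s. G (\<phi> s) + \<Gamma> (\<phi> s) * \<kappa>s s) has_integral \<Gamma> (\<phi> b) * \<kappa> b - \<Gamma> (\<phi> a) * \<kappa> a) {a..b}"
    by (rule fundamental_theorem_of_calculus[OF assms(1)])
       (use d in \<open>auto simp: has_real_derivative_iff_has_vector_derivative[symmetric] intro: has_field_derivative_at_within\<close>)
  have "continuous_on {a..b} (\<lambda>s. \<Gamma> (\<phi> s) * \<kappa>s s)"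
  proof (intro continuous_on_mult assms(7) continuous_at_imp_continuous_on ballI)
    fix s assume s: "s \<in> {a..b}"
    show "isCont (\<lambda>s. \<Gamma> (\<phi> s)) s"
      by (rule DERIV_isCont[OF DERIV_chain2[OF assms(2)[OF assms(3)[OF s]] assms(4)[OF s]]])
  qed
  then have 2: "((\<lambda>s. \<Gamma> (\<phi> s) * \<kappa>s s) has_integral integral {a..b} (\<lambda>s. \<Gamma> (\<phi> s) * \<kappa>s s)) {a..b}"
    by (simp add: integrable_continuous_interval integrable_integral)
  have "((\<lambda>s. G (\<phi> s)) has_integral (\<Gamma> (\<phi> b) * \<kappa> b - \<Gamma> (\<phi> a) * \<kappa> a - integral {a..b} (\<lambda>s. \<Gamma> (\<phi> s) * \<kappa>s s))) {a..b}"
    using has_integral_diff[OF 1 2] by simp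
  then show ?thesis by (rule integral_unique)
qed

text \<open>
  The gain of one derivative: the parameter integral of \<open>G (\<phi> z s)\<close> is as smooth in \<open>z\<close> as a primitive of
  \<open>G\<close>. The classes \<open>W1, W2, W3\<close> track the sizes of the logarithmic derivative, of the reciprocal \<open>s\<close>-derivative and of
  the primitive; near 0 the primitive is smaller by a factor \<open>z\<close>, and the reciprocal \<open>s\<close>-derivative is larger by the same factor.
\<close>
lemma log_smooth_smoothing_term:
  fixes \<phi> :: "real \<Rightarrow> real \<Rightarrow> real"
  assumes ab: "a \<le> b" and Z: "open Z" "0 \<notin> Z" and Y: "0 \<notin> Y"
    and Gam: "\<And>v. v \<in> Y \<Longrightarrow> (\<Gamma> has_real_derivative G v) (at v)"
      "log_smooth k Y {0} WY (\<lambda>v _. \<Gamma> v)"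
    and phi: "\<And>z s. z \<in> Z \<Longrightarrow> s \<in> {a..b} \<Longrightarrow> \<phi> z s \<in> Y"
      "continuous_on (Z \<times> {a..b}) (\<lambda>(z, s). \<phi> z s)"
      "\<And>z s. z \<in> Z \<Longrightarrow> s \<in> {a..b} \<Longrightarrow> ((\<lambda>z. \<phi> z s) has_real_derivative \<phi> z s * \<mu> z s / z) (at z)"
      "\<And>z s. z \<in> Z \<Longrightarrow> s \<in> {a..b} \<Longrightarrow> (\<phi> z has_real_derivative \<phi>s z s) (at s)"
      "\<And>z s. z \<in> Z \<Longrightarrow> s \<in> {a..b} \<Longrightarrow> \<phi>s z s * \<kappa> z s = 1"
      "\<And>z s. z \<in> Z \<Longrightarrow> s \<in> {a..b} \<Longrightarrow> (\<kappa> z has_real_derivative \<kappa>s z s) (at s)"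
    and mu: "log_smooth k Z {a..b} W1 \<mu>" and kap: "log_smooth k Z {a..b} W2 \<kappa>" "log_smooth k Z {a..b} W2 \<kappa>s"
    and W: "linear_class Z {a..b} W3" "linear_class Z {a..b} W" "linear_class Z {0} W'"
      "\<And>g. g \<in> WY \<Longrightarrow> (\<lambda>z s. g (\<phi> z s) 0) \<in> W3"
      "\<And>f m. f \<in> W3 \<Longrightarrow> m \<in> W1 \<Longrightarrow> (\<lambda>z s. f z s * m z s) \<in> W3"
      "\<And>f m. f \<in> W3 \<Longrightarrow> m \<in> W2 \<Longrightarrow> (\<lambda>z s. f z s * m z s) \<in> W"
      "\<And>f s0. f \<in> W \<Longrightarrow> s0 \<in> {a..b} \<Longrightarrow> (\<lambda>z _. f z s0) \<in> W'"
      "\<And>f. f \<in> W \<Longrightarrow> continuous_on (Z \<times> {a..b}) (\<lambda>(z, s). f z s) \<Longrightarrow> (\<lambda>z _. integral {a..b} (f z)) \<in> W'"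
  shows "log_smooth k Z {0} W' (\<lambda>z _. integral {a..b} (\<lambda>s. G (\<phi> z s)))"
proof -
  have G3: "log_smooth k Z {a..b} W3 (\<lambda>z s. \<Gamma> (\<phi> z s))"
    proof (rule log_smooth_compose[where k = k and WY = WY and ?W1.0 = W1 and \<phi> = \<phi> and Y = Y and \<mu> = \<mu>])
    show "(\<lambda>z s. g (\<phi> z s) 0) \<in> W3" if "g \<in> WY" for g by (rule W(4)[OF that])
    show "(\<lambda>z s. f z s * m z s) \<in> W3" if "f \<in> W3" "m \<in> W1" for f m by (rule W(5)[OF that])
  qed (use Gam(2) Y phi mu W(1) in auto)
  have A: "log_smooth k Z {a..b} W (\<lambda>z s. \<Gamma> (\<phi> z s) * \<kappa> z s)"
    by (rule log_smooth_mult[OF G3 kap(1) W(2) W(6)])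
  have B: "log_smooth k Z {a..b} W (\<lambda>z s. \<Gamma> (\<phi> z s) * \<kappa>s z s)"
    by (rule log_smooth_mult[OF G3 kap(2) W(2) W(6)])
  have "log_smooth k Z {0} W' (\<lambda>z u. \<Gamma> (\<phi> z b) * \<kappa> z b - \<Gamma> (\<phi> z a) * \<kappa> z a - integral {a..b} (\<lambda>s. \<Gamma> (\<phi> z s) * \<kappa>s z s))"
    by (intro log_smooth_diff W(3) log_smooth_slice[OF A _ W(7)] log_smooth_integral[OF B Z W(8)]) (use ab in auto)
  then show ?thesis
  proof (rule log_smooth_cong[OF _ W(3) Z(1)])
    fix z and u :: real assume z: "z \<in> Z"
    have c: "continuous_on {a..b} (\<kappa>s z)"
    proof -
      have "continuous_on {a..b} (\<lambda>s. (\<lambda>(z, s). \<kappa>s z s) (z, s))"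
        by (rule continuous_on_compose2[OF conjunct1[OF log_smooth_base[OF kap(2)]]]) (use z in \<open>auto intro!: continuous_intros\<close>)
      then show ?thesis by simp
    qed
    show "integral {a..b} (\<lambda>s. G (\<phi> z s)) =
         \<Gamma> (\<phi> z b) * \<kappa> z b - \<Gamma> (\<phi> z a) * \<kappa> z a - integral {a..b} (\<lambda>s. \<Gamma> (\<phi> z s) * \<kappa>s z s)"
      by (rule integral_by_parts_family[OF ab Gam(1), where \<phi>s = "\<phi>s z"]) (use z phi c in auto)
  qed
qed

section \<open>From measurable to continuous solutions\<close>

lemma emeasure_preimage_le_increasing:
  fixes \<phi> \<phi>' :: "real \<Rightarrow> real"
  assumes "a < b" "m > 0" "T \<in> sets borel"
    and d: "\<And>s. s \<in> {a..b} \<Longrightarrow> (\<phi> has_real_derivative \<phi>' s) (at s)"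
    and c: "continuous_on {a..b} \<phi>'" and m: "\<And>s. s \<in> {a..b} \<Longrightarrow> m \<le> \<phi>' s"
  shows "m * emeasure lborel {s\<in>{a..b}. \<phi> s \<in> T} \<le> emeasure lborel T"
proof -
  have ms: "{s\<in>{a..b}. \<phi> s \<in> T} \<in> sets borel"
  proof -
    have "continuous_on {a..b} \<phi>"
      using d by (meson DERIV_continuous_on has_field_derivative_at_within)
    then have "\<phi> \<in> borel_measurable (restrict_space borel {a..b})"
      by (rule borel_measurable_continuous_on_restrict)
    then have "\<phi> -` T \<inter> space (restrict_space borel {a..b}) \<in> sets (restrict_space borel {a..b})"
      using assms(3) by (rule measurable_sets)
    moreover have "\<phi> -` T \<inter> space (restrict_space borel {a..b}) = {s\<in>{a..b}. \<phi> s \<in> T}"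
      by (auto simp: space_restrict_space)
    ultimately show ?thesis by (simp add: sets_restrict_space_iff)
  qed
  have "m * emeasure lborel {s\<in>{a..b}. \<phi> s \<in> T} = (\<integral>\<^sup>+ s. ennreal m * indicator {s\<in>{a..b}. \<phi> s \<in> T} s \<partial>lborel)"
    using ms by (subst nn_integral_cmult_indicator) auto
  also have "\<dots> \<le> (\<integral>\<^sup>+ s. indicator T (\<phi> s) * ennreal (\<phi>' s) * indicator {a..b} s \<partial>lborel)"
    by (intro nn_integral_mono) (use m in \<open>auto simp: indicator_def intro!: ennreal_leI\<close>)
  also have "\<dots> = (\<integral>\<^sup>+ x. indicator T x * indicator {\<phi> a..\<phi> b} x \<partial>lborel)"
    by (rule nn_integral_substitution_aux[symmetric]) (use assms m in \<open>auto intro: order.trans[of 0 m]\<close>)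
  also have "\<dots> \<le> (\<integral>\<^sup>+ x. indicator T x \<partial>lborel)"
    by (intro nn_integral_mono) (auto simp: indicator_def)
  also have "\<dots> = emeasure lborel T" using assms(3) by simp
  finally show ?thesis .
qed

text \<open>
  A map with derivative at least \<open>m\<close> in absolute value expands measure by at least \<open>m\<close>. By continuity the
  derivative has constant sign, which reduces the claim to the increasing case.
\<close>
lemma emeasure_preimage_le:
  fixes \<phi> \<phi>' :: "real \<Rightarrow> real"
  assumes ab: "a < b" and m0: "m > 0" and T: "T \<in> sets borel"
    and d: "\<And>s. s \<in> {a..b} \<Longrightarrow> (\<phi> has_real_derivative \<phi>' s) (at s)"
    and c: "continuous_on {a..b} \<phi>'" and m: "\<And>s. s \<in> {a..b} \<Longrightarrow> m \<le> \<bar>\<phi>' s\<bar>"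
  shows "m * emeasure lborel {s\<in>{a..b}. \<phi> s \<in> T} \<le> emeasure lborel T"
proof -
  have nz: "\<phi>' s \<noteq> 0" if "s \<in> {a..b}" for s using m[OF that] m0 by auto
  have "(\<forall>s\<in>{a..b}. \<phi>' s > 0) \<or> (\<forall>s\<in>{a..b}. \<phi>' s < 0)"
  proof (rule ccontr)
    assume "\<not> ?thesis"
    then obtain s t where st: "s \<in> {a..b}" "t \<in> {a..b}" "\<phi>' s < 0" "\<phi>' t > 0" using nz by (metis linorder_neqE_linordered_idom)
    have "connected (\<phi>' ` {a..b})" by (rule connected_continuous_image[OF c]) simp
    then have "0 \<in> \<phi>' ` {a..b}" using st by (force simp: connected_iff_interval)
    then show False using nz by auto
  qed
  then show ?thesis
  proof
    assume p: "\<forall>s\<in>{a..b}. \<phi>' s > 0"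
    show ?thesis
    proof (rule emeasure_preimage_le_increasing[OF ab m0 T d c])
      show "m \<le> \<phi>' s" if "s \<in> {a..b}" for s using m[OF that] p that by (simp add: abs_of_pos)
    qed
  next
    assume p: "\<forall>s\<in>{a..b}. \<phi>' s < 0"
    have "(uminus :: real \<Rightarrow> real) -` T \<inter> space borel \<in> sets borel" by (rule measurable_sets[OF _ T]) measurable
    then have u: "(uminus :: real \<Rightarrow> real) -` T \<in> sets borel" by simp
    have "m * emeasure lborel {s\<in>{a..b}. - \<phi> s \<in> uminus -` T} \<le> emeasure lborel (uminus -` T)"
    proof (rule emeasure_preimage_le_increasing[OF ab m0 u, where \<phi>' = "\<lambda>s. - \<phi>' s"])
      show "((\<lambda>s. - \<phi> s) has_real_derivative - \<phi>' s) (at s)" if "s \<in> {a..b}" for s by (rule DERIV_minus[OF d[OF that]])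
      show "m \<le> - \<phi>' s" if "s \<in> {a..b}" for s using m[OF that] p that by (simp add: abs_of_neg)
    qed (intro continuous_intros c)
    also have "emeasure lborel (uminus -` T) = emeasure (distr lborel borel uminus) T"
      using T by (subst emeasure_distr) auto
    also have "\<dots> = emeasure lborel T" by (simp add: lborel_distr_uminus)
    finally show ?thesis by simp
  qed
qed

text \<open>
  A form of Lusin's theorem: convergence almost everywhere of continuous functions is convergence in measure on a
  bounded set.
\<close>
lemma measurable_approx_continuous:
  fixes G :: "real \<Rightarrow> real"
  assumes meas: "G \<in> borel_measurable (lebesgue_on {..<1})" and e: "e > 0" and eta: "\<eta> > 0"
  obtains g T where "continuous_on UNIV g" "open T" "emeasure lborel T \<le> ennreal \<eta>"
    "\<And>v. v \<in> {-M..M} \<Longrightarrow> v < 1 \<Longrightarrow> v \<notin> T \<Longrightarrow> \<bar>g v - G v\<bar> \<le> e"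
proof -
  define H where "H v = (if v \<in> {..<1} then G v else 0)" for v
  have "G measurable_on {..<1}" using meas by (subst measurable_on_iff_borel_measurable) auto
  then obtain N g where N: "negligible N" and g: "\<And>n. continuous_on UNIV (g n)"
    and lim: "\<And>x. x \<notin> N \<Longrightarrow> (\<lambda>n. g n x) \<longlonglongrightarrow> H x" unfolding measurable_on_def H_def by blast
  have H: "H \<in> borel_measurable lebesgue"
    unfolding H_def using borel_measurable_if_I[OF meas] by simp
  define E where "E n = {v\<in>{-M..M}. \<exists>k\<ge>n. \<bar>g k v - H v\<bar> > e}" for n :: nat
  have gm: "g n \<in> borel_measurable lebesgue" for n
    using g[of n] by (intro measurable_completion) (simp add: borel_measurable_continuous_onI)
  have Em: "E n \<in> sets lebesgue" for n
  proof -
    have "E n = (\<Union>k\<in>{n..}. {v \<in> space lebesgue. e < \<bar>g k v - H v\<bar>} \<inter> {-M..M})" by (auto simp: E_def)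
    moreover have "{v \<in> space lebesgue. e < \<bar>g k v - H v\<bar>} \<in> sets lebesgue" for k
      using gm[of k] H by measurable
    ultimately show ?thesis by auto
  qed
  have Ef: "emeasure lebesgue (E n) \<noteq> \<infinity>" for n
  proof -
    have "emeasure lebesgue (E n) \<le> emeasure lebesgue {-M..M}" by (rule emeasure_mono) (auto simp: E_def)
    also have "\<dots> < \<infinity>" by (simp add: emeasure_lborel_Icc_eq)
    finally show ?thesis by simp
  qed
  have "(\<lambda>n. emeasure lebesgue (E n)) \<longlonglongrightarrow> emeasure lebesgue (\<Inter>n. E n)"
  proof (rule Lim_emeasure_decseq)
    show "range E \<subseteq> sets lebesgue" using Em by blast
    show "decseq E" unfolding E_def by (intro decseq_SucI subsetI) (auto intro: Suc_leD)
  qed (rule Ef)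
  moreover have "(\<Inter>n. E n) \<subseteq> N"
  proof
    fix v assume v: "v \<in> (\<Inter>n. E n)"
    show "v \<in> N"
    proof (rule ccontr)
      assume "v \<notin> N"
      from lim[OF this] obtain n where n: "\<And>k. k \<ge> n \<Longrightarrow> \<bar>g k v - H v\<bar> < e"
        using e unfolding lim_sequentially dist_real_def by blast
      from v have "v \<in> E n" by auto
      then show False using n unfolding E_def by force
    qed
  qed
  then have "emeasure lebesgue (\<Inter>n. E n) = 0"
    using N by (meson emeasure_eq_0 negligible_iff_null_sets null_setsD1 null_setsD2)
  ultimately have "(\<lambda>n. emeasure lebesgue (E n)) \<longlonglongrightarrow> 0" by simp
  then have "eventually (\<lambda>n. emeasure lebesgue (E n) < ennreal (\<eta> / 2)) sequentially"
    by (rule order_tendstoD) (use eta in simp)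
  then obtain n where n: "emeasure lebesgue (E n) < ennreal (\<eta> / 2)" by (auto simp: eventually_sequentially)
  have e2: "0 < \<eta> / 2" using eta by simp
  obtain T where T: "open T" "E n \<subseteq> T" "T - E n \<in> lmeasurable" "emeasure lebesgue (T - E n) < ennreal (\<eta> / 2)"
    by (rule sets_lebesgue_outer_open[OF Em[of n] e2])
  show ?thesis
  proof (rule that[of "g n" T])
    have "T - E n \<in> sets lebesgue" using T(3) by (rule fmeasurableD)
    then have "emeasure lebesgue (E n \<union> (T - E n)) \<le> emeasure lebesgue (E n) + emeasure lebesgue (T - E n)"
      by (intro emeasure_subadditive Em)
    also have "\<dots> \<le> ennreal (\<eta> / 2) + ennreal (\<eta> / 2)" using n T(4) by (intro add_mono) auto
    also have "\<dots> = ennreal \<eta>" using eta by (simp flip: ennreal_plus)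
    also have "E n \<union> (T - E n) = T" using T(2) by auto
    finally show "emeasure lborel T \<le> ennreal \<eta>" using T(1) by simp
    show "\<bar>g n v - G v\<bar> \<le> e" if "v \<in> {-M..M}" "v < 1" "v \<notin> T" for v
    proof -
      have "v \<notin> E n" using that(3) T(2) by blast
      then have "\<bar>g n v - H v\<bar> \<le> e" using that(1) unfolding E_def by force
      then show ?thesis using that(2) by (simp add: H_def)
    qed
  qed (rule g T(1))+
qed

text \<open>
  If \<open>G z\<close> is for every \<open>s\<close> a combination of values at points \<open>\<phi> i z s\<close> that move with nonzero speed in
  \<open>s\<close>, then \<open>G\<close> is continuous. Replace \<open>G\<close> on the right by a continuous function that agrees with it outside
  a set of small measure; because the speeds are bounded below, few \<open>s\<close> are bad for \<open>z\<close> or for \<open>z0\<close>, so a common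
  good \<open>s\<close> exists, and there the uniform continuity of the approximation in \<open>z\<close> applies.
\<close>
theorem measurable_solution_isCont:
  fixes G :: "real \<Rightarrow> real" and \<phi> \<phi>s :: "'i \<Rightarrow> real \<Rightarrow> real \<Rightarrow> real"
  assumes meas: "G \<in> borel_measurable (lebesgue_on {..<1})"
    and I: "finite I" and ab: "a < b" and Z: "open Z" "z0 \<in> Z"
    and eq: "\<And>z s. z \<in> Z \<Longrightarrow> s \<in> {a..b} \<Longrightarrow> G z = (\<Sum>i\<in>I. c i * G (\<phi> i z s)) + K s"
    and lt: "\<And>i z s. i \<in> I \<Longrightarrow> z \<in> Z \<Longrightarrow> s \<in> {a..b} \<Longrightarrow> \<phi> i z s < 1"
    and cont: "\<And>i. i \<in> I \<Longrightarrow> continuous_on (Z \<times> {a..b}) (\<lambda>(z, s). \<phi> i z s)"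
    and der: "\<And>i z s. i \<in> I \<Longrightarrow> z \<in> Z \<Longrightarrow> s \<in> {a..b} \<Longrightarrow> (\<phi> i z has_real_derivative \<phi>s i z s) (at s)"
    and conts: "\<And>i. i \<in> I \<Longrightarrow> continuous_on (Z \<times> {a..b}) (\<lambda>(z, s). \<phi>s i z s)"
    and nz: "\<And>i z s. i \<in> I \<Longrightarrow> z \<in> Z \<Longrightarrow> s \<in> {a..b} \<Longrightarrow> \<phi>s i z s \<noteq> 0"
  shows "isCont G z0"
  unfolding continuous_at_eps_delta dist_real_def
proof (intro allI impI)
  fix e :: real assume e: "e > 0"
  obtain r where r: "r > 0" "cball z0 r \<subseteq> Z" using Z open_contains_cball by blast
  define Q where "Q = cball z0 r \<times> {a..b}"
  have Q: "compact Q" "Q \<noteq> {}" unfolding Q_def using r ab by (auto intro: compact_Times)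
  have QZ: "Q \<subseteq> Z \<times> {a..b}" using r by (auto simp: Q_def)
  have "\<exists>M. \<forall>x\<in>Q. \<bar>(\<lambda>(z, s). \<phi> i z s) x\<bar> \<le> M" if "i \<in> I" for i
  proof -
    have "bounded ((\<lambda>(z, s). \<phi> i z s) ` Q)"
      by (rule compact_imp_bounded[OF compact_continuous_image[OF continuous_on_subset[OF cont[OF that] QZ] Q(1)]])
    then show ?thesis unfolding bounded_iff real_norm_def by blast
  qed
  then obtain M0 where M0: "\<And>i x. i \<in> I \<Longrightarrow> x \<in> Q \<Longrightarrow> \<bar>(\<lambda>(z, s). \<phi> i z s) x\<bar> \<le> M0 i" by metis
  define M where "M = (\<Sum>i\<in>I. \<bar>M0 i\<bar>)"
  have M: "\<bar>\<phi> i z s\<bar> \<le> M" if "i \<in> I" "z \<in> cball z0 r" "s \<in> {a..b}" for i z s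
  proof -
    have "\<bar>\<phi> i z s\<bar> \<le> \<bar>M0 i\<bar>" using M0[OF that(1), of "(z, s)"] that by (auto simp: Q_def)
    also have "\<dots> \<le> M" unfolding M_def by (rule member_le_sum) (use that I in auto)
    finally show ?thesis .
  qed
  have "\<exists>m>0. \<forall>x\<in>Q. m \<le> \<bar>(\<lambda>(z, s). \<phi>s i z s) x\<bar>" if i: "i \<in> I" for i
  proof -
    have "continuous_on Q (\<lambda>x. \<bar>(\<lambda>(z, s). \<phi>s i z s) x\<bar>)"
      by (intro continuous_intros continuous_on_subset[OF conts[OF i] QZ])
    from continuous_attains_inf[OF Q this] obtain x where x: "x \<in> Q"
      "\<And>y. y \<in> Q \<Longrightarrow> \<bar>(\<lambda>(z, s). \<phi>s i z s) x\<bar> \<le> \<bar>(\<lambda>(z, s). \<phi>s i z s) y\<bar>" by blast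
    have "\<bar>(\<lambda>(z, s). \<phi>s i z s) x\<bar> > 0" using nz[OF i] x(1) QZ by (auto simp: split_def)
    then show ?thesis using x(2) by blast
  qed
  then obtain m0 where m0: "\<And>i. i \<in> I \<Longrightarrow> m0 i > 0" "\<And>i x. i \<in> I \<Longrightarrow> x \<in> Q \<Longrightarrow> m0 i \<le> \<bar>(\<lambda>(z, s). \<phi>s i z s) x\<bar>" by metis
  define m where "m = Min (insert 1 (m0 ` I))"
  have m: "m > 0" unfolding m_def using m0(1) I by auto
  have mle: "m \<le> \<bar>\<phi>s i z s\<bar>" if "i \<in> I" "z \<in> cball z0 r" "s \<in> {a..b}" for i z s
  proof -
    have "m \<le> m0 i" unfolding m_def using that I by (intro Min_le) auto
    also have "\<dots> \<le> \<bar>\<phi>s i z s\<bar>" using m0(2)[OF that(1), of "(z, s)"] that by (auto simp: Q_def)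
    finally show ?thesis .
  qed
  define N where "N = real (card I)"
  define \<eta> where "\<eta> = m * (b - a) / (4 * (N + 1))"
  have eta: "\<eta> > 0" unfolding \<eta>_def N_def using m ab by simp
  define S where "S = (\<Sum>i\<in>I. \<bar>c i\<bar>)"
  have S: "S \<ge> 0" unfolding S_def by (simp add: sum_nonneg)
  define e' where "e' = e / (4 * (S + 1))"
  have e': "e' > 0" unfolding e'_def using e S by simp
  obtain g T where gT: "continuous_on UNIV g" "open T" "emeasure lborel T \<le> ennreal \<eta>"
    "\<And>v. v \<in> {-M..M} \<Longrightarrow> v < 1 \<Longrightarrow> v \<notin> T \<Longrightarrow> \<bar>g v - G v\<bar> \<le> e'"
    using measurable_approx_continuous[OF meas e' eta, of M] by blast
  have "\<exists>d>0. \<forall>x\<in>Q. \<forall>y\<in>Q. dist y x < d \<longrightarrow> dist (g ((\<lambda>(z, s). \<phi> i z s) y)) (g ((\<lambda>(z, s). \<phi> i z s) x)) < e'" if i: "i \<in> I" for i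
  proof -
    have "continuous_on Q (\<lambda>x. g ((\<lambda>(z, s). \<phi> i z s) x))"
      by (rule continuous_on_compose2[OF gT(1) continuous_on_subset[OF cont[OF i] QZ]]) auto
    then have "uniformly_continuous_on Q (\<lambda>x. g ((\<lambda>(z, s). \<phi> i z s) x))"
      by (rule compact_uniformly_continuous[OF _ Q(1)])
    then show ?thesis using e' unfolding uniformly_continuous_on_def by blast
  qed
  then obtain d0 where d0: "\<And>i. i \<in> I \<Longrightarrow> d0 i > 0"
    "\<And>i x y. i \<in> I \<Longrightarrow> x \<in> Q \<Longrightarrow> y \<in> Q \<Longrightarrow> dist y x < d0 i \<Longrightarrow> dist (g ((\<lambda>(z, s). \<phi> i z s) y)) (g ((\<lambda>(z, s). \<phi> i z s) x)) < e'"
    by metis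
  define d where "d = Min (insert r (d0 ` I))"
  have d: "d > 0" "d \<le> r" unfolding d_def using d0(1) I r(1) by auto
  have dle: "d \<le> d0 i" if "i \<in> I" for i unfolding d_def using that I by (intro Min_le) auto
  have bad: "emeasure lborel {s\<in>{a..b}. \<phi> i z s \<in> T} \<le> ennreal (\<eta> / m)" and bad_sets: "{s\<in>{a..b}. \<phi> i z s \<in> T} \<in> sets lborel"
    if i: "i \<in> I" and z: "z \<in> cball z0 r" for i z
  proof -
    have zZ: "z \<in> Z" using z r by auto
    have c': "continuous_on {a..b} (\<phi>s i z)"
    proof -
      have "continuous_on {a..b} (\<lambda>s. (\<lambda>(z, s). \<phi>s i z s) (z, s))"
        by (rule continuous_on_compose2[OF conts[OF i]]) (use zZ in \<open>auto intro!: continuous_intros\<close>)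
      then show ?thesis by simp
    qed
    have "m * emeasure lborel {s\<in>{a..b}. \<phi> i z s \<in> T} \<le> emeasure lborel T"
      by (rule emeasure_preimage_le[OF ab m _ der[OF i zZ] c' mle[OF i z]]) (use gT in auto)
    also have "\<dots> \<le> ennreal \<eta>" by (rule gT(3))
    finally have 1: "ennreal m * emeasure lborel {s\<in>{a..b}. \<phi> i z s \<in> T} \<le> ennreal m * ennreal (\<eta> / m)"
      using m eta by (simp flip: ennreal_mult)
    show "emeasure lborel {s\<in>{a..b}. \<phi> i z s \<in> T} \<le> ennreal (\<eta> / m)"
    proof (rule ccontr)
      assume "\<not> ?thesis"
      then have "ennreal m * ennreal (\<eta> / m) < ennreal m * emeasure lborel {s\<in>{a..b}. \<phi> i z s \<in> T}"
        using m by (intro ennreal_mult_strict_left_mono) auto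
      then show False using 1 by simp
    qed
    have "continuous_on {a..b} (\<phi> i z)"
      using der[OF i zZ] by (meson DERIV_continuous_on has_field_derivative_at_within)
    then have "\<phi> i z \<in> borel_measurable (restrict_space borel {a..b})"
      by (rule borel_measurable_continuous_on_restrict)
    then have "\<phi> i z -` T \<inter> space (restrict_space borel {a..b}) \<in> sets (restrict_space borel {a..b})"
      by (rule measurable_sets) (use gT(2) in auto)
    moreover have "\<phi> i z -` T \<inter> space (restrict_space borel {a..b}) = {s\<in>{a..b}. \<phi> i z s \<in> T}"
      by (auto simp: space_restrict_space)
    ultimately show "{s\<in>{a..b}. \<phi> i z s \<in> T} \<in> sets lborel" by (simp add: sets_restrict_space_iff)
  qed
  show "\<exists>d>0. \<forall>z'. \<bar>z' - z0\<bar> < d \<longrightarrow> \<bar>G z' - G z0\<bar> < e"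
  proof (intro exI conjI allI impI)
    show "d > 0" by (rule d)
    fix z assume log_deriv: "\<bar>z - z0\<bar> < d"
    have z: "z \<in> cball z0 r" "z0 \<in> cball z0 r" using log_deriv d r by (auto simp: dist_real_def)
    have zZ: "z \<in> Z" using z r by auto
    define A where "A = (\<Union>i\<in>I. {s\<in>{a..b}. \<phi> i z s \<in> T}) \<union> (\<Union>i\<in>I. {s\<in>{a..b}. \<phi> i z0 s \<in> T})"
    have un: "emeasure lborel (\<Union>i\<in>I. {s\<in>{a..b}. \<phi> i z s \<in> T}) \<le> ennreal (N * (\<eta> / m))"
      "(\<Union>i\<in>I. {s\<in>{a..b}. \<phi> i z s \<in> T}) \<in> sets lborel" if "z \<in> cball z0 r" for z
    proof -
      have "emeasure lborel (\<Union>i\<in>I. {s\<in>{a..b}. \<phi> i z s \<in> T}) \<le> (\<Sum>i\<in>I. emeasure lborel {s\<in>{a..b}. \<phi> i z s \<in> T})"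
        by (rule emeasure_subadditive_finite[OF I]) (use bad_sets that in auto)
      also have "\<dots> \<le> (\<Sum>i\<in>I. ennreal (\<eta> / m))" by (rule sum_mono) (use bad that in auto)
      also have "\<dots> = ennreal (N * (\<eta> / m))"
        using m eta by (simp add: N_def ennreal_of_nat_eq_real_of_nat flip: ennreal_mult)
      finally show "emeasure lborel (\<Union>i\<in>I. {s\<in>{a..b}. \<phi> i z s \<in> T}) \<le> ennreal (N * (\<eta> / m))" .
      show "(\<Union>i\<in>I. {s\<in>{a..b}. \<phi> i z s \<in> T}) \<in> sets lborel" by (rule sets.finite_UN[OF I]) (use bad_sets that in auto)
    qed
    have "emeasure lborel A \<le> ennreal (N * (\<eta> / m)) + ennreal (N * (\<eta> / m))"
      unfolding A_def by (rule order.trans[OF emeasure_subadditive[OF un(2)[OF z(1)] un(2)[OF z(2)]] add_mono[OF un(1)[OF z(1)] un(1)[OF z(2)]]])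
    also have "\<dots> = ennreal (2 * (N * (\<eta> / m)))" using m eta by (simp add: N_def flip: ennreal_plus)
    also have "\<dots> < ennreal (b - a)"
    proof (rule ennreal_lessI)
      show "0 < b - a" using ab by simp
      have N: "N \<ge> 0" by (simp add: N_def)
      have "\<eta> / m = (b - a) / (4 * (N + 1))" unfolding \<eta>_def using m by simp
      then have "2 * (N * (\<eta> / m)) = (b - a) * (2 * N) / (4 * (N + 1))" by (simp add: mult_ac)
      also have "\<dots> < b - a"
      proof (subst pos_divide_less_eq)
        show "(b - a) * (2 * N) < (b - a) * (4 * (N + 1))" by (rule mult_strict_left_mono) (use N ab in auto)
      qed (use N in simp)
      finally show "2 * (N * (\<eta> / m)) < b - a" .
    qed
    finally have lessA: "emeasure lborel A < ennreal (b - a)" .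
    have "\<not> {a..b} \<subseteq> A"
    proof
      assume "{a..b} \<subseteq> A"
      then have "emeasure lborel {a..b} \<le> emeasure lborel A"
        by (rule emeasure_mono) (unfold A_def, rule sets.Un[OF un(2)[OF z(1)] un(2)[OF z(2)]])
      then show False using lessA ab by (simp add: emeasure_lborel_Icc_eq)
    qed
    then obtain s where s: "s \<in> {a..b}" "s \<notin> A" by blast
    have tm: "\<bar>G (\<phi> i z s) - G (\<phi> i z0 s)\<bar> \<le> 3 * e'" if i: "i \<in> I" for i
    proof -
      have "\<bar>g (\<phi> i z s) - G (\<phi> i z s)\<bar> \<le> e'"
        by (rule gT(4)) (use M[OF i z(1) s(1)] lt[OF i zZ s(1)] s i in \<open>auto simp: A_def abs_le_iff\<close>)
      moreover have "\<bar>g (\<phi> i z0 s) - G (\<phi> i z0 s)\<bar> \<le> e'"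
        by (rule gT(4)) (use M[OF i z(2) s(1)] lt[OF i Z(2) s(1)] s i in \<open>auto simp: A_def abs_le_iff\<close>)
      moreover have "dist (g ((\<lambda>(z, s). \<phi> i z s) (z, s))) (g ((\<lambda>(z, s). \<phi> i z s) (z0, s))) < e'"
        by (rule d0(2)[OF i]) (use z s log_deriv dle[OF i] in \<open>auto simp: Q_def dist_Pair_Pair dist_real_def\<close>)
      ultimately show ?thesis unfolding dist_real_def by simp
    qed
    have "G z - G z0 = (\<Sum>i\<in>I. c i * (G (\<phi> i z s) - G (\<phi> i z0 s)))"
      unfolding eq[OF zZ s(1)] eq[OF Z(2) s(1)] by (simp add: sum_subtractf right_diff_distrib)
    also have "\<bar>\<dots>\<bar> \<le> (\<Sum>i\<in>I. \<bar>c i\<bar> * (3 * e'))"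
      by (rule order.trans[OF sum_abs sum_mono]) (use tm in \<open>auto simp: abs_mult intro: mult_left_mono\<close>)
    also have "\<dots> = S * (3 * e')" unfolding S_def by (simp add: sum_distrib_right)
    also have "\<dots> < e" unfolding e'_def using e S by (simp add: field_simps add_nonneg_pos)
    finally show "\<bar>G z - G z0\<bar> < e" .
  qed
qed

section \<open>Finite differences and the degenerate corner\<close>

definition mdiff :: "real \<Rightarrow> (real \<Rightarrow> real) \<Rightarrow> real \<Rightarrow> real" where
  "mdiff a f X = f (a * X) - f X"

text \<open>
  Elimination of the unknown functions: a difference in \<open>w\<close> at fixed \<open>\<delta>\<close> annihilates \<open>f4\<close>, one along
  constant \<open>w/\<delta>\<close> annihilates \<open>f1\<close>, and one in \<open>\<delta>\<close> at fixed \<open>w\<close> annihilates \<open>f2\<close>. The factor \<open>1/\<delta>\<close> of \<open>f3\<close> is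
  removed by comparing \<open>\<delta>\<close> with \<open>2 \<delta>\<close>, which leaves the combination \<open>2f(2X) - f(X)\<close>.
\<close>
lemma four_term_elimination:
  fixes f1 f2 f3 f4 p :: "real \<Rightarrow> real"
  assumes bd: "\<And>w \<delta>. w0 \<le> w \<Longrightarrow> w \<le> 4 * w0 \<Longrightarrow> d0 \<le> \<delta> \<Longrightarrow> \<delta> \<le> 8 * d0 \<Longrightarrow>
      \<bar>f1 (w / \<delta>) + f2 w + p (w * \<delta>) + f3 w / \<delta> + f4 \<delta>\<bar> \<le> B"
    and w0: "w0 > 0" and d0: "d0 > 0" and abc: "a \<in> {1..2}" "b \<in> {1..2}" "c \<in> {1..2}"
  shows "\<bar>2 * mdiff c (mdiff (b\<^sup>2) (mdiff a p)) (2 * (w0 * d0)) - mdiff c (mdiff (b\<^sup>2) (mdiff a p)) (w0 * d0)\<bar> \<le> 24 * B"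
proof -
  define g1 where "g1 r = f1 (a * r) - f1 r" for r
  define g2 where "g2 w = f2 (a * w) - f2 w" for w
  define g3 where "g3 w = f3 (a * w) - f3 w" for w
  define gp where "gp = mdiff a p"
  have H1: "\<bar>g1 (w / \<delta>) + g2 w + gp (w * \<delta>) + g3 w / \<delta>\<bar> \<le> 2 * B"
    if "w0 \<le> w" "w \<le> 2 * w0" "d0 \<le> \<delta>" "\<delta> \<le> 8 * d0" for w \<delta>
  proof -
    have "1 * w \<le> a * w" "a * w \<le> 2 * w" using abc that w0 by (auto intro!: mult_right_mono)
    then have aw: "w0 \<le> a * w" "a * w \<le> 4 * w0" using that by auto
    from bd[OF aw that(3,4)] bd[of w \<delta>] that w0
    show ?thesis by (simp add: g1_def g2_def g3_def gp_def mdiff_def diff_divide_distrib mult.assoc)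
  qed
  define k2 where "k2 w = g2 (b * w) - g2 w" for w
  define k3 where "k3 w = g3 (b * w) / b - g3 w" for w
  define kp where "kp = mdiff (b\<^sup>2) gp"
  have H2: "\<bar>k2 w + kp (w * \<delta>) + k3 w / \<delta>\<bar> \<le> 4 * B"
    if "w = w0" "d0 \<le> \<delta>" "\<delta> \<le> 4 * d0" for w \<delta>
  proof -
    have "1 * w \<le> b * w" "b * w \<le> 2 * w" "1 * \<delta> \<le> b * \<delta>" "b * \<delta> \<le> 2 * \<delta>" using abc that w0 d0 by (auto intro!: mult_right_mono)
    then have bw: "w0 \<le> b * w" "b * w \<le> 2 * w0" "d0 \<le> b * \<delta>" "b * \<delta> \<le> 8 * d0" using that by auto
    have 1: "b * w / (b * \<delta>) = w / \<delta>" "b * w * (b * \<delta>) = b\<^sup>2 * (w * \<delta>)" "g3 (b * w) / (b * \<delta>) = g3 (b * w) / b / \<delta>"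
      using abc by (auto simp: power2_eq_square mult_ac)
    have "k2 w + kp (w * \<delta>) + k3 w / \<delta> = (g1 (w / \<delta>) + g2 (b * w) + gp (b\<^sup>2 * (w * \<delta>)) + g3 (b * w) / (b * \<delta>))
        - (g1 (w / \<delta>) + g2 w + gp (w * \<delta>) + g3 w / \<delta>)"
      unfolding 1(3) by (simp add: k2_def k3_def kp_def mdiff_def diff_divide_distrib)
    moreover have "\<bar>g1 (w / \<delta>) + g2 w + gp (w * \<delta>) + g3 w / \<delta>\<bar> \<le> 2 * B"
      by (rule H1) (use that w0 d0 in auto)
    ultimately show ?thesis using H1[OF bw, unfolded 1(1,2)] by linarith
  qed
  have H3: "\<bar>mdiff c kp (w * \<delta>) + (1 / c - 1) * k3 w / \<delta>\<bar> \<le> 8 * B"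
    if "w = w0" "d0 \<le> \<delta>" "\<delta> \<le> 2 * d0" for w \<delta>
  proof -
    have "1 * \<delta> \<le> c * \<delta>" "c * \<delta> \<le> 2 * \<delta>" using abc that d0 by (auto intro!: mult_right_mono)
    then have cd: "d0 \<le> c * \<delta>" "c * \<delta> \<le> 4 * d0" using that by auto
    have 1: "w * (c * \<delta>) = c * (w * \<delta>)" "k3 w / (c * \<delta>) = k3 w / c / \<delta>" by auto
    have "(1 / c - 1) * k3 w / \<delta> = k3 w / c / \<delta> - k3 w / \<delta>" using abc by (simp add: left_diff_distrib diff_divide_distrib)
    with H2[OF that(1) cd] H2[OF that(1), of \<delta>] that d0
    show ?thesis unfolding 1 by (simp add: mdiff_def)
  qed
  have "2 * ((1 / c - 1) * k3 w0 / (2 * d0)) = (1 / c - 1) * k3 w0 / d0" by simp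
  moreover have "\<bar>2 * x - y\<bar> \<le> 24 * B" if "\<bar>x + u\<bar> \<le> 8 * B" "\<bar>y + v\<bar> \<le> 8 * B" "2 * u = v" for x y u v :: real
    using that by linarith
  ultimately have "\<bar>2 * mdiff c kp (w0 * (2 * d0)) - mdiff c kp (w0 * d0)\<bar> \<le> 24 * B"
    using H3[of w0 "2 * d0"] H3[of w0 d0] d0 by auto
  then show ?thesis by (simp add: kp_def gp_def mult_ac)
qed

lemma powr_half_power: "(X / 2 ^ n) powr \<kappa> = X powr \<kappa> * (2 powr (- \<kappa>)) ^ n" if "X > 0" for X :: real
proof -
  have "(2 ^ n :: real) powr \<kappa> = 2 powr (real n * \<kappa>)" by (simp add: powr_realpow[symmetric] powr_powr)
  moreover have "(2 powr (- \<kappa>)) ^ n = (2 :: real) powr (- (real n * \<kappa>))" by (simp add: powr_power mult.commute)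
  ultimately show ?thesis using that by (simp add: powr_divide powr_minus_divide)
qed

text \<open>
  Solve \<open>f(X) = f(X/2)/2 + O(X^\<kappa>)\<close> by iteration towards 0: the errors form a geometric series with ratio
  \<open>2^(-1-\<kappa>) < 1\<close>, and the remainder \<open>2^(-n) f(X/2^n)\<close> vanishes because \<open>X f(X)\<close> tends to 0.
\<close>
lemma doubling_recursion_bound:
  fixes f :: "real \<Rightarrow> real"
  assumes \<kappa>: "\<kappa> > -1" and C: "C \<ge> 0" and bd: "\<And>X. 0 < X \<Longrightarrow> X < X0 \<Longrightarrow> \<bar>2 * f (2 * X) - f X\<bar> \<le> C * X powr \<kappa>"
    and lim: "((\<lambda>X. X * f X) \<longlongrightarrow> 0) (at_right 0)" and X: "0 < X" "X < X0"
  shows "\<bar>f X\<bar> \<le> C * 2 powr (- \<kappa>) / (1 - 2 powr (- 1 - \<kappa>)) * X powr \<kappa>"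
proof -
  define \<theta> where "\<theta> = 2 powr (- 1 - \<kappa>)"
  have th: "0 < \<theta>" "\<theta> < 1" unfolding \<theta>_def using \<kappa> powr_less_cancel_iff[of 2 "-1-\<kappa>" 0] by auto
  have step: "\<bar>f X\<bar> \<le> C * 2 powr (- \<kappa>) * X powr \<kappa> + \<bar>f (X / 2)\<bar> / 2" if "0 < X" "X < X0" for X
  proof -
    have "\<bar>2 * f (2 * (X / 2)) - f (X / 2)\<bar> \<le> C * (X / 2) powr \<kappa>" by (rule bd) (use that in auto)
    also have "(X / 2) powr \<kappa> = X powr \<kappa> * 2 powr (- \<kappa>)" using powr_half_power[of X 1 \<kappa>] that by simp
    finally have "\<bar>2 * f X - f (X / 2)\<bar> \<le> C * 2 powr (- \<kappa>) * X powr \<kappa>" by (simp add: mult_ac)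
    moreover have "0 \<le> C * 2 powr (- \<kappa>) * X powr \<kappa>" using C by simp
    ultimately show ?thesis by (smt (verit) field_sum_of_halves)
  qed
  have ind: "\<bar>f X\<bar> \<le> C * 2 powr (- \<kappa>) * X powr \<kappa> * (\<Sum>j<n. \<theta> ^ j) + \<bar>f (X / 2 ^ n)\<bar> / 2 ^ n" for n
  proof (induction n)
    case (Suc n)
    have "X / 2 ^ n \<le> X" using X by (simp add: divide_le_eq)
    then have "X / 2 ^ n < X0" using X by simp
    then have "\<bar>f (X / 2 ^ n)\<bar> \<le> C * 2 powr (- \<kappa>) * (X / 2 ^ n) powr \<kappa> + \<bar>f (X / 2 ^ n / 2)\<bar> / 2"
      by (intro step) (use X in auto)
    then have "\<bar>f (X / 2 ^ n)\<bar> / 2 ^ n \<le> (C * 2 powr (- \<kappa>) * (X / 2 ^ n) powr \<kappa> + \<bar>f (X / 2 ^ n / 2)\<bar> / 2) / 2 ^ n"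
      by (rule divide_right_mono) simp
    also have "\<dots> = C * 2 powr (- \<kappa>) * X powr \<kappa> * \<theta> ^ n + \<bar>f (X / 2 ^ Suc n)\<bar> / 2 ^ Suc n"
    proof -
      have "\<theta> ^ n = (2 powr (- \<kappa>)) ^ n / 2 ^ n"
        unfolding \<theta>_def by (simp add: powr_diff power_divide powr_minus field_simps)
      then show ?thesis using powr_half_power[OF X(1), of n \<kappa>] by (simp add: add_divide_distrib mult_ac)
    qed
    finally show ?case using Suc.IH by (simp add: distrib_left)
  qed simp
  have "(\<lambda>n. X * (1 / 2) ^ n) \<longlonglongrightarrow> X * 0"
    by (intro tendsto_mult tendsto_const LIMSEQ_realpow_zero) auto
  then have "(\<lambda>n. X / 2 ^ n) \<longlonglongrightarrow> 0" by (simp add: power_divide)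
  then have "filterlim (\<lambda>n. X / 2 ^ n) (at_right 0) sequentially"
    unfolding filterlim_at using X by (auto intro!: always_eventually)
  then have "(\<lambda>n. X / 2 ^ n * f (X / 2 ^ n)) \<longlonglongrightarrow> 0" by (rule filterlim_compose[OF lim])
  then have "(\<lambda>n. \<bar>X / 2 ^ n * f (X / 2 ^ n)\<bar> / X) \<longlonglongrightarrow> 0 / X"
    by (intro tendsto_divide tendsto_rabs_zero tendsto_const) (use X in auto)
  then have l0: "(\<lambda>n. \<bar>f (X / 2 ^ n)\<bar> / 2 ^ n) \<longlonglongrightarrow> 0"
    using X by (simp add: abs_mult)
  have "(\<lambda>n. \<Sum>j<n. \<theta> ^ j) \<longlonglongrightarrow> 1 / (1 - \<theta>)"
    using geometric_sums[of \<theta>] th unfolding sums_def by simp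
  then have "(\<lambda>n. C * 2 powr (- \<kappa>) * X powr \<kappa> * (\<Sum>j<n. \<theta> ^ j) + \<bar>f (X / 2 ^ n)\<bar> / 2 ^ n)
      \<longlonglongrightarrow> C * 2 powr (- \<kappa>) * X powr \<kappa> * (1 / (1 - \<theta>)) + 0"
    by (intro tendsto_intros l0)
  from LIMSEQ_le_const[OF this] ind have "\<bar>f X\<bar> \<le> C * 2 powr (- \<kappa>) * X powr \<kappa> * (1 / (1 - \<theta>)) + 0" by blast
  then show ?thesis unfolding \<theta>_def by simp
qed

text \<open>
  Sum the differences over the dyadic points between \<open>X\<close> and a fixed reference interval. Since \<open>\<kappa> < 0\<close> the terms
  grow geometrically towards \<open>X\<close>, so that the last one dominates.
\<close>
lemma difference_growth_bound:
  fixes g :: "real \<Rightarrow> real"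
  assumes \<kappa>: "\<kappa> < 0" and X0: "0 < X0" "X0 \<le> 1" and bd: "\<And>X. 0 < X \<Longrightarrow> X < X0 \<Longrightarrow> \<bar>mdiff 2 g X\<bar> \<le> C * X powr \<kappa>"
    and M: "\<And>X. X0 / 2 \<le> X \<Longrightarrow> X < X0 \<Longrightarrow> \<bar>g X\<bar> \<le> M"
  obtains C' where "\<forall>X. 0 < X \<longrightarrow> X < X0 \<longrightarrow> \<bar>g X\<bar> \<le> C' * X powr \<kappa>"
proof -
  define \<theta> where "\<theta> = 2 powr \<kappa>"
  have th: "0 < \<theta>" "\<theta> < 1" unfolding \<theta>_def using \<kappa> powr_less_cancel_iff[of 2 \<kappa> 0] by auto
  have C: "C \<ge> 0"
  proof -
    have "0 \<le> C * (X0 / 2) powr \<kappa>" using bd[of "X0 / 2"] X0 by (auto intro: order.trans[OF abs_ge_zero])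
    then show ?thesis using X0 by (simp add: zero_le_mult_iff)
  qed
  have main: "\<bar>g X\<bar> \<le> \<bar>M\<bar> + C * (\<Sum>j<n. \<theta> ^ j) * X powr \<kappa>" if "0 < X" "X0 / 2 \<le> 2 ^ n * X" "2 ^ n * X < X0" for X n
    using that
  proof (induction n arbitrary: X)
    case 0
    then show ?case using M[of X] by simp
  next
    case (Suc n)
    have le: "X \<le> 2 ^ Suc n * X" using Suc.prems(1) one_le_power[of "2::real" "Suc n"] mult_right_mono[of 1 "2 ^ Suc n" X] by simp
    have "\<bar>g (2 * X)\<bar> \<le> \<bar>M\<bar> + C * (\<Sum>j<n. \<theta> ^ j) * (2 * X) powr \<kappa>"
      by (rule Suc.IH) (use Suc.prems in \<open>auto simp: mult_ac\<close>)
    moreover have "(2 * X) powr \<kappa> = \<theta> * X powr \<kappa>" using Suc.prems by (simp add: powr_mult \<theta>_def)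
    moreover have "\<bar>g (2 * X) - g X\<bar> \<le> C * X powr \<kappa>" using bd[of X] Suc.prems le unfolding mdiff_def by simp
    ultimately have "\<bar>g (2 * X)\<bar> \<le> \<bar>M\<bar> + C * (\<Sum>j<n. \<theta> ^ j) * (\<theta> * X powr \<kappa>)" "\<bar>g (2 * X) - g X\<bar> \<le> C * X powr \<kappa>" by simp_all
    then have "\<bar>g X\<bar> \<le> \<bar>M\<bar> + C * (\<Sum>j<n. \<theta> ^ j) * (\<theta> * X powr \<kappa>) + C * X powr \<kappa>" by linarith
    also have "\<dots> = \<bar>M\<bar> + C * (\<Sum>j<Suc n. \<theta> ^ j) * X powr \<kappa>"
      unfolding sum.lessThan_Suc_shift by (simp add: sum_distrib_left sum_distrib_right algebra_simps)
    finally show ?case .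
  qed
  have "\<bar>g X\<bar> \<le> (\<bar>M\<bar> + C / (1 - \<theta>)) * X powr \<kappa>" if X: "0 < X" "X < X0" for X
  proof -
    obtain n where n: "X0 / 2 \<le> 2 ^ n * X" "2 ^ n * X < X0"
    proof -
      obtain m where m: "X0 / X < 2 ^ m" using real_arch_pow[of 2 "X0 / X"] by auto
      define n where "n = (LEAST m. X0 \<le> 2 ^ m * X)"
      have ex: "X0 \<le> 2 ^ m * X" using m X by (simp add: field_simps)
      have 1: "X0 \<le> 2 ^ n * X" unfolding n_def by (rule LeastI[of _ m]) (rule ex)
      have "n \<noteq> 0" using 1 X by (cases "n = 0") auto
      then obtain k where k: "n = Suc k" by (cases n) auto
      have "\<not> X0 \<le> 2 ^ k * X" using not_less_Least[of k "\<lambda>m. X0 \<le> 2 ^ m * X"] k unfolding n_def by auto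
      then show thesis using that[of k] 1 k by simp
    qed
    have "(\<Sum>j<n. \<theta> ^ j) \<le> 1 / (1 - \<theta>)"
      using sum_le_suminf[of "\<lambda>j. \<theta> ^ j" "{..<n}"] th by (simp add: suminf_geometric summable_geometric)
    then have "C * (\<Sum>j<n. \<theta> ^ j) * X powr \<kappa> \<le> C * (1 / (1 - \<theta>)) * X powr \<kappa>"
      using C by (intro mult_right_mono mult_left_mono) auto
    moreover have "\<bar>M\<bar> * 1 \<le> \<bar>M\<bar> * X powr \<kappa>"
    proof (rule mult_left_mono)
      show "1 \<le> X powr \<kappa>" using X X0 \<kappa> powr_mono2'[of "\<kappa>" X 1] by simp
    qed simp
    ultimately show ?thesis using main[OF X(1) n] by (simp add: distrib_right)
  qed
  then show ?thesis by (intro that[of "\<bar>M\<bar> + C / (1 - \<theta>)"]) blast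
qed

text \<open>
  Three applications of the mean value theorem.
\<close>
lemma third_difference_mvt:
  fixes f :: "nat \<Rightarrow> real \<Rightarrow> real"
  assumes h: "h > 0" and d: "\<And>k x. k < 3 \<Longrightarrow> u \<le> x \<Longrightarrow> x \<le> u + 3 * h \<Longrightarrow> (f k has_real_derivative f (Suc k) x) (at x)"
  obtains \<xi> where "u \<le> \<xi>" "\<xi> \<le> u + 3 * h" "f 0 (u + 3 * h) - 3 * f 0 (u + 2 * h) + 3 * f 0 (u + h) - f 0 u = h ^ 3 * f 3 \<xi>"
proof -
  have "\<exists>x>u. x < u + h \<and> (f 0 (u + h + 2 * h) - 2 * f 0 (u + h + h) + f 0 (u + h)) - (f 0 (u + 2 * h) - 2 * f 0 (u + h) + f 0 u)
      = (u + h - u) * (f 1 (x + 2 * h) - 2 * f 1 (x + h) + f 1 x)"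
  proof (rule MVT2)
    fix x assume x: "u \<le> x" "x \<le> u + h"
    show "((\<lambda>x. f 0 (x + 2 * h) - 2 * f 0 (x + h) + f 0 x) has_real_derivative f 1 (x + 2 * h) - 2 * f 1 (x + h) + f 1 x) (at x)"
      using x h d[of 0 "x + 2 * h"] d[of 0 "x + h"] d[of 0 x]
      by (intro DERIV_add DERIV_diff DERIV_cmult) (auto simp: DERIV_shift)
  qed (use h in auto)
  then obtain x where x: "u < x" "x < u + h"
    "(f 0 (u + h + 2 * h) - 2 * f 0 (u + h + h) + f 0 (u + h)) - (f 0 (u + 2 * h) - 2 * f 0 (u + h) + f 0 u)
      = (u + h - u) * (f 1 (x + 2 * h) - 2 * f 1 (x + h) + f 1 x)" by blast
  have "\<exists>y>x. y < x + h \<and> (f 1 (x + h + h) - f 1 (x + h)) - (f 1 (x + h) - f 1 x)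
      = (x + h - x) * (f 2 (y + h) - f 2 y)"
  proof (rule MVT2)
    fix y assume y: "x \<le> y" "y \<le> x + h"
    show "((\<lambda>x. f 1 (x + h) - f 1 x) has_real_derivative f 2 (y + h) - f 2 y) (at y)"
      using x y h d[of 1 "y + h"] d[of 1 y]
      by (intro DERIV_diff) (auto simp: DERIV_shift numeral_2_eq_2)
  qed (use h in auto)
  then obtain y where y: "x < y" "y < x + h"
    "(f 1 (x + h + h) - f 1 (x + h)) - (f 1 (x + h) - f 1 x) = (x + h - x) * (f 2 (y + h) - f 2 y)" by blast
  have "\<exists>\<xi>>y. \<xi> < y + h \<and> f 2 (y + h) - f 2 y = (y + h - y) * f 3 \<xi>"
  proof (rule MVT2)
    fix z assume "y \<le> z" "z \<le> y + h"
    then show "(f 2 has_real_derivative f 3 z) (at z)"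
      using x y h d[of 2 z] by (simp add: numeral_3_eq_3)
  qed (use h in auto)
  then obtain \<xi> where xi: "y < \<xi>" "\<xi> < y + h" "f 2 (y + h) - f 2 y = (y + h - y) * f 3 \<xi>" by blast
  show ?thesis
  proof (rule that[of \<xi>])
    have e: "x + h + h = x + 2 * h" "u + h + 2 * h = u + 3 * h" "u + h + h = u + 2 * h"
      "u + h - u = h" "x + h - x = h" "y + h - y = h" by auto
    have "f 1 (x + 2 * h) - 2 * f 1 (x + h) + f 1 x = h * (h * f 3 \<xi>)" using y(3) unfolding xi(3) e by simp
    then show "f 0 (u + 3 * h) - 3 * f 0 (u + 2 * h) + 3 * f 0 (u + h) - f 0 u = h ^ 3 * f 3 \<xi>"
      using x(3) unfolding e by (simp add: power3_eq_cube mult.assoc)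
  qed (use x y xi h in auto)
qed


text \<open>
  Taylor's formula for \<open>l \<mapsto> Q 0 (z exp l)\<close>, whose derivatives are the \<open>Q m (z exp l)\<close>. Multiplicative
  perturbations of the argument are thus controlled by logarithmic derivatives alone.
\<close>
lemma taylor_log:
  fixes Q :: "nat \<Rightarrow> real \<Rightarrow> real"
  assumes der: "\<And>k z. k < n \<Longrightarrow> 0 < z \<Longrightarrow> z < z1 \<Longrightarrow> (Q k has_real_derivative Q (Suc k) z / z) (at z)"
    and bd: "\<And>z. 0 < z \<Longrightarrow> z < z1 \<Longrightarrow> \<bar>Q n z\<bar> \<le> C * z powr \<sigma>" and s: "0 \<le> \<sigma>" "\<sigma> \<le> 1"
    and z: "0 < z" "z * exp \<bar>l\<bar> < z1" and l: "\<bar>l\<bar> \<le> ln 2" and n: "0 < n"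
  shows "\<bar>Q 0 (z * exp l) - (\<Sum>m<n. Q m z / fact m * l ^ m)\<bar> \<le> 2 * C * \<bar>l\<bar> ^ n * z powr \<sigma>"
proof (cases "l = 0")
  case True
  have "(\<Sum>m<n. Q m z / fact m * l ^ m) = Q 0 z"
    using n True by (simp add: sum.lessThan_Suc_shift gr0_conv_Suc)
  then show ?thesis using n True by (simp add: zero_power)
next
  case False
  have in_range: "0 < z * exp t" "z * exp t < z1" if "\<bar>t\<bar> \<le> \<bar>l\<bar>" for t
  proof -
    have "z * exp t \<le> z * exp \<bar>l\<bar>" using z that by (intro mult_left_mono) auto
    then show "z * exp t < z1" using z(2) by linarith
    show "0 < z * exp t" using z(1) by simp
  qed
  have "\<exists>t. (if l < 0 then l < t \<and> t < 0 else 0 < t \<and> t < l) \<and>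
      (\<lambda>u. Q 0 (z * exp u)) l = (\<Sum>m<n. (\<lambda>m u. Q m (z * exp u)) m 0 / fact m * (l - 0) ^ m) + (\<lambda>m u. Q m (z * exp u)) n t / fact n * (l - 0) ^ n"
  proof (rule Taylor[where a = "- \<bar>l\<bar>" and b = "\<bar>l\<bar>"])
    show "\<forall>m t. m < n \<and> - \<bar>l\<bar> \<le> t \<and> t \<le> \<bar>l\<bar> \<longrightarrow> ((\<lambda>u. Q m (z * exp u)) has_real_derivative Q (Suc m) (z * exp t)) (at t)"
    proof (intro allI impI)
      fix m t assume a: "m < n \<and> - \<bar>l\<bar> \<le> t \<and> t \<le> \<bar>l\<bar>"
      then have r: "0 < z * exp t" "z * exp t < z1" using in_range[of t] by auto
      have "((\<lambda>u. z * exp u) has_real_derivative z * exp t) (at t)" by (auto intro!: derivative_eq_intros)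
      from DERIV_chain2[OF der[OF conjunct1[OF a] r] this] show "((\<lambda>u. Q m (z * exp u)) has_real_derivative Q (Suc m) (z * exp t)) (at t)"
        using z(1) by simp
    qed
  qed (use n False in auto)
  then obtain t where t0: "if l < 0 then l < t \<and> t < 0 else 0 < t \<and> t < l"
      "(\<lambda>u. Q 0 (z * exp u)) l = (\<Sum>m<n. (\<lambda>m u. Q m (z * exp u)) m 0 / fact m * (l - 0) ^ m) + (\<lambda>m u. Q m (z * exp u)) n t / fact n * (l - 0) ^ n"
    by blast
  have t: "\<bar>t\<bar> \<le> \<bar>l\<bar>" "Q 0 (z * exp l) = (\<Sum>m<n. Q m z / fact m * l ^ m) + Q n (z * exp t) / fact n * l ^ n"
    using t0(1) t0(2) by (simp_all split: if_splits)
  have "\<bar>Q n (z * exp t)\<bar> \<le> C * (z * exp t) powr \<sigma>" using bd in_range[OF t(1)] by blast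
  moreover have C: "0 \<le> C" using bd[of z] z in_range[of 0] by (metis abs_ge_zero abs_zero exp_zero mult.right_neutral order_trans powr_gt_zero zero_le_mult_iff not_less order_less_irrefl)
  moreover have "(z * exp t) powr \<sigma> \<le> 2 * z powr \<sigma>"
  proof -
    have "(z * exp t) powr \<sigma> = z powr \<sigma> * exp t powr \<sigma>" using z by (simp add: powr_mult)
    also have "exp t powr \<sigma> \<le> 2"
    proof -
      have "\<sigma> * t \<le> 1 * ln 2" using t(1) l s by (intro order.trans[OF _ mult_right_mono[OF s(2)]] mult_left_mono) auto
      then have "exp (\<sigma> * t) \<le> exp (ln 2)" by (simp only: exp_le_cancel_iff mult_1)
      then show ?thesis by (simp add: powr_def)
    qed
    finally show ?thesis using z by (simp add: mult.commute mult_left_mono)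
  qed
  ultimately have b: "\<bar>Q n (z * exp t)\<bar> \<le> C * (2 * z powr \<sigma>)" by (meson mult_left_mono order_trans)
  have "\<bar>Q n (z * exp t) / fact n * l ^ n\<bar> = \<bar>Q n (z * exp t)\<bar> * \<bar>l\<bar> ^ n / fact n"
    by (simp add: abs_mult power_abs)
  also have "\<dots> \<le> \<bar>Q n (z * exp t)\<bar> * \<bar>l\<bar> ^ n / 1"
    by (rule divide_left_mono) (auto simp: fact_ge_1)
  also have "\<dots> = \<bar>Q n (z * exp t)\<bar> * \<bar>l\<bar> ^ n" by simp
  also have "\<dots> \<le> C * (2 * z powr \<sigma>) * \<bar>l\<bar> ^ n" using b by (intro mult_right_mono) auto
  finally show ?thesis using t(2) by (simp add: mult_ac)
qed


lemma powr_le_of_le_power: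
  fixes z d :: real
  assumes "0 < z" "z \<le> c * d ^ k" "0 < d" "1 \<le> c" "0 \<le> \<sigma>" "\<sigma> \<le> 1"
  shows "z powr \<sigma> \<le> c * (d powr \<sigma>) ^ k"
proof -
  have "z powr \<sigma> \<le> (c * d ^ k) powr \<sigma>" using assms by (intro powr_mono2) auto
  also have "\<dots> = c powr \<sigma> * (d powr \<sigma>) ^ k"
    using assms by (simp add: powr_mult powr_power powr_realpow[symmetric] powr_powr mult.commute)
  also have "\<dots> \<le> c * (d powr \<sigma>) ^ k"
    using assms powr_mono[of \<sigma> 1 c] by (intro mult_right_mono) auto
  finally show ?thesis .
qed

text \<open>
  For small \<open>d\<close> and \<open>w\<close> of order \<open>d^2\<close> the arguments are perturbations by factors \<open>1 + O(d)\<close> of \<open>w/d\<close>, \<open>w\<close> and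
  \<open>wd\<close>. Expansion in the logarithm to the orders 3, 2 and 1 leaves remainders of sizes \<open>d^3 d^\<sigma>\<close>, \<open>d^2 d^(2 \<sigma>)\<close> and
  \<open>d d^(3 \<sigma>)\<close>, of which the last one dominates since \<open>\<sigma> \<le> 1\<close>. The constants 1000 and 100000 are merely generous.
\<close>
lemma corner_relation_estimate:
  fixes Q :: "nat \<Rightarrow> real \<Rightarrow> real" and N M :: "real \<Rightarrow> real"
  assumes der: "\<And>k z. k < 3 \<Longrightarrow> 0 < z \<Longrightarrow> z < z1 \<Longrightarrow> (Q k has_real_derivative Q (Suc k) z / z) (at z)"
    and bd: "\<And>k z. k \<le> 3 \<Longrightarrow> 0 < z \<Longrightarrow> z < z1 \<Longrightarrow> \<bar>Q k z\<bar> \<le> C * z powr \<sigma>"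
    and sg: "0 \<le> \<sigma>" "\<sigma> \<le> 1" and C: "0 \<le> C"
    and dl: "0 < d" "d \<le> 1 / 1000" "1000 * d \<le> z1" and w: "d\<^sup>2 / 64 \<le> w" "w \<le> 64 * d\<^sup>2"
    and rel: "2 * Q 0 (w / (1 - d)) + 2 * Q 0 (w / (d + w)) - (1 - w) * Q 0 (w / ((d + w) * (1 - d)))
        - (1 + w) * Q 0 (w * (d + w) / (1 - d)) - (1 + w) * Q 0 (w * (1 - d) / (d + w))
        + 2 * (1 + w) * N w + 2 * w * M d + 2 * w * Q 0 (d + w) = 0"
  shows "\<bar>d\<^sup>2 * Q 2 (w / d) - 2 * d * Q 1 w + Q 0 (w * d) - (2 * (1 + w) * N w + 2 * Q 0 w) - w * (2 * M d + 2 * Q 0 d)\<bar>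
      \<le> 100000 * C * (d * (d powr \<sigma>) ^ 3)"
proof -
  define q where "q = d powr \<sigma>"
  have q: "0 < q" "q \<le> 1" "d \<le> q"
    using dl sg powr_mono'[of \<sigma> 1 d] powr_mono2[of \<sigma> d 1] by (auto simp: q_def)
  define l where "l = - ln (1 - d)"
  define r where "r = w / d"
  define h where "h = ln (1 + r)"
  define \<rho> where "\<rho> = w / (d + w)"
  have w0: "0 < w" using w dl by (smt (verit) divide_pos_pos zero_less_power)
  have r: "0 < r" "r \<le> 64 * d" using w w0 dl unfolding r_def by (auto simp: field_simps power2_eq_square)
  have wd: "w = r * d" using dl by (simp add: r_def)
  have w1: "w \<le> d * (64 / 1000)" using wd r dl mult_right_mono[of r "64 / 1000" d] by simp
  have l: "d \<le> l" "l \<le> d + 2 * d\<^sup>2" "l \<le> 2 * d"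
  proof -
    have "ln (1 - d) \<le> (1 - d) - 1" by (rule ln_le_minus_one) (use dl in simp)
    then show "d \<le> l" by (simp add: l_def)
    have "- d - 2 * d\<^sup>2 \<le> ln (1 - d)" by (rule ln_one_minus_pos_lower_bound) (use dl in auto)
    then show a: "l \<le> d + 2 * d\<^sup>2" by (simp add: l_def)
    have "2 * d\<^sup>2 \<le> d" using dl by (simp add: power2_eq_square)
    then show "l \<le> 2 * d" using a by simp
  qed
  have h: "0 \<le> h" "h \<le> r" using r ln_le_minus_one[of "1 + r"] by (auto simp: h_def)
  have el: "exp l = 1 / (1 - d)" "exp (- l) = 1 - d" and eh: "exp h = 1 + r" "exp (- h) = 1 / (1 + r)"
    using dl r by (simp_all add: l_def h_def exp_minus inverse_eq_divide)
  have rho: "\<rho> = r * exp (- h)" "0 < \<rho>" "\<rho> \<le> r"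
  proof -
    have "d + w = d * (1 + r)" using wd by (simp add: algebra_simps)
    then show "\<rho> = r * exp (- h)" using r dl by (simp add: \<rho>_def eh wd)
    show "0 < \<rho>" using w0 dl by (simp add: \<rho>_def)
    show "\<rho> \<le> r" using w0 dl by (simp add: \<rho>_def r_def frac_le)
  qed
  have ln2: "1 / 2 \<le> ln (2::real)" using ln_2_less_1 ln_add_one_self_le_self ln2_ge_two_thirds by simp
  have small: "\<bar>t\<bar> \<le> ln 2" "exp \<bar>t\<bar> \<le> 2" if "\<bar>t\<bar> \<le> 1 / 2" for t :: real
  proof -
    show "\<bar>t\<bar> \<le> ln 2" using that ln2 by simp
    then have "exp \<bar>t\<bar> \<le> exp (ln 2)" by (simp only: exp_le_cancel_iff)
    then show "exp \<bar>t\<bar> \<le> 2" by simp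
  qed
  have tl: "z * exp \<bar>t\<bar> < z1" "\<bar>t\<bar> \<le> ln 2" if "0 < z" "z \<le> 64 * d" "\<bar>t\<bar> \<le> 1 / 2" for z t
  proof -
    have "z * exp \<bar>t\<bar> \<le> (64 * d) * 2" using that small(2)[OF that(3)] by (intro mult_mono) auto
    then show "z * exp \<bar>t\<bar> < z1" using dl by simp
  qed (use small that in auto)
  have lh: "\<bar>l\<bar> \<le> 1 / 2" "\<bar>- l\<bar> \<le> 1 / 2" "\<bar>h\<bar> \<le> 1 / 2" "\<bar>- h\<bar> \<le> 1 / 2" "\<bar>h + l\<bar> \<le> 1 / 2"
    using l h r dl by auto
  have wd0: "0 < w * d" "w * d \<le> 64 * d" "w * d \<le> 64 * d ^ 3" using w0 dl w w1
    by (auto simp: power2_eq_square power3_eq_cube)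
  have pw: "w powr \<sigma> \<le> 64 * q\<^sup>2" "r powr \<sigma> \<le> 64 * q" "\<rho> powr \<sigma> \<le> 64 * q" "(w * d) powr \<sigma> \<le> 64 * q ^ 3"
    using powr_le_of_le_power[of w 64 d 2 \<sigma>] powr_le_of_le_power[of r 64 d 1 \<sigma>] powr_le_of_le_power[of \<rho> 64 d 1 \<sigma>]
      powr_le_of_le_power[of "w * d" 64 d 3 \<sigma>] w w0 dl r rho(2,3) wd0 sg by (auto simp: q_def)
  define A where "A = Q 0 (w * exp l) - (Q 0 w + Q 1 w * l)"
  define Bp where "Bp = Q 0 (\<rho> * exp l) - (Q 0 \<rho> + Q 1 \<rho> * l + Q 2 \<rho> / 2 * l\<^sup>2)"
  define Bm where "Bm = Q 0 (\<rho> * exp (- l)) - (Q 0 \<rho> - Q 1 \<rho> * l + Q 2 \<rho> / 2 * l\<^sup>2)"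
  define B2 where "B2 = Q 2 \<rho> - Q 2 r"
  define Cc where "Cc = Q 0 (w * d * exp (h + l)) - Q 0 (w * d)"
  define D where "D = Q 0 (d * exp h) - Q 0 d"
  define U where "U = C * (d * q ^ 3)"
  have d1: "d * d * (q * q) \<le> d * q ^ 3" "d * d * d * q \<le> d * q ^ 3"
    using q dl mult_mono[of d q d q] by (auto simp: power3_eq_cube mult.assoc intro!: mult_left_mono mult_right_mono mult_mono)
  have dq: "x * y \<le> (a * b) * (u * v)" if "0 \<le> x" "x \<le> a * u" "0 \<le> y" "y \<le> b * v" for x y a b u v :: real
    using mult_mono[of x "a * u" y "b * v"] that by (simp add: mult_ac)
  have l2: "l\<^sup>2 \<le> 4 * (d * d)" "l ^ 3 \<le> 8 * (d * d * d)"
    using power_mono[of l "2 * d" 2] power_mono[of l "2 * d" 3] l dl by (auto simp: power2_eq_square power3_eq_cube mult_ac)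
  have KU: "C * x \<le> k * U" if "x \<le> k * (d * q ^ 3)" for x k
    using mult_left_mono[OF that C] by (simp add: U_def mult_ac)
  have A: "\<bar>A\<bar> \<le> 512 * U"
  proof -
    have "\<bar>Q 0 (w * exp l) - (\<Sum>m<2. Q m w / fact m * l ^ m)\<bar> \<le> 2 * C * \<bar>l\<bar> ^ 2 * w powr \<sigma>"
      by (rule taylor_log[where ?z1.0 = z1]) (use der bd sg w0 tl[of w l] w1 dl lh in auto)
    then have "\<bar>A\<bar> \<le> C * (2 * (l\<^sup>2 * w powr \<sigma>))" by (simp add: A_def numeral_2_eq_2 mult_ac)
    also have "\<dots> \<le> 512 * U"
    proof (rule KU)
      have "l\<^sup>2 * w powr \<sigma> \<le> (4 * 64) * ((d * d) * (q * q))" by (rule dq) (use l2 pw in \<open>auto simp: power2_eq_square\<close>)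
      then show "2 * (l\<^sup>2 * w powr \<sigma>) \<le> 512 * (d * q ^ 3)" using d1 by linarith
    qed
    finally show ?thesis .
  qed
  have A': "\<bar>(l - d) * Q 1 w\<bar> \<le> 128 * U"
  proof -
    have "\<bar>(l - d) * Q 1 w\<bar> \<le> (2 * d\<^sup>2) * (C * w powr \<sigma>)"
      unfolding abs_mult by (rule mult_mono) (use l bd[of 1 w] w0 w1 dl in auto)
    also have "\<dots> = C * (2 * (d\<^sup>2 * w powr \<sigma>))" by (simp add: mult_ac)
    also have "\<dots> \<le> 128 * U"
    proof (rule KU)
      have "d\<^sup>2 * w powr \<sigma> \<le> (1 * 64) * ((d * d) * (q * q))" by (rule dq) (use pw in \<open>auto simp: power2_eq_square\<close>)
      then show "2 * (d\<^sup>2 * w powr \<sigma>) \<le> 128 * (d * q ^ 3)" using d1 by linarith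
    qed
    finally show ?thesis .
  qed
  have Bgen: "2 * C * l ^ 3 * \<rho> powr \<sigma> \<le> 1024 * U"
  proof -
    have "2 * C * l ^ 3 * \<rho> powr \<sigma> = C * (2 * (l ^ 3 * \<rho> powr \<sigma>))" by simp
    also have "\<dots> \<le> 1024 * U"
    proof (rule KU)
      have "l ^ 3 * \<rho> powr \<sigma> \<le> (8 * 64) * ((d * d * d) * q)" by (rule dq) (use l2 pw l dl in auto)
      then show "2 * (l ^ 3 * \<rho> powr \<sigma>) \<le> 1024 * (d * q ^ 3)" using d1 by linarith
    qed
    finally show ?thesis .
  qed
  have rho64: "\<rho> \<le> 64 * d" using rho(3) r(2) by linarith
  have al: "\<bar>l\<bar> = l" using l dl by simp
  have Bp: "\<bar>Bp\<bar> \<le> 1024 * U"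
  proof -
    have "\<bar>Q 0 (\<rho> * exp l) - (\<Sum>m<3. Q m \<rho> / fact m * l ^ m)\<bar> \<le> 2 * C * \<bar>l\<bar> ^ 3 * \<rho> powr \<sigma>"
      by (rule taylor_log[where ?z1.0 = z1]) (use der bd sg rho(2) tl[of \<rho> l] rho64 lh in auto)
    then show ?thesis using Bgen unfolding al by (simp add: Bp_def numeral_3_eq_3 numeral_2_eq_2)
  qed
  have Bm: "\<bar>Bm\<bar> \<le> 1024 * U"
  proof -
    have "\<bar>Q 0 (\<rho> * exp (- l)) - (\<Sum>m<3. Q m \<rho> / fact m * (- l) ^ m)\<bar> \<le> 2 * C * \<bar>- l\<bar> ^ 3 * \<rho> powr \<sigma>"
      by (rule taylor_log[where ?z1.0 = z1]) (use der bd sg rho(2) tl[of \<rho> "- l"] rho64 lh in auto)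
    then show ?thesis using Bgen unfolding al abs_minus_cancel by (simp add: Bm_def numeral_3_eq_3 numeral_2_eq_2)
  qed
  have W: "w * (l * \<bar>Q 1 \<rho>\<bar>) \<le> 8192 * U"
  proof -
    have "w * (l * \<bar>Q 1 \<rho>\<bar>) \<le> w * (l * (C * \<rho> powr \<sigma>))"
      by (intro mult_left_mono) (use bd[of 1 \<rho>] w0 l rho(2) rho64 dl in auto)
    also have "\<dots> = C * ((w * l) * \<rho> powr \<sigma>)" by (simp add: mult_ac)
    also have "\<dots> \<le> 8192 * U"
    proof (rule KU)
      have "w * l \<le> (64 * 2) * ((d * d) * d)" by (rule dq) (use w l w0 dl in \<open>auto simp: power2_eq_square\<close>)
      then have "(w * l) * \<rho> powr \<sigma> \<le> (128 * 64) * ((d * d * d) * q)" by (intro dq) (use pw w0 l dl in auto)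
      then show "(w * l) * \<rho> powr \<sigma> \<le> 8192 * (d * q ^ 3)" using d1 by linarith
    qed
    finally show ?thesis .
  qed
  have L2: "\<bar>(d\<^sup>2 - l\<^sup>2) * Q 2 \<rho>\<bar> \<le> 384 * U"
  proof -
    have "l\<^sup>2 - d\<^sup>2 = (l - d) * (l + d)" by (simp add: power2_eq_square algebra_simps)
    also have "\<dots> \<le> (2 * 3) * ((d * d) * d)" by (rule dq) (use l dl in \<open>auto simp: power2_eq_square\<close>)
    finally have "l\<^sup>2 - d\<^sup>2 \<le> 6 * (d * d * d)" by simp
    moreover have "d\<^sup>2 \<le> l\<^sup>2" using l dl by (intro power_mono) auto
    ultimately have dd: "\<bar>d\<^sup>2 - l\<^sup>2\<bar> \<le> 6 * (d * d * d)" by simp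
    have "\<bar>(d\<^sup>2 - l\<^sup>2) * Q 2 \<rho>\<bar> \<le> (6 * (d * d * d)) * (C * \<rho> powr \<sigma>)"
      unfolding abs_mult by (rule mult_mono) (use dd bd[of 2 \<rho>] rho(2) rho64 dl in auto)
    also have "\<dots> = C * (6 * ((d * d * d) * \<rho> powr \<sigma>))" by (simp add: mult_ac)
    also have "\<dots> \<le> 384 * U"
    proof (rule KU)
      have "(d * d * d) * \<rho> powr \<sigma> \<le> (1 * 64) * ((d * d * d) * q)" by (rule dq) (use pw dl in auto)
      then show "6 * ((d * d * d) * \<rho> powr \<sigma>) \<le> 384 * (d * q ^ 3)" using d1 by linarith
    qed
    finally show ?thesis .
  qed
  have B2: "d\<^sup>2 * \<bar>B2\<bar> \<le> 8192 * U"
  proof -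
    have "\<bar>(\<lambda>k. Q (k + 2)) 0 (r * exp (- h)) - (\<Sum>m<1. (\<lambda>k. Q (k + 2)) m r / fact m * (- h) ^ m)\<bar> \<le> 2 * C * \<bar>- h\<bar> ^ 1 * r powr \<sigma>"
      by (rule taylor_log[where ?z1.0 = z1]) (use der[of 2] bd[of 3] sg r tl[of r "- h"] lh in \<open>auto simp: numeral_3_eq_3 numeral_2_eq_2\<close>)
    then have "\<bar>B2\<bar> \<le> 2 * C * h * r powr \<sigma>" using h by (simp add: B2_def rho(1) numeral_2_eq_2)
    then have "d\<^sup>2 * \<bar>B2\<bar> \<le> d\<^sup>2 * (2 * C * h * r powr \<sigma>)" by (intro mult_left_mono) auto
    also have "\<dots> = C * (2 * ((d\<^sup>2 * h) * r powr \<sigma>))" by (simp add: mult_ac)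
    also have "\<dots> \<le> 8192 * U"
    proof (rule KU)
      have "d\<^sup>2 * h \<le> (1 * 64) * ((d * d) * d)" by (rule dq) (use h r dl in \<open>auto simp: power2_eq_square\<close>)
      then have "(d\<^sup>2 * h) * r powr \<sigma> \<le> (64 * 64) * ((d * d * d) * q)" by (intro dq) (use pw h in auto)
      then show "2 * ((d\<^sup>2 * h) * r powr \<sigma>) \<le> 8192 * (d * q ^ 3)" using d1 by linarith
    qed
    finally show ?thesis .
  qed
  have Cc: "\<bar>Cc\<bar> \<le> 8448 * U"
  proof -
    have "\<bar>Q 0 (w * d * exp (h + l)) - (\<Sum>m<1. Q m (w * d) / fact m * (h + l) ^ m)\<bar> \<le> 2 * C * \<bar>h + l\<bar> ^ 1 * (w * d) powr \<sigma>"
      by (rule taylor_log[where ?z1.0 = z1]) (use der bd[of 1] sg wd0 tl[of "w * d" "h + l"] lh in auto)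
    then have "\<bar>Cc\<bar> \<le> C * (2 * ((h + l) * (w * d) powr \<sigma>))" using h l dl by (simp add: Cc_def algebra_simps)
    also have "\<dots> \<le> 8448 * U"
    proof (rule KU)
      have "(h + l) * (w * d) powr \<sigma> \<le> (66 * 64) * (d * q ^ 3)" by (rule dq) (use pw h l r dl in auto)
      then show "2 * ((h + l) * (w * d) powr \<sigma>) \<le> 8448 * (d * q ^ 3)" by linarith
    qed
    finally show ?thesis .
  qed
  have wC: "w * \<bar>Q 0 (w * d)\<bar> \<le> 64 * U"
  proof -
    have "w * \<bar>Q 0 (w * d)\<bar> \<le> w * (C * (w * d) powr \<sigma>)"
      by (intro mult_left_mono) (use bd[of 0 "w * d"] w0 wd0 dl in auto)
    also have "\<dots> = C * (w * (w * d) powr \<sigma>)" by (simp add: mult_ac)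
    also have "\<dots> \<le> 64 * U"
    proof (rule KU)
      have "w * (w * d) powr \<sigma> \<le> (1 * 64) * (d * q ^ 3)" by (rule dq) (use pw w0 w1 dl in auto)
      then show "w * (w * d) powr \<sigma> \<le> 64 * (d * q ^ 3)" by linarith
    qed
    finally show ?thesis .
  qed
  have D: "w * \<bar>D\<bar> \<le> 8192 * U"
  proof -
    have "\<bar>Q 0 (d * exp h) - (\<Sum>m<1. Q m d / fact m * h ^ m)\<bar> \<le> 2 * C * \<bar>h\<bar> ^ 1 * d powr \<sigma>"
      by (rule taylor_log[where ?z1.0 = z1]) (use der bd[of 1] sg dl tl[of d h] lh in auto)
    then have "w * \<bar>D\<bar> \<le> w * (2 * C * h * q)" using h w0 by (intro mult_left_mono) (auto simp: D_def q_def)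
    also have "\<dots> = C * (2 * ((w * h) * q))" by (simp add: mult_ac)
    also have "\<dots> \<le> 8192 * U"
    proof (rule KU)
      have "w * h \<le> (64 * 64) * ((d * d) * d)" by (rule dq) (use w w0 h r dl in \<open>auto simp: power2_eq_square\<close>)
      then have "(w * h) * q \<le> (4096 * 1) * ((d * d * d) * q)" by (intro dq) (use w0 h q in auto)
      then show "2 * ((w * h) * q) \<le> 8192 * (d * q ^ 3)" using d1 by linarith
    qed
    finally show ?thesis .
  qed
  have dw: "d + w = d * exp h" using eh wd by (simp add: algebra_simps)
  have args: "w / (1 - d) = w * exp l" "w / (d + w) = \<rho>" "w / ((d + w) * (1 - d)) = \<rho> * exp l"
    "w * (d + w) / (1 - d) = w * d * exp (h + l)" "w * (1 - d) / (d + w) = \<rho> * exp (- l)" "d + w = d * exp h"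
    unfolding \<rho>_def el by (auto simp: dw exp_add el)
  define T where "T = d\<^sup>2 * Q 2 r - 2 * d * Q 1 w + Q 0 (w * d) - (2 * (1 + w) * N w + 2 * Q 0 w) - w * (2 * M d + 2 * Q 0 d)"
  have "T = 2 * A + 2 * ((l - d) * Q 1 w) - Bp - Bm + w * Bp - w * Bm + 2 * (w * (l * Q 1 \<rho>)) + (d\<^sup>2 - l\<^sup>2) * Q 2 \<rho>
      - d\<^sup>2 * B2 - Cc - w * Cc - w * Q 0 (w * d) + 2 * (w * D)"
    using rel unfolding args(1-5) unfolding args(6) T_def A_def Bp_def Bm_def B2_def Cc_def D_def
    by (simp add: algebra_simps)
  also have "\<bar>\<dots>\<bar> \<le> 100000 * U"
  proof -
    have U: "U \<ge> 0" using C dl q by (simp add: U_def)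
    have w1': "0 \<le> w" "w \<le> 1" using w0 w1 dl by auto
    have wle: "w * x \<le> x" if "0 \<le> x" for x using mult_right_mono[OF w1'(2) that] by simp
    have "\<bar>w * Bp\<bar> \<le> 1024 * U" "\<bar>w * Bm\<bar> \<le> 1024 * U" "\<bar>w * Cc\<bar> \<le> 8448 * U"
      using wle[of "\<bar>Bp\<bar>"] wle[of "\<bar>Bm\<bar>"] wle[of "\<bar>Cc\<bar>"] Bp Bm Cc w1' by (auto simp: abs_mult)
    moreover have "\<bar>w * (l * Q 1 \<rho>)\<bar> \<le> 8192 * U" "\<bar>d\<^sup>2 * B2\<bar> \<le> 8192 * U" "\<bar>w * Q 0 (w * d)\<bar> \<le> 64 * U" "\<bar>w * D\<bar> \<le> 8192 * U"
      using W B2 wC D w1' al by (auto simp: abs_mult)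
    ultimately show ?thesis using A A' Bp Bm L2 Cc U unfolding abs_le_iff by (intro conjI) linarith+
  qed
  finally show ?thesis by (simp add: T_def r_def U_def q_def mult_ac)
qed

section \<open>Asymptotic expansion at zero\<close>

definition growth :: "(real \<Rightarrow> real) \<Rightarrow> real \<Rightarrow> bool" where
  "growth f \<sigma> \<longleftrightarrow> (\<exists>C z0. 0 < z0 \<and> (\<forall>z. 0 < z \<longrightarrow> z < z0 \<longrightarrow> \<bar>f z\<bar> \<le> C * z powr \<sigma>))"

lemma growth_mono:
  assumes "growth f \<sigma>" "\<tau> \<le> \<sigma>"
  shows "growth f \<tau>"
proof -
  obtain C z0 where z0: "0 < z0" and C: "\<And>z. 0 < z \<Longrightarrow> z < z0 \<Longrightarrow> \<bar>f z\<bar> \<le> C * z powr \<sigma>"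
    using assms(1) unfolding growth_def by blast
  have "\<bar>f z\<bar> \<le> \<bar>C\<bar> * z powr \<tau>" if "0 < z" "z < min z0 1" for z
  proof -
    have "\<bar>f z\<bar> \<le> C * z powr \<sigma>" using C that by simp
    also have "\<dots> \<le> \<bar>C\<bar> * z powr \<sigma>" by (rule mult_right_mono) auto
    also have "\<dots> \<le> \<bar>C\<bar> * z powr \<tau>" using assms(2) that by (intro mult_left_mono powr_mono') auto
    finally show ?thesis .
  qed
  then show ?thesis unfolding growth_def using z0 by (intro exI[of _ "\<bar>C\<bar>"] exI[of _ "min z0 1"]) auto
qed

lemma growth_uniform:
  fixes n :: nat
  assumes "\<And>k. k \<le> n \<Longrightarrow> growth (Q k) \<sigma>"
  obtains C z0 where "0 \<le> C" "0 < z0" "\<And>k z. k \<le> n \<Longrightarrow> 0 < z \<Longrightarrow> z < z0 \<Longrightarrow> \<bar>Q k z\<bar> \<le> C * z powr \<sigma>"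
proof -
  have "\<exists>C z0. 0 < z0 \<and> (\<forall>z. 0 < z \<longrightarrow> z < z0 \<longrightarrow> \<bar>Q k z\<bar> \<le> C * z powr \<sigma>)" if "k \<le> n" for k
    using assms[OF that] unfolding growth_def .
  then obtain C z0 where z0: "\<And>k. k \<le> n \<Longrightarrow> 0 < z0 k"
    and C: "\<And>k z. k \<le> n \<Longrightarrow> 0 < z \<Longrightarrow> z < z0 k \<Longrightarrow> \<bar>Q k z\<bar> \<le> C k * z powr \<sigma>" by metis
  show ?thesis
  proof (rule that[of "\<Sum>k\<le>n. \<bar>C k\<bar>" "Min (z0 ` {..n})"])
    show "0 \<le> (\<Sum>k\<le>n. \<bar>C k\<bar>)" by (simp add: sum_nonneg)
    show "0 < Min (z0 ` {..n})" using z0 by auto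
    fix k z assume k: "k \<le> n" and z: "0 < z" "z < Min (z0 ` {..n})"
    have "Min (z0 ` {..n}) \<le> z0 k" using k by (intro Min_le) auto
    then have "z < z0 k" using z(2) by linarith
    then have "\<bar>Q k z\<bar> \<le> C k * z powr \<sigma>" by (rule C[OF k z(1)])
    also have "C k \<le> (\<Sum>k\<le>n. \<bar>C k\<bar>)"
      using member_le_sum[of k "{..n}" "\<lambda>k. \<bar>C k\<bar>"] k by auto
    then have "C k * z powr \<sigma> \<le> (\<Sum>k\<le>n. \<bar>C k\<bar>) * z powr \<sigma>" by (rule mult_right_mono) simp
    finally show "\<bar>Q k z\<bar> \<le> (\<Sum>k\<le>n. \<bar>C k\<bar>) * z powr \<sigma>" .
  qed
qed

lemma tendsto_mult_mdiff:
  assumes "((\<lambda>X. X * g X) \<longlongrightarrow> 0) (at_right 0)" "a > 0"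
  shows "((\<lambda>X. X * mdiff a g X) \<longlongrightarrow> 0) (at_right (0::real))"
proof -
  have "filterlim (\<lambda>X. a * X) (at_right 0) (at_right 0)"
  proof -
    have "((\<lambda>X. a * X) \<longlongrightarrow> a * 0) (at_right 0)" by (intro tendsto_intros)
    then show ?thesis unfolding filterlim_at using assms(2) by (auto simp: eventually_at_filter)
  qed
  from filterlim_compose[OF assms(1) this] have "((\<lambda>X. a * X * g (a * X)) \<longlongrightarrow> 0) (at_right 0)" .
  then have "((\<lambda>X. a * X * g (a * X) / a - X * g X) \<longlongrightarrow> 0 / a - 0) (at_right 0)"
    by (intro tendsto_diff tendsto_divide assms(1) tendsto_const) (use assms(2) in auto)
  then show ?thesis using assms(2) by (simp add: mdiff_def right_diff_distrib mult_ac)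
qed

text \<open>
  The data of the asymptotic analysis: \<open>Q k\<close> stands for \<open>(z d/dz)^k P\<close>, \<open>N w\<close> for \<open>P (-w)\<close> and \<open>M d\<close> for
  \<open>P (1 - d)\<close>. Nothing is known about \<open>N\<close> and \<open>M\<close>; they have to be eliminated. The regularity hypothesis says that
  bounds by powers pass to derivatives.
\<close>
locale corner =
  fixes Q :: "nat \<Rightarrow> real \<Rightarrow> real" and N M :: "real \<Rightarrow> real" and z1 :: real
  assumes z1: "0 < z1" "z1 \<le> 1"
    and der: "\<And>k z. 0 < z \<Longrightarrow> z < z1 \<Longrightarrow> (Q k has_real_derivative Q (Suc k) z / z) (at z)"
    and lim0: "(Q 0 \<longlongrightarrow> 0) (at_right 0)"
    and rel: "\<And>w d. 0 < w \<Longrightarrow> 0 < d \<Longrightarrow> w < z1 \<Longrightarrow> d < z1 \<Longrightarrow>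
        2 * Q 0 (w / (1 - d)) + 2 * Q 0 (w / (d + w)) - (1 - w) * Q 0 (w / ((d + w) * (1 - d)))
        - (1 + w) * Q 0 (w * (d + w) / (1 - d)) - (1 + w) * Q 0 (w * (1 - d) / (d + w))
        + 2 * (1 + w) * N w + 2 * w * M d + 2 * w * Q 0 (d + w) = 0"
    and reg: "\<And>\<sigma> k. 0 \<le> \<sigma> \<Longrightarrow> \<sigma> \<le> 1 \<Longrightarrow> growth (Q 0) \<sigma> \<Longrightarrow> growth (Q k) \<sigma>"
begin

definition p :: "real \<Rightarrow> real" where "p z = Q 0 z / z"

text \<open>
  With \<open>X = wd\<close> of order \<open>d^3\<close>, the error \<open>d^(1 + 3 \<sigma>)\<close> of the corner relation becomes \<open>X^(\<sigma> - 2/3)\<close> after division by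
  \<open>wd\<close>. Elimination and the doubling recursion turn this into a bound for multiplicative third differences of \<open>p\<close>.
\<close>
lemma triple_difference_bound:
  assumes g: "growth (Q 0) \<sigma>" and sg: "0 \<le> \<sigma>" "\<sigma> \<le> 1"
  obtains C X0 where "0 \<le> C" "0 < X0" "X0 \<le> 1"
    "\<forall>a\<in>{1..2}. \<forall>b\<in>{1..2}. \<forall>c\<in>{1..2}. \<forall>X. 0 < X \<longrightarrow> X < X0 \<longrightarrow>
       \<bar>mdiff c (mdiff (b\<^sup>2) (mdiff a p)) X\<bar> \<le> C * X powr (\<sigma> - 2 / 3)"
proof -
  obtain C z0 where C: "0 \<le> C" and z0: "0 < z0"
    and bd: "\<And>k z. k \<le> 3 \<Longrightarrow> 0 < z \<Longrightarrow> z < z0 \<Longrightarrow> \<bar>Q k z\<bar> \<le> C * z powr \<sigma>"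
    using growth_uniform[of 3 Q \<sigma>] reg[OF sg g] by blast
  define d0 where "d0 = min (z1 / 1000) (z0 / 1000)"
  have d0: "0 < d0" "1000 * d0 \<le> z1" "1000 * d0 \<le> z0" "d0 \<le> 1 / 1000" using z1 z0 by (auto simp: d0_def)
  define X0 where "X0 = (d0 / 8) ^ 3"
  define K where "K = 24 * (100000 * C * (8 * 512))"
  have K: "0 \<le> K" using C by (simp add: K_def)
  have X0: "0 < X0" "X0 \<le> 1" using d0 unfolding X0_def by (auto intro!: power_le_one)
  have main: "\<bar>2 * mdiff c (mdiff (b\<^sup>2) (mdiff a p)) (2 * X) - mdiff c (mdiff (b\<^sup>2) (mdiff a p)) X\<bar> \<le> K * X powr (\<sigma> - 2 / 3)"
    if abc: "a \<in> {1..2}" "b \<in> {1..2}" "c \<in> {1..2}" and X: "0 < X" "X < X0" for a b c X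
  proof -
    define e where "e = X powr (1 / 3)"
    have e: "0 < e" "e ^ 3 = X" using X by (auto simp: e_def powr_power)
    have "e ^ 3 < (d0 / 8) ^ 3" using e X by (simp add: X0_def)
    then have e8: "8 * e < d0" using power_less_imp_less_base[of e 3 "d0 / 8"] d0 by simp
    define q where "q = e powr \<sigma>"
    define T where "T w d = d\<^sup>2 * Q 2 (w / d) - 2 * d * Q 1 w + Q 0 (w * d) - (2 * (1 + w) * N w + 2 * Q 0 w) - w * (2 * M d + 2 * Q 0 d)" for w d
    have Tb: "\<bar>T w d / (w * d)\<bar> \<le> 100000 * C * (8 * 512) * X powr (\<sigma> - 2 / 3)"
      if w: "e\<^sup>2 \<le> w" "w \<le> 4 * e\<^sup>2" and d: "e \<le> d" "d \<le> 8 * e" for w d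
    proof -
      have pos: "0 < w" "0 < d" using w d e by (auto intro: less_le_trans[of 0 "e\<^sup>2"])
      have dd: "d \<le> 1 / 1000" "1000 * d \<le> z1" "1000 * d \<le> z0" "d < z1" using d e8 d0 z1 pos by auto
      have d2: "e\<^sup>2 \<le> d\<^sup>2" "d\<^sup>2 \<le> 64 * e\<^sup>2"
        using power_mono[of e d 2] power_mono[of d "8 * e" 2] d e by (auto simp: power_mult_distrib)
      have e2: "e\<^sup>2 \<le> e * 1" unfolding power2_eq_square using e e8 d0 by (intro mult_left_mono) auto
      have "\<bar>T w d\<bar> \<le> 100000 * C * (d * (d powr \<sigma>) ^ 3)"
        unfolding T_def
      proof (rule corner_relation_estimate[where ?z1.0 = "min z1 z0"])
        show "(Q k has_real_derivative Q (Suc k) z / z) (at z)" if "k < 3" "0 < z" "z < min z1 z0" for k z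
          using der that by simp
        show "\<bar>Q k z\<bar> \<le> C * z powr \<sigma>" if "k \<le> 3" "0 < z" "z < min z1 z0" for k z using bd that by simp
        show "d\<^sup>2 / 64 \<le> w" "w \<le> 64 * d\<^sup>2" using w d2 by linarith+
        show "2 * Q 0 (w / (1 - d)) + 2 * Q 0 (w / (d + w)) - (1 - w) * Q 0 (w / ((d + w) * (1 - d)))
          - (1 + w) * Q 0 (w * (d + w) / (1 - d)) - (1 + w) * Q 0 (w * (1 - d) / (d + w))
          + 2 * (1 + w) * N w + 2 * w * M d + 2 * w * Q 0 (d + w) = 0"
        proof (rule rel[OF pos _ dd(4)])
          show "w < z1" using w e2 e e8 d0 z1 by linarith
        qed
      qed (use C sg dd pos in auto)
      also have "(d powr \<sigma>) \<le> 8 * q"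
        using powr_le_of_le_power[of d 8 e 1 \<sigma>] pos d e sg by (simp add: q_def)
      then have "100000 * C * (d * (d powr \<sigma>) ^ 3) \<le> 100000 * C * ((8 * e) * (8 * q) ^ 3)"
        using C d e pos by (intro mult_left_mono mult_mono power_mono) auto
      finally have "\<bar>T w d\<bar> \<le> 100000 * C * (8 * 512) * (e * q ^ 3)" by (simp add: power_mult_distrib mult_ac)
      moreover have "e ^ 3 \<le> w * d"
        using mult_mono[OF w(1) d(1)] pos e by (simp add: power3_eq_cube power2_eq_square mult_ac)
      ultimately have "\<bar>T w d\<bar> / (w * d) \<le> 100000 * C * (8 * 512) * (e * q ^ 3) / e ^ 3"
        using e C by (intro frac_le) (auto simp: q_def)
      then have "\<bar>T w d\<bar> / (w * d) \<le> 100000 * C * (8 * 512) * (e * q ^ 3 / e ^ 3)" by (simp only: times_divide_eq_right)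
      also have "e * q ^ 3 / e ^ 3 = X powr (\<sigma> - 2 / 3)"
      proof -
        have "e * q ^ 3 / e ^ 3 = X powr (1 / 3) * X powr \<sigma> / X powr 1"
          using X e unfolding q_def e_def by (simp add: powr_powr powr_power)
        also have "\<dots> = X powr (1 / 3 + \<sigma> - 1)" by (simp only: powr_add[symmetric] powr_diff[symmetric])
        also have "1 / 3 + \<sigma> - 1 = \<sigma> - 2 / 3" by simp
        finally show ?thesis .
      qed
      finally show ?thesis using pos by (simp add: abs_mult)
    qed
    have "\<bar>2 * mdiff c (mdiff (b\<^sup>2) (mdiff a p)) (2 * (e\<^sup>2 * e)) - mdiff c (mdiff (b\<^sup>2) (mdiff a p)) (e\<^sup>2 * e)\<bar>
        \<le> 24 * (100000 * C * (8 * 512) * X powr (\<sigma> - 2 / 3))"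
    proof (rule four_term_elimination[where ?f1.0 = "\<lambda>r. Q 2 r / r" and ?f2.0 = "\<lambda>w. - 2 * Q 1 w / w"
          and ?f3.0 = "\<lambda>w. - (2 * (1 + w) * N w + 2 * Q 0 w) / w" and ?f4.0 = "\<lambda>d. - (2 * M d + 2 * Q 0 d) / d"])
      fix w d assume w: "e\<^sup>2 \<le> w" "w \<le> 4 * e\<^sup>2" and d: "e \<le> d" "d \<le> 8 * e"
      have pos: "w > 0" "d > 0" using w d e by (auto intro: less_le_trans[of 0 "e\<^sup>2"])
      have "Q 2 (w / d) / (w / d) + - 2 * Q 1 w / w + p (w * d) + - (2 * (1 + w) * N w + 2 * Q 0 w) / w / d + - (2 * M d + 2 * Q 0 d) / d = T w d / (w * d)"
        unfolding T_def p_def using pos by (simp add: field_simps power2_eq_square)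
      then show "\<bar>Q 2 (w / d) / (w / d) + - 2 * Q 1 w / w + p (w * d) + - (2 * (1 + w) * N w + 2 * Q 0 w) / w / d + - (2 * M d + 2 * Q 0 d) / d\<bar>
          \<le> 100000 * C * (8 * 512) * X powr (\<sigma> - 2 / 3)" using Tb[OF w d] by simp
    qed (use abc e in auto)
    moreover have "e\<^sup>2 * e = X" using e(2) by (simp add: power3_eq_cube power2_eq_square)
    ultimately show ?thesis by (simp add: K_def mult.assoc)
  qed
  have lim: "((\<lambda>X. X * mdiff c (mdiff (b\<^sup>2) (mdiff a p)) X) \<longlongrightarrow> 0) (at_right 0)"
    if "a \<in> {1..2}" "b \<in> {1..2}" "c \<in> {1..2}" for a b c
  proof -
    have "((\<lambda>X. X * p X) \<longlongrightarrow> 0) (at_right 0)"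
      by (rule Lim_transform_eventually[OF lim0]) (auto simp: p_def eventually_at_filter)
    then show ?thesis using that by (intro tendsto_mult_mdiff) auto
  qed
  have k1: "\<sigma> - 2 / 3 > -1" using sg by simp
  show ?thesis
  proof (rule that[of "K * 2 powr (- (\<sigma> - 2 / 3)) / (1 - 2 powr (- 1 - (\<sigma> - 2 / 3)))" X0])
    have "2 powr (- 1 - (\<sigma> - 2 / 3)) < (2::real) powr 0" by (rule powr_less_mono) (use k1 in auto)
    then show "0 \<le> K * 2 powr (- (\<sigma> - 2 / 3)) / (1 - 2 powr (- 1 - (\<sigma> - 2 / 3)))" using K by simp
    show "\<forall>a\<in>{1..2}. \<forall>b\<in>{1..2}. \<forall>c\<in>{1..2}. \<forall>X. 0 < X \<longrightarrow> X < X0 \<longrightarrow>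
       \<bar>mdiff c (mdiff (b\<^sup>2) (mdiff a p)) X\<bar> \<le> K * 2 powr (- (\<sigma> - 2 / 3)) / (1 - 2 powr (- 1 - (\<sigma> - 2 / 3))) * X powr (\<sigma> - 2 / 3)"
      by (intro ballI allI impI doubling_recursion_bound[OF k1 K main lim])
  qed (use X0 in auto)
qed

lemma isCont_Q: "0 < z \<Longrightarrow> z < z1 \<Longrightarrow> isCont (Q k) z"
  using der DERIV_isCont by blast

text \<open>
  Undoing the three differences costs nothing as long as the exponent \<open>\<sigma> - 2/3\<close> is negative: \<open>p = O(X^(\<sigma> - 2/3))\<close>, that is
  \<open>Q 0 = O(X^(\<sigma> + 1/3))\<close>.
\<close>
lemma growth_step:
  assumes g: "growth (Q 0) \<sigma>" and sg: "0 \<le> \<sigma>" "\<sigma> < 2 / 3"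
  shows "growth (Q 0) (\<sigma> + 1 / 3)"
proof -
  have s1: "\<sigma> \<le> 1" using sg by simp
  obtain C X0 where C: "0 \<le> C" and X0: "0 < X0" "X0 \<le> 1" and bd: "\<forall>a\<in>{1..2}. \<forall>b\<in>{1..2}. \<forall>c\<in>{1..2}. \<forall>X. 0 < X \<longrightarrow> X < X0 \<longrightarrow>
       \<bar>mdiff c (mdiff (b\<^sup>2) (mdiff a p)) X\<bar> \<le> C * X powr (\<sigma> - 2 / 3)"
    by (rule triple_difference_bound[OF g sg(1) s1])
  define Y where "Y = min X0 (z1 / 8)"
  have Y: "0 < Y" "Y \<le> 1" "Y \<le> X0" "8 * Y \<le> z1" using X0 z1 by (auto simp: Y_def)
  have s2: "sqrt 2 \<in> {1..2}" using real_sqrt_le_mono[of 2 4] by auto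
  have kneg: "\<sigma> - 2 / 3 < 0" using sg by simp
  have bdd: "\<exists>M. \<forall>X. Y / 2 \<le> X \<longrightarrow> X < Y \<longrightarrow> \<bar>f X\<bar> \<le> M" if "continuous_on {Y / 2..Y} f" for f :: "real \<Rightarrow> real"
  proof -
    have "bounded (f ` {Y / 2..Y})" by (rule compact_imp_bounded[OF compact_continuous_image[OF that]]) simp
    then obtain M where "\<forall>x\<in>f ` {Y / 2..Y}. norm x \<le> M" unfolding bounded_iff by blast
    then show ?thesis by (intro exI[of _ M]) auto
  qed
  have cp: "continuous_on {Y / 2..Y} (\<lambda>X. p (m * X))" if "0 < m" "m \<le> 4" for m
  proof (intro continuous_at_imp_continuous_on ballI)
    fix X assume X: "X \<in> {Y / 2..Y}"
    have "m * X \<le> 4 * Y" using X that Y by (intro mult_mono) auto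
    then have "0 < m * X" "m * X < z1" using X that Y by auto
    then have "isCont (\<lambda>z. Q 0 z / z) (m * X)" using isCont_Q by (intro continuous_intros) auto
    then have "isCont p (m * X)" by (simp add: p_def[abs_def])
    then show "isCont (\<lambda>X. p (m * X)) X" by (intro isCont_o2[of X "\<lambda>X. m * X" p]) (auto intro!: continuous_intros)
  qed
  have c0: "continuous_on {Y / 2..Y} p" using cp[of 1] by simp
  have c1: "continuous_on {Y / 2..Y} (mdiff 2 p)"
    unfolding mdiff_def using cp[of 1] cp[of 2] by (intro continuous_intros) auto
  have c2: "continuous_on {Y / 2..Y} (mdiff 2 (mdiff 2 p))"
    unfolding mdiff_def using cp[of 1] cp[of 2] cp[of 4] by (intro continuous_intros) (auto simp: mult.assoc[symmetric])
  have t3: "\<bar>mdiff 2 (mdiff 2 (mdiff 2 p)) X\<bar> \<le> C * X powr (\<sigma> - 2 / 3)" if "0 < X" "X < Y" for X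
    using bd[rule_format, of 2 "sqrt 2" 2 X] s2 that Y by simp
  obtain M2 where M2: "\<forall>X. Y / 2 \<le> X \<longrightarrow> X < Y \<longrightarrow> \<bar>mdiff 2 (mdiff 2 p) X\<bar> \<le> M2" using bdd[OF c2] by blast
  obtain C2 where t2: "\<forall>X. 0 < X \<longrightarrow> X < Y \<longrightarrow> \<bar>mdiff 2 (mdiff 2 p) X\<bar> \<le> C2 * X powr (\<sigma> - 2 / 3)"
    by (rule difference_growth_bound[OF kneg Y(1,2) t3 M2[rule_format]])
  obtain M1 where M1: "\<forall>X. Y / 2 \<le> X \<longrightarrow> X < Y \<longrightarrow> \<bar>mdiff 2 p X\<bar> \<le> M1" using bdd[OF c1] by blast
  obtain C1 where t1: "\<forall>X. 0 < X \<longrightarrow> X < Y \<longrightarrow> \<bar>mdiff 2 p X\<bar> \<le> C1 * X powr (\<sigma> - 2 / 3)"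
    by (rule difference_growth_bound[OF kneg Y(1,2) t2[rule_format] M1[rule_format]])
  obtain M0 where M0: "\<forall>X. Y / 2 \<le> X \<longrightarrow> X < Y \<longrightarrow> \<bar>p X\<bar> \<le> M0" using bdd[OF c0] by blast
  obtain C0 where t0: "\<forall>X. 0 < X \<longrightarrow> X < Y \<longrightarrow> \<bar>p X\<bar> \<le> C0 * X powr (\<sigma> - 2 / 3)"
    by (rule difference_growth_bound[OF kneg Y(1,2) t1[rule_format] M0[rule_format]])
  have "\<bar>Q 0 z\<bar> \<le> C0 * z powr (\<sigma> + 1 / 3)" if "0 < z" "z < Y" for z
  proof -
    have "\<bar>Q 0 z\<bar> = z * \<bar>p z\<bar>" using that by (simp add: p_def abs_mult)
    also have "\<dots> \<le> z powr 1 * (C0 * z powr (\<sigma> - 2 / 3))" using t0[rule_format, OF that] that by simp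
    also have "\<dots> = C0 * (z powr 1 * z powr (\<sigma> - 2 / 3))" by (simp only: mult_ac)
    also have "\<dots> = C0 * z powr (1 + (\<sigma> - 2 / 3))" by (simp only: powr_add)
    finally show ?thesis by (simp add: algebra_simps)
  qed
  then show ?thesis unfolding growth_def using Y(1) by blast
qed

text \<open>
  Bootstrapping through the exponents 0, 1/3, 0.65 and 0.98. The third step starts slightly below 2/3 because the
  gain requires a strict inequality.
\<close>
lemma growth_final: "growth (Q k) (98 / 100)"
proof -
  have g0: "growth (Q 0) 0"
  proof -
    have "eventually (\<lambda>z. \<bar>Q 0 z\<bar> < 1) (at_right 0)"
      using order_tendstoD(2)[OF tendsto_rabs[OF lim0], of 1] by simp
    then obtain b where "b > 0" "\<And>z. 0 < z \<Longrightarrow> z < b \<Longrightarrow> \<bar>Q 0 z\<bar> < 1"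
      unfolding eventually_at_right_field by auto
    then show ?thesis unfolding growth_def by (intro exI[of _ 1] exI[of _ b]) (auto simp: less_imp_le)
  qed
  have g1: "growth (Q 0) (1 / 3)" using growth_step[OF g0] by simp
  have g2: "growth (Q 0) (65 / 100)" by (rule growth_mono[OF growth_step[OF g1]]) auto
  have g3: "growth (Q 0) (98 / 100)" by (rule growth_mono[OF growth_step[OF g2]]) auto
  show ?thesis by (rule reg[OF _ _ g3]) auto
qed

end

lemma growth_add: "growth f \<sigma> \<Longrightarrow> growth g \<sigma> \<Longrightarrow> growth (\<lambda>z. f z + g z) \<sigma>"
proof -
  assume "growth f \<sigma>" "growth g \<sigma>"
  then obtain C z0 D y0 where "0 < z0" and C: "\<And>z. 0 < z \<Longrightarrow> z < z0 \<Longrightarrow> \<bar>f z\<bar> \<le> C * z powr \<sigma>"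
    and "0 < y0" and D: "\<And>z. 0 < z \<Longrightarrow> z < y0 \<Longrightarrow> \<bar>g z\<bar> \<le> D * z powr \<sigma>" unfolding growth_def by blast
  have "\<bar>f z + g z\<bar> \<le> (C + D) * z powr \<sigma>" if "0 < z" "z < min z0 y0" for z
    using C[of z] D[of z] that abs_triangle_ineq[of "f z" "g z"] by (simp add: distrib_right)
  then show ?thesis unfolding growth_def using \<open>0 < z0\<close> \<open>0 < y0\<close> by (intro exI[of _ "C + D"] exI[of _ "min z0 y0"]) auto
qed

lemma growth_minus: "growth f \<sigma> \<Longrightarrow> growth (\<lambda>z. - f z) \<sigma>"
  by (simp add: growth_def)

lemma growth_diff: "growth f \<sigma> \<Longrightarrow> growth g \<sigma> \<Longrightarrow> growth (\<lambda>z. f z - g z) \<sigma>"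
  using growth_add[OF _ growth_minus, of f \<sigma> g] by simp

lemma growth_divide_self:
  assumes "growth f \<sigma>" shows "growth (\<lambda>z. f z / z) (\<sigma> - 1)"
proof -
  obtain C z0 where "0 < z0" and C: "\<And>z. 0 < z \<Longrightarrow> z < z0 \<Longrightarrow> \<bar>f z\<bar> \<le> C * z powr \<sigma>"
    using assms unfolding growth_def by blast
  have "\<bar>f z / z\<bar> \<le> C * z powr (\<sigma> - 1)" if "0 < z" "z < z0" for z
    using divide_right_mono[OF C[OF that], of z] that by (simp add: powr_diff abs_divide)
  then show ?thesis unfolding growth_def using \<open>0 < z0\<close> by blast
qed

lemma growth_tendsto:
  assumes "growth f \<sigma>" "\<sigma> > 0" shows "(f \<longlongrightarrow> 0) (at_right 0)"
proof -
  obtain C z0 where z0: "0 < z0" and C: "\<And>z. 0 < z \<Longrightarrow> z < z0 \<Longrightarrow> \<bar>f z\<bar> \<le> C * z powr \<sigma>"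
    using assms unfolding growth_def by blast
  have "((\<lambda>z. C * z powr \<sigma>) \<longlongrightarrow> C * 0) (at_right 0)"
    using tendsto_powr'[of "\<lambda>z. z" 0 "at_right 0" "\<lambda>_. \<sigma>" \<sigma>] assms(2)
    by (intro tendsto_mult tendsto_const) (auto simp: eventually_at_filter)
  then have lim: "((\<lambda>z. C * z powr \<sigma>) \<longlongrightarrow> 0) (at_right 0)" by simp
  have "eventually (\<lambda>z. norm (f z) \<le> C * z powr \<sigma>) (at_right 0)"
    unfolding eventually_at_right_field real_norm_def using z0 C by blast
  then show ?thesis by (rule Lim_null_comparison[OF _ lim])
qed

text \<open>
  The derivative \<open>g'(z)/z = O(z^(s - 1))\<close> is integrable at 0, so \<open>g\<close> has a limit \<open>l\<close> there.
\<close>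
lemma growth_integrate:
  assumes d: "\<And>z. 0 < z \<Longrightarrow> z < z1 \<Longrightarrow> (g has_real_derivative g' z / z) (at z)" and z1: "0 < z1"
    and gr: "growth g' s" and s: "s > 0"
  obtains l where "growth (\<lambda>z. g z - l) s"
proof -
  obtain C z0 where z0: "0 < z0" and C: "\<And>z. 0 < z \<Longrightarrow> z < z0 \<Longrightarrow> \<bar>g' z\<bar> \<le> C * z powr s"
    using gr unfolding growth_def by blast
  define b where "b = min z0 z1 / 2"
  have b: "0 < b" "b < z0" "b < z1" using z0 z1 by (auto simp: b_def)
  have C0: "0 \<le> C" using C[of b] b by (metis abs_ge_zero order_trans powr_gt_zero zero_le_mult_iff not_less order_less_irrefl)
  have up: "((\<lambda>z. C / s * z powr s) has_real_derivative C * z powr s / z) (at z)" if "0 < z" for z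
    using that s by (auto intro!: derivative_eq_intros simp: powr_diff)
  have mono: "g x + C / s * x powr s \<le> g y + C / s * y powr s" if "0 < x" "x \<le> y" "y \<le> b" for x y
  proof (rule DERIV_nonneg_imp_nondecreasing[OF that(2)])
    fix z assume z: "x \<le> z" "z \<le> y"
    have zz: "0 < z" "z < z0" "z < z1" using z that b by auto
    have "0 \<le> g' z / z + C * z powr s / z"
      using C[OF zz(1,2)] zz by (simp add: add_divide_distrib[symmetric] abs_le_iff)
    then show "\<exists>D. ((\<lambda>z. g z + C / s * z powr s) has_real_derivative D) (at z) \<and> 0 \<le> D"
      using DERIV_add[OF d[OF zz(1,3)] up[OF zz(1)]] by blast
  qed
  have anti: "g y - C / s * y powr s \<le> g x - C / s * x powr s" if "0 < x" "x \<le> y" "y \<le> b" for x y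
  proof (rule DERIV_nonpos_imp_nonincreasing[OF that(2)])
    fix z assume z: "x \<le> z" "z \<le> y"
    have zz: "0 < z" "z < z0" "z < z1" using z that b by auto
    have "g' z / z - C * z powr s / z \<le> 0"
      using C[OF zz(1,2)] zz by (simp add: diff_divide_distrib[symmetric] abs_le_iff divide_le_0_iff)
    then show "\<exists>D. ((\<lambda>z. g z - C / s * z powr s) has_real_derivative D) (at z) \<and> D \<le> 0"
      using DERIV_diff[OF d[OF zz(1,3)] up[OF zz(1)]] by blast
  qed
  have cs: "0 \<le> C / s * x powr s" for x using C0 s by simp
  have le: "\<bar>g x - g y\<bar> \<le> C / s * y powr s" if "0 < x" "x \<le> y" "y \<le> b" for x y
    using mono[OF that] anti[OF that] cs[of x] by (simp add: abs_le_iff)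
  define a where "a n = g (b / (real n + 1))" for n
  have pos: "0 < b / (real n + 1)" "b / (real n + 1) \<le> b" for n using b by (auto simp: divide_le_eq)
  have lim0: "(\<lambda>n. C / s * (b / (real n + 1)) powr s) \<longlonglongrightarrow> 0"
  proof -
    have "(\<lambda>n. b / (real n + 1)) \<longlonglongrightarrow> 0" by real_asymp
    then have "(\<lambda>n. (b / (real n + 1)) powr s) \<longlonglongrightarrow> 0 powr s"
      using less_imp_le[OF pos(1)] s by (intro tendsto_powr') auto
    then have "(\<lambda>n. C / s * (b / (real n + 1)) powr s) \<longlonglongrightarrow> C / s * 0" using s by (intro tendsto_mult tendsto_const) auto
    then show ?thesis by simp
  qed
  have "Cauchy a"
  proof (rule metric_CauchyI)
    fix e :: real assume "0 < e"
    then obtain n0 where n0: "\<And>n. n \<ge> n0 \<Longrightarrow> C / s * (b / (real n + 1)) powr s < e"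
      using order_tendstoD(2)[OF lim0, of e] unfolding eventually_sequentially by blast
    have st: "dist (a m) (a n) < e" if "m \<ge> n" "n \<ge> n0" for m n
    proof -
      have "b / (real m + 1) \<le> b / (real n + 1)" using that b by (intro divide_left_mono) auto
      from le[OF pos(1) this pos(2)] n0[OF that(2)] show ?thesis unfolding a_def dist_real_def by linarith
    qed
    show "\<exists>M. \<forall>m\<ge>M. \<forall>n\<ge>M. dist (a m) (a n) < e"
    proof (intro exI[of _ n0] allI impI)
      fix m n assume "n0 \<le> m" "n0 \<le> n"
      then show "dist (a m) (a n) < e" using st[of m n] st[of n m] by (cases "n \<le> m") (auto simp: dist_commute)
    qed
  qed
  then obtain l where l: "a \<longlonglongrightarrow> l" using Cauchy_convergent convergent_def by blast
  have "\<bar>g z - l\<bar> \<le> C / s * z powr s" if z: "0 < z" "z < b" for z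
  proof -
    have "(\<lambda>n. b / (real n + 1)) \<longlonglongrightarrow> 0" by real_asymp
    then have "eventually (\<lambda>n. b / (real n + 1) < z) sequentially" using z(1) by (rule order_tendstoD)
    then have "eventually (\<lambda>n. \<bar>g z - a n\<bar> \<le> C / s * z powr s) sequentially"
    proof eventually_elim
      case (elim n)
      then show ?case using le[OF pos(1)[of n], of z] z unfolding a_def by (simp add: abs_minus_commute)
    qed
    moreover have "(\<lambda>n. \<bar>g z - a n\<bar>) \<longlonglongrightarrow> \<bar>g z - l\<bar>" by (intro tendsto_intros l)
    ultimately show ?thesis by (intro tendsto_upperbound[of _ _ sequentially]) auto
  qed
  then have "growth (\<lambda>z. g z - l) s" unfolding growth_def using b by blast
  then show ?thesis by (rule that)
qed

context corner begin

text \<open>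
  Since \<open>z d/dz (f/z) = (z f' - f)/z\<close>, the \<open>k\<close>-th logarithmic derivative of \<open>Q 0 z / z\<close> is \<open>E k 0 z / z\<close>; the second index counts
  further derivatives.
\<close>
primrec E :: "nat \<Rightarrow> nat \<Rightarrow> real \<Rightarrow> real" where
  "E 0 j = Q j"
| "E (Suc k) j = (\<lambda>z. E k (Suc j) z - E k j z)"

lemma E_deriv: "0 < z \<Longrightarrow> z < z1 \<Longrightarrow> (E k j has_real_derivative E k (Suc j) z / z) (at z)"
proof (induction k arbitrary: j)
  case (Suc k)
  from DERIV_diff[OF Suc.IH[OF Suc.prems, of "Suc j"] Suc.IH[OF Suc.prems, of j]] show ?case
    by (simp add: diff_divide_distrib)
qed (simp add: der)

lemma E_growth: "growth (E k j) (98 / 100)"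
proof (induction k arbitrary: j)
  case 0 show ?case unfolding E.simps by (rule growth_final)
next
  case (Suc k) show ?case unfolding E.simps by (rule growth_diff[OF Suc.IH Suc.IH])
qed

definition \<phi> :: "nat \<Rightarrow> real \<Rightarrow> real" where "\<phi> k z = E k 0 z / z"

lemma phi_0: "\<phi> 0 = p" by (auto simp: \<phi>_def p_def)

lemma phi_deriv: "0 < z \<Longrightarrow> z < z1 \<Longrightarrow> (\<phi> k has_real_derivative \<phi> (Suc k) z / z) (at z)"
  unfolding \<phi>_def by (rule derivative_eq_intros E_deriv refl | simp)+

lemma phi_growth: "growth (\<phi> k) (- (2 / 100))"
  using growth_divide_self[OF E_growth[of k 0]] unfolding \<phi>_def by simp

text \<open>
  Interpolation: a third difference with logarithmic step \<open>h\<close> equals \<open>h^3\<close> times \<open>\<phi> 3\<close> at a nearby point, and \<open>\<phi> 4\<close>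
  controls the variation of \<open>\<phi> 3\<close>. The third difference is \<open>O(X^(0.98 - 2/3))\<close> and \<open>\<phi> 4 = O(X^(-0.02))\<close>, so the step
  \<open>h = X^0.06\<close> leaves a positive power in both contributions.
\<close>
lemma phi_3_growth: "growth (\<phi> 3) (4 / 100)"
proof -
  have s98: "0 \<le> (98 / 100 :: real)" "(98 / 100 :: real) \<le> 1" by auto
  obtain C X0 where C: "0 \<le> C" and X0: "0 < X0" "X0 \<le> 1" and bd: "\<forall>a\<in>{1..2}. \<forall>b\<in>{1..2}. \<forall>c\<in>{1..2}. \<forall>X. 0 < X \<longrightarrow> X < X0 \<longrightarrow>
       \<bar>mdiff c (mdiff (b\<^sup>2) (mdiff a p)) X\<bar> \<le> C * X powr (98 / 100 - 2 / 3)"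
    by (rule triple_difference_bound[OF growth_final[of 0] s98])
  obtain K z0 where z0: "0 < z0" and K: "\<And>z. 0 < z \<Longrightarrow> z < z0 \<Longrightarrow> \<bar>\<phi> 4 z\<bar> \<le> K * z powr (- (2 / 100))"
    using phi_growth[of 4] unfolding growth_def by blast
  \<comment> \<open>The large denominator keeps the logarithmic step \<open>h = X powr 0.06\<close> below \<open>1/5\<close>.\<close>
  define Y where "Y = min (min X0 z0) z1 / 1000000000000"
  have Y: "0 < Y" "1000 * Y \<le> X0" "1000 * Y \<le> z0" "1000 * Y \<le> z1" "Y \<le> 1 / 1000000000000" using X0 z0 z1 by (auto simp: Y_def)
  have "\<bar>\<phi> 3 X\<bar> \<le> (C + 3 * \<bar>K\<bar>) * X powr (4 / 100)" if X: "0 < X" "X < Y" for X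
  proof -
    define h where "h = X powr (6 / 100)"
    have h: "0 < h" "h \<le> 1 / 5"
    proof -
      show "0 < h" using X by (simp add: h_def)
      have "h \<le> (1 / 1000000000000) powr (6 / 100)" unfolding h_def using X Y by (intro powr_mono2) auto
      also have "\<dots> = (1 / 10) powr (12 * (6 / 100))"
      proof -
        have t: "(1 / 10 :: real) powr 12 = 1 / 1000000000000" by (simp add: power_divide)
        show ?thesis unfolding t[symmetric] by (rule powr_powr)
      qed
      also have "\<dots> \<le> (1 / 10) powr (70 / 100)" by (rule powr_mono') auto
      also have "\<dots> \<le> 1 / 5"
      proof (rule power_le_imp_le_base[of _ 9])
        have "((1 / 10) powr (70 / 100)) ^ Suc 9 = (1 / 10 :: real) powr 7" by (simp add: powr_power)
        also have "\<dots> = (1 / 10) ^ 7" using powr_realpow[of "1 / 10 :: real" 7] by simp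
        also have "\<dots> \<le> (1 / 5) ^ Suc 9" by (simp add: power_divide)
        finally show "((1 / 10) powr (70 / 100)) ^ Suc 9 \<le> (1 / 5 :: real) ^ Suc 9" .
      qed auto
      finally show "h \<le> 1 / 5" .
    qed
    define u where "u = ln X"
    have eu: "exp u = X" using X by (simp add: u_def)
    have e2: "exp (3 * h) \<le> 2"
    proof -
      have "(2::real) / 3 \<le> ln 2" using ln2_ge_two_thirds by simp
      then have "3 * h \<le> ln 2" using h by simp
      then have "exp (3 * h) \<le> exp (ln 2)" by (simp only: exp_le_cancel_iff)
      then show ?thesis by simp
    qed
    have rng: "0 < exp x" "X \<le> exp x" "exp x < z1" "exp x < z0" if "u \<le> x" "x \<le> u + 3 * h" for x
    proof -
      have "exp x \<le> exp u * exp (3 * h)" unfolding exp_add[symmetric] using that by simp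
      also have "\<dots> \<le> X * 2" unfolding eu using e2 X by (intro mult_left_mono) auto
      finally show "exp x < z1" "exp x < z0" using X Y by auto
      show "X \<le> exp x" unfolding eu[symmetric] using that by simp
    qed auto
    have d: "((\<lambda>u. \<phi> k (exp u)) has_real_derivative \<phi> (Suc k) (exp x)) (at x)" if "u \<le> x" "x \<le> u + 3 * h" for k x
      using DERIV_chain2[OF phi_deriv[of "exp x" k] DERIV_exp] rng[OF that] by simp
    have dd: "((\<lambda>k u. \<phi> k (exp u)) k has_real_derivative (\<lambda>k u. \<phi> k (exp u)) (Suc k) x) (at x)"
      if "k < 3" "u \<le> x" "x \<le> u + 3 * h" for k x using d[OF that(2,3)] by simp
    obtain \<xi> where xi: "u \<le> \<xi>" "\<xi> \<le> u + 3 * h"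
      "\<phi> 0 (exp (u + 3 * h)) - 3 * \<phi> 0 (exp (u + 2 * h)) + 3 * \<phi> 0 (exp (u + h)) - \<phi> 0 (exp u) = h ^ 3 * \<phi> 3 (exp \<xi>)"
      by (rule third_difference_mvt[where f = "\<lambda>k u. \<phi> k (exp u)", OF h(1) dd])
    have "exp h \<in> {1..2}"
    proof -
      have "exp h \<le> exp (3 * h)" using h by simp
      also note e2
      finally show ?thesis using h by simp
    qed
    moreover have "sqrt (exp h) \<in> {1..2}"
    proof -
      have "sqrt (exp h) \<le> sqrt 4" by (rule real_sqrt_le_mono) (use \<open>exp h \<in> {1..2}\<close> in auto)
      then show ?thesis using h by simp
    qed
    ultimately have "\<bar>mdiff (exp h) (mdiff ((sqrt (exp h))\<^sup>2) (mdiff (exp h) p)) X\<bar> \<le> C * X powr (98 / 100 - 2 / 3)"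
      by (intro bd[rule_format]) (use X Y in auto)
    also have "mdiff (exp h) (mdiff ((sqrt (exp h))\<^sup>2) (mdiff (exp h) p)) X
        = \<phi> 0 (exp (u + 3 * h)) - 3 * \<phi> 0 (exp (u + 2 * h)) + 3 * \<phi> 0 (exp (u + h)) - \<phi> 0 (exp u)"
    proof -
      have "exp (u + h) = exp h * X" "exp (u + 2 * h) = exp h * (exp h * X)" "exp (u + 3 * h) = exp h * (exp h * (exp h * X))"
        by (simp_all add: eu[symmetric] exp_add[symmetric] algebra_simps)
      then show ?thesis by (simp add: mdiff_def phi_0 eu)
    qed
    finally have "h ^ 3 * \<bar>\<phi> 3 (exp \<xi>)\<bar> \<le> C * X powr (98 / 100 - 2 / 3)" using xi(3) h by (simp add: abs_mult)
    also have "\<dots> \<le> C * X powr (22 / 100)" using X Y C by (intro mult_left_mono powr_mono') auto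
    also have "X powr (22 / 100) = h ^ 3 * X powr (4 / 100)" using X by (simp add: h_def powr_power powr_add[symmetric])
    also have "C * (h ^ 3 * X powr (4 / 100)) = h ^ 3 * (C * X powr (4 / 100))" by (simp only: mult_ac)
    finally have "h ^ 3 * \<bar>\<phi> 3 (exp \<xi>)\<bar> \<le> h ^ 3 * (C * X powr (4 / 100))" .
    then have 1: "\<bar>\<phi> 3 (exp \<xi>)\<bar> \<le> C * X powr (4 / 100)" using h by simp
    have 2: "\<bar>\<phi> 3 (exp \<xi>) - \<phi> 3 (exp u)\<bar> \<le> 3 * \<bar>K\<bar> * X powr (4 / 100)"
    proof (cases "u = \<xi>")
      case False
      have "\<exists>x>u. x < \<xi> \<and> \<phi> 3 (exp \<xi>) - \<phi> 3 (exp u) = (\<xi> - u) * \<phi> 4 (exp x)"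
        by (rule MVT2) (use False xi d[of _ 3] in \<open>auto simp: numeral_eq_Suc\<close>)
      then obtain x where x: "u < x" "x < \<xi>" "\<phi> 3 (exp \<xi>) - \<phi> 3 (exp u) = (\<xi> - u) * \<phi> 4 (exp x)" by blast
      note rx = rng[of x]
      have "\<bar>\<phi> 4 (exp x)\<bar> \<le> K * exp x powr (- (2 / 100))" using K rx x xi by auto
      also have "\<dots> \<le> \<bar>K\<bar> * exp x powr (- (2 / 100))" by (rule mult_right_mono) auto
      also have "\<dots> \<le> \<bar>K\<bar> * X powr (- (2 / 100))" using rx x xi X by (intro mult_left_mono powr_mono2') auto
      finally have "\<bar>(\<xi> - u) * \<phi> 4 (exp x)\<bar> \<le> (3 * h) * (\<bar>K\<bar> * X powr (- (2 / 100)))"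
        unfolding abs_mult using xi by (intro mult_mono) auto
      also have "\<dots> = 3 * \<bar>K\<bar> * (X powr (6 / 100) * X powr (- (2 / 100)))" by (simp add: h_def)
      also have "X powr (6 / 100) * X powr (- (2 / 100)) = X powr (4 / 100)" by (simp only: powr_add[symmetric]) simp
      finally show ?thesis using x(3) by simp
    qed simp
    show ?thesis using 1 2 eu by (simp add: distrib_right)
  qed
  then show ?thesis unfolding growth_def using Y(1) by blast
qed

text \<open>
  As the third logarithmic derivative of \<open>p\<close> is \<open>O(z^0.04)\<close>, three integrations in \<open>ln z\<close> make \<open>p\<close> a quadratic polynomial in
  \<open>ln z\<close> up to \<open>O(z^0.04)\<close>.
\<close>
theorem corner_expansion:
  obtains \<alpha> \<beta> \<gamma> where "((\<lambda>z. Q 0 z / z - (\<alpha> * (ln z)\<^sup>2 + \<beta> * ln z + \<gamma>)) \<longlongrightarrow> 0) (at_right 0)"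
    "((\<lambda>z. Q 1 z / z - (\<alpha> * (ln z)\<^sup>2 + (\<beta> + 2 * \<alpha>) * ln z + (\<gamma> + \<beta>))) \<longlongrightarrow> 0) (at_right 0)"
    "(Q 2 \<longlongrightarrow> 0) (at_right 0)"
proof -
  have s: "(4 / 100 :: real) > 0" by simp
  have d2: "(\<phi> 2 has_real_derivative \<phi> 3 z / z) (at z)" if "0 < z" "z < z1" for z
    using phi_deriv[OF that, of 2] by (simp add: numeral_3_eq_3 numeral_2_eq_2)
  obtain a where a: "growth (\<lambda>z. \<phi> 2 z - a) (4 / 100)"
    by (rule growth_integrate[OF d2 z1(1) phi_3_growth s])
  have d1: "((\<lambda>z. \<phi> 1 z - a * ln z) has_real_derivative (\<phi> 2 z - a) / z) (at z)" if "0 < z" "z < z1" for z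
    using phi_deriv[OF that, of 1] that by (auto intro!: derivative_eq_intros simp: diff_divide_distrib numeral_2_eq_2)
  obtain b where b: "growth (\<lambda>z. \<phi> 1 z - a * ln z - b) (4 / 100)"
    by (rule growth_integrate[OF d1 z1(1) a s])
  have d0: "((\<lambda>z. \<phi> 0 z - a / 2 * (ln z)\<^sup>2 - b * ln z) has_real_derivative (\<phi> 1 z - a * ln z - b) / z) (at z)" if "0 < z" "z < z1" for z
    using phi_deriv[OF that, of 0] that by (auto intro!: derivative_eq_intros simp: diff_divide_distrib)
  obtain c where c: "growth (\<lambda>z. \<phi> 0 z - a / 2 * (ln z)\<^sup>2 - b * ln z - c) (4 / 100)"
    by (rule growth_integrate[OF d0 z1(1) b s])
  show ?thesis
  proof (rule that[of "a / 2" b c])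
    show "((\<lambda>z. Q 0 z / z - (a / 2 * (ln z)\<^sup>2 + b * ln z + c)) \<longlongrightarrow> 0) (at_right 0)"
      using growth_tendsto[OF c s] by (simp add: \<phi>_def algebra_simps)
    have "growth (\<lambda>z. (\<phi> 0 z - a / 2 * (ln z)\<^sup>2 - b * ln z - c) + (\<phi> 1 z - a * ln z - b)) (4 / 100)"
      by (rule growth_add[OF c b])
    from growth_tendsto[OF this s]
    show "((\<lambda>z. Q 1 z / z - (a / 2 * (ln z)\<^sup>2 + (b + 2 * (a / 2)) * ln z + (c + b))) \<longlongrightarrow> 0) (at_right 0)"
      by (simp add: \<phi>_def diff_divide_distrib algebra_simps)
    show "(Q 2 \<longlongrightarrow> 0) (at_right 0)" by (rule growth_tendsto[OF growth_final[of 2]]) simp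
  qed
qed

end

section \<open>The explicit solution of the differentiated equation\<close>

text \<open>
  The left-hand side of the relation that differentiation of the functional equation along rays \<open>(\<tau> t, \<tau> y)\<close> produces for
  \<open>P z = z G'(z)\<close>, multiplied by \<open>w\<close>.
\<close>
definition ray_form :: "(real \<Rightarrow> real) \<Rightarrow> real \<Rightarrow> real \<Rightarrow> real" where
  "ray_form P t y = (let w = t + y - 1 in
     2 * P (w / t) + 2 * P (w / y) - (1 - w) * P (w / (t * y)) - (1 + w) * (P (w * y / t) + P (w * t / y))
     + 2 * (1 + w) * P (- w) + 2 * w * (P t + P y))"

text \<open>
  Three times \<open>z d/dz\<close> of the single-valued trilogarithm.
\<close>
definition P0 :: "real \<Rightarrow> real" where
  "P0 z = (ln \<bar>z\<bar>)\<^sup>2 * (z / (1 - z)) + ln \<bar>z\<bar> * ln (1 - z)"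

text \<open>
  Every \<open>1 - v\<close>, for the seven arguments \<open>v\<close>, factors into \<open>t\<close>, \<open>y\<close>, \<open>1 - t\<close>, \<open>1 - y\<close>, \<open>t + y\<close>. In the logarithms of these
  factors and of \<open>w\<close> the relation is a polynomial identity.
\<close>
lemma ray_form_P0:
  assumes "0 < t" "t < 1" "0 < y" "y < 1" "1 < t + y"
  shows "ray_form P0 t y = 0"
proof -
  define w where "w = t + y - 1"
  have w: "0 < w" "1 - t > 0" "1 - y > 0" "t + y > 0" using assms by (auto simp: w_def)
  define A B C D E F where "A = ln w" and "B = ln t" and "C = ln y" and "D = ln (1 - t)" and "E = ln (1 - y)" and "F = ln (t + y)"
  have 1: "P0 (w / t) = (A - B)\<^sup>2 * (w / (1 - y)) + (A - B) * (E - B)"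
  proof -
    have "1 - w / t = (1 - y) / t" using assms by (simp add: field_simps w_def)
    moreover have "w / t / ((1 - y) / t) = w / (1 - y)" using assms by simp
    ultimately show ?thesis unfolding P0_def using assms w by (simp add: ln_div A_def B_def E_def)
  qed
  have 2: "P0 (w / y) = (A - C)\<^sup>2 * (w / (1 - t)) + (A - C) * (D - C)"
  proof -
    have "1 - w / y = (1 - t) / y" using assms by (simp add: field_simps w_def)
    moreover have "w / y / ((1 - t) / y) = w / (1 - t)" using assms by simp
    ultimately show ?thesis unfolding P0_def using assms w by (simp add: ln_div A_def C_def D_def)
  qed
  have 3: "P0 (w / (t * y)) = (A - B - C)\<^sup>2 * (w / ((1 - t) * (1 - y))) + (A - B - C) * (D + E - B - C)"
  proof -
    have "1 - w / (t * y) = (1 - t) * (1 - y) / (t * y)" using assms by (simp add: field_simps w_def)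
    moreover have "w / (t * y) / ((1 - t) * (1 - y) / (t * y)) = w / ((1 - t) * (1 - y))" using assms by simp
    ultimately show ?thesis unfolding P0_def using assms w by (simp add: diff_diff_eq ln_div ln_mult A_def B_def C_def D_def E_def)
  qed
  have 4: "P0 (w * y / t) = (A + C - B)\<^sup>2 * (w * y / ((t + y) * (1 - y))) + (A + C - B) * (F + E - B)"
  proof -
    have "1 - w * y / t = (t + y) * (1 - y) / t" using assms by (simp add: field_simps w_def)
    moreover have "w * y / t / ((t + y) * (1 - y) / t) = w * y / ((t + y) * (1 - y))" using assms by simp
    ultimately show ?thesis unfolding P0_def using assms w by (simp add: diff_diff_eq ln_div ln_mult A_def B_def C_def F_def E_def)
  qed
  have 5: "P0 (w * t / y) = (A + B - C)\<^sup>2 * (w * t / ((t + y) * (1 - t))) + (A + B - C) * (F + D - C)"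
  proof -
    have "1 - w * t / y = (t + y) * (1 - t) / y" using assms by (simp add: field_simps w_def)
    moreover have "w * t / y / ((t + y) * (1 - t) / y) = w * t / ((t + y) * (1 - t))" using assms by simp
    ultimately show ?thesis unfolding P0_def using assms w by (simp add: diff_diff_eq ln_div ln_mult A_def B_def C_def F_def D_def)
  qed
  have 6: "P0 (- w) = A\<^sup>2 * (- w / (t + y)) + A * F"
    unfolding P0_def using w by (simp add: w_def A_def F_def)
  have 7: "P0 t = B\<^sup>2 * (t / (1 - t)) + B * D" "P0 y = C\<^sup>2 * (y / (1 - y)) + C * E"
    unfolding P0_def using assms by (auto simp: B_def C_def D_def E_def)
  define a b c where "a = 1 / (1 - t)" and "b = 1 / (1 - y)" and "c = 1 / (t + y)"
  have abc: "a * (1 - t) = 1" "b * (1 - y) = 1" "c * (t + y) = 1" using w by (auto simp: a_def b_def c_def)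
  have "ray_form P0 t y = 2 * ((A - B)\<^sup>2 * (w * b) + (A - B) * (E - B)) + 2 * ((A - C)\<^sup>2 * (w * a) + (A - C) * (D - C))
     - (1 - w) * ((A - B - C)\<^sup>2 * (w * a * b) + (A - B - C) * (D + E - B - C))
     - (1 + w) * ((A + C - B)\<^sup>2 * (w * y * c * b) + (A + C - B) * (F + E - B) + ((A + B - C)\<^sup>2 * (w * t * c * a) + (A + B - C) * (F + D - C)))
     + 2 * (1 + w) * (A\<^sup>2 * (- w * c) + A * F) + 2 * w * (B\<^sup>2 * (t * a) + B * D + (C\<^sup>2 * (y * b) + C * E))"
    unfolding ray_form_def w_def[symmetric] Let_def 1 2 3 4 5 6 7 a_def b_def c_def by simp
  also have "\<dots> = 0" using abc w_def by algebra
  finally show ?thesis .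
qed

lemma inversion_P0:
  assumes "0 < y" "y < 1"
  shows "(1 - y) * P0 y = y * P0 (1 - y) + P0 (1 - 1 / y)"
proof -
  define C E where "C = ln y" and "E = ln (1 - y)"
  have e: "1 - 1 / y = - ((1 - y) / y)" "\<bar>1 - 1 / y\<bar> = (1 - y) / y" "1 - (1 - 1 / y) = 1 / y"
    using assms by (auto simp: field_simps abs_if)
  have "P0 (1 - 1 / y) = (E - C)\<^sup>2 * (- (1 - y)) + (E - C) * (- C)"
    unfolding P0_def e(2,3) using assms by (simp add: ln_div C_def E_def field_simps)
  moreover have "P0 y = C\<^sup>2 * (y / (1 - y)) + C * E" "P0 (1 - y) = E\<^sup>2 * ((1 - y) / y) + E * C"
    unfolding P0_def using assms by (auto simp: C_def E_def)
  moreover have "(1 - y) * (C\<^sup>2 * (y / (1 - y)) + C * E) = C\<^sup>2 * y + (1 - y) * (C * E)"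
    "y * (E\<^sup>2 * ((1 - y) / y) + E * C) = E\<^sup>2 * (1 - y) + y * (E * C)"
    using assms by (auto simp: distrib_left)
  ultimately show ?thesis by (simp add: power2_eq_square algebra_simps)
qed

definition P01 :: "real \<Rightarrow> real" where "P01 z = (ln z)\<^sup>2 * (z / (1 - z)\<^sup>2) + ln z * (z / (1 - z)) + ln (1 - z)"
definition P02 :: "real \<Rightarrow> real" where "P02 z = (ln z)\<^sup>2 * (z * (1 + z) / (1 - z) ^ 3) + 3 * ln z * (z / (1 - z)\<^sup>2)"

lemma
  assumes "0 < z" "z < (1::real)"
  shows deriv_ln_sq: "((\<lambda>z. (ln z)\<^sup>2) has_real_derivative 2 * ln z / z) (at z)"
    and deriv_ln_one_minus: "((\<lambda>z. ln (1 - z)) has_real_derivative - (1 / (1 - z))) (at z)"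
    and deriv_quot1: "((\<lambda>z. z / (1 - z)) has_real_derivative 1 / (1 - z)\<^sup>2) (at z)"
    and deriv_quot2: "((\<lambda>z. z / (1 - z)\<^sup>2) has_real_derivative (1 + z) / (1 - z) ^ 3) (at z)"
proof -
  have u: "1 - z \<noteq> 0" using assms by simp
  show "((\<lambda>z. (ln z)\<^sup>2) has_real_derivative 2 * ln z / z) (at z)"
    "((\<lambda>z. ln (1 - z)) has_real_derivative - (1 / (1 - z))) (at z)"
    "((\<lambda>z. z / (1 - z)) has_real_derivative 1 / (1 - z)\<^sup>2) (at z)"
    using assms by (auto intro!: derivative_eq_intros simp: power2_eq_square)
  have "((\<lambda>z. z / (1 - z)\<^sup>2) has_real_derivative (1 * (1 - z)\<^sup>2 - z * (2 * (1 - z) * (0 - 1))) / ((1 - z)\<^sup>2 * (1 - z)\<^sup>2)) (at z)"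
    by (rule derivative_eq_intros refl | (use u in simp; fail))+
  moreover have "(1 * (1 - z)\<^sup>2 - z * (2 * (1 - z) * (0 - 1))) / ((1 - z)\<^sup>2 * (1 - z)\<^sup>2) = (1 + z) / (1 - z) ^ 3"
  proof -
    have "(1 * (1 - z)\<^sup>2 - z * (2 * (1 - z) * (0 - 1))) = (1 - z) * (1 + z)" "(1 - z)\<^sup>2 * (1 - z)\<^sup>2 = (1 - z) * (1 - z) ^ 3"
      by algebra+
    then show ?thesis using u by simp
  qed
  ultimately show "((\<lambda>z. z / (1 - z)\<^sup>2) has_real_derivative (1 + z) / (1 - z) ^ 3) (at z)" by simp
qed

lemma P0_deriv:
  assumes "0 < z" "z < 1" shows "(P0 has_real_derivative P01 z / z) (at z)"
proof -
  have nz: "z \<noteq> 0" "1 - z \<noteq> 0" using assms by auto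
  note d = DERIV_add[OF DERIV_mult[OF deriv_ln_sq[OF assms] deriv_quot1[OF assms]]
      DERIV_mult[OF DERIV_ln_divide[OF assms(1)] deriv_ln_one_minus[OF assms]]]
  have "P01 z / z = 2 * ln z / z * (z / (1 - z)) + 1 / (1 - z)\<^sup>2 * (ln z)\<^sup>2 + (1 / z * ln (1 - z) + - (1 / (1 - z)) * ln z)"
    unfolding P01_def using nz by (simp add: add_divide_distrib)
  with d have "((\<lambda>z. (ln z)\<^sup>2 * (z / (1 - z)) + ln z * ln (1 - z)) has_real_derivative P01 z / z) (at z)" by simp
  then show ?thesis
    by (rule has_field_derivative_transform_within_open[where S = "{0<..<1}"]) (use assms in \<open>auto simp: P0_def\<close>)
qed

lemma P01_deriv:
  assumes "0 < z" "z < 1" shows "(P01 has_real_derivative P02 z / z) (at z)"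
proof -
  have nz: "z \<noteq> 0" "1 - z \<noteq> 0" using assms by auto
  note d = DERIV_add[OF DERIV_add[OF DERIV_mult[OF deriv_ln_sq[OF assms] deriv_quot2[OF assms]]
      DERIV_mult[OF DERIV_ln_divide[OF assms(1)] deriv_quot1[OF assms]]] deriv_ln_one_minus[OF assms]]
  have "P02 z / z = 2 * ln z / z * (z / (1 - z)\<^sup>2) + (1 + z) / (1 - z) ^ 3 * (ln z)\<^sup>2
      + (1 / z * (z / (1 - z)) + 1 / (1 - z)\<^sup>2 * ln z) + - (1 / (1 - z))"
    unfolding P02_def using nz by (simp add: add_divide_distrib algebra_simps)
  with d show ?thesis unfolding P01_def[abs_def] by simp
qed

lemma P0_asymp: "((\<lambda>z. P0 z / z - ((ln z)\<^sup>2 - ln z)) \<longlongrightarrow> 0) (at_right 0)"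
proof -
  have "((\<lambda>z::real. ((ln z)\<^sup>2 * (z / (1 - z)) + ln z * ln (1 - z)) / z - ((ln z)\<^sup>2 - ln z)) \<longlongrightarrow> 0) (at_right 0)"
    by real_asymp
  then show ?thesis
    by (rule Lim_transform_eventually) (auto simp: P0_def eventually_at_filter)
qed

lemma P01_asymp: "((\<lambda>z. P01 z / z - ((ln z)\<^sup>2 + ln z - 1)) \<longlongrightarrow> 0) (at_right 0)"
  unfolding P01_def by real_asymp

section \<open>Vanishing of the residual\<close>

lemma filterlim_mult_at_right_0:
  fixes m :: "real \<Rightarrow> real"
  assumes "(m \<longlongrightarrow> m0) (at_right 0)" "0 < m0"
  shows "filterlim (\<lambda>w. w * m w) (at_right 0) (at_right 0)"
proof -
  have "((\<lambda>w. w * m w) \<longlongrightarrow> 0 * m0) (at_right 0)" by (intro tendsto_intros assms)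
  moreover have "eventually (\<lambda>w. 0 < w * m w) (at_right 0)"
    using order_tendstoD(1)[OF assms] eventually_at_right_less[of 0] by eventually_elim simp
  ultimately show ?thesis unfolding filterlim_at by (auto elim: eventually_mono)
qed

text \<open>
  The difference \<open>R\<close> between \<open>P\<close> and the multiple of \<open>P0\<close> that has the same \<open>ln^2\<close> coefficient. \<open>R1\<close> and \<open>R2\<close> are its
  logarithmic derivatives.
\<close>
locale residual =
  fixes e0 :: real and R R1 R2 :: "real \<Rightarrow> real" and \<beta> \<gamma> :: real
  assumes e0: "(sqrt 5 - 1) / 2 < e0" "e0 < 1"
    and ray: "\<And>t y. 0 < y \<Longrightarrow> y < e0 \<Longrightarrow> 0 < t \<Longrightarrow> t < 1 \<Longrightarrow> 1 < t + y \<Longrightarrow> ray_form R t y = 0"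
    and inv: "\<And>y. 0 < y \<Longrightarrow> y < e0 \<Longrightarrow> (1 - y) * R y = y * R (1 - y) + R (1 - 1 / y)"
    and d1: "\<And>z. 0 < z \<Longrightarrow> z < 1 \<Longrightarrow> (R has_real_derivative R1 z / z) (at z)"
    and d2: "\<And>z. 0 < z \<Longrightarrow> z < 1 \<Longrightarrow> (R1 has_real_derivative R2 z / z) (at z)"
    and a0: "((\<lambda>z. R z / z - (\<beta> * ln z + \<gamma>)) \<longlongrightarrow> 0) (at_right 0)"
    and a1: "((\<lambda>z. R1 z / z - (\<beta> * ln z + (\<gamma> + \<beta>))) \<longlongrightarrow> 0) (at_right 0)"
begin

lemma golden: "1 < e0\<^sup>2 + e0" "1 / 2 < e0" "0 < e0" "(1 - e0) / e0 < e0"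
proof -
  have "sqrt 5 < 2 * e0 + 1" using e0(1) by simp
  moreover have s: "2 < sqrt 5" by (rule real_less_rsqrt) simp
  ultimately have "(sqrt 5)\<^sup>2 < (2 * e0 + 1)\<^sup>2" by (intro power_strict_mono) auto
  then show 1: "1 < e0\<^sup>2 + e0" by (simp add: power2_eq_square algebra_simps)
  show "1 / 2 < e0" using e0(1) s by simp
  then show "0 < e0" by simp
  then show "(1 - e0) / e0 < e0" using 1 by (simp add: divide_less_eq power2_eq_square)
qed

lemma R_cont: "0 < z \<Longrightarrow> z < 1 \<Longrightarrow> isCont R z"
  using d1 DERIV_isCont by blast

definition \<epsilon> :: "real \<Rightarrow> real" where "\<epsilon> z = R z / z - (\<beta> * ln z + \<gamma>)"

lemma R_eps: "0 < z \<Longrightarrow> R z = z * (\<beta> * ln z + \<gamma> + \<epsilon> z)"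
  by (simp add: \<epsilon>_def algebra_simps)

lemma eps_lim: "filterlim z (at_right 0) F \<Longrightarrow> ((\<lambda>x. \<epsilon> (z x)) \<longlongrightarrow> 0) F"
  unfolding \<epsilon>_def by (rule filterlim_compose[OF a0])

lemma R_lim0: "(R \<longlongrightarrow> 0) (at_right 0)"
proof -
  have "((\<lambda>z. \<beta> * (z * ln z) + z * \<gamma> + z * \<epsilon> z) \<longlongrightarrow> \<beta> * 0 + 0 * \<gamma> + 0 * 0) (at_right 0)"
    by (intro tendsto_intros eps_lim filterlim_ident) real_asymp
  then have "((\<lambda>z. \<beta> * (z * ln z) + z * \<gamma> + z * \<epsilon> z) \<longlongrightarrow> 0) (at_right 0)" by simp
  then show ?thesis
    by (rule Lim_transform_eventually)
       (auto simp: eventually_at_filter R_eps algebra_simps)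
qed

text \<open>
  Divide the ray relation with \<open>t = 1 - y + w\<close> by \<open>2w\<close> and let \<open>w\<close> tend to 0. The small arguments are all proportional to
  \<open>w\<close>; their \<open>ln w\<close> terms collect into \<open>\<beta> ln w + \<gamma>\<close>. The term \<open>R (-w)\<close> does not depend on \<open>y\<close>, so neither does the
  limit.
\<close>
lemma reflection_limit:
  assumes y: "0 < y" "y < e0"
  shows "((\<lambda>w. - (1 + w) * R (- w) / w - (\<beta> * ln w + \<gamma>)) \<longlongrightarrow> R (1 - y) + R y) (at_right 0)"
proof -
  have y1: "0 < 1 - y" "y < 1" using y e0 by auto
  define t where "t w = 1 - y + w" for w
  have t0: "(t \<longlongrightarrow> 1 - y) (at_right 0)" unfolding t_def by (rule tendsto_eq_intros refl | simp)+
  have w0: "((\<lambda>w::real. w) \<longlongrightarrow> 0) (at_right 0)" by (rule tendsto_ident_at)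
  have lt: "((\<lambda>w. ln (t w)) \<longlongrightarrow> ln (1 - y)) (at_right 0)" using t0 y1 by (intro tendsto_ln) auto
  have lw: "((\<lambda>w::real. w * (\<beta> * ln w + \<gamma>)) \<longlongrightarrow> 0) (at_right 0)"
  proof -
    have "((\<lambda>w::real. \<beta> * (w * ln w) + w * \<gamma>) \<longlongrightarrow> \<beta> * 0 + 0 * \<gamma>) (at_right 0)"
      by (intro tendsto_intros) real_asymp
    then show ?thesis by (simp add: algebra_simps)
  qed
  have e1: "((\<lambda>w. \<epsilon> (w * (1 / t w))) \<longlongrightarrow> 0) (at_right 0)"
    by (rule eps_lim[OF filterlim_mult_at_right_0[where ?m0.0 = "1 / (1 - y)"]]) (use y1 in \<open>auto intro!: tendsto_intros t0\<close>)
  have e2: "((\<lambda>w. \<epsilon> (w * (1 / y))) \<longlongrightarrow> 0) (at_right 0)"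
    by (rule eps_lim[OF filterlim_mult_at_right_0[where ?m0.0 = "1 / y"]]) (use y in \<open>auto intro!: tendsto_intros\<close>)
  have e3: "((\<lambda>w. \<epsilon> (w * (1 / (t w * y)))) \<longlongrightarrow> 0) (at_right 0)"
    by (rule eps_lim[OF filterlim_mult_at_right_0[where ?m0.0 = "1 / ((1 - y) * y)"]]) (use y y1 in \<open>auto intro!: tendsto_intros t0\<close>)
  have e4: "((\<lambda>w. \<epsilon> (w * (y / t w))) \<longlongrightarrow> 0) (at_right 0)"
    by (rule eps_lim[OF filterlim_mult_at_right_0[where ?m0.0 = "y / (1 - y)"]]) (use y y1 in \<open>auto intro!: tendsto_intros t0\<close>)
  have e5: "((\<lambda>w. \<epsilon> (w * (t w / y))) \<longlongrightarrow> 0) (at_right 0)"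
    by (rule eps_lim[OF filterlim_mult_at_right_0[where ?m0.0 = "(1 - y) / y"]]) (use y y1 in \<open>auto intro!: tendsto_intros t0\<close>)
  define H where "H w = ((2 - (3 * w + w\<^sup>2) / (t w * y)) * (w * (\<beta> * ln w + \<gamma>))
     + \<beta> * (2 / t w * (- ln (t w)) + 2 / y * (- ln y) - (1 - w) / (t w * y) * (- ln (t w) - ln y)
          - (1 + w) * (y / t w) * (ln y - ln (t w)) - (1 + w) * (t w / y) * (ln (t w) - ln y))
     + (2 / t w * \<epsilon> (w * (1 / t w)) + 2 / y * \<epsilon> (w * (1 / y)) - (1 - w) / (t w * y) * \<epsilon> (w * (1 / (t w * y)))
          - (1 + w) * (y / t w) * \<epsilon> (w * (y / t w)) - (1 + w) * (t w / y) * \<epsilon> (w * (t w / y)))) / 2 + (R (t w) + R y)" for w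
  have "(H \<longlongrightarrow> ((2 - (3 * 0 + 0\<^sup>2) / ((1 - y) * y)) * 0
     + \<beta> * (2 / (1 - y) * (- ln (1 - y)) + 2 / y * (- ln y) - (1 - 0) / ((1 - y) * y) * (- ln (1 - y) - ln y)
          - (1 + 0) * (y / (1 - y)) * (ln y - ln (1 - y)) - (1 + 0) * ((1 - y) / y) * (ln (1 - y) - ln y))
     + (2 / (1 - y) * 0 + 2 / y * 0 - (1 - 0) / ((1 - y) * y) * 0
          - (1 + 0) * (y / (1 - y)) * 0 - (1 + 0) * ((1 - y) / y) * 0)) / 2 + (R (1 - y) + R y)) (at_right 0)"
    unfolding H_def using y y1
    by (intro tendsto_add tendsto_diff tendsto_mult tendsto_divide tendsto_const tendsto_minus tendsto_power t0 w0 lt lw e1 e2 e3 e4 e5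
        isCont_tendsto_compose[OF R_cont]) auto
  moreover have "2 / (1 - y) * (- ln (1 - y)) + 2 / y * (- ln y) - (1 - 0) / ((1 - y) * y) * (- ln (1 - y) - ln y)
          - (1 + 0) * (y / (1 - y)) * (ln y - ln (1 - y)) - (1 + 0) * ((1 - y) / y) * (ln (1 - y) - ln y) = 0"
    using y y1 by (simp add: divide_simps) (simp add: algebra_simps)
  ultimately have Hl: "(H \<longlongrightarrow> R (1 - y) + R y) (at_right 0)" by simp
  show ?thesis
  proof (rule Lim_transform_eventually[OF Hl])
    have "eventually (\<lambda>w. w < y) (at_right 0)" using y(1) by (rule order_tendstoD(2)[OF w0])
    then show "eventually (\<lambda>w. H w = - (1 + w) * R (- w) / w - (\<beta> * ln w + \<gamma>)) (at_right 0)"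
      using eventually_at_right_less[of 0]
    proof eventually_elim
      case (elim w)
      have tw: "0 < t w" "t w < 1" "1 < t w + y" "t w + y - 1 = w" "t w = 1 + w - y" using elim y1 by (auto simp: t_def)
      have r: "ray_form R (t w) y = 0" by (rule ray) (use tw y in auto)
      have m: "R (w / t w) = w * (1 / t w) * (\<beta> * (ln w - ln (t w)) + \<gamma> + \<epsilon> (w * (1 / t w)))"
        "R (w / y) = w * (1 / y) * (\<beta> * (ln w - ln y) + \<gamma> + \<epsilon> (w * (1 / y)))"
        "R (w / (t w * y)) = w * (1 / (t w * y)) * (\<beta> * (ln w - ln (t w) - ln y) + \<gamma> + \<epsilon> (w * (1 / (t w * y))))"
        "R (w * y / t w) = w * (y / t w) * (\<beta> * (ln w + ln y - ln (t w)) + \<gamma> + \<epsilon> (w * (y / t w)))"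
        "R (w * t w / y) = w * (t w / y) * (\<beta> * (ln w + ln (t w) - ln y) + \<gamma> + \<epsilon> (w * (t w / y)))"
        using R_eps[of "w / t w"] R_eps[of "w / y"] R_eps[of "w / (t w * y)"] R_eps[of "w * y / t w"] R_eps[of "w * t w / y"] elim tw y
        by (simp_all add: ln_div ln_mult diff_diff_eq)
      define a b where "a = 1 / t w" and "b = 1 / y"
      have ab: "a * t w = 1" "b * y = 1" using tw y by (auto simp: a_def b_def)
      define L where "L = \<beta> * ln w + \<gamma>"
      have r': "2 * (w * a * (L - \<beta> * ln (t w) + \<epsilon> (w * (1 / t w)))) + 2 * (w * b * (L - \<beta> * ln y + \<epsilon> (w * (1 / y))))
         - (1 - w) * (w * (a * b) * (L - \<beta> * ln (t w) - \<beta> * ln y + \<epsilon> (w * (1 / (t w * y)))))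
         - (1 + w) * (w * (y * a) * (L + \<beta> * ln y - \<beta> * ln (t w) + \<epsilon> (w * (y / t w)))
              + w * (t w * b) * (L + \<beta> * ln (t w) - \<beta> * ln y + \<epsilon> (w * (t w / y))))
         + 2 * (1 + w) * R (- w) + 2 * w * (R (t w) + R y) = 0"
        using r unfolding ray_form_def Let_def tw(4) m unfolding a_def b_def L_def by (simp add: algebra_simps)
      have "w * (2 * H w) = w * (2 * (- (1 + w) * R (- w) / w - (\<beta> * ln w + \<gamma>)))"
      proof -
        have "w * (2 * (- (1 + w) * R (- w) / w - (\<beta> * ln w + \<gamma>))) = - 2 * (1 + w) * R (- w) - 2 * w * L"
          using elim by (simp add: L_def field_simps)
        also have "\<dots> = w * (((2 - (3 * w + w\<^sup>2) * (a * b)) * (w * L)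
             + \<beta> * (2 * a * (- ln (t w)) + 2 * b * (- ln y) - (1 - w) * (a * b) * (- ln (t w) - ln y)
                  - (1 + w) * (y * a) * (ln y - ln (t w)) - (1 + w) * (t w * b) * (ln (t w) - ln y))
             + (2 * a * \<epsilon> (w * (1 / t w)) + 2 * b * \<epsilon> (w * (1 / y)) - (1 - w) * (a * b) * \<epsilon> (w * (1 / (t w * y)))
                  - (1 + w) * (y * a) * \<epsilon> (w * (y / t w)) - (1 + w) * (t w * b) * \<epsilon> (w * (t w / y))))
             + 2 * (R (t w) + R y))"
          using r' ab tw(5) by algebra
        also have "\<dots> = w * (2 * H w)"
          unfolding H_def a_def b_def L_def by (simp add: field_simps)
        finally show ?thesis by (rule sym)
      qed
      then show ?case using elim by simp
    qed
  qed
qed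


text \<open>
  The constant value of \<open>R y + R (1 - y)\<close>, read off at \<open>y = 1/2\<close>.
\<close>
definition \<kappa> :: real where "\<kappa> = R (1 / 2) + R (1 / 2)"

lemma reflection: assumes "0 < y" "y < 1" shows "R y + R (1 - y) = \<kappa>"
proof -
  have *: "R (1 - y) + R y = \<kappa>" if "0 < y" "y < e0" for y
    using tendsto_unique[OF _ reflection_limit[OF that] reflection_limit[of "1 / 2"]] golden by (simp add: \<kappa>_def)
  show ?thesis
  proof (cases "y < e0")
    case True then show ?thesis using * assms by (simp add: add.commute)
  next
    case False
    then have "R (1 - (1 - y)) + R (1 - y) = \<kappa>" using assms golden by (intro *) auto
    then show ?thesis by simp
  qed
qed

definition X :: "real \<Rightarrow> real" where "X w = 2 * R w + 2 * (1 + w) * R (- w) + 2 * w * \<kappa>"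

text \<open>
  Central differences in \<open>ln r\<close>.
\<close>
lemma second_difference_limit:
  assumes r: "0 < r" "r < 1"
  shows "((\<lambda>l. (R (r * exp l) + R (r * exp (- l)) - 2 * R r) / l\<^sup>2) \<longlongrightarrow> R2 r) (at_right 0)"
    "((\<lambda>l. (R (r * exp l) - R (r * exp (- l))) / l) \<longlongrightarrow> 2 * R1 r) (at_right 0)"
proof -
  have ev: "eventually (\<lambda>l. r * exp l < 1 \<and> r * exp (- l) < 1) (at_right 0)"
  proof (intro eventually_conj)
    have "((\<lambda>l. r * exp l) \<longlongrightarrow> r * exp 0) (at_right 0)" "((\<lambda>l. r * exp (- l)) \<longlongrightarrow> r * exp (- 0)) (at_right 0)"
      by (intro tendsto_intros)+
    then show "eventually (\<lambda>l. r * exp l < 1) (at_right 0)" "eventually (\<lambda>l. r * exp (- l) < 1) (at_right 0)"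
      using r by (auto intro: order_tendstoD(2))
  qed
  have dR: "((\<lambda>l. R (r * exp (c * l))) has_real_derivative c * R1 (r * exp (c * l))) (at l)" if "r * exp (c * l) < 1" for l c
  proof -
    have "((\<lambda>l. r * exp (c * l)) has_real_derivative c * (r * exp (c * l))) (at l)"
      by (auto intro!: derivative_eq_intros)
    from DERIV_chain2[OF d1[OF _ that] this] show ?thesis using r by (simp add: mult.commute)
  qed
  have dR1: "((\<lambda>l. R1 (r * exp (c * l))) has_real_derivative c * R2 (r * exp (c * l))) (at l)" if "r * exp (c * l) < 1" for l c
  proof -
    have "((\<lambda>l. r * exp (c * l)) has_real_derivative c * (r * exp (c * l))) (at l)"
      by (auto intro!: derivative_eq_intros)
    from DERIV_chain2[OF d2[OF _ that] this] show ?thesis using r by (simp add: mult.commute)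
  qed
  have quot: "((\<lambda>l. f l / l) \<longlongrightarrow> D) (at_right 0)" if "(f has_real_derivative D) (at 0)" "f 0 = 0" for f :: "real \<Rightarrow> real" and D
  proof -
    have "((\<lambda>l. (f l - f 0) / (l - 0)) \<longlongrightarrow> D) (at 0)" using that(1) unfolding has_field_derivative_iff by simp
    then have "((\<lambda>l. (f l - f 0) / (l - 0)) \<longlongrightarrow> D) (at_right 0)" by (rule tendsto_within_subset) simp
    then show ?thesis using that(2) by simp
  qed
  have "((\<lambda>l. R (r * exp (1 * l)) - R (r * exp (- 1 * l))) has_real_derivative 1 * R1 (r * exp (1 * 0)) - - 1 * R1 (r * exp (- 1 * 0))) (at 0)"
    by (intro DERIV_diff dR) (use r in auto)
  then have "((\<lambda>l. R (r * exp l) - R (r * exp (- l))) has_real_derivative 2 * R1 r) (at 0)" by simp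
  from quot[OF this] show "((\<lambda>l. (R (r * exp l) - R (r * exp (- l))) / l) \<longlongrightarrow> 2 * R1 r) (at_right 0)" by simp
  have "((\<lambda>l. R1 (r * exp (1 * l)) - R1 (r * exp (- 1 * l))) has_real_derivative 1 * R2 (r * exp (1 * 0)) - - 1 * R2 (r * exp (- 1 * 0))) (at 0)"
    by (intro DERIV_diff dR1) (use r in auto)
  then have "((\<lambda>l. R1 (r * exp l) - R1 (r * exp (- l))) has_real_derivative 2 * R2 r) (at 0)" by simp
  from quot[OF this] have q1: "((\<lambda>l. (R1 (r * exp l) - R1 (r * exp (- l))) / l) \<longlongrightarrow> 2 * R2 r) (at_right 0)" by simp
  show "((\<lambda>l. (R (r * exp l) + R (r * exp (- l)) - 2 * R r) / l\<^sup>2) \<longlongrightarrow> R2 r) (at_right 0)"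
  proof (rule lhopital_right_0)
    have "isCont R r" by (rule R_cont[OF r])
    then have "((\<lambda>l. R (r * exp l) + R (r * exp (- l)) - 2 * R r) \<longlongrightarrow> R (r * exp 0) + R (r * exp (- 0)) - 2 * R r) (at_right 0)"
      by (intro tendsto_intros isCont_tendsto_compose[of _ R]) auto
    then show "((\<lambda>l. R (r * exp l) + R (r * exp (- l)) - 2 * R r) \<longlongrightarrow> 0) (at_right 0)" by simp
    have "((\<lambda>l::real. l\<^sup>2) \<longlongrightarrow> 0\<^sup>2) (at_right 0)" by (intro tendsto_intros)
    then show "((\<lambda>l::real. l\<^sup>2) \<longlongrightarrow> 0) (at_right 0)" by simp
    show "eventually (\<lambda>l::real. l\<^sup>2 \<noteq> 0) (at_right 0)" "eventually (\<lambda>l::real. 2 * l \<noteq> 0) (at_right 0)"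
      by (auto simp: eventually_at_filter)
    show "eventually (\<lambda>l. ((\<lambda>l. R (r * exp l) + R (r * exp (- l)) - 2 * R r) has_real_derivative R1 (r * exp l) - R1 (r * exp (- l))) (at l)) (at_right 0)"
      using ev
    proof eventually_elim
      case (elim l)
      have "((\<lambda>l. R (r * exp (1 * l)) + R (r * exp (- 1 * l)) - 2 * R r) has_real_derivative 1 * R1 (r * exp (1 * l)) + - 1 * R1 (r * exp (- 1 * l)) - 0) (at l)"
        by (intro DERIV_diff DERIV_add dR DERIV_const) (use elim in auto)
      then show ?case by simp
    qed
    show "eventually (\<lambda>l::real. ((\<lambda>l. l\<^sup>2) has_real_derivative 2 * l) (at l)) (at_right 0)"
      by (auto intro!: always_eventually derivative_eq_intros)
    have "((\<lambda>l. (R1 (r * exp l) - R1 (r * exp (- l))) / l / 2) \<longlongrightarrow> 2 * R2 r / 2) (at_right 0)"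
      by (intro tendsto_divide q1 tendsto_const) auto
    then show "((\<lambda>l. (R1 (r * exp l) - R1 (r * exp (- l))) / (2 * l)) \<longlongrightarrow> R2 r) (at_right 0)"
      by (simp add: mult.commute)
  qed
qed

definition corner_rhs :: "real \<Rightarrow> real" where
  "corner_rhs r = r * (2 * (1 - r) * \<beta> * (ln r + 1) - \<beta> * ln r + \<gamma> - 2 * (1 - r) * \<beta> * ln (1 - r))"

text \<open>
  The ray relation in the corner \<open>w = r y\<close>, \<open>t = 1 - (1 - r) y\<close>, divided by \<open>y^2\<close>. The arguments \<open>w/y\<close>, \<open>w/(ty)\<close> and
  \<open>wt/y\<close> are \<open>r\<close>, \<open>r/t\<close> and \<open>rt\<close>, so that they form a second difference at \<open>r\<close>; the remaining ones tend to 0, where the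
  expansion of \<open>R\<close> applies. All unknown terms are collected in \<open>X w\<close>.
\<close>
lemma corner_limit:
  assumes r: "0 < r" "r < 1"
  shows "((\<lambda>y. X (r * y) / y\<^sup>2) \<longlongrightarrow> (1 - r)\<^sup>2 * R2 r - 2 * r * (1 - r) * R1 r - corner_rhs r) (at_right 0)"
proof -
  define t where "t y = 1 - (1 - r) * y" for y
  define l where "l y = - ln (t y)" for y
  have y0: "((\<lambda>y::real. y) \<longlongrightarrow> 0) (at_right 0)" by (rule tendsto_ident_at)
  have t0: "(t \<longlongrightarrow> 1) (at_right 0)" unfolding t_def by (rule tendsto_eq_intros refl | simp)+
  have l0: "(l \<longlongrightarrow> 0) (at_right 0)" unfolding l_def using t0 by (auto intro!: tendsto_eq_intros)
  have small: "eventually (\<lambda>y. 0 < y \<and> y < e0 \<and> y < 1 / 2) (at_right 0)"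
    using order_tendstoD(2)[OF y0 golden(3)] order_tendstoD(2)[OF y0, of "1/2"] eventually_at_right_less[of "0::real"]
    by (auto elim: eventually_elim2 intro: eventually_conj)
  have tin: "0 < t y" "t y < 1" "0 < (1 - r) * y" "0 < l y" if "0 < y" "y < 1 / 2" for y
  proof -
    have "(1 - r) * y < 1 * 1" using r that by (intro mult_strict_mono) auto
    then show "0 < t y" by (simp add: t_def)
    show "0 < (1 - r) * y" using r that by simp
    then show "t y < 1" by (simp add: t_def)
    then show "0 < l y" using \<open>0 < t y\<close> by (simp add: l_def)
  qed
  have lr: "filterlim l (at_right 0) (at_right 0)"
    unfolding filterlim_at using l0 small by (auto elim!: eventually_mono dest: tin)
  have ly: "((\<lambda>y. l y / y) \<longlongrightarrow> 1 - r) (at_right 0)"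
    unfolding l_def t_def using r by real_asymp
  have lyl: "((\<lambda>y. (l y / y - (1 - r)) * ln y) \<longlongrightarrow> 0) (at_right 0)"
    unfolding l_def t_def using r by real_asymp
  have ell: "((\<lambda>y. (exp (l y) - 1) * ln y) \<longlongrightarrow> 0) (at_right 0)"
  proof -
    have "((\<lambda>y. (1 / (1 - (1 - r) * y) - 1) * ln y) \<longlongrightarrow> 0) (at_right 0)" using r by real_asymp
    then show ?thesis
    proof (rule Lim_transform_eventually)
      show "eventually (\<lambda>y. (1 / (1 - (1 - r) * y) - 1) * ln y = (exp (l y) - 1) * ln y) (at_right 0)"
        using small
      proof eventually_elim
        case (elim y)
        then have "exp (l y) = 1 / t y" using tin[of y] by (simp add: l_def exp_minus inverse_eq_divide)
        then show ?case by (simp add: t_def)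
      qed
    qed
  qed
  have tll: "((\<lambda>y. ((1 + r * y) / t y - 1) * ln y) \<longlongrightarrow> 0) (at_right 0)"
    unfolding t_def using r by real_asymp
  \<comment> \<open>the second difference\<close>
  have S: "((\<lambda>y. - ((R (r * exp (l y)) + R (r * exp (- l y)) - 2 * R r) / (l y)\<^sup>2) * (l y / y)\<^sup>2
       + r * ((R (r * exp (l y)) - R (r * exp (- l y))) / l y) * (l y / y))
      \<longlongrightarrow> - R2 r * (1 - r)\<^sup>2 + r * (2 * R1 r) * (1 - r)) (at_right 0)"
    by (intro tendsto_intros ly filterlim_compose[OF second_difference_limit(1)[OF r] lr] filterlim_compose[OF second_difference_limit(2)[OF r] lr])
  have mv: "\<exists>\<theta>. 0 < y \<and> y < 1 / 2 \<longrightarrow> 0 < \<theta> \<and> \<theta> < l y \<and> R (r * y * exp (l y)) - R (r * y) = l y * R1 (r * y * exp \<theta>)" for y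
  proof (cases "0 < y \<and> y < 1 / 2")
    case True
    then have ty: "0 < t y" "t y < 1" "0 < l y" using tin[of y] by auto
    have le: "r * y * exp u < 1" if "u \<le> l y" for u
    proof -
      have "r * y * exp u \<le> r * y * exp (l y)" using that r True by (intro mult_left_mono) auto
      also have "\<dots> = r * y / t y" using ty by (simp add: l_def exp_minus inverse_eq_divide)
      also have "\<dots> < 1" using ty True r by (simp add: divide_less_eq t_def algebra_simps)
      finally show ?thesis .
    qed
    have "\<exists>\<theta>>0. \<theta> < l y \<and> R (r * y * exp (l y)) - R (r * y * exp 0) = (l y - 0) * R1 (r * y * exp \<theta>)"
    proof (rule MVT2[OF ty(3)])
      fix u assume u: "0 \<le> u" "u \<le> l y"
      have "((\<lambda>u. r * y * exp u) has_real_derivative r * y * exp u) (at u)" by (auto intro!: derivative_eq_intros)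
      from DERIV_chain2[OF d1[OF _ le[OF u(2)]] this] show "((\<lambda>u. R (r * y * exp u)) has_real_derivative R1 (r * y * exp u)) (at u)"
        using r True by simp
    qed
    then show ?thesis by auto
  qed auto
  then obtain \<theta> where th: "\<And>y. 0 < y \<and> y < 1 / 2 \<longrightarrow> 0 < \<theta> y \<and> \<theta> y < l y \<and> R (r * y * exp (l y)) - R (r * y) = l y * R1 (r * y * exp (\<theta> y))"
    by metis
  have th0: "(\<theta> \<longlongrightarrow> 0) (at_right 0)"
  proof (rule tendsto_sandwich[OF _ _ tendsto_const l0])
    show "eventually (\<lambda>y. 0 \<le> \<theta> y) (at_right 0)" "eventually (\<lambda>y. \<theta> y \<le> l y) (at_right 0)"
      using small by (eventually_elim, use th in force)+
  qed
  have thl: "((\<lambda>y. (exp (\<theta> y) - 1) * ln y) \<longlongrightarrow> 0) (at_right 0)"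
  proof (rule tendsto_0_le[OF ell, where K = 1])
    show "eventually (\<lambda>y. norm ((exp (\<theta> y) - 1) * ln y) \<le> norm ((exp (l y) - 1) * ln y) * 1) (at_right 0)"
      using small
    proof eventually_elim
      case (elim y)
      then have "0 < \<theta> y" "\<theta> y < l y" using th[of y] by auto
      then show ?case by (simp add: abs_mult mult_right_mono)
    qed
  qed
  define \<epsilon>1 where "\<epsilon>1 z = R1 z / z - (\<beta> * ln z + (\<gamma> + \<beta>))" for z
  have R1e: "R1 z = z * (\<beta> * ln z + (\<gamma> + \<beta>) + \<epsilon>1 z)" if "0 < z" for z
    using that by (simp add: \<epsilon>1_def)
  have fr: "filterlim (\<lambda>y. y * (r * exp (\<theta> y))) (at_right 0) (at_right 0)"
    by (rule filterlim_mult_at_right_0[OF tendsto_mult[OF tendsto_const tendsto_exp[OF th0]]]) (use r in simp)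
  have E1: "((\<lambda>y. \<epsilon>1 (y * (r * exp (\<theta> y)))) \<longlongrightarrow> 0) (at_right 0)"
    unfolding \<epsilon>1_def by (rule filterlim_compose[OF a1 fr])
  have E2: "((\<lambda>y. \<epsilon> (y * (r * y / t y))) \<longlongrightarrow> 0) (at_right 0)"
  proof (rule eps_lim)
    have "((\<lambda>y. y * (r * y / t y)) \<longlongrightarrow> 0 * (r * 0 / 1)) (at_right 0)" by (intro tendsto_intros t0) auto
    moreover have "eventually (\<lambda>y. 0 < y * (r * y / t y)) (at_right 0)"
      using small by eventually_elim (use tin r in auto)
    ultimately show "filterlim (\<lambda>y. y * (r * y / t y)) (at_right 0) (at_right 0)"
      unfolding filterlim_at by (auto elim: eventually_mono)
  qed
  have E3: "((\<lambda>y. \<epsilon> y) \<longlongrightarrow> 0) (at_right 0)" by (rule eps_lim[OF filterlim_ident])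
  have E4: "((\<lambda>y. \<epsilon> (y * (1 - r))) \<longlongrightarrow> 0) (at_right 0)"
    by (rule eps_lim[OF filterlim_mult_at_right_0[OF tendsto_const]]) (use r in simp)
  define T where "T y = 2 * (l y / y) * r * exp (\<theta> y) * (\<beta> * (ln r + \<theta> y) + (\<gamma> + \<beta>) + \<epsilon>1 (y * (r * exp (\<theta> y))))
       - (1 + r * y) * (r / t y) * (\<beta> * (ln r + l y) + \<gamma> + \<epsilon> (y * (r * y / t y)))
       + 2 * r * (\<gamma> + \<epsilon> y - (1 - r) * (\<beta> * ln (1 - r) + \<gamma> + \<epsilon> (y * (1 - r))))
       + 2 * r * \<beta> * ((l y / y - (1 - r)) * ln y + (l y / y) * ((exp (\<theta> y) - 1) * ln y) - ((1 + r * y) / t y - 1) * ln y)" for y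
  have "(T \<longlongrightarrow> 2 * (1 - r) * r * exp 0 * (\<beta> * (ln r + 0) + (\<gamma> + \<beta>) + 0)
       - (1 + r * 0) * (r / 1) * (\<beta> * (ln r + 0) + \<gamma> + 0)
       + 2 * r * (\<gamma> + 0 - (1 - r) * (\<beta> * ln (1 - r) + \<gamma> + 0))
       + 2 * r * \<beta> * (0 + (1 - r) * 0 - 0)) (at_right 0)"
    unfolding T_def by (intro tendsto_intros ly th0 E1 E2 E3 E4 t0 l0 lyl thl tll) auto
  also have "2 * (1 - r) * r * exp 0 * (\<beta> * (ln r + 0) + (\<gamma> + \<beta>) + 0)
       - (1 + r * 0) * (r / 1) * (\<beta> * (ln r + 0) + \<gamma> + 0)
       + 2 * r * (\<gamma> + 0 - (1 - r) * (\<beta> * ln (1 - r) + \<gamma> + 0))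
       + 2 * r * \<beta> * (0 + (1 - r) * 0 - 0) = corner_rhs r"
    by (simp add: corner_rhs_def algebra_simps)
  finally have T: "(T \<longlongrightarrow> corner_rhs r) (at_right 0)" .
  from tendsto_minus[OF tendsto_add[OF S T]]
  have lim: "((\<lambda>y. - ((- ((R (r * exp (l y)) + R (r * exp (- l y)) - 2 * R r) / (l y)\<^sup>2) * (l y / y)\<^sup>2
       + r * ((R (r * exp (l y)) - R (r * exp (- l y))) / l y) * (l y / y)) + T y)) \<longlongrightarrow> (1 - r)\<^sup>2 * R2 r - 2 * r * (1 - r) * R1 r - corner_rhs r) (at_right 0)"
    by (simp add: algebra_simps)
  show ?thesis
  proof (rule Lim_transform_eventually[OF lim])
    show "eventually (\<lambda>y. - ((- ((R (r * exp (l y)) + R (r * exp (- l y)) - 2 * R r) / (l y)\<^sup>2) * (l y / y)\<^sup>2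
       + r * ((R (r * exp (l y)) - R (r * exp (- l y))) / l y) * (l y / y)) + T y) = X (r * y) / y\<^sup>2) (at_right 0)"
      using small
    proof eventually_elim
      case (elim y)
      have y: "0 < y" "y < e0" "y < 1 / 2" using elim by auto
      note ty = tin[OF y(1,3)]
      define w where "w = r * y"
      have w: "0 < w" "t y + y - 1 = w" using r y by (auto simp: w_def t_def algebra_simps)
      have el: "exp (l y) = 1 / t y" "exp (- l y) = t y" using ty by (auto simp: l_def exp_minus inverse_eq_divide)
      have r0: "ray_form R (t y) y = 0" by (rule ray) (use y ty w in auto)
      have args: "w / y = r" "w / (t y * y) = r * exp (l y)" "w * t y / y = r * exp (- l y)" "w / t y = r * y * exp (l y)"
        using y unfolding w_def el by auto
      have tk: "R (t y) = \<kappa> - R ((1 - r) * y)"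
        using reflection[of "t y"] ty by (simp add: t_def)
      have A: "R (r * y * exp (l y)) = R w + l y * R1 (r * y * exp (\<theta> y))" using th[of y] y by (simp add: w_def)
      have B: "R1 (r * y * exp (\<theta> y)) = w * exp (\<theta> y) * (\<beta> * (ln r + ln y + \<theta> y) + (\<gamma> + \<beta>) + \<epsilon>1 (y * (r * exp (\<theta> y))))"
        using R1e[of "r * y * exp (\<theta> y)"] y r by (simp add: w_def ln_mult mult_ac)
      have C: "R (w * y / t y) = w * y / t y * (\<beta> * (ln r + 2 * ln y + l y) + \<gamma> + \<epsilon> (y * (r * y / t y)))"
        using R_eps[of "w * y / t y"] w y ty r by (simp add: w_def ln_mult ln_div l_def mult_ac)
      have D: "R y = y * (\<beta> * ln y + \<gamma> + \<epsilon> y)" "R ((1 - r) * y) = (1 - r) * y * (\<beta> * (ln (1 - r) + ln y) + \<gamma> + \<epsilon> (y * (1 - r)))"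
        using R_eps[of y] R_eps[of "(1 - r) * y"] y r ty by (auto simp: ln_mult mult.commute)
      define P Q1 Q2 where "P = R (r * exp (l y))" and "Q1 = R (r * exp (- l y))" and "Q2 = R (- w)"
      have eq: "2 * (R w + l y * (w * exp (\<theta> y) * (\<beta> * (ln r + ln y + \<theta> y) + (\<gamma> + \<beta>) + \<epsilon>1 (y * (r * exp (\<theta> y))))))
          + 2 * R r - (1 - w) * P - (1 + w) * (w * y / t y * (\<beta> * (ln r + 2 * ln y + l y) + \<gamma> + \<epsilon> (y * (r * y / t y))) + Q1)
          + 2 * (1 + w) * Q2 + 2 * w * (\<kappa> - (1 - r) * y * (\<beta> * (ln (1 - r) + ln y) + \<gamma> + \<epsilon> (y * (1 - r))) + y * (\<beta> * ln y + \<gamma> + \<epsilon> y)) = 0"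
        using r0 unfolding ray_form_def Let_def w(2) args A B C tk D P_def Q1_def Q2_def .
      define a where "a = 1 / t y"
      have eq': "X w = - (2 * (l y * (w * exp (\<theta> y) * (\<beta> * (ln r + ln y + \<theta> y) + (\<gamma> + \<beta>) + \<epsilon>1 (y * (r * exp (\<theta> y))))))
          + 2 * R r - (1 - w) * P - (1 + w) * (w * y * a * (\<beta> * (ln r + 2 * ln y + l y) + \<gamma> + \<epsilon> (y * (r * y / t y))) + Q1)
          + 2 * w * (- (1 - r) * y * (\<beta> * (ln (1 - r) + ln y) + \<gamma> + \<epsilon> (y * (1 - r))) + y * (\<beta> * ln y + \<gamma> + \<epsilon> y)))"
        using eq unfolding X_def Q2_def a_def by (simp add: algebra_simps)
      have ring: "- ((- U * k + r * V * m) + T) = U * k - r * (V * m) - T" for U k V m T :: real by algebra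
      define b where "b = 1 / y"
      have b: "b * y = 1" "y * b = 1" using y by (auto simp: b_def)
      have c: "(P + Q1 - 2 * R r) / (l y)\<^sup>2 * (l y / y)\<^sup>2 = (P + Q1 - 2 * R r) * b\<^sup>2" "(P - Q1) / l y * (l y / y) = (P - Q1) * b"
        using ty y by (auto simp: b_def power_divide)
      have e1: "- ((- ((P + Q1 - 2 * R r) / (l y)\<^sup>2) * (l y / y)\<^sup>2 + r * ((P - Q1) / l y) * (l y / y)) + T y)
          = (P + Q1 - 2 * R r) * b\<^sup>2 - r * ((P - Q1) * b) - T y"
        unfolding c[symmetric] ring ..
      have e2: "T y = 2 * (l y * b) * r * exp (\<theta> y) * (\<beta> * (ln r + \<theta> y) + (\<gamma> + \<beta>) + \<epsilon>1 (y * (r * exp (\<theta> y))))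
       - (1 + r * y) * (r * a) * (\<beta> * (ln r + l y) + \<gamma> + \<epsilon> (y * (r * y / t y)))
       + 2 * r * (\<gamma> + \<epsilon> y - (1 - r) * (\<beta> * ln (1 - r) + \<gamma> + \<epsilon> (y * (1 - r))))
       + 2 * r * \<beta> * ((l y * b - (1 - r)) * ln y + (l y * b) * ((exp (\<theta> y) - 1) * ln y) - ((1 + r * y) * a - 1) * ln y)"
        by (simp add: T_def a_def b_def)
      have e3: "(P + Q1 - 2 * R r) * b\<^sup>2 - r * ((P - Q1) * b) - T y = X w * b\<^sup>2"
        unfolding e2 eq' using b w_def by algebra
      have e4: "X w * b\<^sup>2 = X (r * y) / y\<^sup>2" by (simp add: b_def w_def power_divide)
      show ?case using trans[OF e1 trans[OF e3 e4]] unfolding P_def Q1_def .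
    qed
  qed
qed


text \<open>
  \<open>X\<close> is a function of \<open>w = r y\<close> alone, so the limit of \<open>X w / w^2\<close> cannot depend on \<open>r\<close>.
\<close>
lemma corner_identity:
  obtains \<eta> where "\<And>r. 0 < r \<Longrightarrow> r < 1 \<Longrightarrow> (1 - r)\<^sup>2 * R2 r - 2 * r * (1 - r) * R1 r = corner_rhs r + \<eta> * r\<^sup>2"
proof -
  define V where "V r = (1 - r)\<^sup>2 * R2 r - 2 * r * (1 - r) * R1 r - corner_rhs r" for r
  have lim: "((\<lambda>w. X w / w\<^sup>2) \<longlongrightarrow> V r / r\<^sup>2) (at_right 0)" if r: "0 < r" "r < 1" for r
  proof -
    have "filterlim (\<lambda>w. w * (1 / r)) (at_right 0) (at_right 0)"
      by (rule filterlim_mult_at_right_0[OF tendsto_const]) (use r in simp)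
    from filterlim_compose[OF corner_limit[OF r] this]
    have "((\<lambda>w. X (r * (w * (1 / r))) / (w * (1 / r))\<^sup>2) \<longlongrightarrow> V r) (at_right 0)" by (simp add: V_def)
    then have "((\<lambda>w. X (r * (w * (1 / r))) / (w * (1 / r))\<^sup>2 / r\<^sup>2) \<longlongrightarrow> V r / r\<^sup>2) (at_right 0)"
      by (intro tendsto_divide tendsto_const) (use r in auto)
    then show ?thesis using r by (simp add: power_divide)
  qed
  show ?thesis
  proof (rule that[of "V (1 / 2) / (1 / 2)\<^sup>2"])
    fix r :: real assume r: "0 < r" "r < 1"
    have "V r / r\<^sup>2 = V (1 / 2) / (1 / 2)\<^sup>2"
      by (rule tendsto_unique[OF _ lim[OF r] lim]) auto
    then have "V r = V (1 / 2) / (1 / 2)\<^sup>2 * r\<^sup>2" using r by (simp add: field_simps)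
    then show "(1 - r)\<^sup>2 * R2 r - 2 * r * (1 - r) * R1 r = corner_rhs r + V (1 / 2) / (1 / 2)\<^sup>2 * r\<^sup>2"
      by (simp add: V_def)
  qed
qed

lemma R1_lim0: "(R1 \<longlongrightarrow> 0) (at_right 0)"
proof -
  have "((\<lambda>z. \<beta> * (z * ln z) + z * (\<gamma> + \<beta>) + z * (R1 z / z - (\<beta> * ln z + (\<gamma> + \<beta>)))) \<longlongrightarrow> \<beta> * 0 + 0 * (\<gamma> + \<beta>) + 0 * 0) (at_right 0)"
    by (intro tendsto_intros a1) real_asymp
  then have "((\<lambda>z. \<beta> * (z * ln z) + z * (\<gamma> + \<beta>) + z * (R1 z / z - (\<beta> * ln z + (\<gamma> + \<beta>)))) \<longlongrightarrow> 0) (at_right 0)" by simp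
  then show ?thesis
    by (rule Lim_transform_eventually) (auto simp: eventually_at_filter algebra_simps)
qed

text \<open>
  The left-hand side of the corner identity is \<open>r\<close> times the derivative of \<open>(1 - r)^2 R1 r\<close>, so the equation integrates in
  closed form with initial value 0. The reflection \<open>R r + R (1 - r) = \<kappa>\<close> imposes a symmetry of \<open>R'\<close> that determines the
  constants \<open>\<gamma>\<close> and \<open>\<eta>\<close>.
\<close>
lemma R1_explicit:
  assumes r: "0 < r" "r < 1"
  shows "R1 r = \<beta> * (r * ln r / (1 - r) + ln (1 - r))"
proof -
  obtain \<eta> where chi: "\<And>r. 0 < r \<Longrightarrow> r < 1 \<Longrightarrow> (1 - r)\<^sup>2 * R2 r - 2 * r * (1 - r) * R1 r = corner_rhs r + \<eta> * r\<^sup>2"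
    by (rule corner_identity) blast
  define G where "G r = \<beta> * (r * (1 - r) * ln r + (1 - r)\<^sup>2 * ln (1 - r) + 2 * r - r\<^sup>2) + \<eta> * r\<^sup>2 / 2 + \<gamma> * r" for r
  define H where "H r = (1 - r)\<^sup>2 * R1 r - G r" for r
  have dH: "(H has_real_derivative 0) (at r)" if r: "0 < r" "r < 1" for r
  proof -
    have nz: "r \<noteq> 0" "1 - r \<noteq> 0" using r by auto
    have dG: "(G has_real_derivative \<beta> * ((1 - r - r) * ln r + r * (1 - r) * (1 / r) + (- 2 * (1 - r) * ln (1 - r) + (1 - r)\<^sup>2 * (- (1 / (1 - r)))) + 2 - 2 * r) + \<eta> * r + \<gamma>) (at r)"
      unfolding G_def[abs_def] using r
      by (auto intro!: derivative_eq_intros deriv_ln_one_minus simp: power2_eq_square)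
    have dA: "((\<lambda>r. (1 - r)\<^sup>2 * R1 r) has_real_derivative (2 * (1 - r) * (0 - 1)) * R1 r + R2 r / r * (1 - r)\<^sup>2) (at r)"
      by (intro DERIV_mult d2[OF r]) (auto intro!: derivative_eq_intros)
    have "(2 * (1 - r) * (0 - 1)) * R1 r + R2 r / r * (1 - r)\<^sup>2 = ((1 - r)\<^sup>2 * R2 r - 2 * r * (1 - r) * R1 r) / r"
      using nz by (simp add: field_simps)
    also have "\<dots> = corner_rhs r / r + \<eta> * r" unfolding chi[OF r] using nz by (simp add: add_divide_distrib power2_eq_square)
    also have "corner_rhs r / r = 2 * (1 - r) * \<beta> * (ln r + 1) - \<beta> * ln r + \<gamma> - 2 * (1 - r) * \<beta> * ln (1 - r)"
      using nz by (simp add: corner_rhs_def)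
    also have "\<dots> + \<eta> * r = \<beta> * ((1 - r - r) * ln r + r * (1 - r) * (1 / r) + (- 2 * (1 - r) * ln (1 - r) + (1 - r)\<^sup>2 * (- (1 / (1 - r)))) + 2 - 2 * r) + \<eta> * r + \<gamma>"
    proof -
      have "(1 - r)\<^sup>2 * (- (1 / (1 - r))) = - (1 - r)" "r * (1 - r) * (1 / r) = 1 - r" using nz by (simp_all add: power2_eq_square)
      then show ?thesis by (simp only:) (simp add: algebra_simps)
    qed
    finally have e: "(2 * (1 - r) * (0 - 1)) * R1 r + R2 r / r * (1 - r)\<^sup>2 = \<dots>" .
    show ?thesis unfolding H_def[abs_def] using DERIV_diff[OF dA dG] unfolding e by simp
  qed
  have G0: "(G \<longlongrightarrow> 0) (at_right 0)" unfolding G_def by real_asymp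
  have "((\<lambda>r. (1 - r)\<^sup>2 * R1 r - G r) \<longlongrightarrow> (1 - 0)\<^sup>2 * 0 - 0) (at_right 0)" by (intro tendsto_intros R1_lim0 G0)
  then have H0: "(H \<longlongrightarrow> 0) (at_right 0)" by (simp add: H_def[abs_def])
  have H: "H r = 0" if r: "0 < r" "r < 1" for r
  proof -
    have c: "H x = H r" if "0 < x" "x < r" for x
      by (rule DERIV_isconst3[where f = H and a = 0 and b = 1 and x = x and y = r]) (use that r dH in auto)
    have "((\<lambda>_::real. H r) \<longlongrightarrow> 0) (at_right 0)"
      by (rule Lim_transform_eventually[OF H0])
         (use c r in \<open>auto simp: eventually_at_right_field intro: exI[of _ r]\<close>)
    then show ?thesis by (simp add: tendsto_const_iff)
  qed
  \<comment> \<open>The part of the solution that is not symmetric under \<open>r \<mapsto> 1 - r\<close> has to vanish.\<close>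
  define n0 n1 where "n0 = 2 * \<beta> + \<gamma>" and "n1 = \<eta> / 2 - \<beta>"
  have form: "R1 r / r = \<beta> * (ln r / (1 - r) + ln (1 - r) / r) + (n0 + n1 * r) / (1 - r)\<^sup>2" if r: "0 < r" "r < 1" for r
  proof -
    define u where "u = 1 - r"
    have u: "u \<noteq> 0" "r \<noteq> 0" using r by (auto simp: u_def)
    have "u\<^sup>2 * R1 r = \<beta> * (r * u * ln r + u\<^sup>2 * ln u + 2 * r - r\<^sup>2) + \<eta> * r\<^sup>2 / 2 + \<gamma> * r"
      using H[OF r] by (simp add: H_def G_def u_def)
    also have "\<dots> = u\<^sup>2 * (r * (\<beta> * (ln r / u + ln u / r) + (n0 + n1 * r) / u\<^sup>2))"
      using u by (simp add: n0_def n1_def field_simps power2_eq_square)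
    finally have "R1 r = r * (\<beta> * (ln r / u + ln u / r) + (n0 + n1 * r) / u\<^sup>2)" using u by simp
    then show ?thesis using u by (simp add: u_def)
  qed
  have sym: "R1 r / r = R1 (1 - r) / (1 - r)" if r: "0 < r" "r < 1" for r
  proof -
    have "((\<lambda>r. R r + R (1 - r)) has_real_derivative R1 r / r + R1 (1 - r) / (1 - r) * (0 - 1)) (at r)"
      by (intro DERIV_add d1 r DERIV_chain2[OF d1]) (use r in \<open>auto intro!: derivative_eq_intros\<close>)
    moreover have "((\<lambda>r. R r + R (1 - r)) has_real_derivative 0) (at r)"
      by (rule has_field_derivative_transform_within_open[OF DERIV_const[of \<kappa>], where S = "{0<..<1}"]) (use r reflection in auto)
    ultimately have "R1 r / r + R1 (1 - r) / (1 - r) * (0 - 1) = 0" by (rule DERIV_unique)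
    then show ?thesis by simp
  qed
  have q: "(n0 + n1 * r) / (1 - r)\<^sup>2 = (n0 + n1 * (1 - r)) / r\<^sup>2" if "0 < r" "r < 1" for r
  proof -
    have "R1 (1 - r) / (1 - r) = \<beta> * (ln (1 - r) / r + ln r / (1 - r)) + (n0 + n1 * (1 - r)) / r\<^sup>2"
      using form[of "1 - r"] that by simp
    moreover have "\<beta> * (ln (1 - r) / r + ln r / (1 - r)) = \<beta> * (ln r / (1 - r) + ln (1 - r) / r)" by (simp only: add.commute)
    ultimately show ?thesis using sym[OF that] form[OF that] by linarith
  qed
  have "n0 = 0" "n1 = 0" using q[of "1 / 4"] q[of "1 / 3"] by (auto simp: power2_eq_square)
  then have "R1 r / r = \<beta> * (ln r / (1 - r) + ln (1 - r) / r)" using form[OF r] by simp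
  then have "R1 r = r * (\<beta> * (ln r / (1 - r) + ln (1 - r) / r))" using r by (simp add: divide_eq_eq mult.commute)
  then show ?thesis using r by (simp add: distrib_left)
qed

text \<open>
  The ray relation with \<open>y = w + d\<close> and \<open>t = 1 - d\<close>, for fixed \<open>w\<close> and \<open>d\<close> tending to 0. Arguments and values near 1 are
  converted by reflection into values near 0.
\<close>
lemma R_negative:
  assumes w: "0 < w" "w < e0"
  shows "(1 + w) * (2 * R w - R (w\<^sup>2) + 2 * R (- w)) + 2 * w * \<kappa> = 0"
proof -
  define t where "t d = 1 - d" for d :: real
  have d0: "((\<lambda>d::real. d) \<longlongrightarrow> 0) (at_right 0)" by (rule tendsto_ident_at)
  have t0: "(t \<longlongrightarrow> 1) (at_right 0)" unfolding t_def by (rule tendsto_eq_intros refl | simp)+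
  define y where "y d = w + d" for d
  have yl: "(y \<longlongrightarrow> w) (at_right 0)" unfolding y_def by (rule tendsto_eq_intros refl | simp)+
  have w1: "w < 1" using w e0 by simp
  have near1: "((\<lambda>d. R (f d)) \<longlongrightarrow> \<kappa>) (at_right 0)"
    if f: "(f \<longlongrightarrow> 1) (at_right 0)" and ev: "eventually (\<lambda>d. 0 < f d \<and> f d < 1) (at_right (0::real))" for f
  proof -
    have "((\<lambda>d. 1 - f d) \<longlongrightarrow> 1 - 1) (at_right 0)" by (intro tendsto_intros f)
    then have "filterlim (\<lambda>d. 1 - f d) (at_right 0) (at_right 0)"
      unfolding filterlim_at using ev by (auto elim: eventually_mono)
    from filterlim_compose[OF R_lim0 this] have "((\<lambda>d. \<kappa> - R (1 - f d)) \<longlongrightarrow> \<kappa> - 0) (at_right 0)" by (intro tendsto_intros)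
    then have "((\<lambda>d. \<kappa> - R (1 - f d)) \<longlongrightarrow> \<kappa>) (at_right 0)" by simp
    then show ?thesis
    proof (rule Lim_transform_eventually)
      show "eventually (\<lambda>d. \<kappa> - R (1 - f d) = R (f d)) (at_right 0)"
        using ev by eventually_elim (use reflection in \<open>auto simp: algebra_simps\<close>)
    qed
  qed
  have small: "eventually (\<lambda>d. 0 < d \<and> d < e0 - w \<and> d < 1 / 2) (at_right 0)"
    using order_tendstoD(2)[OF d0, of "e0 - w"] order_tendstoD(2)[OF d0, of "1/2"] eventually_at_right_less[of "0::real"] w
    by (auto elim: eventually_elim2 intro: eventually_conj)
  have range: "0 < t d" "t d < 1" "w < y d" "0 < y d" "y d < e0" "t d + y d - 1 = w" "t d * y d > w" "w * t d < y d" if "0 < d" "d < e0 - w" "d < 1 / 2" for d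
  proof -
    show "0 < t d" "t d < 1" "w < y d" "y d < e0" "t d + y d - 1 = w" using that by (auto simp: t_def y_def)
    then show "0 < y d" using w by simp
    have "t d * y d - w = d * (1 - y d)" by (simp add: t_def y_def algebra_simps)
    moreover have "0 < d * (1 - y d)" using that e0 by (intro mult_pos_pos) (auto simp: y_def)
    ultimately show "t d * y d > w" by simp
    have "w * t d < w * 1" using w \<open>t d < 1\<close> by (intro mult_strict_left_mono)
    then show "w * t d < y d" using \<open>w < y d\<close> by simp
  qed
  have l1: "((\<lambda>d. R (t d)) \<longlongrightarrow> \<kappa>) (at_right 0)"
    by (rule near1[OF t0]) (use small in \<open>auto elim!: eventually_mono dest: range\<close>)
  have l2: "((\<lambda>d. R (w / y d)) \<longlongrightarrow> \<kappa>) (at_right 0)"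
  proof (rule near1)
    have "((\<lambda>d. w / y d) \<longlongrightarrow> w / w) (at_right 0)" by (intro tendsto_intros yl) (use w in auto)
    then show "((\<lambda>d. w / y d) \<longlongrightarrow> 1) (at_right 0)" using w by simp
    show "eventually (\<lambda>d. 0 < w / y d \<and> w / y d < 1) (at_right 0)" using small
      by eventually_elim (use range w in auto)
  qed
  have l3: "((\<lambda>d. R (w / (t d * y d))) \<longlongrightarrow> \<kappa>) (at_right 0)"
  proof (rule near1)
    have "((\<lambda>d. w / (t d * y d)) \<longlongrightarrow> w / (1 * w)) (at_right 0)" by (intro tendsto_intros yl t0) (use w in auto)
    then show "((\<lambda>d. w / (t d * y d)) \<longlongrightarrow> 1) (at_right 0)" using w by simp
    show "eventually (\<lambda>d. 0 < w / (t d * y d) \<and> w / (t d * y d) < 1) (at_right 0)" using small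
    proof eventually_elim
      case (elim d)
      then show ?case using range[of d] w by (simp add: divide_less_eq)
    qed
  qed
  have l5: "((\<lambda>d. R (w * t d / y d)) \<longlongrightarrow> \<kappa>) (at_right 0)"
  proof (rule near1)
    have "((\<lambda>d. w * t d / y d) \<longlongrightarrow> w * 1 / w) (at_right 0)" by (intro tendsto_intros yl t0) (use w in auto)
    then show "((\<lambda>d. w * t d / y d) \<longlongrightarrow> 1) (at_right 0)" using w by simp
    show "eventually (\<lambda>d. 0 < w * t d / y d \<and> w * t d / y d < 1) (at_right 0)" using small
    proof eventually_elim
      case (elim d)
      then show ?case using range[of d] w by (simp add: divide_less_eq)
    qed
  qed
  have l4: "((\<lambda>d. R (w / t d)) \<longlongrightarrow> R (w / 1)) (at_right 0)"
    by (intro isCont_tendsto_compose[OF R_cont] tendsto_intros t0) (use w w1 in auto)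
  have l6: "((\<lambda>d. R (w * y d / t d)) \<longlongrightarrow> R (w * w / 1)) (at_right 0)"
    by (intro isCont_tendsto_compose[OF R_cont] tendsto_intros t0 yl) (use w w1 mult_strict_mono[of w 1 w 1] in auto)
  have l7: "((\<lambda>d. R (y d)) \<longlongrightarrow> R w) (at_right 0)"
    by (intro isCont_tendsto_compose[OF R_cont] yl) (use w w1 in auto)
  have "((\<lambda>d. 2 * R (w / t d) + 2 * R (w / y d) - (1 - w) * R (w / (t d * y d)) - (1 + w) * (R (w * y d / t d) + R (w * t d / y d))
     + 2 * (1 + w) * R (- w) + 2 * w * (R (t d) + R (y d))) \<longlongrightarrow> 2 * R (w / 1) + 2 * \<kappa> - (1 - w) * \<kappa> - (1 + w) * (R (w * w / 1) + \<kappa>)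
     + 2 * (1 + w) * R (- w) + 2 * w * (\<kappa> + R w)) (at_right 0)"
    by (intro tendsto_intros l1 l2 l3 l4 l5 l6 l7)
  moreover have "((\<lambda>d. 2 * R (w / t d) + 2 * R (w / y d) - (1 - w) * R (w / (t d * y d)) - (1 + w) * (R (w * y d / t d) + R (w * t d / y d))
     + 2 * (1 + w) * R (- w) + 2 * w * (R (t d) + R (y d))) \<longlongrightarrow> 0) (at_right 0)"
  proof (rule Lim_transform_eventually[OF tendsto_const])
    show "eventually (\<lambda>d. 0 = 2 * R (w / t d) + 2 * R (w / y d) - (1 - w) * R (w / (t d * y d)) - (1 + w) * (R (w * y d / t d) + R (w * t d / y d))
     + 2 * (1 + w) * R (- w) + 2 * w * (R (t d) + R (y d))) (at_right 0)" using small
    proof eventually_elim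
      case (elim d)
      have "ray_form R (t d) (y d) = 0" by (rule ray) (use range[of d] elim w in auto)
      then show ?case using range(6)[of d] elim by (simp add: ray_form_def Let_def)
    qed
  qed
  ultimately have "2 * R (w / 1) + 2 * \<kappa> - (1 - w) * \<kappa> - (1 + w) * (R (w * w / 1) + \<kappa>)
     + 2 * (1 + w) * R (- w) + 2 * w * (\<kappa> + R w) = 0" by (intro tendsto_unique[of "at_right (0::real)"]) auto
  then show ?thesis by (simp add: power2_eq_square algebra_simps)
qed

text \<open>
  On the overlap \<open>(1 - e0)/e0 < w < e0\<close> both the ray relation and the inversion express \<open>R (-w)\<close>; equating the two gives an
  identity for \<open>R\<close> at \<open>w\<close>, \<open>w^2\<close> and \<open>w/(1 + w)\<close>. Its derivative, computed with the explicit \<open>R1\<close>, leaves only \<open>\<kappa>\<close>.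
\<close>
lemma kappa_zero: "\<kappa> = 0"
proof -
  define I where "I = {(1 - e0) / e0<..<e0}"
  define f where "f w = R (w\<^sup>2) - 2 * R w + 2 * R (w / (1 + w)) - 4 * \<kappa> * (w / (1 + w))" for w
  have I: "0 < w" "w < e0" "w < 1" "1 / (1 + w) < e0" if "w \<in> I" for w
  proof -
    show "0 < w" "w < e0" using that golden e0 by (auto simp: I_def intro: le_less_trans[of 0 "(1 - e0) / e0"])
    then show "w < 1" using e0 by simp
    have "1 - e0 < w * e0" using that golden by (simp add: I_def divide_less_eq)
    then show "1 / (1 + w) < e0" using \<open>0 < w\<close> by (simp add: divide_less_eq algebra_simps)
  qed
  have f0: "f w = 0" if w: "w \<in> I" for w
  proof -
    note w' = I[OF w]
    define s where "s = w / (1 + w)"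
    have s: "0 < s" "s < 1" "1 - s = 1 / (1 + w)" "s * (1 + w) = w" using w' by (auto simp: s_def field_simps)
    have "(1 - 1 / (1 + w)) * R (1 / (1 + w)) = 1 / (1 + w) * R (1 - 1 / (1 + w)) + R (1 - 1 / (1 / (1 + w)))"
      by (rule inv) (use w' in auto)
    moreover have "1 - 1 / (1 + w) = s" using s(3) by simp
    ultimately have "s * R (1 - s) = (1 - s) * R s + R (- w)" using s(3) by simp
    moreover have "R (1 - s) = \<kappa> - R s" using reflection[OF s(1,2)] by simp
    ultimately have neg: "R (- w) = s * \<kappa> - R s" by (simp add: algebra_simps)
    have "(1 + w) * (2 * R w - R (w\<^sup>2) + 2 * (s * \<kappa> - R s)) + 2 * (s * (1 + w)) * \<kappa> = 0"
      using R_negative[OF w'(1,2)] unfolding neg s(4) .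
    then have "(1 + w) * (2 * R w - R (w\<^sup>2) + 2 * (s * \<kappa> - R s) + 2 * s * \<kappa>) = 0" by (simp add: algebra_simps)
    then have "2 * R w - R (w\<^sup>2) + 2 * (s * \<kappa> - R s) + 2 * s * \<kappa> = 0" using w' by simp
    then show ?thesis by (simp add: f_def s_def[symmetric] algebra_simps)
  qed
  obtain w where w: "w \<in> I" using dense[OF golden(4)] by (auto simp: I_def)
  note w' = I[OF w]
  have s: "0 < w / (1 + w)" "w / (1 + w) < 1" using w' by auto
  have w2: "0 < w\<^sup>2" "w\<^sup>2 < 1" using w' by (auto simp: power_less_one_iff abs_square_less_1)
  have ds: "((\<lambda>w. w / (1 + w)) has_real_derivative 1 / (1 + w)\<^sup>2) (at w)"
    using w' by (auto intro!: derivative_eq_intros simp: power2_eq_square)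
  have "(f has_real_derivative R1 (w\<^sup>2) / w\<^sup>2 * (2 * w) - 2 * (R1 w / w) + 2 * (R1 (w / (1 + w)) / (w / (1 + w)) * (1 / (1 + w)\<^sup>2)) - 4 * \<kappa> * (1 / (1 + w)\<^sup>2)) (at w)"
    unfolding f_def[abs_def]
  proof (intro DERIV_diff DERIV_add DERIV_cmult d1[OF w'(1,3)] ds)
    show "((\<lambda>w. R (w\<^sup>2)) has_real_derivative R1 (w\<^sup>2) / w\<^sup>2 * (2 * w)) (at w)"
      by (rule DERIV_chain2[where f = R and g = "\<lambda>w. w\<^sup>2", OF d1[OF w2]]) (auto intro!: derivative_eq_intros)
    show "((\<lambda>w. R (w / (1 + w))) has_real_derivative R1 (w / (1 + w)) / (w / (1 + w)) * (1 / (1 + w)\<^sup>2)) (at w)"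
      by (rule DERIV_chain2[where f = R and g = "\<lambda>w. w / (1 + w)", OF d1[OF s] ds])
  qed
  moreover have "(f has_real_derivative 0) (at w)"
    by (rule has_field_derivative_transform_within_open[OF DERIV_const[of 0], where S = I]) (use w f0 in \<open>auto simp: I_def\<close>)
  ultimately have "R1 (w\<^sup>2) / w\<^sup>2 * (2 * w) - 2 * (R1 w / w) + 2 * (R1 (w / (1 + w)) / (w / (1 + w)) * (1 / (1 + w)\<^sup>2)) - 4 * \<kappa> * (1 / (1 + w)\<^sup>2) = 0"
    by (rule DERIV_unique)
  moreover have "R1 (w\<^sup>2) / w\<^sup>2 * (2 * w) - 2 * (R1 w / w) + 2 * (R1 (w / (1 + w)) / (w / (1 + w)) * (1 / (1 + w)\<^sup>2)) = 0"
  proof -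
    define A B C where "A = ln w" and "B = ln (1 - w)" and "C = ln (1 + w)"
    have "1 - w\<^sup>2 = (1 - w) * (1 + w)" by (simp add: power2_eq_square algebra_simps)
    then have "ln (1 - w\<^sup>2) = B + C" using w' by (simp add: B_def C_def ln_mult)
    then have 1: "R1 (w\<^sup>2) = \<beta> * (w\<^sup>2 * (2 * A) / ((1 - w) * (1 + w)) + (B + C))"
      using R1_explicit[OF w2] w' \<open>1 - w\<^sup>2 = (1 - w) * (1 + w)\<close> by (simp add: A_def ln_realpow)
    have 2: "R1 w = \<beta> * (w * A / (1 - w) + B)" using R1_explicit[OF w'(1,3)] by (simp add: A_def B_def)
    have "1 - w / (1 + w) = 1 / (1 + w)" using w' by (simp add: field_simps)
    then have 3: "R1 (w / (1 + w)) = \<beta> * (w * (A - C) - C)"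
      using R1_explicit[OF s] w' by (simp add: A_def C_def ln_div)
    define a b c where "a = 1 / w" and "b = 1 / (1 - w)" and "c = 1 / (1 + w)"
    have abc: "a * w = 1" "b * (1 - w) = 1" "c * (1 + w) = 1" using w' by (auto simp: a_def b_def c_def)
    have "R1 (w\<^sup>2) / w\<^sup>2 * (2 * w) - 2 * (R1 w / w) + 2 * (R1 (w / (1 + w)) / (w / (1 + w)) * (1 / (1 + w)\<^sup>2))
       = \<beta> * (w\<^sup>2 * (2 * A) * (b * c) + (B + C)) * a\<^sup>2 * (2 * w) - 2 * (\<beta> * (w * A * b + B) * a) + 2 * (\<beta> * (w * (A - C) - C) * (a * (1 + w)) * c\<^sup>2)"
      unfolding 1 2 3 a_def b_def c_def by (simp add: power_divide)
    also have "\<dots> = 0" using abc by algebra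
    finally show ?thesis .
  qed
  ultimately show ?thesis using w' by simp
qed

text \<open>
  For \<open>\<beta> \<noteq> 0\<close> the explicit derivative has a fixed sign, so \<open>R\<close> is strictly monotone; but \<open>R\<close> tends to 0 at 0 and
  vanishes at \<open>1/2\<close>.
\<close>
lemma beta_zero: "\<beta> = 0"
proof (rule ccontr)
  assume b: "\<beta> \<noteq> 0"
  define S where "S z = R z * (- sgn \<beta>)" for z
  have dS: "\<exists>D. (S has_real_derivative D) (at z) \<and> 0 < D" if z: "0 < z" "z < 1" for z
  proof (intro exI conjI)
    show "(S has_real_derivative R1 z / z * (- sgn \<beta>)) (at z)"
      unfolding S_def[abs_def] by (rule DERIV_cmult_right[OF d1[OF z]])
    have "z * ln z / (1 - z) + ln (1 - z) < 0" using z by (intro add_neg_neg divide_neg_pos mult_pos_neg) auto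
    then have "0 < \<bar>\<beta>\<bar> * (- (z * ln z / (1 - z) + ln (1 - z)))" using b by (intro mult_pos_pos) auto
    also have "\<dots> = R1 z * (- sgn \<beta>)" unfolding R1_explicit[OF z] by (simp add: abs_sgn algebra_simps)
    finally have "0 < R1 z * (- sgn \<beta>) / z" using z by (intro divide_pos_pos) auto
    then show "0 < R1 z / z * (- sgn \<beta>)" by simp
  qed
  have mono: "S x < S y" if "0 < x" "x < y" "y < 1" for x y
    by (rule DERIV_pos_imp_increasing[OF that(2)]) (use dS that in auto)
  have half: "S (1 / 2) = 0" using kappa_zero by (simp add: S_def \<kappa>_def)
  have "((\<lambda>z. R z * (- sgn \<beta>)) \<longlongrightarrow> 0 * (- sgn \<beta>)) (at_right 0)" by (intro tendsto_intros R_lim0)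
  then have "(S \<longlongrightarrow> 0) (at_right 0)" by (simp add: S_def[abs_def])
  moreover have "eventually (\<lambda>z. S z \<le> S (1 / 4)) (at_right 0)"
    unfolding eventually_at_right_field by (intro exI[of _ "1 / 4"]) (use mono in \<open>auto intro: less_imp_le\<close>)
  ultimately have "0 \<le> S (1 / 4)" by (intro tendsto_upperbound[of S 0 "at_right 0"]) auto
  then show False using mono[of "1 / 4" "1 / 2"] half by simp
qed

text \<open>
  With \<open>\<beta> = 0\<close> the function \<open>R\<close> is constant on \<open>]0, 1[\<close>. On the negative axis the first range comes from the ray relation, the
  second one from the inversion.
\<close>
theorem R_zero:
  "0 < z \<Longrightarrow> z < 1 \<Longrightarrow> R z = 0"
  "0 < w \<Longrightarrow> w < e0 \<Longrightarrow> R (- w) = 0"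
  "(1 - e0) / e0 < w \<Longrightarrow> R (- w) = 0"
proof -
  show R0: "R z = 0" if z: "0 < z" "z < 1" for z
  proof -
    have c: "R x = R z" if "0 < x" "x < z" for x
    proof (rule DERIV_isconst3[where f = R and a = 0 and b = 1 and x = x and y = z])
      show "DERIV R u :> 0" if "u \<in> {0<..<1}" for u
        using d1[of u] R1_explicit[of u] beta_zero that by simp
    qed (use that z in auto)
    have "((\<lambda>_::real. R z) \<longlongrightarrow> 0) (at_right 0)"
      by (rule Lim_transform_eventually[OF R_lim0])
         (use c z in \<open>auto simp: eventually_at_right_field intro: exI[of _ z]\<close>)
    then show ?thesis by (simp add: tendsto_const_iff)
  qed
  show "R (- w) = 0" if w: "0 < w" "w < e0" for w
  proof -
    have "w\<^sup>2 < 1" "w < 1" using w e0 by (auto simp: power_less_one_iff abs_square_less_1)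
    then show ?thesis using R_negative[OF w] R0[of w] R0[of "w\<^sup>2"] kappa_zero w by simp
  qed
  show "R (- w) = 0" if w: "(1 - e0) / e0 < w" for w
  proof -
    have w0: "0 < w" using w golden e0 by (auto intro: le_less_trans[of 0 "(1 - e0) / e0"])
    have "1 - e0 < w * e0" using w golden by (simp add: divide_less_eq)
    then have "1 / (1 + w) < e0" using w0 by (simp add: divide_less_eq algebra_simps)
    then have "(1 - 1 / (1 + w)) * R (1 / (1 + w)) = 1 / (1 + w) * R (1 - 1 / (1 + w)) + R (1 - 1 / (1 / (1 + w)))"
      using w0 by (intro inv) auto
    moreover have "R (1 / (1 + w)) = 0" "R (1 - 1 / (1 + w)) = 0" using w0 by (auto intro!: R0)
    ultimately show ?thesis by simp
  qed
qed

end

section \<open>The trilogarithm and the Spence-Kummer equation\<close>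

lemma of_real_slit_plane: "x < 1 \<Longrightarrow> complex_of_real x \<in> slit_plane"
  by (auto simp: slit_plane_def)

text \<open>
  The identity holds on the unit disc by the power series and extends to the slit plane by analytic continuation.
\<close>
lemma polylog_deriv_times:
  assumes "z \<in> slit_plane"
  shows "z * deriv (polylog (Suc n)) z = polylog n z"
proof (rule analytic_continuation_open[where s = "ball 0 1" and s' = slit_plane and f = "\<lambda>z. z * deriv (polylog (Suc n)) z" and g = "polylog n"])
  show "(\<lambda>z. z * deriv (polylog (Suc n)) z) holomorphic_on slit_plane"
    by (intro holomorphic_intros holomorphic_deriv polylog_holomorphic open_slit_plane)
  fix z :: complex assume z: "z \<in> ball 0 1"
  show "z * deriv (polylog (Suc n)) z = polylog n z"
  proof (cases "z = 0")
    case True then show ?thesis by (simp add: polylog_eq_series polylog_series_0_right)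
  next
    case False
    have "(polylog (Suc n) has_field_derivative polylog_series n z / z) (at z)"
      by (rule has_field_derivative_transform_within_open[OF polylog_series_has_field_derivative[of z n] open_ball[of 0 1]])
         (use z False in \<open>auto simp: polylog_eq_series\<close>)
    then have "deriv (polylog (Suc n)) z = polylog_series n z / z" by (rule DERIV_imp_deriv)
    then show ?thesis using z False by (simp add: polylog_eq_series)
  qed
qed (use assms ball_subset_slit_plane open_slit_plane connected_slit_plane polylog_holomorphic in auto)

lemma Li_has_derivative_Re:
  assumes "x < 1" shows "(Li n has_real_derivative Re (deriv (polylog n) (of_real x))) (at x)"
proof -
  have "(polylog n has_field_derivative deriv (polylog n) (of_real x)) (at (of_real x))"
    by (rule holomorphic_derivI[OF polylog_holomorphic open_slit_plane of_real_slit_plane[OF assms]])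
  then have "((\<lambda>x. polylog n (of_real x)) has_vector_derivative deriv (polylog n) (of_real x)) (at x)"
    by (rule has_vector_derivative_real_field)
  then have "((\<lambda>x. Re (polylog n (of_real x))) has_vector_derivative Re (deriv (polylog n) (of_real x))) (at x)"
    by (rule bounded_linear.has_vector_derivative[OF bounded_linear_Re])
  then show ?thesis by (simp add: has_real_derivative_iff_has_vector_derivative Li_def[abs_def])
qed

lemma Li_isCont: "x < 1 \<Longrightarrow> isCont (Li n) x"
  using Li_has_derivative_Re DERIV_isCont by blast

lemma Li_deriv:
  assumes "x < 1" "x \<noteq> 0" shows "(Li (Suc n) has_real_derivative Li n x / x) (at x)"
proof -
  have "of_real x * deriv (polylog (Suc n)) (of_real x) = complex_of_real (Li n x)"
    using polylog_deriv_times[OF of_real_slit_plane[OF assms(1)], of n] polylog_of_real[OF assms(1), of n] by simp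
  then have "deriv (polylog (Suc n)) (of_real x) = complex_of_real (Li n x / x)" using assms by (simp add: field_simps)
  then show ?thesis using Li_has_derivative_Re[OF assms(1), of "Suc n"] by simp
qed

lemma Li_1: "x < 1 \<Longrightarrow> Li 1 x = - ln (1 - x)"
proof -
  assume x: "x < 1"
  have "polylog 1 (of_real x) = - Ln (complex_of_real (1 - x))" using polylog_1[OF of_real_slit_plane[OF x]] by simp
  then show ?thesis unfolding Li_def using x by (simp only: Ln_of_real[of "1 - x"]) (simp add: Ln_of_real del: of_real_diff)
qed

lemma Li_0_right: "Li n 0 = 0"
  by (simp add: Li_def polylog_eq_series polylog_series_0_right)

lemma Li_series:
  assumes "0 \<le> x" "x < 1" shows "Li n x = (\<Sum>k. x ^ Suc k / real (Suc k) ^ n)"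
proof -
  have n: "cmod (of_real x) < 1" using assms by simp
  have e: "(of_real x) ^ Suc k / of_nat (Suc k) ^ n = complex_of_real (x ^ Suc k / real (Suc k) ^ n)" for k
    by (simp del: power_Suc of_nat_Suc)
  have s: "summable (\<lambda>k. complex_of_real (x ^ Suc k / real (Suc k) ^ n))"
    using polylog_series_summable[OF n, of n] unfolding e .
  then have "summable (\<lambda>k. x ^ Suc k / real (Suc k) ^ n)" by (simp only: summable_complex_of_real)
  then have "polylog n (of_real x) = of_real (\<Sum>k. x ^ Suc k / real (Suc k) ^ n)"
    unfolding polylog_eq_series[OF n] polylog_series_def e by (simp only: suminf_of_real)
  then show ?thesis by (simp add: Li_def)
qed

text \<open>
  Abel's theorem in its elementary form: for order at least 2 the series converges uniformly up to the boundary.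
\<close>
lemma Li_tendsto_1:
  assumes "2 \<le> n" shows "(Li n \<longlongrightarrow> (\<Sum>k. 1 / real (Suc k) ^ n)) (at_left 1)"
proof -
  define h where "h x = (\<Sum>k. x ^ Suc k / real (Suc k) ^ n)" for x :: real
  have sm: "summable (\<lambda>k. 1 / real (Suc k) ^ n)"
  proof -
    have "summable (\<lambda>k. inverse (real (Suc k) ^ n))"
      using inverse_power_summable[OF assms, where ?'a = real] by (subst summable_Suc_iff) 
    then show ?thesis by (simp add: inverse_eq_divide)
  qed
  have "uniform_limit {0..1} (\<lambda>m x. \<Sum>k<m. x ^ Suc k / real (Suc k) ^ n) h sequentially"
    unfolding h_def
  proof (rule Weierstrass_m_test[OF _ sm])
    fix k and x :: real assume x: "x \<in> {0..1}"
    then have "x ^ Suc k \<le> 1" "0 \<le> x ^ Suc k" by (auto intro: power_le_one simp del: power_Suc)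
    then show "norm (x ^ Suc k / real (Suc k) ^ n) \<le> 1 / real (Suc k) ^ n"
      by (simp add: abs_divide divide_right_mono del: power_Suc)
  qed
  then have "continuous_on {0..1} h"
    by (rule uniform_limit_theorem[rotated]) (auto intro!: always_eventually continuous_intros)
  then have "(h \<longlongrightarrow> h 1) (at_left 1)" by (rule continuous_on_Icc_at_leftD) simp
  moreover have "h 1 = (\<Sum>k. 1 / real (Suc k) ^ n)" by (simp add: h_def)
  moreover have "eventually (\<lambda>x. h x = Li n x) (at_left 1)"
    unfolding eventually_at_left_field by (intro exI[of _ 0]) (auto simp: h_def Li_series)
  ultimately show ?thesis using Lim_transform_eventually by fastforce
qed

lemma Li2_tendsto_1: "(Li 2 \<longlongrightarrow> pi\<^sup>2 / 6) (at_left 1)"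
proof -
  have e: "(\<Sum>k. 1 / real (Suc k) ^ 2) = pi\<^sup>2 / 6"
    using inverse_squares_sums by (intro sums_unique[symmetric]) (simp add: add.commute)
  show ?thesis using Li_tendsto_1[of 2] unfolding e by simp
qed

lemma Li3_tendsto_1: "(Li 3 \<longlongrightarrow> Li3_one) (at_left 1)"
  using Li_tendsto_1[of 3] by (simp add: Li3_one_def)

text \<open>
  The common pattern of the polylogarithm identities: the difference of both sides has derivative zero, and a limit at one end point
  determines the constant.
\<close>
lemma zero_deriv_eq_limit:
  fixes f :: "real \<Rightarrow> real"
  assumes "\<And>x. a < x \<Longrightarrow> x < b \<Longrightarrow> (f has_real_derivative 0) (at x)"
    and "(f \<longlongrightarrow> L) (at_right a) \<or> (f \<longlongrightarrow> L) (at_left b)" and x: "a < x" "x < b"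
  shows "f x = L"
proof -
  have c: "f u = f x" if "a < u" "u < b" for u
    by (rule DERIV_isconst3[where a = a and b = b and f = f]) (use that x assms(1) in auto)
  from assms(2) show ?thesis
  proof
    assume "(f \<longlongrightarrow> L) (at_right a)"
    moreover have "eventually (\<lambda>u. f u = f x) (at_right a)"
      unfolding eventually_at_right_field using c less_trans[OF x] by blast
    ultimately have "((\<lambda>_. f x) \<longlongrightarrow> L) (at_right a)" by (rule Lim_transform_eventually)
    then show ?thesis by (simp add: tendsto_const_iff)
  next
    assume "(f \<longlongrightarrow> L) (at_left b)"
    moreover have "eventually (\<lambda>u. f u = f x) (at_left b)"
      unfolding eventually_at_left_field using c less_trans[OF x] by blast
    ultimately have "((\<lambda>_. f x) \<longlongrightarrow> L) (at_left b)" by (rule Lim_transform_eventually)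
    then show ?thesis by (simp add: tendsto_const_iff)
  qed
qed

lemma Li_chain:
  assumes "(U has_real_derivative D) (at x)" "U x < 1" "U x \<noteq> 0"
  shows "((\<lambda>x. Li (Suc n) (U x)) has_real_derivative Li n (U x) / U x * D) (at x)"
  by (rule DERIV_chain2[OF Li_deriv[OF assms(2,3)] assms(1)])

lemma Li2_chain:
  assumes "(U has_real_derivative D) (at x)" "U x < 1" "U x \<noteq> 0"
  shows "((\<lambda>x. Li 2 (U x)) has_real_derivative - ln (1 - U x) / U x * D) (at x)"
  using Li_chain[OF assms, of 1] Li_1[OF assms(2)] by (simp add: numeral_2_eq_2)

lemma Li3_chain:
  assumes "(U has_real_derivative D) (at x)" "U x < 1" "U x \<noteq> 0"
  shows "((\<lambda>x. Li 3 (U x)) has_real_derivative Li 2 (U x) / U x * D) (at x)"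
  using Li_chain[OF assms, of 2] by (simp add: numeral_3_eq_3 numeral_2_eq_2)

lemma d_one_minus_inverse: "0 < y \<Longrightarrow> ((\<lambda>y::real. 1 - 1 / y) has_real_derivative 1 / y\<^sup>2) (at y)"
  by (auto intro!: derivative_eq_intros simp: power2_eq_square)

lemma Li2_landen:
  assumes y: "0 < y" "y < 1" shows "Li 2 (1 - y) + Li 2 (1 - 1 / y) = - (ln y)\<^sup>2 / 2"
proof -
  define f where "f y = Li 2 (1 - y) + Li 2 (1 - 1 / y) + (ln y)\<^sup>2 / 2" for y
  have "f y = 0"
  proof (rule zero_deriv_eq_limit[where f = f and a = 0 and b = 1])
    fix y :: real assume y: "0 < y" "y < 1"
    have "(f has_real_derivative (- ln (1 - (1 - y)) / (1 - y) * (0 - 1) + - ln (1 - (1 - 1 / y)) / (1 - 1 / y) * (1 / y\<^sup>2)) + (2 * ln y / y) / 2) (at y)"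
      unfolding f_def[abs_def]
      by (intro DERIV_add Li2_chain DERIV_cdivide deriv_ln_sq d_one_minus_inverse DERIV_diff DERIV_const DERIV_ident) (use y in \<open>auto simp: field_simps\<close>)
    moreover have "(- ln (1 - (1 - y)) / (1 - y) * (0 - 1) + - ln (1 - (1 - 1 / y)) / (1 - 1 / y) * (1 / y\<^sup>2)) + (2 * ln y / y) / 2 = 0"
    proof -
      define A a b where "A = ln y" and "a = 1 / y" and "b = 1 / (1 - y)"
      have ab: "a * y = 1" "b * (1 - y) = 1" using y by (auto simp: a_def b_def)
      have "1 - 1 / y = - ((1 - y) * a)" using y by (simp add: a_def field_simps)
      moreover have "ln (1 - (1 - 1 / y)) = - A" using y by (simp add: A_def ln_div)
      ultimately have "(- ln (1 - (1 - y)) / (1 - y) * (0 - 1) + - ln (1 - (1 - 1 / y)) / (1 - 1 / y) * (1 / y\<^sup>2)) + (2 * ln y / y) / 2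
          = A * b - A * (b * y) * (a * a) + A * a"
        using y by (simp add: A_def a_def b_def power2_eq_square)
      also have "\<dots> = 0" using ab by algebra
      finally show ?thesis .
    qed
    ultimately show "(f has_real_derivative 0) (at y)" by simp
  next
    have "(f \<longlongrightarrow> Li 2 (1 - 1) + Li 2 (1 - 1 / 1) + (ln 1)\<^sup>2 / 2) (at_left 1)"
      unfolding f_def by (intro tendsto_intros isCont_tendsto_compose[OF Li_isCont]) auto
    then show "(f \<longlongrightarrow> 0) (at_right 0) \<or> (f \<longlongrightarrow> 0) (at_left 1)" by (simp add: Li_0_right)
  qed (use y in auto)
  then show ?thesis by (simp add: f_def)
qed

lemma Li2_reflection:
  assumes y: "0 < y" "y < 1" shows "Li 2 y + Li 2 (1 - y) = pi\<^sup>2 / 6 - ln y * ln (1 - y)"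
proof -
  define f where "f y = Li 2 y + Li 2 (1 - y) + ln y * ln (1 - y)" for y
  have "f y = pi\<^sup>2 / 6"
  proof (rule zero_deriv_eq_limit[where f = f and a = 0 and b = 1])
    fix y :: real assume y: "0 < y" "y < 1"
    have "(f has_real_derivative (- ln (1 - y) / y * 1 + - ln (1 - (1 - y)) / (1 - y) * (0 - 1)) + (1 / y * ln (1 - y) + - (1 / (1 - y)) * ln y)) (at y)"
      unfolding f_def[abs_def]
      by (intro DERIV_add Li2_chain DERIV_mult DERIV_ln_divide deriv_ln_one_minus DERIV_diff DERIV_const DERIV_ident) (use y in auto)
    then show "(f has_real_derivative 0) (at y)" by simp
  next
    have "((\<lambda>y. Li 2 (1 - y)) \<longlongrightarrow> pi\<^sup>2 / 6) (at_right 0)"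
    proof (rule filterlim_compose[OF Li2_tendsto_1])
      have "((\<lambda>y::real. 1 - y) \<longlongrightarrow> 1 - 0) (at_right 0)" by (intro tendsto_intros)
      then show "filterlim (\<lambda>y::real. 1 - y) (at_left 1) (at_right 0)"
        unfolding filterlim_at by (auto simp: eventually_at_filter)
    qed
    moreover have "((\<lambda>y::real. ln y * ln (1 - y)) \<longlongrightarrow> 0) (at_right 0)" by real_asymp
    moreover have "(Li 2 \<longlongrightarrow> Li 2 0) (at_right 0)"
      by (intro isCont_tendsto_compose[OF Li_isCont, where f = "\<lambda>x. x"] tendsto_ident_at) auto
    ultimately have "(f \<longlongrightarrow> Li 2 0 + pi\<^sup>2 / 6 + 0) (at_right 0)" unfolding f_def by (intro tendsto_add)
    then show "(f \<longlongrightarrow> pi\<^sup>2 / 6) (at_right 0) \<or> (f \<longlongrightarrow> pi\<^sup>2 / 6) (at_left 1)" by (simp add: Li_0_right)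
  qed (use y in auto)
  then show ?thesis by (simp add: f_def)
qed

lemma Li3_three_term:
  assumes y: "0 < y" "y < 1"
  shows "Li 3 y + Li 3 (1 - y) + Li 3 (1 - 1 / y) = Li3_one + (ln y) ^ 3 / 6 + pi\<^sup>2 / 6 * ln y - (ln y)\<^sup>2 * ln (1 - y) / 2"
proof -
  define f where "f y = Li 3 y + Li 3 (1 - y) + Li 3 (1 - 1 / y) - ((ln y) ^ 3 / 6 + pi\<^sup>2 / 6 * ln y - (ln y)\<^sup>2 * ln (1 - y) / 2)" for y
  have "f y = Li3_one"
  proof (rule zero_deriv_eq_limit[where f = f and a = 0 and b = 1])
    fix y :: real assume y: "0 < y" "y < 1"
    have d3: "((\<lambda>y. (ln y) ^ 3) has_real_derivative 3 * (ln y)\<^sup>2 * (1 / y)) (at y)"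
      using y by (auto intro!: derivative_eq_intros simp: power2_eq_square)
    have "(f has_real_derivative (Li 2 y / y * 1 + Li 2 (1 - y) / (1 - y) * (0 - 1) + Li 2 (1 - 1 / y) / (1 - 1 / y) * (1 / y\<^sup>2))
       - ((3 * (ln y)\<^sup>2 * (1 / y)) / 6 + pi\<^sup>2 / 6 * (1 / y) - (2 * ln y / y * ln (1 - y) + - (1 / (1 - y)) * (ln y)\<^sup>2) / 2)) (at y)"
      unfolding f_def[abs_def]
      by (intro DERIV_add DERIV_diff Li3_chain DERIV_mult DERIV_cmult DERIV_cdivide DERIV_ln_divide deriv_ln_one_minus deriv_ln_sq d3 DERIV_const DERIV_ident d_one_minus_inverse)
        (use y in \<open>auto simp: field_simps\<close>)
    moreover have "(Li 2 y / y * 1 + Li 2 (1 - y) / (1 - y) * (0 - 1) + Li 2 (1 - 1 / y) / (1 - 1 / y) * (1 / y\<^sup>2))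
       - ((3 * (ln y)\<^sup>2 * (1 / y)) / 6 + pi\<^sup>2 / 6 * (1 / y) - (2 * ln y / y * ln (1 - y) + - (1 / (1 - y)) * (ln y)\<^sup>2) / 2) = 0"
    proof -
      define A B a b u where "A = ln y" and "B = ln (1 - y)" and "a = 1 / y" and "b = 1 / (1 - y)" and "u = Li 2 (1 - y)"
      have ab: "a * y = 1" "b * (1 - y) = 1" using y by (auto simp: a_def b_def)
      have e: "1 - 1 / y = - ((1 - y) * a)" using y by (simp add: a_def field_simps)
      have l: "Li 2 (1 - 1 / y) = - A\<^sup>2 / 2 - u" using Li2_landen[OF y] by (simp add: A_def u_def)
      have t: "Li 2 (1 - 1 / y) / (1 - 1 / y) * (1 / y\<^sup>2) = (A\<^sup>2 / 2 + u) * (b * y) * (a * a)"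
      proof -
        have "(- A\<^sup>2 / 2 - u) / (- ((1 - y) * a)) = (A\<^sup>2 / 2 + u) * (b * y)"
          using y by (simp add: a_def b_def field_simps)
        moreover have "1 / y\<^sup>2 = a * a" by (simp add: a_def power2_eq_square)
        ultimately show ?thesis unfolding l unfolding e by (simp only:)
      qed
      have r: "Li 2 y = pi\<^sup>2 / 6 - A * B - u" using Li2_reflection[OF y] by (simp add: A_def B_def u_def)
      have div: "c / y = c * a" "c / (1 - y) = c * b" for c by (auto simp: a_def b_def)
      have "((pi\<^sup>2 / 6 - A * B - u) * a * 1 + u * b * (0 - 1) + (A\<^sup>2 / 2 + u) * (b * y) * (a * a))
        - ((3 * A\<^sup>2 * (1 * a)) / 6 + pi\<^sup>2 / 6 * (1 * a) - (2 * A * a * B + - (1 * b) * A\<^sup>2) / 2) = 0"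
      proof -
        have "b * y * (a * a) = a + b" using ab by algebra
        then have "(A\<^sup>2 / 2 + u) * (b * y) * (a * a) = (A\<^sup>2 / 2 + u) * (a + b)" by (simp only: mult.assoc)
        then show ?thesis by (simp add: algebra_simps diff_divide_distrib)
      qed
      then show ?thesis
        unfolding t unfolding r u_def[symmetric] A_def[symmetric] B_def[symmetric] unfolding div .
    qed
    ultimately show "(f has_real_derivative 0) (at y)" by simp
  next
    have l1: "((\<lambda>y::real. (ln y)\<^sup>2 * ln (1 - y) / 2) \<longlongrightarrow> 0) (at_left 1)" by real_asymp
    have "(f \<longlongrightarrow> Li3_one + Li 3 (1 - 1) + Li 3 (1 - 1 / 1) - ((ln 1) ^ 3 / 6 + pi\<^sup>2 / 6 * ln 1 - 0)) (at_left 1)"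
      unfolding f_def by (intro tendsto_add tendsto_diff Li3_tendsto_1 l1 isCont_tendsto_compose[OF Li_isCont] tendsto_intros) auto
    then show "(f \<longlongrightarrow> Li3_one) (at_right 0) \<or> (f \<longlongrightarrow> Li3_one) (at_left 1)" by (simp add: Li_0_right)
  qed (use y in auto)
  then show ?thesis by (simp add: f_def)
qed


lemma arguments_bounds:
  assumes "0 < x" "x < y" "y < (1::real)"
  shows "x / y < 1" "x * y < 1" "(1 - y) / (1 - x) < 1" "x * (1 - y) / (y * (1 - x)) < 1"
    "x * (1 - y) / (x - 1) < 1" "(1 - y) / (y * (x - 1)) < 1" "x * (1 - y)\<^sup>2 / (y * (1 - x)\<^sup>2) < 1"
proof -
  have p: "0 < y" "0 < 1 - x" using assms by auto
  show "x / y < 1" "(1 - y) / (1 - x) < 1" using p assms by (auto simp: divide_less_eq)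
  show xy: "x * y < 1" using assms mult_strict_mono[of x 1 y 1] by simp
  have yx: "0 < y * (1 - x)" "0 < y * (1 - x)\<^sup>2" using assms by auto
  show "x * (1 - y) / (y * (1 - x)) < 1" using yx assms by (simp add: divide_less_eq algebra_simps)
  show "x * (1 - y) / (x - 1) < 1"
    using assms by (intro less_trans[OF divide_pos_neg[of "x * (1 - y)" "x - 1"]]) auto
  show "(1 - y) / (y * (x - 1)) < 1"
    using assms by (intro less_trans[OF divide_pos_neg[of "1 - y" "y * (x - 1)"]]) (auto intro: mult_pos_neg)
  have "0 < (y - x) * (1 - x * y)" using assms xy by simp
  also have "\<dots> = y * (1 - x)\<^sup>2 - x * (1 - y)\<^sup>2" by algebra
  finally show "x * (1 - y)\<^sup>2 / (y * (1 - x)\<^sup>2) < 1" using yx by (simp add: divide_less_eq)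
qed

lemma
  assumes "0 < x" "x < y" "y < (1::real)"
  shows deriv_U3: "((\<lambda>x. x / y) has_real_derivative 1 / y) (at x)"
    and deriv_U4: "((\<lambda>x. (1 - y) / (1 - x)) has_real_derivative (1 - y) / (1 - x)\<^sup>2) (at x)"
    and deriv_U5: "((\<lambda>x. x * (1 - y) / (y * (1 - x))) has_real_derivative (1 - y) / (y * (1 - x)\<^sup>2)) (at x)"
    and deriv_U7: "((\<lambda>x. x * (1 - y) / (x - 1)) has_real_derivative - (1 - y) / (1 - x)\<^sup>2) (at x)"
    and deriv_U8: "((\<lambda>x. (1 - y) / (y * (x - 1))) has_real_derivative - (1 - y) / (y * (1 - x)\<^sup>2)) (at x)"
    and deriv_U9: "((\<lambda>x. x * (1 - y)\<^sup>2 / (y * (1 - x)\<^sup>2)) has_real_derivative (1 - y)\<^sup>2 * (1 + x) / (y * (1 - x) ^ 3)) (at x)"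
proof -
  have nz: "y \<noteq> 0" "1 - x \<noteq> 0" "x - 1 \<noteq> 0" "x \<noteq> 1" using assms by auto
  show "((\<lambda>x. x / y) has_real_derivative 1 / y) (at x)" using nz by (auto intro!: derivative_eq_intros)
  note q = deriv_quot1[OF assms(1) less_trans[OF assms(2,3)]] deriv_quot2[OF assms(1) less_trans[OF assms(2,3)]]
  have i: "((\<lambda>x. 1 / (1 - x)) has_real_derivative 1 / (1 - x)\<^sup>2) (at x)"
    using nz by (auto intro!: derivative_eq_intros simp: power2_eq_square)
  show "((\<lambda>x. (1 - y) / (1 - x)) has_real_derivative (1 - y) / (1 - x)\<^sup>2) (at x)"
    using DERIV_cmult[OF i, of "1 - y"] by simp
  have "(\<lambda>x. x * (1 - y) / (y * (1 - x))) = (\<lambda>x. (1 - y) / y * (x / (1 - x)))" by (simp add: fun_eq_iff)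
  then show "((\<lambda>x. x * (1 - y) / (y * (1 - x))) has_real_derivative (1 - y) / (y * (1 - x)\<^sup>2)) (at x)"
    using DERIV_cmult[OF q(1), of "(1 - y) / y"] by simp
  have m: "a / (x - 1) = - (a / (1 - x))" for a x :: real by (metis minus_diff_eq minus_divide_right)
  have "(\<lambda>x. x * (1 - y) / (x - 1)) = (\<lambda>x. - (1 - y) * (x / (1 - x)))" unfolding m by (rule ext, simp only: divide_inverse, algebra)
  then show "((\<lambda>x. x * (1 - y) / (x - 1)) has_real_derivative - (1 - y) / (1 - x)\<^sup>2) (at x)"
    using DERIV_cmult[OF q(1), of "- (1 - y)"] by simp
  have "(\<lambda>x. (1 - y) / (y * (x - 1))) = (\<lambda>x. - ((1 - y) / y) * (1 / (1 - x)))"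
    using m[of "(1 - y) / y"] by (simp add: fun_eq_iff)
  then show "((\<lambda>x. (1 - y) / (y * (x - 1))) has_real_derivative - (1 - y) / (y * (1 - x)\<^sup>2)) (at x)"
    using DERIV_cmult[OF i, of "- ((1 - y) / y)"] by (simp add: minus_divide_left)
  have "(\<lambda>x. x * (1 - y)\<^sup>2 / (y * (1 - x)\<^sup>2)) = (\<lambda>x. (1 - y)\<^sup>2 / y * (x / (1 - x)\<^sup>2))" by (simp add: fun_eq_iff)
  then show "((\<lambda>x. x * (1 - y)\<^sup>2 / (y * (1 - x)\<^sup>2)) has_real_derivative (1 - y)\<^sup>2 * (1 + x) / (y * (1 - x) ^ 3)) (at x)"
    using DERIV_cmult[OF q(2), of "(1 - y)\<^sup>2 / y"] by simp
qed

lemma log_derivatives: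
  assumes "0 < x" "x < y" "y < (1::real)"
  shows "c / x * 1 = c / x" "c / (x / y) * (1 / y) = c / x" "c / (x * y) * y = c / x"
    "c / ((1 - y) / (1 - x)) * ((1 - y) / (1 - x)\<^sup>2) = c / (1 - x)"
    "c / (x * (1 - y) / (y * (1 - x))) * ((1 - y) / (y * (1 - x)\<^sup>2)) = c / (x * (1 - x))"
    "c / (x * (1 - y) / (x - 1)) * (- (1 - y) / (1 - x)\<^sup>2) = c / (x * (1 - x))"
    "c / ((1 - y) / (y * (x - 1))) * (- (1 - y) / (y * (1 - x)\<^sup>2)) = c / (1 - x)"
    "c / (x * (1 - y)\<^sup>2 / (y * (1 - x)\<^sup>2)) * ((1 - y)\<^sup>2 * (1 + x) / (y * (1 - x) ^ 3)) = c * (1 + x) / (x * (1 - x))"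
proof -
  define u v where "u = 1 - x" and "v = 1 - y"
  have nz: "x \<noteq> 0" "y \<noteq> 0" "u \<noteq> 0" "v \<noteq> 0" and e: "x - 1 = - u" using assms by (auto simp: u_def v_def)
  show "c / x * 1 = c / x" "c / (x / y) * (1 / y) = c / x" "c / (x * y) * y = c / x" using nz by auto
  show "c / ((1 - y) / (1 - x)) * ((1 - y) / (1 - x)\<^sup>2) = c / (1 - x)"
    "c / (x * (1 - y) / (y * (1 - x))) * ((1 - y) / (y * (1 - x)\<^sup>2)) = c / (x * (1 - x))"
    "c / (x * (1 - y) / (x - 1)) * (- (1 - y) / (1 - x)\<^sup>2) = c / (x * (1 - x))"
    "c / ((1 - y) / (y * (x - 1))) * (- (1 - y) / (y * (1 - x)\<^sup>2)) = c / (1 - x)"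
    "c / (x * (1 - y)\<^sup>2 / (y * (1 - x)\<^sup>2)) * ((1 - y)\<^sup>2 * (1 + x) / (y * (1 - x) ^ 3)) = c * (1 + x) / (x * (1 - x))"
    unfolding e u_def[symmetric] v_def[symmetric] using nz by (simp_all add: power2_eq_square power3_eq_cube)
qed

lemma log_one_minus:
  assumes "0 < x" "x < y" "y < (1::real)"
  shows "ln (1 - x / y) = ln (y - x) - ln y"
    "ln (1 - (1 - y) / (1 - x)) = ln (y - x) - ln (1 - x)"
    "ln (1 - x * (1 - y) / (y * (1 - x))) = ln (y - x) - ln y - ln (1 - x)"
    "ln (1 - x * (1 - y) / (x - 1)) = ln (1 - x * y) - ln (1 - x)"
    "ln (1 - (1 - y) / (y * (x - 1))) = ln (1 - x * y) - ln y - ln (1 - x)"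
    "ln (1 - x * (1 - y)\<^sup>2 / (y * (1 - x)\<^sup>2)) = ln (y - x) + ln (1 - x * y) - ln y - 2 * ln (1 - x)"
proof -
  have p: "0 < y" "0 < 1 - x" "0 < y - x" "0 < 1 - x * y" using assms mult_strict_mono[of x 1 y 1] by auto
  have m: "a / (x - 1) = - (a / (1 - x))" for a :: real by (metis minus_diff_eq minus_divide_right)
  have e: "1 - x / y = (y - x) / y" "1 - (1 - y) / (1 - x) = (y - x) / (1 - x)"
    "1 - x * (1 - y) / (y * (1 - x)) = (y - x) / y / (1 - x)"
    "1 - x * (1 - y) / (x - 1) = (1 - x * y) / (1 - x)"
    using p unfolding m by (auto simp: field_simps)
  have "1 - (1 - y) / (y * (x - 1)) = 1 + (1 - y) / y / (1 - x)" using m[of "(1 - y) / y"] by simp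
  also have "\<dots> = (1 - x * y) / y / (1 - x)" using p by (simp add: field_simps)
  finally have e5: "1 - (1 - y) / (y * (x - 1)) = (1 - x * y) / y / (1 - x)" .
  have "1 - x * (1 - y)\<^sup>2 / (y * (1 - x)\<^sup>2) = (y * (1 - x)\<^sup>2 - x * (1 - y)\<^sup>2) / (y * (1 - x)\<^sup>2)"
    using p by (simp add: diff_divide_distrib)
  also have "y * (1 - x)\<^sup>2 - x * (1 - y)\<^sup>2 = (y - x) * (1 - x * y)" by algebra
  finally have e6: "1 - x * (1 - y)\<^sup>2 / (y * (1 - x)\<^sup>2) = (y - x) * (1 - x * y) / (y * (1 - x)\<^sup>2)" .
  show "ln (1 - x / y) = ln (y - x) - ln y"
    "ln (1 - (1 - y) / (1 - x)) = ln (y - x) - ln (1 - x)"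
    "ln (1 - x * (1 - y) / (y * (1 - x))) = ln (y - x) - ln y - ln (1 - x)"
    "ln (1 - x * (1 - y) / (x - 1)) = ln (1 - x * y) - ln (1 - x)"
    "ln (1 - (1 - y) / (y * (x - 1))) = ln (1 - x * y) - ln y - ln (1 - x)"
    "ln (1 - x * (1 - y)\<^sup>2 / (y * (1 - x)\<^sup>2)) = ln (y - x) + ln (1 - x * y) - ln y - 2 * ln (1 - x)"
    unfolding e e5 e6 using p by (auto simp: ln_div ln_mult ln_realpow)
qed

text \<open>
  Two dilogarithm identities that make the derivative of the Spence-Kummer relation vanish: after differentiation in \<open>x\<close> the terms
  group by the poles \<open>1/x\<close> and \<open>1/(1 - x)\<close>. Each identity holds because its own derivative is a combination of logarithms that
  cancels, and at \<open>x = 0\<close> it degenerates to Landen's identity.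
\<close>
lemma Li2_arguments:
  assumes xy: "0 < x" "x < y" "y < 1"
  shows "2 * Li 2 x - Li 2 (x / y) - Li 2 (x * y) + 2 * Li 2 (x * (1 - y) / (y * (1 - x)))
      + 2 * Li 2 (x * (1 - y) / (x - 1)) - Li 2 (x * (1 - y)\<^sup>2 / (y * (1 - x)\<^sup>2)) = 0" (is "?f x = 0")
    and "Li 2 ((1 - y) / (1 - x)) + Li 2 (x * (1 - y) / (y * (1 - x))) + Li 2 (x * (1 - y) / (x - 1))
      + Li 2 ((1 - y) / (y * (x - 1))) - Li 2 (x * (1 - y)\<^sup>2 / (y * (1 - x)\<^sup>2)) = - (ln y)\<^sup>2 / 2" (is "?g x = _")
proof -
  have d: "(?f has_real_derivative 2 * (- ln (1 - x) / x * 1) - - ln (1 - x / y) / (x / y) * (1 / y) - - ln (1 - x * y) / (x * y) * y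
       + 2 * (- ln (1 - x * (1 - y) / (y * (1 - x))) / (x * (1 - y) / (y * (1 - x))) * ((1 - y) / (y * (1 - x)\<^sup>2)))
       + 2 * (- ln (1 - x * (1 - y) / (x - 1)) / (x * (1 - y) / (x - 1)) * (- (1 - y) / (1 - x)\<^sup>2))
       - - ln (1 - x * (1 - y)\<^sup>2 / (y * (1 - x)\<^sup>2)) / (x * (1 - y)\<^sup>2 / (y * (1 - x)\<^sup>2)) * ((1 - y)\<^sup>2 * (1 + x) / (y * (1 - x) ^ 3))) (at x)"
    "(?g has_real_derivative - ln (1 - (1 - y) / (1 - x)) / ((1 - y) / (1 - x)) * ((1 - y) / (1 - x)\<^sup>2)
       + - ln (1 - x * (1 - y) / (y * (1 - x))) / (x * (1 - y) / (y * (1 - x))) * ((1 - y) / (y * (1 - x)\<^sup>2))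
       + - ln (1 - x * (1 - y) / (x - 1)) / (x * (1 - y) / (x - 1)) * (- (1 - y) / (1 - x)\<^sup>2)
       + - ln (1 - (1 - y) / (y * (x - 1))) / ((1 - y) / (y * (x - 1))) * (- (1 - y) / (y * (1 - x)\<^sup>2))
       - - ln (1 - x * (1 - y)\<^sup>2 / (y * (1 - x)\<^sup>2)) / (x * (1 - y)\<^sup>2 / (y * (1 - x)\<^sup>2)) * ((1 - y)\<^sup>2 * (1 + x) / (y * (1 - x) ^ 3))) (at x)"
    if xy: "0 < x" "x < y" for x
    by (intro DERIV_add DERIV_diff DERIV_cmult Li2_chain DERIV_ident deriv_U3 deriv_U4 deriv_U5 deriv_U7 deriv_U8 deriv_U9
        DERIV_cmult_right[OF DERIV_ident, where c = y, simplified] xy assms(3) arguments_bounds[OF xy assms(3)]; use xy assms(3) in simp)+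
  have d0: "(?f has_real_derivative 0) (at x)" "(?g has_real_derivative 0) (at x)" if xy: "0 < x" "x < y" for x
  proof -
    note L = log_derivatives[OF xy assms(3)] log_one_minus[OF xy assms(3)]
    define A B C D a b where "A = ln (1 - x)" and "B = ln (y - x)" and "C = ln (1 - x * y)" and "D = ln y" and "a = 1 / x" and "b = 1 / (1 - x)"
    have ab: "a * x = 1" "b * (1 - x) = 1" using xy assms(3) by (auto simp: a_def b_def)
    have div: "c / x = c * a" "c / (1 - x) = c * b" "c / (x * (1 - x)) = c * a * b" for c by (auto simp: a_def b_def)
    have "2 * (- A * a) - - (B - D) * a - - C * a + 2 * (- (B - D - A) * a * b) + 2 * (- (C - A) * a * b) - - (B + C - D - 2 * A) * (1 + x) * a * b = 0"
      using ab by algebra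
    then show "(?f has_real_derivative 0) (at x)"
      using d(1)[OF xy] unfolding L unfolding div A_def B_def C_def D_def by simp
    have "- (B - A) * b + - (B - D - A) * a * b + - (C - A) * a * b + - (C - D - A) * b - - (B + C - D - 2 * A) * (1 + x) * a * b = 0"
      using ab by algebra
    then show "(?g has_real_derivative 0) (at x)"
      using d(2)[OF xy] unfolding L unfolding div A_def B_def C_def D_def by simp
  qed
  have y: "y \<noteq> 0" "y < 1" "0 < y" using assms by auto
  have inv: "(1 - y) / (y * (0 - 1)) = 1 - 1 / y" using y by (simp add: field_simps)
  show "?f x = 0"
  proof (rule zero_deriv_eq_limit[where f = ?f and a = 0 and b = y])
    have "(?f \<longlongrightarrow> 2 * Li 2 0 - Li 2 (0 / y) - Li 2 (0 * y) + 2 * Li 2 (0 * (1 - y) / (y * (1 - 0)))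
      + 2 * Li 2 (0 * (1 - y) / (0 - 1)) - Li 2 (0 * (1 - y)\<^sup>2 / (y * (1 - 0)\<^sup>2))) (at_right 0)"
      by (intro tendsto_intros isCont_tendsto_compose[OF Li_isCont]) (use y in auto)
    then show "(?f \<longlongrightarrow> 0) (at_right 0) \<or> (?f \<longlongrightarrow> 0) (at_left y)" by (simp add: Li_0_right)
  qed (use d0 assms in auto)
  show "?g x = - (ln y)\<^sup>2 / 2"
  proof (rule zero_deriv_eq_limit[where f = ?g and a = 0 and b = y])
    have "(?g \<longlongrightarrow> Li 2 ((1 - y) / (1 - 0)) + Li 2 (0 * (1 - y) / (y * (1 - 0))) + Li 2 (0 * (1 - y) / (0 - 1))
      + Li 2 ((1 - y) / (y * (0 - 1))) - Li 2 (0 * (1 - y)\<^sup>2 / (y * (1 - 0)\<^sup>2))) (at_right 0)"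
      by (intro tendsto_intros isCont_tendsto_compose[OF Li_isCont]) (use y inv in auto)
    then show "(?g \<longlongrightarrow> - (ln y)\<^sup>2 / 2) (at_right 0) \<or> (?g \<longlongrightarrow> - (ln y)\<^sup>2 / 2) (at_left y)"
      using Li2_landen[OF y(3,2)] unfolding inv by (simp add: Li_0_right)
  qed (use d0 assms in auto)
qed

text \<open>
  Both sides have the same derivative in \<open>x\<close> by the dilogarithm identities, and as \<open>x\<close> tends to 0 the relation becomes the
  three-term relation for the trilogarithm.
\<close>
theorem spence_kummer:
  assumes xy: "0 < x" "x < y" "y < 1"
  shows "2 * Li 3 (U1 x y) + 2 * Li 3 (U2 x y) - Li 3 (U3 x y) + 2 * Li 3 (U4 x y) + 2 * Li 3 (U5 x y)
      - Li 3 (U6 x y) + 2 * Li 3 (U7 x y) + 2 * Li 3 (U8 x y) - Li 3 (U9 x y) = E3 x y"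
proof -
  define f where "f x = 2 * Li 3 x + 2 * Li 3 y - Li 3 (x / y) + 2 * Li 3 ((1 - y) / (1 - x)) + 2 * Li 3 (x * (1 - y) / (y * (1 - x)))
      - Li 3 (x * y) + 2 * Li 3 (x * (1 - y) / (x - 1)) + 2 * Li 3 ((1 - y) / (y * (x - 1))) - Li 3 (x * (1 - y)\<^sup>2 / (y * (1 - x)\<^sup>2))
      + (ln y)\<^sup>2 * (ln (1 - y) - ln (1 - x))" for x
  define L where "L = 2 * Li3_one + pi\<^sup>2 / 3 * ln y + 1 / 3 * (ln y) ^ 3"
  have y: "y \<noteq> 0" "y < 1" "0 < y" using assms by auto
  have "f x = L"
  proof (rule zero_deriv_eq_limit[where f = f and a = 0 and b = y])
    fix x assume xy: "0 < x" "x < y"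
    note L = log_derivatives[OF xy assms(3)]
    have d: "(f has_real_derivative 2 * (Li 2 x / x * 1) + 0 - Li 2 (x / y) / (x / y) * (1 / y)
       + 2 * (Li 2 ((1 - y) / (1 - x)) / ((1 - y) / (1 - x)) * ((1 - y) / (1 - x)\<^sup>2))
       + 2 * (Li 2 (x * (1 - y) / (y * (1 - x))) / (x * (1 - y) / (y * (1 - x))) * ((1 - y) / (y * (1 - x)\<^sup>2)))
       - Li 2 (x * y) / (x * y) * y
       + 2 * (Li 2 (x * (1 - y) / (x - 1)) / (x * (1 - y) / (x - 1)) * (- (1 - y) / (1 - x)\<^sup>2))
       + 2 * (Li 2 ((1 - y) / (y * (x - 1))) / ((1 - y) / (y * (x - 1))) * (- (1 - y) / (y * (1 - x)\<^sup>2)))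
       - Li 2 (x * (1 - y)\<^sup>2 / (y * (1 - x)\<^sup>2)) / (x * (1 - y)\<^sup>2 / (y * (1 - x)\<^sup>2)) * ((1 - y)\<^sup>2 * (1 + x) / (y * (1 - x) ^ 3))
       + (ln y)\<^sup>2 * (0 - - (1 / (1 - x)))) (at x)"
      unfolding f_def[abs_def]
      by (intro DERIV_add DERIV_diff DERIV_cmult Li3_chain DERIV_ident DERIV_const deriv_U3 deriv_U4 deriv_U5 deriv_U7 deriv_U8 deriv_U9
          deriv_ln_one_minus DERIV_cmult_right[OF DERIV_ident, where c = y, simplified] xy assms(3) arguments_bounds[OF xy assms(3)]; use xy assms(3) in simp)+
    define a b where "a = 1 / x" and "b = 1 / (1 - x)"
    have ab: "a * x = 1" "b * (1 - x) = 1" using xy assms(3) by (auto simp: a_def b_def)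
    have div: "c / x = c * a" "c / (1 - x) = c * b" "c / (x * (1 - x)) = c * a * b" for c by (auto simp: a_def b_def)
    define l1 l3 l4 l5 l6 l7 l8 l9 where "l1 = Li 2 x" and "l3 = Li 2 (x / y)" and "l4 = Li 2 ((1 - y) / (1 - x))" and "l5 = Li 2 (x * (1 - y) / (y * (1 - x)))"
      and "l6 = Li 2 (x * y)" and "l7 = Li 2 (x * (1 - y) / (x - 1))" and "l8 = Li 2 ((1 - y) / (y * (x - 1)))" and "l9 = Li 2 (x * (1 - y)\<^sup>2 / (y * (1 - x)\<^sup>2))"
    note defs = l1_def l3_def l4_def l5_def l6_def l7_def l8_def l9_def
    have id: "2 * l1 - l3 - l6 + 2 * l5 + 2 * l7 - l9 = 0" "l4 + l5 + l7 + l8 - l9 = - (ln y)\<^sup>2 / 2"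
      using Li2_arguments[OF xy assms(3)] unfolding defs by auto
    have "2 * (l1 * a) + 0 - l3 * a + 2 * (l4 * b) + 2 * (l5 * a * b) - l6 * a + 2 * (l7 * a * b) + 2 * (l8 * b) - l9 * (1 + x) * a * b + (ln y)\<^sup>2 * (0 - - (1 * b)) = 0"
      using ab id by algebra
    then show "(f has_real_derivative 0) (at x)"
      using d unfolding L unfolding defs[symmetric] unfolding div by simp
  next
    have inv: "(1 - y) / (y * (0 - 1)) = 1 - 1 / y" using y by (simp add: field_simps)
    have lim: "(f \<longlongrightarrow> 2 * Li 3 0 + 2 * Li 3 y - Li 3 (0 / y) + 2 * Li 3 ((1 - y) / (1 - 0)) + 2 * Li 3 (0 * (1 - y) / (y * (1 - 0)))
      - Li 3 (0 * y) + 2 * Li 3 (0 * (1 - y) / (0 - 1)) + 2 * Li 3 ((1 - y) / (y * (0 - 1))) - Li 3 (0 * (1 - y)\<^sup>2 / (y * (1 - 0)\<^sup>2))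
      + (ln y)\<^sup>2 * (ln (1 - y) - ln (1 - 0))) (at_right 0)"
      unfolding f_def by (intro tendsto_intros isCont_tendsto_compose[OF Li_isCont]) (use y inv in auto)
    have "2 * Li 3 0 + 2 * Li 3 y - Li 3 (0 / y) + 2 * Li 3 ((1 - y) / (1 - 0)) + 2 * Li 3 (0 * (1 - y) / (y * (1 - 0)))
      - Li 3 (0 * y) + 2 * Li 3 (0 * (1 - y) / (0 - 1)) + 2 * Li 3 ((1 - y) / (y * (0 - 1))) - Li 3 (0 * (1 - y)\<^sup>2 / (y * (1 - 0)\<^sup>2))
      + (ln y)\<^sup>2 * (ln (1 - y) - ln (1 - 0)) = 2 * (Li 3 y + Li 3 (1 - y) + Li 3 (1 - 1 / y)) + (ln y)\<^sup>2 * ln (1 - y)"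
      unfolding inv by (simp add: Li_0_right)
    also have "\<dots> = L" unfolding Li3_three_term[OF y(3,2)] L_def by (simp add: algebra_simps)
    finally show "(f \<longlongrightarrow> L) (at_right 0) \<or> (f \<longlongrightarrow> L) (at_left y)" using lim by simp
  qed (use assms in auto)
  moreover have "ln ((1 - y) / (1 - x)) = ln (1 - y) - ln (1 - x)" using assms by (simp add: ln_div)
  ultimately show ?thesis
    unfolding E3_def U1_def U2_def U3_def U4_def U5_def U6_def U7_def U8_def U9_def f_def L_def by simp
qed

definition L3r :: "real \<Rightarrow> real" where "L3r z = L3 (complex_of_real z)"

lemma L3r_eq:
  assumes "z < 1" "z \<noteq> 0"
  shows "L3r z = Li 3 z - ln \<bar>z\<bar> * Li 2 z - (ln \<bar>z\<bar>)\<^sup>2 * ln (1 - z) / 3"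
proof -
  have "L3r z = Re (complex_of_real (Li 3 z - ln \<bar>z\<bar> * Li 2 z + 1 / 3 * (ln \<bar>z\<bar>)\<^sup>2 * Li 1 z))"
    unfolding L3r_def L3_def using assms by (simp add: polylog_of_real)
  then show ?thesis using Li_1[OF assms(1)] by simp
qed

lemma L3r_deriv:
  assumes "z < 1" "z \<noteq> 0"
  shows "(L3r has_real_derivative P0 z / (3 * z)) (at z)"
proof -
  have dl: "((\<lambda>z. ln \<bar>z\<bar>) has_real_derivative 1 / z) (at z)"
  proof (cases "z > 0")
    case True
    show ?thesis
      by (rule has_field_derivative_transform_within_open[OF DERIV_ln_divide[OF True] open_greaterThan[of 0]]) (use True in auto)
  next
    case False
    then have "((\<lambda>z. ln (- z)) has_real_derivative 1 / z) (at z)" using assms by (auto intro!: derivative_eq_intros)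
    then show ?thesis
      by (rule has_field_derivative_transform_within_open[OF _ open_lessThan[of 0]]) (use False assms in auto)
  qed
  have d1: "((\<lambda>z. ln (1 - z)) has_real_derivative - (1 / (1 - z))) (at z)"
    using assms by (auto intro!: derivative_eq_intros)
  have dsq: "((\<lambda>z. (ln \<bar>z\<bar>)\<^sup>2) has_real_derivative 2 * ln \<bar>z\<bar> * (1 / z)) (at z)"
    using DERIV_power[OF dl, of 2] by simp
  have d: "((\<lambda>z. Li 3 z - ln \<bar>z\<bar> * Li 2 z - (ln \<bar>z\<bar>)\<^sup>2 * ln (1 - z) / 3) has_real_derivative
      Li 2 z / z * 1 - (1 / z * Li 2 z + - ln (1 - z) / z * 1 * ln \<bar>z\<bar>) - (2 * ln \<bar>z\<bar> * (1 / z) * ln (1 - z) + - (1 / (1 - z)) * (ln \<bar>z\<bar>)\<^sup>2) / 3) (at z)"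
    by (intro DERIV_diff DERIV_mult DERIV_cdivide dl dsq d1 Li3_chain Li2_chain DERIV_ident) (use assms in auto)
  also have "Li 2 z / z * 1 - (1 / z * Li 2 z + - ln (1 - z) / z * 1 * ln \<bar>z\<bar>) - (2 * ln \<bar>z\<bar> * (1 / z) * ln (1 - z) + - (1 / (1 - z)) * (ln \<bar>z\<bar>)\<^sup>2) / 3 = P0 z / (3 * z)"
    unfolding P0_def using assms by (simp add: field_simps)
  finally show ?thesis
    by (rule has_field_derivative_transform_within_open[where S = "{..<1} - {0}"]) (use assms in \<open>auto simp: L3r_eq\<close>)
qed

lemma Li_quotient_limit: "\<exists>c. ((\<lambda>z. Li n z / z) \<longlongrightarrow> c) (at 0)"
proof -
  have "(Li n has_real_derivative Re (deriv (polylog n) (of_real 0))) (at 0)" by (rule Li_has_derivative_Re) simp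
  then show ?thesis unfolding has_field_derivative_iff by (auto simp: Li_0_right)
qed

lemma L3r_isCont_0: "isCont L3r 0"
proof -
  obtain c where c: "((\<lambda>z. Li 2 z / z) \<longlongrightarrow> c) (at 0)" using Li_quotient_limit by blast
  have zl: "((\<lambda>z::real. z * ln \<bar>z\<bar>) \<longlongrightarrow> 0) (at 0)"
    by (rule filterlim_split_at_real) real_asymp+
  have zl2: "((\<lambda>z::real. (ln \<bar>z\<bar>)\<^sup>2 * ln (1 - z) / 3) \<longlongrightarrow> 0) (at 0)"
    by (rule filterlim_split_at_real) real_asymp+
  have "(Li 3 \<longlongrightarrow> Li 3 0) (at 0)" using Li_isCont[of 0 3] by (simp add: isCont_def)
  then have "((\<lambda>z. Li 3 z - z * ln \<bar>z\<bar> * (Li 2 z / z) - (ln \<bar>z\<bar>)\<^sup>2 * ln (1 - z) / 3) \<longlongrightarrow> Li 3 0 - 0 * c - 0) (at 0)"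
    by (intro tendsto_diff tendsto_mult zl c zl2)
  then have "((\<lambda>z. Li 3 z - z * ln \<bar>z\<bar> * (Li 2 z / z) - (ln \<bar>z\<bar>)\<^sup>2 * ln (1 - z) / 3) \<longlongrightarrow> L3r 0) (at 0)"
    by (simp add: Li_0_right L3r_def L3_def)
  then show ?thesis unfolding isCont_def
  proof (rule Lim_transform_eventually)
    show "eventually (\<lambda>z. Li 3 z - z * ln \<bar>z\<bar> * (Li 2 z / z) - (ln \<bar>z\<bar>)\<^sup>2 * ln (1 - z) / 3 = L3r z) (at 0)"
      unfolding eventually_at by (intro exI[of _ 1]) (auto simp: L3r_eq dist_real_def)
  qed
qed

text \<open>
  The logarithmic correction terms of L3 are exactly those that cancel the right-hand side of Li3_three_term, by Landen's identity and
  Euler's reflection for the dilogarithm.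
\<close>
lemma L3r_three_term:
  assumes y: "0 < y" "y < 1"
  shows "L3r y + L3r (1 - y) + L3r (1 - 1 / y) = Li3_one"
proof -
  define A B u where "A = ln y" and "B = ln (1 - y)" and "u = Li 2 (1 - y)"
  have ab: "\<bar>1 - 1 / y\<bar> = (1 - y) / y" "1 - (1 - 1 / y) = 1 / y" "1 - 1 / y < 1" "1 - 1 / y \<noteq> 0" using y by (auto simp: field_simps abs_if)
  have l: "Li 2 (1 - 1 / y) = - A\<^sup>2 / 2 - u" using Li2_landen[OF y] by (simp add: A_def u_def)
  have r: "Li 2 y = pi\<^sup>2 / 6 - A * B - u" using Li2_reflection[OF y] by (simp add: A_def B_def u_def)
  have "L3r (1 - 1 / y) = Li 3 (1 - 1 / y) - (B - A) * (- A\<^sup>2 / 2 - u) - (B - A)\<^sup>2 * (- A) / 3"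
    unfolding L3r_eq[OF ab(3,4)] ab(1,2) l using y by (simp add: ln_div A_def B_def)
  moreover have "L3r y = Li 3 y - A * (pi\<^sup>2 / 6 - A * B - u) - A\<^sup>2 * B / 3"
    using y by (simp add: L3r_eq[of y] r) (simp add: A_def B_def)
  moreover have "L3r (1 - y) = Li 3 (1 - y) - B * u - B\<^sup>2 * A / 3"
    using y by (simp add: L3r_eq A_def B_def u_def)
  moreover note Li3_three_term[OF y, folded A_def B_def]
  ultimately show ?thesis by (simp add: field_simps power2_eq_square power3_eq_cube)
qed

lemma L3r_steep: "((\<lambda>z. L3r z / (z * (ln z)\<^sup>2)) \<longlongrightarrow> 1 / 3) (at_right 0)"
proof -
  obtain c2 c3 where c: "((\<lambda>z. Li 2 z / z) \<longlongrightarrow> c2) (at 0)" "((\<lambda>z. Li 3 z / z) \<longlongrightarrow> c3) (at 0)" using Li_quotient_limit by metis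
  have c': "((\<lambda>z. Li 2 z / z) \<longlongrightarrow> c2) (at_right 0)" "((\<lambda>z. Li 3 z / z) \<longlongrightarrow> c3) (at_right 0)"
    by (rule tendsto_within_subset[OF c(1)], simp) (rule tendsto_within_subset[OF c(2)], simp)
  have l: "((\<lambda>z::real. 1 / ln z) \<longlongrightarrow> 0) (at_right 0)" "((\<lambda>z::real. ln (1 - z) / z) \<longlongrightarrow> - 1) (at_right 0)" by real_asymp+
  have "((\<lambda>z. Li 3 z / z * (1 / ln z)\<^sup>2 - Li 2 z / z * (1 / ln z) - ln (1 - z) / z / 3) \<longlongrightarrow> c3 * 0\<^sup>2 - c2 * 0 - (- 1) / 3) (at_right 0)"
    by (intro tendsto_intros c' l) auto
  then have "((\<lambda>z. Li 3 z / z * (1 / ln z)\<^sup>2 - Li 2 z / z * (1 / ln z) - ln (1 - z) / z / 3) \<longlongrightarrow> 1 / 3) (at_right 0)" by simp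
  then show ?thesis
  proof (rule Lim_transform_eventually)
    show "eventually (\<lambda>z. Li 3 z / z * (1 / ln z)\<^sup>2 - Li 2 z / z * (1 / ln z) - ln (1 - z) / z / 3 = L3r z / (z * (ln z)\<^sup>2)) (at_right 0)"
      unfolding eventually_at_right_field
      by (intro exI[of _ 1]) (auto simp: L3r_eq field_simps power2_eq_square)
  qed
qed

section \<open>Localisation, composition and smoothing estimates\<close>

lemma big_O_integral:
  fixes g :: "real \<Rightarrow> real \<Rightarrow> real"
  assumes g: "g \<in> big_O Z {a..b} \<beta>" and c: "continuous_on (Z \<times> {a..b}) (\<lambda>(z, s). g z s)" and ab: "a \<le> b"
  shows "(\<lambda>z _. integral {a..b} (g z)) \<in> big_O Z {0} \<beta>"
proof -
  obtain C where C: "\<forall>z\<in>Z. \<forall>s\<in>{a..b}. \<bar>g z s\<bar> \<le> C * \<beta> z" using g unfolding big_O_def by blast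
  show ?thesis
  proof (rule ObI[where C = "C * (b - a)"])
    fix z assume z: "z \<in> Z"
    have "continuous_on {a..b} (\<lambda>s. (\<lambda>(z, s). g z s) (z, s))"
      by (rule continuous_on_compose2[OF c]) (use z in \<open>auto intro!: continuous_intros\<close>)
    then have "norm (integral {a..b} (g z)) \<le> (C * \<beta> z) * (b - a)"
      using C z ab by (intro integral_bound) auto
    then show "\<bar>integral {a..b} (g z)\<bar> \<le> C * (b - a) * \<beta> z" by (simp add: mult_ac)
  qed
qed

definition log_deriv :: "(real \<Rightarrow> real) \<Rightarrow> real \<Rightarrow> real" where "log_deriv f z = z * deriv f z"

lemma log_smooth_0_iff_isCont:
  assumes "open Z"
  shows "log_smooth 0 Z {0} UNIV (\<lambda>z _. f z) \<longleftrightarrow> (\<forall>z\<in>Z. isCont f z)"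
proof -
  have "continuous_on Z f" if "continuous_on (Z \<times> {0::real}) (\<lambda>x. f (fst x))"
  proof -
    have "continuous_on Z (\<lambda>z. (\<lambda>x. f (fst x)) (z, 0::real))"
      by (rule continuous_on_compose2[OF that]) (auto intro!: continuous_intros)
    then show ?thesis by simp
  qed
  moreover have "continuous_on (Z \<times> {0::real}) (\<lambda>x. f (fst x))" if "continuous_on Z f"
    by (rule continuous_on_compose2[OF that]) (auto intro!: continuous_intros)
  ultimately show ?thesis by (auto simp: split_def continuous_on_eq_continuous_at[OF assms, symmetric])
qed

lemma log_smooth_zd:
  assumes "log_smooth (Suc k) Z {0} W (\<lambda>z _. f z)" "linear_class Z {0} W" "open Z" "0 \<notin> Z"
  shows "log_smooth k Z {0} W (\<lambda>z _. log_deriv f z)"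
    and "\<And>z. z \<in> Z \<Longrightarrow> (f has_real_derivative log_deriv f z / z) (at z)"
proof -
  from log_smooth_Suc_ex[OF assms(1)] obtain f' where f': "\<forall>z\<in>Z. \<forall>s\<in>{0}. (f has_real_derivative f' z s / z) (at z)"
    "log_smooth k Z {0} W f'" by (elim exE conjE) (rule that)
  have e: "log_deriv f z = f' z 0" if "z \<in> Z" for z
  proof -
    have "deriv f z = f' z 0 / z" using f'(1) that by (intro DERIV_imp_deriv) auto
    moreover have "z \<noteq> 0" using that assms(4) by auto
    ultimately show ?thesis by (simp add: log_deriv_def)
  qed
  show "log_smooth k Z {0} W (\<lambda>z _. log_deriv f z)" by (rule log_smooth_cong[OF f'(2) assms(2,3)]) (use e in auto)
  show "(f has_real_derivative log_deriv f z / z) (at z)" if "z \<in> Z" for z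
    using f'(1) that e by auto
qed

lemma log_smooth_zdI:
  assumes "log_smooth k Z {0} W (\<lambda>z _. log_deriv f z)" "log_smooth 0 Z {0} W (\<lambda>z _. f z)"
    "\<And>z. z \<in> Z \<Longrightarrow> (f has_real_derivative log_deriv f z / z) (at z)"
  shows "log_smooth (Suc k) Z {0} W (\<lambda>z _. f z)"
  by (rule log_smooth_SucI[where f' = "\<lambda>z _. log_deriv f z"]) (use assms log_smooth_base[OF assms(2)] in auto)

lemma log_smooth_zd_funpow:
  assumes "log_smooth (j + k) Z {0} W (\<lambda>z _. f z)" "linear_class Z {0} W" "open Z" "0 \<notin> Z"
  shows "log_smooth k Z {0} W (\<lambda>z _. (log_deriv ^^ j) f z)"
  using assms(1)
proof (induction j arbitrary: k)
  case 0 then show ?case by simp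
next
  case (Suc j)
  have "log_smooth (Suc k) Z {0} W (\<lambda>z _. (log_deriv ^^ j) f z)" by (rule Suc.IH) (use Suc.prems in simp)
  from log_smooth_zd(1)[OF this assms(2-4)] show ?case by simp
qed

text \<open>
  The canonical choice \<open>log_deriv f\<close> of the derivative makes locally found derivatives agree on overlaps.
\<close>
lemma log_smooth_local:
  assumes "open U" "0 \<notin> U"
    and "\<And>z. z \<in> U \<Longrightarrow> \<exists>Z. open Z \<and> z \<in> Z \<and> log_smooth k Z {0} UNIV (\<lambda>z _. f z)"
  shows "log_smooth k U {0} UNIV (\<lambda>z _. f z)"
  using assms(3)
proof (induction k arbitrary: f)
  case 0
  have "isCont f z" if "z \<in> U" for z
    using 0[OF that] log_smooth_0_iff_isCont by blast
  then show ?case using log_smooth_0_iff_isCont[OF assms(1)] by blast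
next
  case (Suc k)
  have loc: "\<exists>Z. open Z \<and> z \<in> Z \<and> 0 \<notin> Z \<and> log_smooth (Suc k) Z {0} UNIV (\<lambda>z _. f z)" if z: "z \<in> U" for z
  proof -
    obtain Z where Z: "open Z" "z \<in> Z" "log_smooth (Suc k) Z {0} UNIV (\<lambda>z _. f z)" using Suc.prems[OF z] by (elim exE conjE) (rule that)
    have "log_smooth (Suc k) (Z \<inter> U) {0} UNIV (\<lambda>z _. f z)" by (rule log_smooth_mono_set[OF Z(3)]) auto
    then show ?thesis using Z assms z by (intro exI[of _ "Z \<inter> U"]) (auto simp del: log_smooth.simps)
  qed
  have d: "(f has_real_derivative log_deriv f z / z) (at z)" if zU: "z \<in> U" for z
  proof -
    obtain Z where Z: "open Z" "z \<in> Z" "0 \<notin> Z" "log_smooth (Suc k) Z {0} UNIV (\<lambda>z _. f z)" using loc[OF zU] by (elim exE conjE) (rule that)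
    show ?thesis by (rule log_smooth_zd(2)[OF Z(4) linear_class_UNIV Z(1,3,2)])
  qed
  show ?case
  proof (rule log_smooth_zdI[OF _ _ d])
    show "log_smooth k U {0} UNIV (\<lambda>z _. log_deriv f z)"
    proof (rule Suc.IH)
      fix z assume zU: "z \<in> U"
      obtain Z where Z: "open Z" "z \<in> Z" "0 \<notin> Z" "log_smooth (Suc k) Z {0} UNIV (\<lambda>z _. f z)" using loc[OF zU] by (elim exE conjE) (rule that)
      show "\<exists>Z. open Z \<and> z \<in> Z \<and> log_smooth k Z {0} UNIV (\<lambda>z _. log_deriv f z)"
        by (intro exI[of _ Z] conjI Z(1,2) log_smooth_zd(1)[OF Z(4) linear_class_UNIV Z(1,3)])
    qed
    show "log_smooth 0 U {0} UNIV (\<lambda>z _. f z)"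
      unfolding log_smooth_0_iff_isCont[OF assms(1)] using d DERIV_isCont by blast
  qed
qed

lemma log_smooth_compose1:
  assumes "log_smooth k Y {0} WY (\<lambda>v _. g v)" "0 \<notin> Y"
    and phi: "\<And>z. z \<in> Z \<Longrightarrow> \<phi> z \<in> Y"
      "\<And>z. z \<in> Z \<Longrightarrow> (\<phi> has_real_derivative \<phi> z * \<mu> z / z) (at z)"
    and mu: "log_smooth k Z {0} W1 (\<lambda>z _. \<mu> z)" and W: "linear_class Z {0} W"
      "\<And>g. g \<in> WY \<Longrightarrow> (\<lambda>z s. g (\<phi> z) 0) \<in> W"
      "\<And>f m. f \<in> W \<Longrightarrow> m \<in> W1 \<Longrightarrow> (\<lambda>z s. f z s * m z s) \<in> W"
  shows "log_smooth k Z {0} W (\<lambda>z _. g (\<phi> z))"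
proof -
  have "continuous_on Z \<phi>"
    using phi(2) DERIV_isCont by (intro continuous_at_imp_continuous_on) blast
  then have c: "continuous_on (Z \<times> {0}) (\<lambda>(z, s). \<phi> z)"
    unfolding split_def by (rule continuous_on_compose2) (auto intro!: continuous_intros)
  show ?thesis
    by (rule log_smooth_compose[where k = k and Y = Y and WY = WY and g = g and Z = Z and S = "{0}" and W = W and ?W1.0 = W1
      and \<phi> = "\<lambda>z _. \<phi> z" and \<mu> = "\<lambda>z _. \<mu> z"]) (assumption | rule assms c)+
qed

lemma log_smooth_bounded_on_compact:
  assumes "log_smooth k U {0} UNIV g" "compact K" "K \<subseteq> U" "Y \<subseteq> K"
  shows "log_smooth k Y {0} (big_O Y {0} (\<lambda>_. 1)) g"
  using assms(1)
proof (induction k arbitrary: g)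
  have W: "g \<in> big_O Y {0} (\<lambda>_. 1)" if "continuous_on (U \<times> {0}) (\<lambda>(z, s). g z s)" for g :: "real \<Rightarrow> real \<Rightarrow> real"
  proof -
    have "compact ((\<lambda>(z, s). g z s) ` (K \<times> {0}))"
      by (rule compact_continuous_image[OF continuous_on_subset[OF that]]) (use assms in \<open>auto intro: compact_Times\<close>)
    then obtain M where "\<forall>x\<in>(\<lambda>(z, s). g z s) ` (K \<times> {0}). norm x \<le> M" using compact_imp_bounded bounded_iff by metis
    then show ?thesis using assms(4) by (intro ObI[where C = M]) auto
  qed
  {
    case 0
    then show ?case using W assms by (auto intro: continuous_on_subset)
  next
    case (Suc k)
    from log_smooth_Suc_ex[OF Suc.prems] obtain g' where g': "\<forall>z\<in>U. \<forall>s\<in>{0}. ((\<lambda>z. g z s) has_real_derivative g' z s / z) (at z)"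
      "log_smooth k U {0} UNIV g'" "continuous_on (U \<times> {0}) (\<lambda>(z, s). g z s)" by (elim exE conjE) (rule that)
    show ?case
      by (rule log_smooth_SucI[OF continuous_on_subset[OF g'(3)] W[OF g'(3)] g'(1)[rule_format] Suc.IH[OF g'(2)]]) (use assms in auto)
  }
qed

text \<open>
  Subtracting the value at the limit point \<open>\<phi>0 s\<close> turns a composition with bounded arguments into a function of order \<open>z\<close>: the
  function itself by the mean value theorem, its derivatives because the logarithmic derivative \<open>\<mu>\<close> of \<open>\<phi>\<close> is of order \<open>z\<close>.
\<close>
lemma log_smooth_difference:
  assumes g: "log_smooth (Suc k) U {0} UNIV (\<lambda>v _. g v)" and U: "open U" "0 \<notin> U" "{k1..k2} \<subseteq> U"
    and Z: "open Z" "Z \<subseteq> {0<..<1}"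
    and phi: "\<And>z s. z \<in> Z \<Longrightarrow> s \<in> S \<Longrightarrow> \<phi> z s \<in> {k1<..<k2}"
      "\<And>s. s \<in> S \<Longrightarrow> \<phi>0 s \<in> {k1<..<k2}"
      "\<And>z s. z \<in> Z \<Longrightarrow> s \<in> S \<Longrightarrow> \<bar>\<phi> z s - \<phi>0 s\<bar> \<le> C * z"
      "continuous_on (Z \<times> S) (\<lambda>(z, s). \<phi> z s)" "continuous_on S \<phi>0"
      "\<And>z s. z \<in> Z \<Longrightarrow> s \<in> S \<Longrightarrow> ((\<lambda>z. \<phi> z s) has_real_derivative \<phi> z s * \<mu> z s / z) (at z)"
    and mu: "log_smooth k Z S (big_O Z S (\<lambda>z. z)) \<mu>"
  shows "log_smooth (Suc k) Z S (big_O Z S (\<lambda>z. z)) (\<lambda>z s. g (\<phi> z s) - g (\<phi>0 s))"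
proof -
  have dg: "(g has_real_derivative log_deriv g v / v) (at v)" if "v \<in> U" for v by (rule log_smooth_zd(2)[OF g linear_class_UNIV U(1,2) that])
  have U': "{k1<..<k2} \<subseteq> U" "0 \<notin> {k1<..<k2}" using U greaterThanLessThan_subseteq_atLeastAtMost_iff[of k1 k2 k1 k2] by blast+
  have bd: "log_smooth k {k1<..<k2} {0} (big_O {k1<..<k2} {0} (\<lambda>_. 1)) (\<lambda>v _. log_deriv g v)"
    by (rule log_smooth_bounded_on_compact[OF log_smooth_zd(1)[OF g linear_class_UNIV U(1,2)] compact_Icc U(3)]) auto
  have "\<exists>L. \<forall>u\<in>{k1..k2}. \<forall>v\<in>{k1..k2}. \<bar>g u - g v\<bar> \<le> L * \<bar>u - v\<bar>"
  proof -
    have "log_smooth k U {0} UNIV (\<lambda>v _. log_deriv g v)" by (rule log_smooth_zd(1)[OF g linear_class_UNIV U(1,2)])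
    then have "log_smooth 0 U {0} UNIV (\<lambda>v _. log_deriv g v)" by (rule log_smooth_le) simp
    then have "continuous_on {k1..k2} (\<lambda>v. log_deriv g v / v)"
      unfolding log_smooth_0_iff_isCont[OF U(1)] using U by (intro continuous_at_imp_continuous_on ballI continuous_intros) auto
    then have "bounded ((\<lambda>v. log_deriv g v / v) ` {k1..k2})" by (intro compact_imp_bounded compact_continuous_image) auto
    then obtain L where L: "\<forall>v\<in>{k1..k2}. \<bar>log_deriv g v / v\<bar> \<le> L" unfolding bounded_iff by auto
    have "norm (g u - g v) \<le> L * norm (u - v)" if "u \<in> {k1..k2}" "v \<in> {k1..k2}" for u v
      by (rule field_differentiable_bound[OF convex_real_interval(5) _ _ that(1,2), where f' = "\<lambda>v. log_deriv g v / v"])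
        (use L in \<open>auto intro!: has_field_derivative_at_within[OF dg] subsetD[OF U(3)]\<close>)
    then show ?thesis by (intro exI[of _ L]) auto
  qed
  then obtain L where L: "\<bar>g u - g v\<bar> \<le> L * \<bar>u - v\<bar>" if "u \<in> {k1..k2}" "v \<in> {k1..k2}" for u v by blast
  show ?thesis
  proof (rule log_smooth_SucI[where f' = "\<lambda>z s. log_deriv g (\<phi> z s) * \<mu> z s"])
    have gc: "isCont g v" if "v \<in> {k1<..<k2}" for v using dg U' that DERIV_isCont by blast
    then have gc: "continuous_on {k1<..<k2} g" by (intro continuous_at_imp_continuous_on) auto
    have "continuous_on (Z \<times> S) (\<lambda>x. g (case x of (z, s) \<Rightarrow> \<phi> z s))" by (rule continuous_on_compose2[OF gc phi(4)]) (use phi in auto)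
    moreover have "continuous_on (Z \<times> S) (\<lambda>x. g (\<phi>0 (snd x)))"
      by (rule continuous_on_compose2[OF gc continuous_on_compose2[OF phi(5)]]) (use phi in \<open>auto intro!: continuous_intros\<close>)
    ultimately show "continuous_on (Z \<times> S) (\<lambda>(z, s). g (\<phi> z s) - g (\<phi>0 s))"
      using continuous_on_diff by (fastforce simp: split_def)
    show "(\<lambda>z s. g (\<phi> z s) - g (\<phi>0 s)) \<in> big_O Z S (\<lambda>z. z)"
    proof (rule ObI[where C = "\<bar>L\<bar> * C"])
      fix z s assume zs: "z \<in> Z" "s \<in> S"
      have "\<bar>g (\<phi> z s) - g (\<phi>0 s)\<bar> \<le> L * \<bar>\<phi> z s - \<phi>0 s\<bar>" using phi(1)[OF zs] phi(2)[OF zs(2)] by (intro L) auto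
      also have "\<dots> \<le> \<bar>L\<bar> * \<bar>\<phi> z s - \<phi>0 s\<bar>" by (rule mult_right_mono) auto
      also have "\<dots> \<le> \<bar>L\<bar> * (C * z)" by (rule mult_left_mono[OF phi(3)[OF zs]]) simp
      finally show "\<bar>g (\<phi> z s) - g (\<phi>0 s)\<bar> \<le> \<bar>L\<bar> * C * z" by (simp add: mult.assoc)
    qed
    show "((\<lambda>z. g (\<phi> z s) - g (\<phi>0 s)) has_real_derivative log_deriv g (\<phi> z s) * \<mu> z s / z) (at z)" if zs: "z \<in> Z" "s \<in> S" for z s
    proof -
      have m: "\<phi> z s \<in> U" "\<phi> z s \<noteq> 0" using phi(1)[OF zs] U' by (blast, metis)
      show ?thesis
        using DERIV_diff[OF DERIV_chain2[OF dg[OF m(1)] phi(6)[OF zs]] DERIV_const] m(2) by (simp add: field_simps)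
    qed
    show "log_smooth k Z S (big_O Z S (\<lambda>z. z)) (\<lambda>z s. log_deriv g (\<phi> z s) * \<mu> z s)"
    proof (rule log_smooth_mult[OF _ mu linear_class_Ob])
      have le: "big_O Z S (\<lambda>z. z) \<subseteq> big_O Z S (\<lambda>_. 1)"
        using Z(2) by (intro subsetI, elim big_O_mono[where K = 1]) auto
      have mu1: "log_smooth k Z S (big_O Z S (\<lambda>_. 1)) \<mu>" by (rule log_smooth_mono_set[OF mu _ _ le]) auto
      show "log_smooth k Z S (big_O Z S (\<lambda>_. 1)) (\<lambda>z s. log_deriv g (\<phi> z s))"
      proof (rule log_smooth_compose[OF bd U'(2) phi(1,4,6) mu1 linear_class_Ob])
        show "(\<lambda>z s. f (\<phi> z s) 0) \<in> big_O Z S (\<lambda>_. 1)" if "f \<in> big_O {k1<..<k2} {0} (\<lambda>_. 1)" for f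
        proof -
          obtain M where "\<forall>v\<in>{k1<..<k2}. \<forall>s\<in>{0}. \<bar>f v s\<bar> \<le> M * 1" using \<open>f \<in> _\<close> unfolding big_O_def by blast
          then show ?thesis using phi(1) by (intro ObI[where C = M]) auto
        qed
        show "(\<lambda>z s. f z s * m z s) \<in> big_O Z S (\<lambda>_. 1)" if "f \<in> big_O Z S (\<lambda>_. 1)" "m \<in> big_O Z S (\<lambda>_. 1)" for f m
          using big_O_mult[OF that] by simp
      qed
      show "(\<lambda>z s. f z s * m z s) \<in> big_O Z S (\<lambda>z. z)" if "f \<in> big_O Z S (\<lambda>_. 1)" "m \<in> big_O Z S (\<lambda>z. z)" for f m
        using big_O_mult[OF that] by simp
    qed
  qed
qed


lemma log_smooth_inverse_id:
  assumes "0 \<notin> Z" "(\<lambda>z s. 1 / z) \<in> W" "linear_class Z S W"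
  shows "log_smooth k Z S W (\<lambda>z s. 1 / z)"
proof (induction k)
  case 0 then show ?case using assms by (auto simp: split_def intro!: continuous_intros)
next
  case (Suc k)
  show ?case
  proof (rule log_smooth_SucI[OF _ assms(2) _ log_smooth_scale[OF Suc.IH assms(3), of "-1"]])
    show "continuous_on (Z \<times> S) (\<lambda>(z, s). 1 / z)" using assms(1) by (auto simp: split_def intro!: continuous_intros)
    show "((\<lambda>z. 1 / z) has_real_derivative - 1 * (1 / z) / z) (at z)" if "z \<in> Z" for z
    proof -
      have "z \<noteq> 0" using that assms(1) by auto
      then show ?thesis by (auto intro!: derivative_eq_intros simp: power2_eq_square)
    qed
  qed
qed

lemma log_smooth_inverse_one_plus:
  assumes "Z \<subseteq> {0<..}"
  shows "log_smooth k Z S (big_O Z S (\<lambda>_. 1)) (\<lambda>z s. 1 / (1 + z))"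
proof (induction k)
  have nz: "1 + z \<noteq> 0" if "z \<in> Z" for z using assms that by force
  have b: "(\<lambda>z s. 1 / (1 + z)) \<in> big_O Z S (\<lambda>_. 1)"
    using assms by (intro ObI[where C = 1]) (force simp: divide_le_eq)
  have c: "continuous_on (Z \<times> S) (\<lambda>(z, s). 1 / (1 + z))"
    unfolding split_def by (intro continuous_intros) (use nz in auto)
  {
    case 0 then show ?case using b c by simp
  next
    case (Suc k)
    show ?case
    proof (rule log_smooth_SucI[OF c b _ log_smooth_diff[OF log_smooth_alg_mult[OF Suc.IH Suc.IH algebra_class_Ob] Suc.IH linear_class_Ob]])
      show "((\<lambda>z. 1 / (1 + z)) has_real_derivative (1 / (1 + z) * (1 / (1 + z)) - 1 / (1 + z)) / z) (at z)" if z: "z \<in> Z" for z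
      proof -
        have z0: "0 < z" using z assms by auto
        define b where "b = 1 / (1 + z)"
        have "b * (1 + z) = 1" using z0 by (simp add: b_def)
        then have "b * b - b = - (b * b) * z" by algebra
        then have "- (1 / ((1 + z) * (1 + z))) = (1 / (1 + z) * (1 / (1 + z)) - 1 / (1 + z)) / z" using z0 by (simp flip: b_def) (simp add: b_def)
        then show ?thesis using nz[OF z] by (auto intro!: derivative_eq_intros simp: power2_eq_square)
      qed
    qed
  }
qed

lemma log_smooth_quotient_one_plus:
  assumes "Z \<subseteq> {0<..}" "open Z"
  shows "log_smooth k Z S (big_O Z S (\<lambda>_. 1)) (\<lambda>z s. z / (1 + z))"
  by (rule log_smooth_cong[OF log_smooth_diff[OF log_smooth_alg_const[OF algebra_class_Ob, of _ _ _ 1] log_smooth_inverse_one_plus[OF assms(1)] linear_class_Ob] linear_class_Ob assms(2)])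
    (use assms(1) in \<open>auto simp: diff_divide_eq_iff add_eq_0_iff dest!: subsetD\<close>)

lemma
  assumes "Z \<subseteq> {0<..1 / 2 :: real}"
  shows log_smooth_one_minus: "log_smooth k Z S (big_O Z S (\<lambda>_. 1)) (\<lambda>z s. 1 - z)"
    and log_smooth_inverse_one_minus: "log_smooth k Z S (big_O Z S (\<lambda>_. 1)) (\<lambda>z s. 1 / (1 - z))"
    and log_smooth_quotient_one_minus: "log_smooth k Z S (big_O Z S (\<lambda>z. z)) (\<lambda>z s. z / (1 - z))"
    and log_smooth_one_minus_power: "log_smooth k Z S (big_O Z S (\<lambda>_. 1)) (\<lambda>z s. (1 - z) ^ j)"
proof -
  have Z: "0 \<notin> Z" and bd: "0 < z" "z \<le> 1 / 2" if "z \<in> Z" for z using assms that by auto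
  have id: "log_smooth k Z S (big_O Z S (\<lambda>_. 1)) (\<lambda>z s. z)" "log_smooth k Z S (big_O Z S (\<lambda>z. z)) (\<lambda>z s. z)"
    using assms by (intro log_smooth_id ObI[where C = 1]; force)+
  show m: "log_smooth k Z S (big_O Z S (\<lambda>_. 1)) (\<lambda>z s. 1 - z)"
    by (rule log_smooth_diff[OF log_smooth_alg_const[OF algebra_class_Ob] id(1) linear_class_Ob])
  show i: "log_smooth k Z S (big_O Z S (\<lambda>_. 1)) (\<lambda>z s. 1 / (1 - z))"
    by (rule log_smooth_inverse[OF m algebra_class_Ob]) (use bd in \<open>force intro!: ObI[where C = 2] simp: divide_le_eq\<close>)+
  have "log_smooth k Z S (big_O Z S (\<lambda>z. z)) (\<lambda>z s. z * (1 / (1 - z)))"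
    by (rule log_smooth_mult[OF id(2) i linear_class_Ob]) (use big_O_mult in fastforce)
  then show "log_smooth k Z S (big_O Z S (\<lambda>z. z)) (\<lambda>z s. z / (1 - z))" by simp
  show "log_smooth k Z S (big_O Z S (\<lambda>_. 1)) (\<lambda>z s. (1 - z) ^ j)"
  proof (induction j)
    case 0 then show ?case using log_smooth_alg_const[OF algebra_class_Ob, of k Z S 1] by simp
  next
    case (Suc j)
    show ?case unfolding power_Suc by (rule log_smooth_alg_mult[OF m Suc.IH algebra_class_Ob])
  qed
qed

lemma log_smooth_ray:
  assumes h: "log_smooth k Y {0} WY (\<lambda>v _. h v)" "0 \<notin> Y"
    and Z: "open Z" "Z \<subseteq> {0<..}" "\<And>z. z \<in> Z \<Longrightarrow> \<rho> * z / (1 + z) ^ j \<in> Y"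
    and W: "linear_class Z {0} W" "\<And>g. g \<in> WY \<Longrightarrow> (\<lambda>z s. g (\<rho> * z / (1 + z) ^ j) 0) \<in> W"
      "\<And>f m. f \<in> W \<Longrightarrow> m \<in> big_O Z {0} (\<lambda>_. 1) \<Longrightarrow> (\<lambda>z s. f z s * m z s) \<in> W"
  shows "log_smooth k Z {0} W (\<lambda>z _. h (\<rho> * z / (1 + z) ^ j))"
proof -
  have m: "log_smooth k Z {0} (big_O Z {0} (\<lambda>_. 1)) (\<lambda>z _. 1 - real j * (z / (1 + z)))"
    by (intro log_smooth_diff log_smooth_scale log_smooth_quotient_one_plus log_smooth_alg_const algebra_class_Ob linear_class_Ob Z)
  have d: "((\<lambda>z. \<rho> * z / (1 + z) ^ j) has_real_derivative \<rho> * z / (1 + z) ^ j * (1 - real j * (z / (1 + z))) / z) (at z)" if "z \<in> Z" for z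
  proof -
    have z: "0 < z" using that Z by auto
    have "((\<lambda>z. \<rho> * z * inverse (1 + z) ^ j) has_real_derivative \<rho> * inverse (1 + z) ^ j + real j * inverse (1 + z) ^ (j - 1) * - (inverse (1 + z) ^ 2) * (\<rho> * z)) (at z)"
      using z by (auto intro!: derivative_eq_intros simp: power2_eq_square)
    also have "\<rho> * inverse (1 + z) ^ j + real j * inverse (1 + z) ^ (j - 1) * - (inverse (1 + z) ^ 2) * (\<rho> * z) = \<rho> * inverse (1 + z) ^ j * (1 - real j * (z * inverse (1 + z)))"
    proof -
      have "\<rho> * b ^ j + real j * b ^ (j - 1) * - (b ^ 2) * (\<rho> * z) = \<rho> * b ^ j * (1 - real j * (z * b))" for b
        by (cases j) (simp_all add: power2_eq_square algebra_simps)
      then show ?thesis .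
    qed
    also have "\<dots> = \<rho> * z * inverse (1 + z) ^ j * (1 - real j * (z * inverse (1 + z))) / z" using z by simp
    finally show ?thesis by (simp add: divide_inverse power_inverse)
  qed
  show ?thesis
    by (rule log_smooth_compose1[where k = k and Y = Y and WY = WY and g = h and Z = Z and W = W and ?W1.0 = "big_O Z {0} (\<lambda>_. 1)"
      and \<phi> = "\<lambda>z. \<rho> * z / (1 + z) ^ j" and \<mu> = "\<lambda>z. 1 - real j * (z / (1 + z))"]) (assumption | rule assms m d)+
qed

text \<open>
  The bookkeeping of the smoothing step near 0: the primitive is \<open>O(z^(1 + \<sigma>))\<close>, the reciprocal \<open>s\<close>-derivative \<open>O(1/z)\<close>, so the
  averaged term is again \<open>O(z^\<sigma>)\<close>, with one derivative more.
\<close>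
lemma log_smooth_smoothing_near_0:
  fixes h f :: "real \<Rightarrow> real"
  assumes sg: "0 \<le> \<sigma>" and del: "0 < \<delta>"
    and h: "log_smooth k {0<..<\<delta>} {0} (big_O {0<..<\<delta>} {0} (\<lambda>z. z powr \<sigma>)) (\<lambda>v _. h v)" "continuous_on {0..<\<delta>} h" "h 0 = 0"
    and ab: "a \<le> b"
    and f: "\<And>s. s \<in> {a..b} \<Longrightarrow> 0 < f s \<and> f s \<le> M" "\<And>s. s \<in> {a..b} \<Longrightarrow> (f has_real_derivative f' s) (at s)"
      "\<And>s. s \<in> {a..b} \<Longrightarrow> (f' has_real_derivative f'' s) (at s)" "continuous_on {a..b} f''" "\<And>s. s \<in> {a..b} \<Longrightarrow> f' s \<noteq> 0"
  shows "\<exists>\<delta>'>0. log_smooth (Suc k) {0<..<\<delta>'} {0} (big_O {0<..<\<delta>'} {0} (\<lambda>z. z powr \<sigma>)) (\<lambda>z _. integral {a..b} (\<lambda>s. h (z * f s / (1 - z) ^ j)))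
    \<and> (\<forall>z\<in>{0<..<\<delta>'}. (\<lambda>s. h (z * f s / (1 - z) ^ j)) integrable_on {a..b})"
proof -
  have M: "0 < M" using f(1)[of a] ab by auto
  define \<delta>' where "\<delta>' = min (1 / 2) (\<delta> / (M * 2 ^ j))"
  have d': "0 < \<delta>'" "\<delta>' \<le> 1 / 2" "\<delta>' \<le> \<delta> / (M * 2 ^ j)"
    unfolding \<delta>'_def by (use M del in simp) (rule min.cobounded1 min.cobounded2)+
  define Y Z where "Y = {0<..<\<delta>}" and "Z = {0<..<\<delta>'}"
  have Z: "open Z" "0 \<notin> Z" "Z \<subseteq> {0<..1 / 2 :: real}" and Y: "0 \<notin> Y" using d' by (auto simp: Y_def Z_def)
  define \<phi> where "\<phi> z s = z * f s / (1 - z) ^ j" for z s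
  have z12: "0 < z" "z \<le> 1 / 2" "0 < 1 - z" if "z \<in> Z" for z using that Z by auto
  have pw: "(1 / 2) ^ j \<le> (1 - z) ^ j" "0 < (1 - z) ^ j" if "z \<in> Z" for z using z12[OF that] by (auto intro: power_mono)
  have phib: "\<phi> z s \<le> (M * 2 ^ j) * z" "\<phi> z s \<in> Y" if "z \<in> Z" "s \<in> {a..b}" for z s
  proof -
    have "\<phi> z s \<le> z * M / (1 / 2) ^ j"
      unfolding \<phi>_def using f(1)[OF that(2)] z12[OF that(1)] pw[OF that(1)] M by (intro frac_le mult_left_mono) auto
    then show 1: "\<phi> z s \<le> (M * 2 ^ j) * z" by (simp add: power_divide mult_ac)
    have "z < \<delta> / (M * 2 ^ j)" using that(1) d'(3) by (simp add: Z_def)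
    then have "(M * 2 ^ j) * z < \<delta>" using M by (subst (asm) pos_less_divide_eq) (auto simp: mult.commute)
    moreover have "0 < \<phi> z s" unfolding \<phi>_def using f(1)[OF that(2)] z12[OF that(1)] by simp
    ultimately show "\<phi> z s \<in> Y" using 1 by (simp add: Y_def)
  qed
  define \<Gamma> where "\<Gamma> v = integral {0..v} h" for v
  obtain C where C: "\<bar>h v\<bar> \<le> C * v powr \<sigma>" if "v \<in> Y" for v
    using conjunct2[OF log_smooth_base[OF h(1)]] unfolding big_O_def Y_def by blast
  have Gd: "(\<Gamma> has_real_derivative h v) (at v)" if "v \<in> Y" for v
  proof -
    have v: "0 < v" "v < (v + \<delta>) / 2" "(v + \<delta>) / 2 < \<delta>" using that by (auto simp: Y_def)
    have "continuous_on {0..(v + \<delta>) / 2} h" by (rule continuous_on_subset[OF h(2)]) (use v in auto)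
    then have "(\<Gamma> has_real_derivative h v) (at v within {0..(v + \<delta>) / 2})"
      unfolding \<Gamma>_def by (rule integral_has_real_derivative) (use v in auto)
    moreover have "v \<in> interior {0..(v + \<delta>) / 2}" using v by simp
    ultimately show ?thesis by (simp only: at_within_interior)
  qed
  have Gb: "\<bar>\<Gamma> v\<bar> \<le> \<bar>C\<bar> * v powr (1 + \<sigma>)" if v: "v \<in> Y" for v
  proof -
    have v': "0 < v" "v < \<delta>" using v by (auto simp: Y_def)
    have "norm (integral {0..v} h) \<le> (\<bar>C\<bar> * v powr \<sigma>) * (v - 0)"
    proof (rule integral_bound)
      show "continuous_on ({0..v}) h" by (rule continuous_on_subset[OF h(2)]) (use v' in auto)
      fix u assume "u \<in> {0..v}"
      then have u: "0 \<le> u" "u \<le> v" by auto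
      show "norm (h u) \<le> \<bar>C\<bar> * v powr \<sigma>"
      proof (cases "u = 0")
        case False
        then have "\<bar>h u\<bar> \<le> C * u powr \<sigma>" using C u v' by (simp add: Y_def)
        also have "\<dots> \<le> \<bar>C\<bar> * v powr \<sigma>" using u sg by (intro mult_mono powr_mono2) auto
        finally show ?thesis by simp
      qed (simp add: h(3))
    qed (use v' in auto)
    then show ?thesis using v' by (simp add: \<Gamma>_def powr_add mult_ac)
  qed
  have "log_smooth (Suc k) Y {0} (big_O Y {0} (\<lambda>z. z powr (1 + \<sigma>))) (\<lambda>v _. \<Gamma> v)"
  proof (rule log_smooth_SucI[where f' = "\<lambda>v _. v * h v"])
    have "continuous_on Y \<Gamma>" using Gd DERIV_isCont by (intro continuous_at_imp_continuous_on) blast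
    then show "continuous_on (Y \<times> {0}) (\<lambda>(z, s). \<Gamma> z)"
      unfolding split_def by (rule continuous_on_compose2) (auto intro!: continuous_intros)
    show "(\<lambda>v _. \<Gamma> v) \<in> big_O Y {0} (\<lambda>z. z powr (1 + \<sigma>))" by (rule ObI[where C = "\<bar>C\<bar>"]) (use Gb in auto)
    show "(\<Gamma> has_real_derivative v * h v / v) (at v)" if "v \<in> Y" for v
      using Gd[OF that] that by (auto simp: Y_def)
    show "log_smooth k Y {0} (big_O Y {0} (\<lambda>z. z powr (1 + \<sigma>))) (\<lambda>v _. v * h v)"
    proof (rule log_smooth_mult[OF log_smooth_id h(1)[folded Y_def] linear_class_Ob])
      show "(\<lambda>z s. z) \<in> big_O Y {0} (\<lambda>z. z)" by (rule ObI[where C = 1]) (auto simp: Y_def)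
      show "(\<lambda>z s. f z s * g z s) \<in> big_O Y {0} (\<lambda>z. z powr (1 + \<sigma>))" if "f \<in> big_O Y {0} (\<lambda>z. z)" "g \<in> big_O Y {0} (\<lambda>z. z powr \<sigma>)" for f g
        by (rule big_O_mono[OF big_O_mult[OF that], where K = 1]) (auto simp: Y_def powr_add)
    qed (rule Y)
  qed
  note G = this
  define \<mu> where "\<mu> z = 1 + real j * (z / (1 - z))" for z :: real
  have smu: "log_smooth (Suc k) Z {a..b} (big_O Z {a..b} (\<lambda>_. 1)) (\<lambda>z s. \<mu> z)"
  proof -
    have le: "big_O Z {a..b} (\<lambda>z. z) \<subseteq> big_O Z {a..b} (\<lambda>_. 1)"
      using Z(3) by (intro subsetI, elim big_O_mono[where K = 1]) force
    have q: "log_smooth (Suc k) Z {a..b} (big_O Z {a..b} (\<lambda>_. 1)) (\<lambda>z s. z / (1 - z))"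
      by (rule log_smooth_mono_set[OF log_smooth_quotient_one_minus[OF Z(3)] _ _ le]) auto
    show ?thesis unfolding \<mu>_def by (intro log_smooth_add log_smooth_scale q log_smooth_alg_const algebra_class_Ob linear_class_Ob)
  qed
  have f0: "f s \<noteq> 0" "f' s \<noteq> 0" if "s \<in> {a..b}" for s using f that by force+
  have cf: "continuous_on {a..b} f" "continuous_on {a..b} f'"
    using f(2,3) DERIV_isCont by (intro continuous_at_imp_continuous_on; blast)+
  have kap: "log_smooth (Suc k) Z {a..b} (big_O Z {a..b} (\<lambda>z. 1 / z)) (\<lambda>z s. (1 - z) ^ j / z * g s)"
    if g: "continuous_on {a..b} g" for g
  proof -
    have "log_smooth (Suc k) Z {a..b} (big_O Z {a..b} (\<lambda>z. 1 / z)) (\<lambda>z s. 1 / z)"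
      using Z by (intro log_smooth_inverse_id linear_class_Ob ObI[where C = 1]) force+
    then have "log_smooth (Suc k) Z {a..b} (big_O Z {a..b} (\<lambda>z. 1 / z)) (\<lambda>z s. (1 - z) ^ j * (1 / z))"
      by (intro log_smooth_mult[OF log_smooth_one_minus_power[OF Z(3)] _ linear_class_Ob]) (use big_O_mult in fastforce)+
    moreover have "log_smooth (Suc k) Z {a..b} (big_O Z {a..b} (\<lambda>_. 1)) (\<lambda>z s. g s)"
    proof (rule log_smooth_param[OF g _ linear_class_Ob])
      have "bounded (g ` {a..b})" using g by (intro compact_imp_bounded compact_continuous_image) auto
      then obtain B where "\<forall>s\<in>{a..b}. \<bar>g s\<bar> \<le> B" unfolding bounded_iff by auto
      then show "(\<lambda>z. g) \<in> big_O Z {a..b} (\<lambda>_. 1)" by (intro ObI[where C = B]) auto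
    qed
    ultimately have "log_smooth (Suc k) Z {a..b} (big_O Z {a..b} (\<lambda>z. 1 / z)) (\<lambda>z s. (1 - z) ^ j * (1 / z) * g s)"
      by (rule log_smooth_mult[OF _ _ linear_class_Ob]) (use big_O_mult in fastforce)
    then show ?thesis by simp
  qed
  have "log_smooth (Suc k) Z {0} (big_O Z {0} (\<lambda>z. z powr \<sigma>)) (\<lambda>z _. integral {a..b} (\<lambda>s. h (\<phi> z s)))"
  proof (rule log_smooth_smoothing_term[where \<phi> = \<phi> and Y = Y and \<Gamma> = \<Gamma> and WY = "big_O Y {0} (\<lambda>z. z powr (1 + \<sigma>))"
        and \<mu> = "\<lambda>z s. \<mu> z" and ?W1.0 = "big_O Z {a..b} (\<lambda>_. 1)" and ?W2.0 = "big_O Z {a..b} (\<lambda>z. 1 / z)"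
        and \<phi>s = "\<lambda>z s. z * f' s / (1 - z) ^ j" and \<kappa> = "\<lambda>z s. (1 - z) ^ j / z * (1 / f' s)" and \<kappa>s = "\<lambda>z s. (1 - z) ^ j / z * (- f'' s / (f' s)\<^sup>2)"
        and ?W3.0 = "big_O Z {a..b} (\<lambda>z. z powr (1 + \<sigma>))" and W = "big_O Z {a..b} (\<lambda>z. z powr \<sigma>)", OF ab Z(1,2) Y Gd G phib(2) _ _ _ _ _ smu kap kap linear_class_Ob linear_class_Ob linear_class_Ob])
    show "continuous_on (Z \<times> {a..b}) (\<lambda>(z, s). \<phi> z s)"
      unfolding \<phi>_def split_def
      by (intro continuous_intros continuous_on_compose2[OF cf(1)]) (use pw in force)+
    fix z s assume z: "z \<in> Z" and s: "s \<in> {a..b}"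
    show "((\<lambda>z. \<phi> z s) has_real_derivative \<phi> z s * \<mu> z / z) (at z)"
    proof -
      have z1: "1 - z \<noteq> 0" "z \<noteq> 0" using z12[OF z] by auto
      have "((\<lambda>z. z * f s * inverse (1 - z) ^ j) has_real_derivative f s * inverse (1 - z) ^ j + real j * inverse (1 - z) ^ (j - 1) * (inverse (1 - z) ^ 2) * (z * f s)) (at z)"
        using z1 by (auto intro!: derivative_eq_intros simp: power2_eq_square)
      also have "f s * inverse (1 - z) ^ j + real j * inverse (1 - z) ^ (j - 1) * (inverse (1 - z) ^ 2) * (z * f s) = \<phi> z s * \<mu> z / z"
      proof -
        have "f s * b ^ j + real j * b ^ (j - 1) * (b ^ 2) * (z * f s) = f s * b ^ j * (1 + real j * (z * b))" for b
          by (cases j) (simp_all add: power2_eq_square algebra_simps)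
        also have "f s * inverse (1 - z) ^ j * (1 + real j * (z * inverse (1 - z))) = \<phi> z s * \<mu> z / z"
          unfolding \<phi>_def \<mu>_def using z1 by (simp add: divide_inverse power_inverse)
        finally show ?thesis .
      qed
      finally show ?thesis by (simp add: divide_inverse power_inverse \<phi>_def)
    qed
    show "(\<phi> z has_real_derivative z * f' s / (1 - z) ^ j) (at s)"
      unfolding \<phi>_def[abs_def] by (intro DERIV_cdivide DERIV_cmult f(2) s)
    show "z * f' s / (1 - z) ^ j * ((1 - z) ^ j / z * (1 / f' s)) = 1" using z12[OF z] f0[OF s] by simp
    have "((\<lambda>s. 1 / f' s) has_real_derivative - f'' s / (f' s)\<^sup>2) (at s)"
      using f(3)[OF s] f0[OF s] by (auto intro!: derivative_eq_intros simp: power2_eq_square)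
    then show "((\<lambda>s. (1 - z) ^ j / z * (1 / f' s)) has_real_derivative (1 - z) ^ j / z * (- f'' s / (f' s)\<^sup>2)) (at s)"
      by (rule DERIV_cmult)
  next
    show "continuous_on {a..b} (\<lambda>s. 1 / f' s)" "continuous_on {a..b} (\<lambda>s. - f'' s / (f' s)\<^sup>2)"
      by (intro continuous_intros cf f(4); use f0 in auto)+
  next
    fix g assume "g \<in> big_O Y {0} (\<lambda>z. z powr (1 + \<sigma>))"
    then obtain D where D: "\<forall>v\<in>Y. \<forall>s\<in>{0}. \<bar>g v s\<bar> \<le> D * v powr (1 + \<sigma>)" unfolding big_O_def by blast
    show "(\<lambda>z s. g (\<phi> z s) 0) \<in> big_O Z {a..b} (\<lambda>z. z powr (1 + \<sigma>))"
    proof (rule ObI[where C = "\<bar>D\<bar> * (M * 2 ^ j) powr (1 + \<sigma>)"])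
      fix z s assume zs: "z \<in> Z" "s \<in> {a..b}"
      have "\<bar>g (\<phi> z s) 0\<bar> \<le> D * \<phi> z s powr (1 + \<sigma>)" using D phib(2)[OF zs] by blast
      also have "\<dots> \<le> \<bar>D\<bar> * ((M * 2 ^ j) * z) powr (1 + \<sigma>)"
        using phib[OF zs] sg by (intro mult_mono powr_mono2) (auto simp: Y_def)
      also have "\<dots> = \<bar>D\<bar> * (M * 2 ^ j) powr (1 + \<sigma>) * z powr (1 + \<sigma>)" using M z12[OF zs(1)] by (simp add: powr_mult)
      finally show "\<bar>g (\<phi> z s) 0\<bar> \<le> \<bar>D\<bar> * (M * 2 ^ j) powr (1 + \<sigma>) * z powr (1 + \<sigma>)" .
    qed
  next
    fix g m assume gm: "g \<in> big_O Z {a..b} (\<lambda>z. z powr (1 + \<sigma>))" "m \<in> big_O Z {a..b} (\<lambda>_. 1)"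
    show "(\<lambda>z s. g z s * m z s) \<in> big_O Z {a..b} (\<lambda>z. z powr (1 + \<sigma>))" using big_O_mult[OF gm] by simp
  next
    fix g m assume gm: "g \<in> big_O Z {a..b} (\<lambda>z. z powr (1 + \<sigma>))" "m \<in> big_O Z {a..b} (\<lambda>z. 1 / z)"
    show "(\<lambda>z s. g z s * m z s) \<in> big_O Z {a..b} (\<lambda>z. z powr \<sigma>)"
      by (rule big_O_mono[OF big_O_mult[OF gm], where K = 1]) (use z12 in \<open>force simp: powr_add abs_mult\<close>)
  next
    fix g s0 assume "g \<in> big_O Z {a..b} (\<lambda>z. z powr \<sigma>)" "s0 \<in> {a..b}"
    then show "(\<lambda>z _. g z s0) \<in> big_O Z {0} (\<lambda>z. z powr \<sigma>)" unfolding big_O_def by blast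
  next
    fix g assume g: "g \<in> big_O Z {a..b} (\<lambda>z. z powr \<sigma>)" and c: "continuous_on (Z \<times> {a..b}) (\<lambda>(z, s). g z s)"
    show "(\<lambda>z _. integral {a..b} (g z)) \<in> big_O Z {0} (\<lambda>z. z powr \<sigma>)" by (rule big_O_integral[OF g c ab])
  qed
  moreover have "(\<lambda>s. h (\<phi> z s)) integrable_on {a..b}" if z: "z \<in> Z" for z
  proof (intro integrable_continuous_interval continuous_on_compose2[OF h(2)])
    show "continuous_on {a..b} (\<phi> z)" unfolding \<phi>_def[abs_def] by (intro continuous_intros cf) (use z12[OF z] in auto)
    show "\<phi> z ` {a..b} \<subseteq> {0..<\<delta>}" using phib(2)[OF z] by (force simp: Y_def)
  qed
  ultimately show ?thesis using d'(1) unfolding Z_def \<phi>_def by blast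
qed

section \<open>Smoothness of the solutions of the homogeneous equation\<close>

lemma
  shows log_smooth_rational: "log_smooth k Z S UNIV (\<lambda>z s. c)" "0 \<notin> Z \<Longrightarrow> log_smooth k Z S UNIV (\<lambda>z s. z)" "log_smooth k Z S UNIV (\<lambda>z s. s)"
    "log_smooth k Z S UNIV f \<Longrightarrow> log_smooth k Z S UNIV g \<Longrightarrow> log_smooth k Z S UNIV (\<lambda>z s. f z s + g z s)"
    "log_smooth k Z S UNIV f \<Longrightarrow> log_smooth k Z S UNIV g \<Longrightarrow> log_smooth k Z S UNIV (\<lambda>z s. f z s - g z s)"
    "log_smooth k Z S UNIV f \<Longrightarrow> log_smooth k Z S UNIV g \<Longrightarrow> log_smooth k Z S UNIV (\<lambda>z s. f z s * g z s)"
    "log_smooth k Z S UNIV f \<Longrightarrow> log_smooth k Z S UNIV g \<Longrightarrow> (\<And>z s. z \<in> Z \<Longrightarrow> s \<in> S \<Longrightarrow> g z s \<noteq> 0) \<Longrightarrow> log_smooth k Z S UNIV (\<lambda>z s. f z s / g z s)"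
  by (auto intro!: log_smooth_param log_smooth_id log_smooth_add log_smooth_diff log_smooth_alg_mult log_smooth_divide)

lemma log_smooth_smoothing_local:
  fixes g :: "real \<Rightarrow> real"
  assumes g: "log_smooth k Y {0} UNIV (\<lambda>v _. g v)" and Y: "Y = {lo<..<hi} \<or> Y = {0<..}" "0 \<notin> Y"
    and ab: "a \<le> b" and Z: "open Z" "0 \<notin> Z"
    and phi: "\<And>z s. z \<in> Z \<Longrightarrow> s \<in> {a..b} \<Longrightarrow> \<phi> z s \<in> Y"
      "\<And>z s. z \<in> Z \<Longrightarrow> s \<in> {a..b} \<Longrightarrow> ((\<lambda>z. \<phi> z s) has_real_derivative \<phi>z z s) (at z)"
      "\<And>z s. z \<in> Z \<Longrightarrow> s \<in> {a..b} \<Longrightarrow> z * \<phi>z z s = \<phi> z s * \<mu> z s"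
      "\<And>z s. z \<in> Z \<Longrightarrow> s \<in> {a..b} \<Longrightarrow> (\<phi> z has_real_derivative \<phi>s z s) (at s)"
      "\<And>z s. z \<in> Z \<Longrightarrow> s \<in> {a..b} \<Longrightarrow> \<phi>s z s * \<kappa> z s = 1"
      "\<And>z s. z \<in> Z \<Longrightarrow> s \<in> {a..b} \<Longrightarrow> (\<kappa> z has_real_derivative \<kappa>s z s) (at s)"
    and K: "\<And>k. log_smooth k Z {a..b} UNIV \<phi>" "\<And>k. log_smooth k Z {a..b} UNIV \<mu>" "\<And>k. log_smooth k Z {a..b} UNIV \<kappa>" "\<And>k. log_smooth k Z {a..b} UNIV \<kappa>s"
  shows "log_smooth (Suc k) Z {0} UNIV (\<lambda>z _. integral {a..b} (\<lambda>s. g (\<phi> z s)))"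
    and "\<And>z. z \<in> Z \<Longrightarrow> (\<lambda>s. g (\<phi> z s)) integrable_on {a..b}"
proof -
  have oY: "open Y" using Y(1) by auto
  have "log_smooth 0 Y {0} UNIV (\<lambda>v _. g v)" by (rule log_smooth_le[OF g]) simp
  then have c: "\<And>v. v \<in> Y \<Longrightarrow> isCont g v" using log_smooth_0_iff_isCont[OF oY] by blast
  show "(\<lambda>s. g (\<phi> z s)) integrable_on {a..b}" if "z \<in> Z" for z
    by (intro integrable_continuous_interval continuous_at_imp_continuous_on ballI)
      (rule isCont_o2[OF DERIV_isCont[OF phi(4)] c[OF phi(1)]]; use that in simp)
  have "\<exists>\<Gamma>. \<forall>v\<in>Y. (\<Gamma> has_real_derivative g v) (at v)"
    using Y(1)
  proof
    assume Y: "Y = {lo<..<hi}"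
    show ?thesis
    proof (cases "lo < hi")
      case True
      have "\<exists>F. \<forall>x::real. ereal lo < x \<longrightarrow> x < ereal hi \<longrightarrow> (F has_vector_derivative g x) (at x)"
        by (rule einterval_antiderivative) (use True c Y in auto)
      then obtain F where "\<forall>x>lo. x < hi \<longrightarrow> (F has_vector_derivative g x) (at x)" by auto
      then show ?thesis by (intro exI[of _ F]) (auto simp: Y has_real_derivative_iff_has_vector_derivative)
    qed (simp add: Y)
  next
    assume Y: "Y = {0<..}"
    have "\<exists>F. \<forall>x::real. ereal 0 < x \<longrightarrow> x < (\<infinity>::ereal) \<longrightarrow> (F has_vector_derivative g x) (at x)"
      by (rule einterval_antiderivative) (use c Y in auto)
    then obtain F where "\<forall>x>0. (F has_vector_derivative g x) (at x)" by auto
    then show ?thesis by (intro exI[of _ F]) (auto simp: Y has_real_derivative_iff_has_vector_derivative)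
  qed
  then obtain \<Gamma> where G: "(\<Gamma> has_real_derivative g v) (at v)" if "v \<in> Y" for v by blast
  have "log_smooth (Suc k) Y {0} UNIV (\<lambda>v _. \<Gamma> v)"
  proof (rule log_smooth_SucI[where f' = "\<lambda>v _. v * g v"])
    have "continuous_on Y \<Gamma>" using G DERIV_isCont by (intro continuous_at_imp_continuous_on) blast
    then show "continuous_on (Y \<times> {0}) (\<lambda>(z, s). \<Gamma> z)"
      unfolding split_def by (rule continuous_on_compose2) (auto intro!: continuous_intros)
    show "(\<Gamma> has_real_derivative v * g v / v) (at v)" if "v \<in> Y" for v
    proof -
      have "v \<noteq> 0" using that Y(2) by auto
      then show ?thesis using G[OF that] by simp
    qed
    show "log_smooth k Y {0} UNIV (\<lambda>v _. v * g v)" by (rule log_smooth_rational(6)[OF log_smooth_rational(2)[OF Y(2)] g])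
  qed simp
  moreover have "((\<lambda>z. \<phi> z s) has_real_derivative \<phi> z s * \<mu> z s / z) (at z)" if "z \<in> Z" "s \<in> {a..b}" for z s
  proof -
    have "z \<noteq> 0" using that(1) Z(2) by auto
    then show ?thesis using phi(2)[OF that] phi(3)[OF that, symmetric] by simp
  qed
  ultimately show "log_smooth (Suc k) Z {0} UNIV (\<lambda>z _. integral {a..b} (\<lambda>s. g (\<phi> z s)))"
    by (intro log_smooth_smoothing_term[OF ab Z Y(2) G, where WY = UNIV and ?W1.0 = UNIV and ?W2.0 = UNIV and ?W3.0 = UNIV and W = UNIV
        and \<phi> = \<phi> and \<mu> = \<mu> and \<phi>s = \<phi>s and \<kappa> = \<kappa> and \<kappa>s = \<kappa>s])
      (use phi(1,4-6) K(2-4) conjunct1[OF log_smooth_base[OF K(1)]] in \<open>auto simp del: log_smooth.simps\<close>)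
qed

text \<open>
  The data for integration by parts, for each of the arguments as a function of \<open>z\<close> and \<open>s\<close>, where \<open>w = z + s - 1\<close>: the
  \<open>z\<close>-derivative and its logarithmic form, the \<open>s\<close>-derivative, its reciprocal, and the derivative of the reciprocal.
\<close>
lemma argument_w_over_z:
  assumes "z \<noteq> 0" "s \<noteq> 0" "z + s - 1 \<noteq> 0" "1 - z \<noteq> 0" "2 * s + z - 1 \<noteq> (0 :: real)"
  shows "((\<lambda>z. (z + s - 1) / z) has_real_derivative (1 - s) / (z * z)) (at z)" and "z * ((1 - s) / (z * z)) = ((z + s - 1) / z) * ((1 - s) / (z + s - 1))"
    and "((\<lambda>s. (z + s - 1) / z) has_real_derivative 1 / z) (at s)" and "(1 / z) * (z) = 1" and "((\<lambda>s. z) has_real_derivative 0) (at s)"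
proof -
  show "((\<lambda>z. (z + s - 1) / z) has_real_derivative (1 - s) / (z * z)) (at z)" using assms by - (rule DERIV_cong, (rule derivative_intros | assumption | simp)+; (simp add: divide_simps; (algebra | simp add: algebra_simps)?)?)
  show "z * ((1 - s) / (z * z)) = ((z + s - 1) / z) * ((1 - s) / (z + s - 1))" using assms by simp
  show "((\<lambda>s. (z + s - 1) / z) has_real_derivative 1 / z) (at s)" using assms by - (rule DERIV_cong, (rule derivative_intros | assumption | simp)+; (simp add: divide_simps; (algebra | simp add: algebra_simps)?)?)
  show "(1 / z) * (z) = 1" using assms by simp
  show "((\<lambda>s. z) has_real_derivative 0) (at s)" using assms by - (rule DERIV_cong, (rule derivative_intros | assumption | simp)+; (simp add: divide_simps; (algebra | simp add: algebra_simps)?)?)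
qed

lemma argument_w_over_s:
  assumes "z \<noteq> 0" "s \<noteq> 0" "z + s - 1 \<noteq> 0" "1 - z \<noteq> 0" "2 * s + z - 1 \<noteq> (0 :: real)"
  shows "((\<lambda>z. (z + s - 1) / s) has_real_derivative 1 / s) (at z)" and "z * (1 / s) = ((z + s - 1) / s) * (z / (z + s - 1))"
    and "((\<lambda>s. (z + s - 1) / s) has_real_derivative (1 - z) / (s * s)) (at s)" and "((1 - z) / (s * s)) * (s * s / (1 - z)) = 1" and "((\<lambda>s. s * s / (1 - z)) has_real_derivative 2 * s / (1 - z)) (at s)"
proof -
  show "((\<lambda>z. (z + s - 1) / s) has_real_derivative 1 / s) (at z)" using assms by - (rule DERIV_cong, (rule derivative_intros | assumption | simp)+; (simp add: divide_simps; (algebra | simp add: algebra_simps)?)?)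
  show "z * (1 / s) = ((z + s - 1) / s) * (z / (z + s - 1))" using assms by simp
  show "((\<lambda>s. (z + s - 1) / s) has_real_derivative (1 - z) / (s * s)) (at s)" using assms by - (rule DERIV_cong, (rule derivative_intros | assumption | simp)+; (simp add: divide_simps; (algebra | simp add: algebra_simps)?)?)
  show "((1 - z) / (s * s)) * (s * s / (1 - z)) = 1" using assms by simp
  show "((\<lambda>s. s * s / (1 - z)) has_real_derivative 2 * s / (1 - z)) (at s)" using assms by - (rule DERIV_cong, (rule derivative_intros | assumption | simp)+; (simp add: divide_simps; (algebra | simp add: algebra_simps)?)?)
qed

lemma argument_w_over_zs:
  assumes "z \<noteq> 0" "s \<noteq> 0" "z + s - 1 \<noteq> 0" "1 - z \<noteq> 0" "2 * s + z - 1 \<noteq> (0 :: real)"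
  shows "((\<lambda>z. (z + s - 1) / (z * s)) has_real_derivative (1 - s) / (z * z * s)) (at z)" and "z * ((1 - s) / (z * z * s)) = ((z + s - 1) / (z * s)) * ((1 - s) / (z + s - 1))"
    and "((\<lambda>s. (z + s - 1) / (z * s)) has_real_derivative (1 - z) / (z * (s * s))) (at s)" and "((1 - z) / (z * (s * s))) * (z * (s * s) / (1 - z)) = 1" and "((\<lambda>s. z * (s * s) / (1 - z)) has_real_derivative 2 * z * s / (1 - z)) (at s)"
proof -
  show "((\<lambda>z. (z + s - 1) / (z * s)) has_real_derivative (1 - s) / (z * z * s)) (at z)" using assms by - (rule DERIV_cong, (rule derivative_intros | assumption | simp)+; (simp add: divide_simps; (algebra | simp add: algebra_simps)?)?)
  show "z * ((1 - s) / (z * z * s)) = ((z + s - 1) / (z * s)) * ((1 - s) / (z + s - 1))" using assms by simp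
  show "((\<lambda>s. (z + s - 1) / (z * s)) has_real_derivative (1 - z) / (z * (s * s))) (at s)" using assms by - (rule DERIV_cong, (rule derivative_intros | assumption | simp)+; (simp add: divide_simps; (algebra | simp add: algebra_simps)?)?)
  show "((1 - z) / (z * (s * s))) * (z * (s * s) / (1 - z)) = 1" using assms by simp
  show "((\<lambda>s. z * (s * s) / (1 - z)) has_real_derivative 2 * z * s / (1 - z)) (at s)" using assms by - (rule DERIV_cong, (rule derivative_intros | assumption | simp)+; (simp add: divide_simps; (algebra | simp add: algebra_simps)?)?)
qed

lemma argument_sw_over_z:
  assumes "z \<noteq> 0" "s \<noteq> 0" "z + s - 1 \<noteq> 0" "1 - z \<noteq> 0" "2 * s + z - 1 \<noteq> (0 :: real)"
  shows "((\<lambda>z. s * (z + s - 1) / z) has_real_derivative s * (1 - s) / (z * z)) (at z)" and "z * (s * (1 - s) / (z * z)) = (s * (z + s - 1) / z) * ((1 - s) / (z + s - 1))"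
    and "((\<lambda>s. s * (z + s - 1) / z) has_real_derivative (2 * s + z - 1) / z) (at s)" and "((2 * s + z - 1) / z) * (z / (2 * s + z - 1)) = 1" and "((\<lambda>s. z / (2 * s + z - 1)) has_real_derivative - 2 * z / ((2 * s + z - 1) * (2 * s + z - 1))) (at s)"
proof -
  show "((\<lambda>z. s * (z + s - 1) / z) has_real_derivative s * (1 - s) / (z * z)) (at z)" using assms DERIV_cmult[OF argument_w_over_z(1), of z s s] by simp
  show "z * (s * (1 - s) / (z * z)) = (s * (z + s - 1) / z) * ((1 - s) / (z + s - 1))" using assms by simp
  show "((\<lambda>s. s * (z + s - 1) / z) has_real_derivative (2 * s + z - 1) / z) (at s)" using assms by - (rule DERIV_cong, (rule derivative_intros | assumption | simp)+; (simp add: divide_simps; (algebra | simp add: algebra_simps)?)?)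
  show "((2 * s + z - 1) / z) * (z / (2 * s + z - 1)) = 1" using assms by simp
  show "((\<lambda>s. z / (2 * s + z - 1)) has_real_derivative - 2 * z / ((2 * s + z - 1) * (2 * s + z - 1))) (at s)" using assms by - (rule DERIV_cong, (rule derivative_intros | assumption | simp)+; (simp add: divide_simps; (algebra | simp add: algebra_simps)?)?)
qed

lemma argument_zw_over_s:
  assumes "z \<noteq> 0" "s \<noteq> 0" "z + s - 1 \<noteq> 0" "1 - z \<noteq> 0" "2 * s + z - 1 \<noteq> (0 :: real)"
  shows "((\<lambda>z. z * (z + s - 1) / s) has_real_derivative (2 * z + s - 1) / s) (at z)" and "z * ((2 * z + s - 1) / s) = (z * (z + s - 1) / s) * ((2 * z + s - 1) / (z + s - 1))"
    and "((\<lambda>s. z * (z + s - 1) / s) has_real_derivative z * (1 - z) / (s * s)) (at s)" and "(z * (1 - z) / (s * s)) * (s * s / (z * (1 - z))) = 1" and "((\<lambda>s. s * s / (z * (1 - z))) has_real_derivative 2 * s / (z * (1 - z))) (at s)"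
proof -
  show "((\<lambda>z. z * (z + s - 1) / s) has_real_derivative (2 * z + s - 1) / s) (at z)" using assms by - (rule DERIV_cong, (rule derivative_intros | assumption | simp)+; (simp add: divide_simps; (algebra | simp add: algebra_simps)?)?)
  show "z * ((2 * z + s - 1) / s) = (z * (z + s - 1) / s) * ((2 * z + s - 1) / (z + s - 1))" using assms by simp
  show "((\<lambda>s. z * (z + s - 1) / s) has_real_derivative z * (1 - z) / (s * s)) (at s)" using assms DERIV_cmult[OF argument_w_over_s(3), of z s z] by simp
  show "(z * (1 - z) / (s * s)) * (s * s / (z * (1 - z))) = 1" using assms by simp
  show "((\<lambda>s. s * s / (z * (1 - z))) has_real_derivative 2 * s / (z * (1 - z))) (at s)" using assms by - (rule DERIV_cong, (rule derivative_intros | assumption | simp)+; (simp add: divide_simps; (algebra | simp add: algebra_simps)?)?)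
qed

lemma argument_s_over_z:
  assumes "z \<noteq> 0" "s \<noteq> 0" "z + s - 1 \<noteq> 0" "1 - z \<noteq> 0" "2 * s + z - 1 \<noteq> (0 :: real)"
  shows "((\<lambda>z. s / z) has_real_derivative - s / (z * z)) (at z)" and "z * (- s / (z * z)) = (s / z) * (- 1)"
    and "((\<lambda>s. s / z) has_real_derivative 1 / z) (at s)" and "(1 / z) * (z) = 1" and "((\<lambda>s. z) has_real_derivative 0) (at s)"
proof -
  show "((\<lambda>z. s / z) has_real_derivative - s / (z * z)) (at z)" using assms by - (rule DERIV_cong, (rule derivative_intros | assumption | simp)+; (simp add: divide_simps; (algebra | simp add: algebra_simps)?)?)
  show "z * (- s / (z * z)) = (s / z) * (- 1)" using assms by simp
  show "((\<lambda>s. s / z) has_real_derivative 1 / z) (at s)" using assms by - (rule DERIV_cong, (rule derivative_intros | assumption | simp)+; (simp add: divide_simps; (algebra | simp add: algebra_simps)?)?)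
  show "(1 / z) * (z) = 1" using assms by simp
  show "((\<lambda>s. z) has_real_derivative 0) (at s)" using assms by - (rule DERIV_cong, (rule derivative_intros | assumption | simp)+; (simp add: divide_simps; (algebra | simp add: algebra_simps)?)?)
qed

lemma argument_z_over_s:
  assumes "z \<noteq> 0" "s \<noteq> 0" "z + s - 1 \<noteq> 0" "1 - z \<noteq> 0" "2 * s + z - 1 \<noteq> (0 :: real)"
  shows "((\<lambda>z. z / s) has_real_derivative 1 / s) (at z)" and "z * (1 / s) = (z / s) * (1)"
    and "((\<lambda>s. z / s) has_real_derivative - z / (s * s)) (at s)" and "(- z / (s * s)) * ((- 1) * (s * s) / z) = 1" and "((\<lambda>s. (- 1) * (s * s) / z) has_real_derivative - 2 * s / z) (at s)"
proof -
  show "((\<lambda>z. z / s) has_real_derivative 1 / s) (at z)" using assms by - (rule DERIV_cong, (rule derivative_intros | assumption | simp)+; (simp add: divide_simps; (algebra | simp add: algebra_simps)?)?)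
  show "z * (1 / s) = (z / s) * (1)" using assms by simp
  show "((\<lambda>s. z / s) has_real_derivative - z / (s * s)) (at s)" using assms by - (rule DERIV_cong, (rule derivative_intros | assumption | simp)+; (simp add: divide_simps; (algebra | simp add: algebra_simps)?)?)
  show "(- z / (s * s)) * ((- 1) * (s * s) / z) = 1" using assms by simp
  show "((\<lambda>s. (- 1) * (s * s) / z) has_real_derivative - 2 * s / z) (at s)" using assms by - (rule DERIV_cong, (rule derivative_intros | assumption | simp)+; (simp add: divide_simps; (algebra | simp add: algebra_simps)?)?)
qed

text \<open>
  The homogeneous equation. Its unknown is \<open>F - Li 3\<close>.
\<close>
locale kummer =
  fixes e0 :: real and G :: "real \<Rightarrow> real"
  assumes golden: "(sqrt 5 - 1) / 2 < e0" "e0 < 1"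
    and meas: "G \<in> borel_measurable (lebesgue_on {..<1})"
    and eq: "\<And>x y. 0 < x \<Longrightarrow> x < y \<Longrightarrow> y < e0 \<Longrightarrow>
      2 * G x + 2 * G y - G (x / y) + 2 * G ((1 - y) / (1 - x)) + 2 * G (x * (1 - y) / (y * (1 - x)))
      - G (x * y) + 2 * G (x * (1 - y) / (x - 1)) + 2 * G ((1 - y) / (y * (x - 1))) - G (x * (1 - y)\<^sup>2 / (y * (1 - x)\<^sup>2)) = 0"
    and cont0: "isCont G 0"
begin

definition N :: "real \<Rightarrow> real" where "N v = G (- v)"

lemma half: "1 / 2 < e0" "0 < e0"
proof -
  have "2 < sqrt 5" by (rule real_less_rsqrt) simp
  then show "1 / 2 < e0" using golden(1) by simp
  then show "0 < e0" by simp
qed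

lemma eq_ty:
  assumes "0 < y" "y < e0" "0 < t" "t < 1" "1 < t + y" and w: "w = t + y - 1"
  shows "2 * G (w / t) + 2 * G (w / y) - G (w / (t * y)) - G (y * w / t) - G (t * w / y) + 2 * N w + 2 * N (t / y) + 2 * G y + 2 * G t = 0"
proof -
  have y: "0 < 1 - y" "y \<noteq> 0" "t \<noteq> 0" using assms golden by auto
  define x where "x = w / t"
  have x: "1 - x = (1 - y) / t" using y by (simp add: x_def w field_simps)
  then have x': "x - 1 = - ((1 - y) / t)" by simp
  have "w < t * y" using mult_pos_pos[of "1 - t" "1 - y"] assms y by (simp add: w algebra_simps)
  then have 1: "0 < x" "x < y" using assms unfolding x_def by (auto simp: divide_less_eq mult.commute)
  have 2: "(1 - y) / (1 - x) = t" "x * (1 - y) / (y * (1 - x)) = w / y" "x * (1 - y) / (x - 1) = - w"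
    "(1 - y) / (y * (x - 1)) = - (t / y)" "x * (1 - y)\<^sup>2 / (y * (1 - x)\<^sup>2) = t * w / y" "x / y = w / (t * y)" "x * y = y * w / t"
    unfolding x x' using y by (auto simp: x_def power2_eq_square divide_simps)
  show ?thesis using eq[OF 1 assms(2)] unfolding 2 by (simp add: N_def x_def)
qed

text \<open>
  The equation solved for \<open>G z\<close>, where \<open>z\<close> is either of the two coordinates. The boolean records which one plays the role of
  \<open>y\<close> and hence has to stay below \<open>e0\<close>; it affects only the argument \<open>-t/y\<close>.
\<close>
lemma eq_zs:
  assumes "0 < z" "z < 1" "0 < s" "s < 1" "1 < z + s" "if b then z < e0 else s < e0"
  shows "G z = - G ((z + s - 1) / z) - G ((z + s - 1) / s) + 1 / 2 * G ((z + s - 1) / (z * s)) + 1 / 2 * G (s * (z + s - 1) / z) + 1 / 2 * G (z * (z + s - 1) / s)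
    - N (z + s - 1) - N (if b then s / z else z / s) - G s"
proof -
  define w where "w = z + s - 1"
  have w: "w = s + z - 1" by (simp add: w_def)
  show ?thesis
  proof (cases b)
    case True
    then show ?thesis
      using eq_ty[OF assms(1) _ assms(3,4) _ w] assms unfolding w_def[symmetric] mult.commute[of s z] by (simp add: add.commute[of s z])
  next
    case False
    then show ?thesis
      using eq_ty[OF assms(3) _ assms(1,2,5) w_def] assms unfolding w_def[symmetric] by simp
  qed
qed

lemma arguments_in_unit_interval:
  assumes "0 < z" "z < 1" "0 < s" "s < 1" "1 < z + (s :: real)"
  shows "(z + s - 1) / z \<in> {0<..<1}" "(z + s - 1) / s \<in> {0<..<1}" "(z + s - 1) / (z * s) \<in> {0<..<1}"
    "s * (z + s - 1) / z \<in> {0<..<1}" "z * (z + s - 1) / s \<in> {0<..<1}"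
proof -
  have "z + s - 1 < z * s" using mult_pos_pos[of "1 - z" "1 - s"] assms by (simp add: algebra_simps)
  then show "(z + s - 1) / (z * s) \<in> {0<..<1}" using assms by simp
  show "(z + s - 1) / z \<in> {0<..<1}" "(z + s - 1) / s \<in> {0<..<1}" using assms by (auto simp: divide_less_eq)
  have "s * (z + s - 1) < 1 * (z + s - 1)" "z * (z + s - 1) < 1 * (z + s - 1)"
    using assms by (intro mult_strict_right_mono; simp)+
  then have "s * (z + s - 1) < z" "z * (z + s - 1) < s" using assms unfolding mult_1 by linarith+
  then show "s * (z + s - 1) / z \<in> {0<..<1}" "z * (z + s - 1) / s \<in> {0<..<1}" using assms by (auto simp: divide_less_eq)
qed

text \<open>
  For \<open>z0 < e0\<close> the point \<open>z\<close> can be the coordinate \<open>y\<close>; otherwise \<open>1 - z0 < e0\<close>, since \<open>e0 > 1/2\<close>, and there is room for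
  \<open>s = y\<close> between \<open>1 - z\<close> and \<open>e0\<close>.
\<close>
lemma local_family:
  assumes "0 < z0" "z0 < 1"
  obtains Z a c b where "open Z" "z0 \<in> Z" "a < c"
    "\<forall>z s. z \<in> Z \<longrightarrow> s \<in> {a..c} \<longrightarrow> 0 < z \<and> z < 1 \<and> 0 < s \<and> s < 1 \<and> 1 < z + s \<and> (if b then z < e0 else s < e0)"
proof -
  \<comment> \<open>A quarter of the available room, so that \<open>z\<close> may move by \<open>r\<close> and \<open>s\<close> may run from \<open>1 - z0 + 2 r\<close> to \<open>1 - z0 + 3 r\<close>.\<close>
  define r where "r = min (min z0 (1 - z0)) (if z0 < e0 then e0 - z0 else e0 - (1 - z0)) / 4"
  have r: "0 < r" "4 * r \<le> z0" "4 * r \<le> 1 - z0" "if z0 < e0 then 4 * r \<le> e0 - z0 else 4 * r \<le> e0 - (1 - z0)"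
    unfolding r_def using assms half by auto
  show ?thesis
  proof (rule that[of "{z0 - r<..<z0 + r}" "1 - z0 + 2 * r" "1 - z0 + 3 * r" "z0 < e0"])
    show "\<forall>z s. z \<in> {z0 - r<..<z0 + r} \<longrightarrow> s \<in> {1 - z0 + 2 * r..1 - z0 + 3 * r} \<longrightarrow>
      0 < z \<and> z < 1 \<and> 0 < s \<and> s < 1 \<and> 1 < z + s \<and> (if z0 < e0 then z < e0 else s < e0)"
      using r assms by (auto split: if_splits)
  qed (use r in auto)
qed

lemma isCont_G:
  assumes z0: "0 < z0" "z0 < 1"
  shows "isCont G z0"
proof -
  obtain Z a c b where Z: "open Z" "z0 \<in> Z" and ac: "a < c"
    and dom: "\<forall>z s. z \<in> Z \<longrightarrow> s \<in> {a..c} \<longrightarrow> 0 < z \<and> z < 1 \<and> 0 < s \<and> s < 1 \<and> 1 < z + s \<and> (if b then z < e0 else s < e0)"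
    by (rule local_family[OF z0])
  define \<phi> where "\<phi> i z s = [(z + s - 1) / z, (z + s - 1) / s, (z + s - 1) / (z * s), s * (z + s - 1) / z, z * (z + s - 1) / s,
    - (z + s - 1), - (if b then s / z else z / s)] ! i" for i :: nat and z s :: real
  define \<phi>s where "\<phi>s i z s = [1 / z, (1 - z) / s\<^sup>2, (1 - z) / (z * s\<^sup>2), (2 * s + z - 1) / z, z * (1 - z) / s\<^sup>2,
    - 1, (if b then - (1 / z) else z / s\<^sup>2)] ! i" for i :: nat and z s :: real
  define cf where "cf i = [-1, -1, 1 / 2, 1 / 2, 1 / 2, -1, -1 :: real] ! i" for i
  define I :: "nat set" where "I = {0, 1, 2, 3, 4, 5, 6}"
  show ?thesis
  proof (rule measurable_solution_isCont[OF meas _ ac Z, where I = I and c = cf and \<phi> = \<phi> and \<phi>s = \<phi>s and K = "\<lambda>s. - G s"])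
    fix z s assume zs: "z \<in> Z" "s \<in> {a..c}"
    note d = dom[rule_format, OF zs]
    show "G z = (\<Sum>i\<in>I. cf i * G (\<phi> i z s)) + - G s"
      using eq_zs[of z s b] d by (simp add: I_def cf_def \<phi>_def N_def)
    fix i assume i: "i \<in> I"
    show "\<phi> i z s < 1" using i arguments_in_unit_interval[of z s] d unfolding I_def
      by (auto simp: \<phi>_def intro: less_trans[of _ 0])
    have nz: "z \<noteq> 0" "s \<noteq> 0" using d by auto
    show "(\<phi> i z has_real_derivative \<phi>s i z s) (at s)"
      using i nz unfolding I_def
      by (elim insertE; cases b; simp add: \<phi>_def[abs_def] \<phi>s_def; auto intro!: derivative_eq_intros simp: power2_eq_square divide_simps; simp add: algebra_simps)
    have "2 * s + z - 1 > 0" using d by linarith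
    then show "\<phi>s i z s \<noteq> 0" using i d unfolding I_def by (elim insertE; cases b; simp add: \<phi>s_def)
  next
    fix i assume i: "i \<in> I"
    have nz: "fst x \<noteq> 0" "snd x \<noteq> 0" if "x \<in> Z \<times> {a..c}" for x using dom that by force+
    show "continuous_on (Z \<times> {a..c}) (\<lambda>(z, s). \<phi> i z s)"
      using i unfolding I_def split_def
      by (elim insertE; cases b; simp add: \<phi>_def; intro continuous_intros; use nz in force)
    show "continuous_on (Z \<times> {a..c}) (\<lambda>(z, s). \<phi>s i z s)"
      using i unfolding I_def split_def
      by (elim insertE; cases b; simp add: \<phi>s_def; intro continuous_intros; use nz in force)
  qed (simp add: I_def)
qed

text \<open>
  Averaging \<open>eq_zs\<close> over \<open>s\<close> expresses \<open>G z\<close> by parameter integrals, each of which gains a derivative.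
\<close>
lemma smooth_step:
  assumes k: "log_smooth k {0<..<1} {0} UNIV (\<lambda>v _. G v)" "log_smooth k {0<..} {0} UNIV (\<lambda>v _. N v)"
  shows "log_smooth (Suc k) {0<..<1} {0} UNIV (\<lambda>v _. G v)"
proof (rule log_smooth_local)
  fix z0 :: real assume "z0 \<in> {0<..<1}"
  then have z0: "0 < z0" "z0 < 1" by auto
  obtain Z a c b where Z: "open Z" "z0 \<in> Z" and ac: "a < c"
    and dom: "\<forall>z s. z \<in> Z \<longrightarrow> s \<in> {a..c} \<longrightarrow> 0 < z \<and> z < 1 \<and> 0 < s \<and> s < 1 \<and> 1 < z + s \<and> (if b then z < e0 else s < e0)"
    by (rule local_family[OF z0])
  have Z0: "0 \<notin> Z" using dom[rule_format, of 0 a] ac by auto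
  have nz: "z \<noteq> 0" "s \<noteq> 0" "z + s - 1 \<noteq> 0" "1 - z \<noteq> 0" "2 * s + z - 1 \<noteq> 0" "0 < z + s - 1" "0 < s" "0 < z" "z < 1" "s < 1"
    if "z \<in> Z" "s \<in> {a..c}" for z s using dom[rule_format, OF that] by auto
  have arg: "(z + s - 1) / z \<in> {0<..<1}" "(z + s - 1) / s \<in> {0<..<1}" "(z + s - 1) / (z * s) \<in> {0<..<1}"
    "s * (z + s - 1) / z \<in> {0<..<1}" "z * (z + s - 1) / s \<in> {0<..<1}" "z + s - 1 \<in> {0<..}" "s / z \<in> {0<..}" "z / s \<in> {0<..}" if "z \<in> Z" "s \<in> {a..c}" for z s
    using arguments_in_unit_interval[of z s] dom[rule_format, OF that] by auto
  have nz': "z * s \<noteq> 0" "s * s \<noteq> 0" "z * z \<noteq> 0" "z * (1 - z) \<noteq> 0" "(2 * s + z - 1) * (2 * s + z - 1) \<noteq> 0" if "z \<in> Z" "s \<in> {a..c}" for z s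
    using nz(1-5)[OF that] by simp_all
  have Y: "{0<..<1::real} = {0<..<1} \<or> {0<..<1::real} = {0<..}" "0 \<notin> {0<..<1::real}"
    "{0<..} = {0<..<1::real} \<or> {0<..} = {0::real<..}" "0 \<notin> {0::real<..}" by auto
  note S = log_smooth_smoothing_local[OF k(1) Y(1,2) less_imp_le[OF ac] Z(1) Z0]
  note T = log_smooth_smoothing_local[OF k(2) Y(3,4) less_imp_le[OF ac] Z(1) Z0]
  define J where "J g \<phi> z = integral {a..c} (\<lambda>s. g (\<phi> z s))" for g :: "real \<Rightarrow> real" and \<phi> :: "real \<Rightarrow> real \<Rightarrow> real" and z
  have zf: "z \<noteq> 0" "1 - z \<noteq> 0" "0 < z" "z < 1" "z \<noteq> 1" if "z \<in> Z" for z using nz[OF that, of a] ac by auto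
  have sf: "s \<noteq> 0" "0 < s" "s < 1" if "s \<in> {a..c}" for s using nz[OF Z(2) that] by auto
  have J0: "log_smooth (Suc k) Z {0} UNIV (\<lambda>z _. J G (\<lambda>z s. (z + s - 1) / z) z)" "\<And>z. z \<in> Z \<Longrightarrow> ((\<lambda>s. G ((z + s - 1) / z)) has_integral J G (\<lambda>z s. (z + s - 1) / z) z) {a..c}"
    unfolding J_def by (intro integrable_integral S[where \<mu> = "\<lambda>z s. (1 - s) / (z + s - 1)" and \<phi>z = "\<lambda>z s. (1 - s) / (z * z)" and \<phi>s = "\<lambda>z s. 1 / z"
      and \<kappa> = "\<lambda>z s. z" and \<kappa>s = "\<lambda>z s. 0"] log_smooth_rational Z0 arg argument_w_over_z[OF nz(1-5)]; (assumption | (rule nz nz'; assumption)))+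
  have J1: "log_smooth (Suc k) Z {0} UNIV (\<lambda>z _. J G (\<lambda>z s. (z + s - 1) / s) z)" "\<And>z. z \<in> Z \<Longrightarrow> ((\<lambda>s. G ((z + s - 1) / s)) has_integral J G (\<lambda>z s. (z + s - 1) / s) z) {a..c}"
    unfolding J_def by (intro integrable_integral S[where \<mu> = "\<lambda>z s. z / (z + s - 1)" and \<phi>z = "\<lambda>z s. 1 / s" and \<phi>s = "\<lambda>z s. (1 - z) / (s * s)"
      and \<kappa> = "\<lambda>z s. s * s / (1 - z)" and \<kappa>s = "\<lambda>z s. 2 * s / (1 - z)"] log_smooth_rational Z0 arg argument_w_over_s[OF nz(1-5)]; (assumption | (rule nz nz'; assumption)))+
  have J2: "log_smooth (Suc k) Z {0} UNIV (\<lambda>z _. J G (\<lambda>z s. (z + s - 1) / (z * s)) z)" "\<And>z. z \<in> Z \<Longrightarrow> ((\<lambda>s. G ((z + s - 1) / (z * s))) has_integral J G (\<lambda>z s. (z + s - 1) / (z * s)) z) {a..c}"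
    unfolding J_def by (intro integrable_integral S[where \<mu> = "\<lambda>z s. (1 - s) / (z + s - 1)" and \<phi>z = "\<lambda>z s. (1 - s) / (z * z * s)" and \<phi>s = "\<lambda>z s. (1 - z) / (z * (s * s))"
      and \<kappa> = "\<lambda>z s. z * (s * s) / (1 - z)" and \<kappa>s = "\<lambda>z s. 2 * z * s / (1 - z)"] log_smooth_rational Z0 arg argument_w_over_zs[OF nz(1-5)]; (assumption | (rule nz nz'; assumption)))+
  have J3: "log_smooth (Suc k) Z {0} UNIV (\<lambda>z _. J G (\<lambda>z s. s * (z + s - 1) / z) z)" "\<And>z. z \<in> Z \<Longrightarrow> ((\<lambda>s. G (s * (z + s - 1) / z)) has_integral J G (\<lambda>z s. s * (z + s - 1) / z) z) {a..c}"
    unfolding J_def by (intro integrable_integral S[where \<mu> = "\<lambda>z s. (1 - s) / (z + s - 1)" and \<phi>z = "\<lambda>z s. s * (1 - s) / (z * z)" and \<phi>s = "\<lambda>z s. (2 * s + z - 1) / z"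
      and \<kappa> = "\<lambda>z s. z / (2 * s + z - 1)" and \<kappa>s = "\<lambda>z s. - 2 * z / ((2 * s + z - 1) * (2 * s + z - 1))"] log_smooth_rational Z0 arg argument_sw_over_z[OF nz(1-5)]; (assumption | (rule nz nz'; assumption)))+
  have J4: "log_smooth (Suc k) Z {0} UNIV (\<lambda>z _. J G (\<lambda>z s. z * (z + s - 1) / s) z)" "\<And>z. z \<in> Z \<Longrightarrow> ((\<lambda>s. G (z * (z + s - 1) / s)) has_integral J G (\<lambda>z s. z * (z + s - 1) / s) z) {a..c}"
    unfolding J_def by (intro integrable_integral S[where \<mu> = "\<lambda>z s. (2 * z + s - 1) / (z + s - 1)" and \<phi>z = "\<lambda>z s. (2 * z + s - 1) / s" and \<phi>s = "\<lambda>z s. z * (1 - z) / (s * s)"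
      and \<kappa> = "\<lambda>z s. s * s / (z * (1 - z))" and \<kappa>s = "\<lambda>z s. 2 * s / (z * (1 - z))"] log_smooth_rational Z0 arg argument_zw_over_s[OF nz(1-5)]; (assumption | (rule nz nz'; assumption)))+
  have w5: "z * 1 = (z + s - 1) * (z / (z + s - 1))" if "z \<in> Z" "s \<in> {a..c}" for z s using nz(3)[OF that] by simp
  have J5: "log_smooth (Suc k) Z {0} UNIV (\<lambda>z _. J N (\<lambda>z s. z + s - 1) z)" "\<And>z. z \<in> Z \<Longrightarrow> ((\<lambda>s. N (z + s - 1)) has_integral J N (\<lambda>z s. z + s - 1) z) {a..c}"
    unfolding J_def by (intro integrable_integral T[where \<mu> = "\<lambda>z s. z / (z + s - 1)" and \<phi>z = "\<lambda>z s. 1" and \<phi>s = "\<lambda>z s. 1"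
      and \<kappa> = "\<lambda>z s. 1" and \<kappa>s = "\<lambda>z s. 0"] log_smooth_rational Z0 arg w5; (assumption | (rule nz nz'; assumption) | (simp; fail) | (auto intro!: derivative_eq_intros; fail)))+
  have J6: "log_smooth (Suc k) Z {0} UNIV (\<lambda>z _. J N (\<lambda>z s. s / z) z)" "\<And>z. z \<in> Z \<Longrightarrow> ((\<lambda>s. N (s / z)) has_integral J N (\<lambda>z s. s / z) z) {a..c}"
    unfolding J_def by (intro integrable_integral T[where \<mu> = "\<lambda>z s. - 1" and \<phi>z = "\<lambda>z s. - s / (z * z)" and \<phi>s = "\<lambda>z s. 1 / z"
      and \<kappa> = "\<lambda>z s. z" and \<kappa>s = "\<lambda>z s. 0"] log_smooth_rational Z0 arg argument_s_over_z[OF nz(1-5)]; (assumption | (rule nz nz'; assumption)))+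
  have J7: "log_smooth (Suc k) Z {0} UNIV (\<lambda>z _. J N (\<lambda>z s. z / s) z)" "\<And>z. z \<in> Z \<Longrightarrow> ((\<lambda>s. N (z / s)) has_integral J N (\<lambda>z s. z / s) z) {a..c}"
    unfolding J_def by (intro integrable_integral T[where \<mu> = "\<lambda>z s. 1" and \<phi>z = "\<lambda>z s. 1 / s" and \<phi>s = "\<lambda>z s. - z / (s * s)"
      and \<kappa> = "\<lambda>z s. (- 1) * (s * s) / z" and \<kappa>s = "\<lambda>z s. - 2 * s / z"] log_smooth_rational Z0 arg argument_z_over_s[OF nz(1-5)]; (assumption | (rule nz nz'; assumption)))+
  define H where "H z = - J G (\<lambda>z s. (z + s - 1) / z) z - J G (\<lambda>z s. (z + s - 1) / s) z + 1 / 2 * J G (\<lambda>z s. (z + s - 1) / (z * s)) z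
    + 1 / 2 * J G (\<lambda>z s. s * (z + s - 1) / z) z + 1 / 2 * J G (\<lambda>z s. z * (z + s - 1) / s) z - J N (\<lambda>z s. z + s - 1) z
    - (if b then J N (\<lambda>z s. s / z) z else J N (\<lambda>z s. z / s) z) - integral {a..c} G" for z
  have KH: "log_smooth (Suc k) Z {0} UNIV (\<lambda>z _. H z)"
  proof -
    have 7: "log_smooth (Suc k) Z {0} UNIV (\<lambda>z _. if b then J N (\<lambda>z s. s / z) z else J N (\<lambda>z s. z / s) z)"
      using J6(1) J7(1) by (cases b) (simp_all del: log_smooth.simps)
    have neg: "log_smooth (Suc k) Z {0} UNIV (\<lambda>z _. - J G (\<lambda>z s. (z + s - 1) / z) z)"
      using log_smooth_scale[OF J0(1) linear_class_UNIV, of "-1"] by (simp del: log_smooth.simps)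
    show ?thesis unfolding H_def by (intro log_smooth_scale log_smooth_add log_smooth_diff neg J0(1) J1(1) J2(1) J3(1) J4(1) J5(1) 7 log_smooth_rational(1) linear_class_UNIV)
  qed
  have GH: "G z = 1 / (c - a) * H z" if z: "z \<in> Z" for z
  proof -
    have GI: "(G has_integral integral {a..c} G) {a..c}"
    proof (intro integrable_integral integrable_continuous_interval continuous_at_imp_continuous_on ballI)
      show "isCont G s" if "s \<in> {a..c}" for s using nz[OF z that] by (intro isCont_G) auto
    qed
    have 7: "((\<lambda>s. N (if b then s / z else z / s)) has_integral (if b then J N (\<lambda>z s. s / z) z else J N (\<lambda>z s. z / s) z)) {a..c}"
      using J6(2)[OF z] J7(2)[OF z] by (cases b) simp_all
    have "((\<lambda>s. - G ((z + s - 1) / z) - G ((z + s - 1) / s) + 1 / 2 * G ((z + s - 1) / (z * s)) + 1 / 2 * G (s * (z + s - 1) / z) + 1 / 2 * G (z * (z + s - 1) / s)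
      - N (z + s - 1) - N (if b then s / z else z / s) - G s) has_integral H z) {a..c}"
      unfolding H_def
      by (intro has_integral_add has_integral_diff has_integral_neg has_integral_mult_right J0(2) J1(2) J2(2) J3(2) J4(2) J5(2) 7 GI z)
    then have "((\<lambda>s. G z) has_integral H z) {a..c}"
      by (rule has_integral_eq[rotated]) (rule eq_zs[symmetric]; use dom[rule_format, OF z] in blast)
    moreover have "((\<lambda>s. G z) has_integral (c - a) * G z) {a..c}"
      using has_integral_const_real[of "G z" a c] ac by simp
    ultimately have "H z = (c - a) * G z" by (rule has_integral_unique)
    then show ?thesis using ac by simp
  qed
  show "\<exists>Z. open Z \<and> z0 \<in> Z \<and> log_smooth (Suc k) Z {0} UNIV (\<lambda>z _. G z)"
    by (intro exI[of _ Z] conjI Z log_smooth_cong[OF log_smooth_scale[OF KH linear_class_UNIV, of "1 / (c - a)"] linear_class_UNIV Z(1)] GH)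
qed auto

lemma e0_square: "1 < e0\<^sup>2 + e0" "(1 - e0) / e0 < e0"
proof -
  have "sqrt 5 < 2 * e0 + 1" using golden(1) by simp
  then have "(sqrt 5)\<^sup>2 < (2 * e0 + 1)\<^sup>2" by (intro power_strict_mono) auto
  then show "1 < e0\<^sup>2 + e0" by (simp add: power2_eq_square algebra_simps)
  then show "(1 - e0) / e0 < e0" using half by (simp add: divide_less_eq power2_eq_square)
qed

text \<open>
  The limit \<open>w \<rightarrow> 0\<close> at a fixed ratio \<open>t/y\<close>. Keeping the ratio fixed makes the argument \<open>-t/y\<close> constant, so that no
  continuity on the negative axis is needed.
\<close>
lemma reflection:
  assumes y: "0 < y" "y < e0"
  shows "2 * (G y + G (1 - y) + N ((1 - y) / y)) + 3 * G 0 = 0"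
proof -
  have y1: "y < 1" "0 < 1 - y" "y \<noteq> 0" "1 - y \<noteq> 0" using y golden by auto
  define f where "f w = 2 * G (w / ((1 - y) * (1 + w))) + 2 * G (w / (y * (1 + w))) - G (w / ((1 - y) * (1 + w) * (y * (1 + w))))
    - G (y * (1 + w) * w / ((1 - y) * (1 + w))) - G ((1 - y) * (1 + w) * w / (y * (1 + w))) + 2 * G (- w) + 2 * N ((1 - y) / y)
    + 2 * G (y * (1 + w)) + 2 * G ((1 - y) * (1 + w))" for w
  have at0: "((\<lambda>w. G (g w)) \<longlongrightarrow> G 0) (at_right 0)" if "(g \<longlongrightarrow> 0) (at_right 0)" for g :: "real \<Rightarrow> real"
    by (rule isCont_tendsto_compose[OF cont0 that])
  have lim: "(f \<longlongrightarrow> 2 * G 0 + 2 * G 0 - G 0 - G 0 - G 0 + 2 * G 0 + 2 * N ((1 - y) / y) + 2 * G (y * (1 + 0)) + 2 * G ((1 - y) * (1 + 0))) (at_right 0)"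
    unfolding f_def
    by (intro tendsto_add tendsto_diff tendsto_mult tendsto_const at0 isCont_tendsto_compose[OF isCont_G] tendsto_ident_at)
      (rule tendsto_eq_intros refl | use y1 y in simp)+
  have "eventually (\<lambda>w. f w = 0) (at_right 0)"
    unfolding eventually_at_right_field
  proof (intro exI[of _ "min (e0 / y - 1) (1 / (1 - y) - 1)"] conjI allI impI)
    show "0 < min (e0 / y - 1) (1 / (1 - y) - 1)" using y y1 by (simp add: less_divide_eq)
    fix w assume w: "0 < w" "w < min (e0 / y - 1) (1 / (1 - y) - 1)"
    have "1 + w < e0 / y" "1 + w < 1 / (1 - y)" using w by auto
    then have b: "y * (1 + w) < e0" "(1 - y) * (1 + w) < 1" using y y1 by (simp_all add: less_divide_eq mult.commute)
    have q: "(1 - y) * (1 + w) / (y * (1 + w)) = (1 - y) / y" using w by simp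
    have p: "0 < y * (1 + w)" "0 < (1 - y) * (1 + w)" using y y1 w by auto
    have e: "w = (1 - y) * (1 + w) + y * (1 + w) - 1" by algebra
    have "1 < (1 - y) * (1 + w) + y * (1 + w)" using w e by linarith
    from eq_ty[OF p(1) b(1) p(2) b(2) this e] show "f w = 0" unfolding q f_def N_def .
  qed
  then have "((\<lambda>w. 0) \<longlongrightarrow> 2 * G 0 + 2 * G 0 - G 0 - G 0 - G 0 + 2 * G 0 + 2 * N ((1 - y) / y) + 2 * G (y * (1 + 0)) + 2 * G ((1 - y) * (1 + 0))) (at_right (0::real))"
    by (rule Lim_transform_eventually[OF lim])
  then have "2 * G 0 + 2 * G 0 - G 0 - G 0 - G 0 + 2 * G 0 + 2 * N ((1 - y) / y) + 2 * G (y * (1 + 0)) + 2 * G ((1 - y) * (1 + 0)) = 0"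
    using tendsto_unique[OF _ tendsto_const] by (metis trivial_limit_at_right_real)
  then show ?thesis by simp
qed

lemma N_large:
  assumes v: "(1 - e0) / e0 < v"
  shows "N v = - (G (1 / (1 + v)) + G (1 * v / (1 + v) ^ 1)) - 3 / 2 * G 0"
proof -
  have "0 < (1 - e0) / e0" using half golden by simp
  then have v0: "0 < v" using v by linarith
  have "1 / (1 + v) < e0" using v v0 half by (simp add: field_simps)
  moreover have "(1 - 1 / (1 + v)) / (1 / (1 + v)) = v" "1 - 1 / (1 + v) = v / (1 + v)" using v0 by (auto simp: field_simps)
  ultimately show ?thesis using reflection[of "1 / (1 + v)"] v0 by simp
qed

text \<open>
  The equation solved for \<open>G (-v)\<close> along the ray \<open>t/y = 1/e0\<close>, where the other negative argument is constant. This ratio is the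
  one for which \<open>y < e0\<close> and \<open>t < 1\<close> hold exactly as long as \<open>v < e0\<close>.
\<close>
lemma N_small:
  assumes v: "0 < v" "v < e0"
  shows "N v = - G ((1 + e0) * v / (1 + v) ^ 1) - G ((1 + e0) / e0 * v / (1 + v) ^ 1) + 1 / 2 * G ((1 + e0)\<^sup>2 / e0 * v / (1 + v) ^ 2)
    + 1 / 2 * G (e0 * v / (1 + v) ^ 0) + 1 / 2 * G (1 / e0 * v / (1 + v) ^ 0) - N (1 / e0) - G (e0 / (1 + e0) * (1 + v)) - G (1 / (1 + e0) * (1 + v))"
    "(1 + e0) * v / (1 + v) ^ 1 \<in> {0<..<1}" "(1 + e0) / e0 * v / (1 + v) ^ 1 \<in> {0<..<1}" "(1 + e0)\<^sup>2 / e0 * v / (1 + v) ^ 2 \<in> {0<..<1}"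
    "e0 * v / (1 + v) ^ 0 \<in> {0<..<1}" "1 / e0 * v / (1 + v) ^ 0 \<in> {0<..<1}" "e0 / (1 + e0) * (1 + v) \<in> {0<..<1}" "1 / (1 + e0) * (1 + v) \<in> {0<..<1}"
proof -
  have e: "0 < e0" "e0 < 1" "e0 \<noteq> 0" "1 + e0 \<noteq> 0" "1 + v \<noteq> 0" "0 < 1 + e0" "0 < 1 + v" using half golden v by auto
  define y t where "y = e0 / (1 + e0) * (1 + v)" and "t = 1 / (1 + e0) * (1 + v)"
  have "y < e0 / (1 + e0) * (1 + e0)" unfolding y_def using v e by (intro mult_strict_left_mono) auto
  moreover have "e0 / (1 + e0) * (1 + e0) = e0" "1 / (1 + e0) * (1 + e0) = 1" using e by auto
  ultimately have y: "0 < y" "y < e0" and t1: "1 / (1 + e0) * (1 + e0) = 1" unfolding y_def using e by (simp, linarith, linarith)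
  have "t < 1 / (1 + e0) * (1 + e0)" unfolding t_def using v e by (intro mult_strict_left_mono) auto
  then have t: "0 < t" "t < 1" unfolding t1 unfolding t_def using e by (simp, linarith)
  have ty: "t + y = 1 + v"
  proof -
    have "1 / (1 + e0) + e0 / (1 + e0) = 1" using e by (simp flip: add_divide_distrib)
    then show ?thesis unfolding t_def y_def by (metis distrib_right mult_1)
  qed
  have q: "v / t = (1 + e0) * v / (1 + v) ^ 1" "v / y = (1 + e0) / e0 * v / (1 + v) ^ 1" "v / (t * y) = (1 + e0)\<^sup>2 / e0 * v / (1 + v) ^ 2"
    "y * v / t = e0 * v / (1 + v) ^ 0" "t * v / y = 1 / e0 * v / (1 + v) ^ 0" "t / y = 1 / e0"
    unfolding t_def y_def using e by (auto simp: power2_eq_square mult_ac)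
  have eqn: "2 * G (v / t) + 2 * G (v / y) - G (v / (t * y)) - G (y * v / t) - G (t * v / y) + 2 * N v + 2 * N (t / y) + 2 * G y + 2 * G t = 0"
    by (rule eq_ty[OF y t]) (use ty v in auto)
  show "N v = - G ((1 + e0) * v / (1 + v) ^ 1) - G ((1 + e0) / e0 * v / (1 + v) ^ 1) + 1 / 2 * G ((1 + e0)\<^sup>2 / e0 * v / (1 + v) ^ 2)
    + 1 / 2 * G (e0 * v / (1 + v) ^ 0) + 1 / 2 * G (1 / e0 * v / (1 + v) ^ 0) - N (1 / e0) - G (e0 / (1 + e0) * (1 + v)) - G (1 / (1 + e0) * (1 + v))"
    using eqn unfolding q y_def[symmetric] t_def[symmetric] by linarith
  have y1: "y < 1" using y e by linarith
  have "t + y - 1 = v" using ty by simp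
  then show "(1 + e0) * v / (1 + v) ^ 1 \<in> {0<..<1}" "(1 + e0) / e0 * v / (1 + v) ^ 1 \<in> {0<..<1}" "(1 + e0)\<^sup>2 / e0 * v / (1 + v) ^ 2 \<in> {0<..<1}"
    "e0 * v / (1 + v) ^ 0 \<in> {0<..<1}" "1 / e0 * v / (1 + v) ^ 0 \<in> {0<..<1}"
    using arguments_in_unit_interval[OF t y(1) y1] v ty unfolding q[symmetric] by auto
  show "e0 / (1 + e0) * (1 + v) \<in> {0<..<1}" "1 / (1 + e0) * (1 + v) \<in> {0<..<1}"
    using y t y1 unfolding y_def[symmetric] t_def[symmetric] by auto
qed

lemma deriv_scaled_one_plus: "1 + v \<noteq> 0 \<Longrightarrow> v \<noteq> 0 \<Longrightarrow> ((\<lambda>v. l * (1 + v)) has_real_derivative l * (1 + v) * (v / (1 + v)) / v) (at v)"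
  by (auto intro!: derivative_eq_intros)

text \<open>
  The two representations of \<open>N\<close> by values of \<open>G\<close> on \<open>]0, 1[\<close> cover the whole half-line since \<open>(1 - e0)/e0 < e0\<close>.
\<close>
lemma smooth_N:
  assumes k: "log_smooth k {0<..<1} {0} UNIV (\<lambda>v _. G v)"
  shows "log_smooth k {0<..} {0} UNIV (\<lambda>v _. N v)"
proof (rule log_smooth_local)
  fix v0 :: real assume v0: "v0 \<in> {0<..}"
  have Z0: "0 \<notin> {0<..<1::real}" by simp
  have q: "log_smooth k Z {0} UNIV (\<lambda>v _. v / (1 + v))" if "open Z" "Z \<subseteq> {0<..}" for Z
    by (rule log_smooth_mono_set[OF log_smooth_quotient_one_plus[OF that(2,1)]]) auto
  show "\<exists>Z. open Z \<and> v0 \<in> Z \<and> log_smooth k Z {0} UNIV (\<lambda>v _. N v)"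
  proof (cases "v0 < e0")
    case True
    have Z: "open {0<..<e0}" "{0<..<e0} \<subseteq> {0<..}" by auto
    have ray: "log_smooth k {0<..<e0} {0} UNIV (\<lambda>v _. G (\<rho> * v / (1 + v) ^ j))" if "\<And>v. v \<in> {0<..<e0} \<Longrightarrow> \<rho> * v / (1 + v) ^ j \<in> {0<..<1}" for \<rho> j
      by (rule log_smooth_ray[OF k Z0 Z that linear_class_UNIV]) auto
    have lin: "log_smooth k {0<..<e0} {0} UNIV (\<lambda>v _. G (l * (1 + v)))" if "\<And>v. v \<in> {0<..<e0} \<Longrightarrow> l * (1 + v) \<in> {0<..<1}" for l
      by (rule log_smooth_compose1[OF k Z0 that deriv_scaled_one_plus q[OF Z] linear_class_UNIV]) auto
    have "log_smooth k {0<..<e0} {0} UNIV (\<lambda>v _. N v)"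
    proof (rule log_smooth_cong[OF _ linear_class_UNIV Z(1)])
      have neg: "log_smooth k {0<..<e0} {0} UNIV (\<lambda>v _. - G ((1 + e0) * v / (1 + v) ^ 1))"
        using log_smooth_scale[OF ray[OF N_small(2)] linear_class_UNIV, of "-1"] by (simp del: log_smooth.simps)
      show "log_smooth k {0<..<e0} {0} UNIV (\<lambda>v _. - G ((1 + e0) * v / (1 + v) ^ 1) - G ((1 + e0) / e0 * v / (1 + v) ^ 1) + 1 / 2 * G ((1 + e0)\<^sup>2 / e0 * v / (1 + v) ^ 2)
        + 1 / 2 * G (e0 * v / (1 + v) ^ 0) + 1 / 2 * G (1 / e0 * v / (1 + v) ^ 0) - N (1 / e0) - G (e0 / (1 + e0) * (1 + v)) - G (1 / (1 + e0) * (1 + v)))"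
        by (intro log_smooth_diff log_smooth_add log_smooth_scale log_smooth_rational(1) neg linear_class_UNIV ray lin N_small) auto
    qed (use N_small(1) in auto)
    then show ?thesis using True v0 by (intro exI[of _ "{0<..<e0}"]) (auto simp del: log_smooth.simps)
  next
    case False
    define Z where "Z = {(1 - e0) / e0<..}"
    have p: "0 < (1 - e0) / e0" using half golden by simp
    have Z: "open Z" "Z \<subseteq> {0<..}" using p by (auto simp: Z_def)
    have pos: "0 < v" if "v \<in> Z" for v using that Z by auto
    have 1: "log_smooth k Z {0} UNIV (\<lambda>v _. G (1 * v / (1 + v) ^ 1))"
      by (rule log_smooth_ray[OF k Z0 Z _ linear_class_UNIV]) (use pos in \<open>auto simp: add_pos_pos\<close>)
    have 2: "log_smooth k Z {0} UNIV (\<lambda>v _. G (1 / (1 + v)))"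
    proof (rule log_smooth_compose1[OF k Z0 _ _ log_smooth_scale[OF q[OF Z] linear_class_UNIV, of "-1"] linear_class_UNIV])
      fix v assume "v \<in> Z"
      then have v: "0 < v" "1 + v \<noteq> 0" using pos[of v] by auto
      show "1 / (1 + v) \<in> {0<..<1}" using v by simp
      show "((\<lambda>v. 1 / (1 + v)) has_real_derivative 1 / (1 + v) * (- 1 * (v / (1 + v))) / v) (at v)"
        using v by (auto intro!: derivative_eq_intros)
    qed auto
    have "log_smooth k Z {0} UNIV (\<lambda>v _. N v)"
    proof (rule log_smooth_cong[OF log_smooth_diff[OF log_smooth_scale[OF log_smooth_add[OF 2 1 linear_class_UNIV] linear_class_UNIV, of "-1"] log_smooth_rational(1)[of _ _ _ "3 / 2 * G 0"] linear_class_UNIV] linear_class_UNIV Z(1)])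
      show "N v = - 1 * (G (1 / (1 + v)) + G (1 * v / (1 + v) ^ 1)) - 3 / 2 * G 0" if "v \<in> Z" for v
        using N_large[of v] that by (simp add: Z_def)
    qed
    moreover have "v0 \<in> Z" using False e0_square(2) by (simp add: Z_def)
    ultimately show ?thesis using Z by blast
  qed
qed auto

lemma smooth: "log_smooth k {0<..<1} {0} UNIV (\<lambda>v _. G v)" "log_smooth k {0<..} {0} UNIV (\<lambda>v _. N v)"
proof -
  show "log_smooth k {0<..<1} {0} UNIV (\<lambda>v _. G v)" for k
  proof (induction k)
    case 0 show ?case unfolding log_smooth_0_iff_isCont[OF open_greaterThanLessThan] using isCont_G by simp
  next
    case (Suc k) then show ?case by (intro smooth_step smooth_N)
  qed
  then show "log_smooth k {0<..} {0} UNIV (\<lambda>v _. N v)" by (rule smooth_N)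
qed

end

section \<open>Estimates near zero\<close>

lemma big_O_id_le_powr:
  assumes "Z \<subseteq> {0<..<1}" "\<sigma> \<le> 1"
  shows "big_O Z S (\<lambda>z. z) \<subseteq> big_O Z S (\<lambda>z. z powr \<sigma>)"
proof (intro subsetI, elim big_O_mono[where K = 1])
  fix z assume "z \<in> Z"
  then have z: "0 < z" "z < 1" using assms by auto
  then have "z powr 1 \<le> z powr \<sigma>" by (intro powr_mono') (use assms in auto)
  then show "\<bar>z\<bar> \<le> 1 * z powr \<sigma>" using z by simp
qed

lemma powr_Ob_compose:
  assumes "g \<in> big_O {0<..<\<delta>} {0} (\<lambda>z. z powr \<sigma>)" "0 \<le> \<sigma>" "0 \<le> M"
    and "\<And>z. z \<in> Z \<Longrightarrow> 0 < z" "\<And>z. z \<in> Z \<Longrightarrow> \<phi> z \<in> {0<..<\<delta>}" "\<And>z. z \<in> Z \<Longrightarrow> \<phi> z \<le> M * z"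
  shows "(\<lambda>z s. g (\<phi> z) 0) \<in> big_O Z {0} (\<lambda>z. z powr \<sigma>)"
proof -
  obtain D where D: "\<forall>v\<in>{0<..<\<delta>}. \<forall>s\<in>{0}. \<bar>g v s\<bar> \<le> D * v powr \<sigma>" using assms(1) unfolding big_O_def by blast
  show ?thesis
  proof (rule ObI[where C = "\<bar>D\<bar> * M powr \<sigma>"])
    fix z s :: real assume z: "z \<in> Z"
    have "\<bar>g (\<phi> z) 0\<bar> \<le> D * \<phi> z powr \<sigma>" using D assms(5)[OF z] by blast
    also have "\<dots> \<le> \<bar>D\<bar> * (M * z) powr \<sigma>"
      using assms(5,6)[OF z] assms(2) by (intro mult_mono powr_mono2) auto
    also have "\<dots> = \<bar>D\<bar> * M powr \<sigma> * z powr \<sigma>" using assms(3) assms(4)[OF z] by (simp add: powr_mult)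
    finally show "\<bar>g (\<phi> z) 0\<bar> \<le> \<bar>D\<bar> * M powr \<sigma> * z powr \<sigma>" .
  qed
qed

lemma log_deriv_diff_const: "log_deriv (\<lambda>v. f v - c) = log_deriv f"
proof -
  have "((\<lambda>v. f v - c) has_real_derivative D) (at x) \<longleftrightarrow> (f has_real_derivative D) (at x)" for D x
    using DERIV_diff[of "\<lambda>v. f v - c" D x UNIV "\<lambda>v. - c" 0] DERIV_diff[of f D x UNIV "\<lambda>v. c" 0] by auto
  then show ?thesis by (simp add: log_deriv_def[abs_def] deriv_def)
qed

context kummer
begin

text \<open>
  Centring at the value \<open>G 0\<close> makes both functions small near 0; the constants in all relations below cancel.
\<close>
definition h :: "real \<Rightarrow> real" where "h v = G v - G 0"
definition hn :: "real \<Rightarrow> real" where "hn v = N v - G 0"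

lemma N_small_centred:
  assumes v: "0 < v" "v < e0"
  shows "hn v = - h ((1 + e0) * v / (1 + v) ^ 1) - h ((1 + e0) / e0 * v / (1 + v) ^ 1) + 1 / 2 * h ((1 + e0)\<^sup>2 / e0 * v / (1 + v) ^ 2)
    + 1 / 2 * h (e0 * v / (1 + v) ^ 0) + 1 / 2 * h (1 / e0 * v / (1 + v) ^ 0)
    - (G (e0 / (1 + e0) * (1 + v)) - G (e0 / (1 + e0))) - (G (1 / (1 + e0) * (1 + v)) - G (1 / (1 + e0)))"
proof -
  have e: "0 < e0" "e0 \<noteq> 0" "1 + e0 \<noteq> 0" "0 < 1 + e0" using half by auto
  have "1 - e0 / (1 + e0) = 1 / (1 + e0)" "(1 - e0 / (1 + e0)) / (e0 / (1 + e0)) = 1 / e0" using e by (auto simp: field_simps)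
  moreover have "e0 / (1 + e0) < e0" "0 < e0 / (1 + e0)" using e by (auto simp: divide_less_eq)
  ultimately have "2 * (G (e0 / (1 + e0)) + G (1 / (1 + e0)) + N (1 / e0)) + 3 * G 0 = 0"
    using reflection[of "e0 / (1 + e0)"] by simp
  moreover have "- a1 - a2 + 1 / 2 * a3 + 1 / 2 * a4 + 1 / 2 * a5 - n - b1 - b2 - c
      = - (a1 - c) - (a2 - c) + 1 / 2 * (a3 - c) + 1 / 2 * (a4 - c) + 1 / 2 * (a5 - c) - (b1 - x) - (b2 - y)"
    if "2 * (x + y + n) + 3 * c = 0" for a1 a2 a3 a4 a5 b1 b2 c n x y :: real using that by argo
  ultimately show ?thesis unfolding h_def hn_def N_small(1)[OF v] by blast
qed

text \<open>
  Bounds pass from the positive to the negative side through \<open>N_small\<close>: five arguments are comparable to \<open>v\<close>, and the other two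
  terms are differences of order \<open>v\<close>.
\<close>
lemma near_N:
  assumes sg: "0 \<le> \<sigma>" "\<sigma> \<le> 1" and del: "0 < \<delta>"
    and k: "log_smooth k {0<..<\<delta>} {0} (big_O {0<..<\<delta>} {0} (\<lambda>z. z powr \<sigma>)) (\<lambda>v _. h v)"
  shows "\<exists>\<delta>'>0. log_smooth k {0<..<\<delta>'} {0} (big_O {0<..<\<delta>'} {0} (\<lambda>z. z powr \<sigma>)) (\<lambda>v _. hn v)"
proof -
  have e: "0 < e0" "e0 < 1" "1 / 2 < e0" "0 < 1 + e0" "1 + e0 \<noteq> 0" using half golden by auto
  define \<delta>' where "\<delta>' = min (\<delta> / 8) (1 / 12)"
  define Z where "Z = {0<..<\<delta>'}"
  have d': "0 < \<delta>'" "8 * \<delta>' \<le> \<delta>" "12 * \<delta>' \<le> 1" using del by (auto simp: \<delta>'_def)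
  have Z: "open Z" "Z \<subseteq> {0<..}" "Z \<subseteq> {0<..<1}" "0 \<notin> Z" using d' by (auto simp: Z_def)
  have zb: "0 < z" "8 * z < \<delta>" "12 * z < 1" "z < e0" if "z \<in> Z" for z using that d' e by (auto simp: Z_def)
  have ray: "log_smooth k Z {0} (big_O Z {0} (\<lambda>z. z powr \<sigma>)) (\<lambda>v _. h (\<rho> * v / (1 + v) ^ j))" if r: "0 < \<rho>" "\<rho> \<le> 8" for \<rho> j
  proof -
    have b: "\<rho> * v / (1 + v) ^ j \<le> 8 * v" "\<rho> * v / (1 + v) ^ j \<in> {0<..<\<delta>}" if "v \<in> Z" for v
    proof -
      note v = zb[OF that]
      have "1 \<le> (1 + v) ^ j" using v by (intro one_le_power) auto
      then have "\<rho> * v / (1 + v) ^ j \<le> \<rho> * v / 1" using v r by (intro divide_left_mono) auto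
      also have "\<dots> \<le> 8 * v" using v r by simp
      finally show 1: "\<rho> * v / (1 + v) ^ j \<le> 8 * v" .
      have "0 < \<rho> * v / (1 + v) ^ j" using v r by simp
      then show "\<rho> * v / (1 + v) ^ j \<in> {0<..<\<delta>}" using 1 v by simp
    qed
    show ?thesis
    proof (rule log_smooth_ray[OF k _ Z(1,2) b(2) linear_class_Ob])
      show "(\<lambda>z s. g (\<rho> * z / (1 + z) ^ j) 0) \<in> big_O Z {0} (\<lambda>z. z powr \<sigma>)" if "g \<in> big_O {0<..<\<delta>} {0} (\<lambda>z. z powr \<sigma>)" for g
        by (rule powr_Ob_compose[OF that sg(1), where M = 8]) (use b zb in auto)
      show "(\<lambda>z s. f z s * m z s) \<in> big_O Z {0} (\<lambda>z. z powr \<sigma>)" if "f \<in> big_O Z {0} (\<lambda>z. z powr \<sigma>)" "m \<in> big_O Z {0} (\<lambda>_. 1)" for f m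
        using big_O_mult[OF that] by simp
    qed simp
  qed
  have lin: "log_smooth k Z {0} (big_O Z {0} (\<lambda>z. z powr \<sigma>)) (\<lambda>v _. G (l * (1 + v)) - G l)" if l: "1 / 3 \<le> l" "l \<le> 2 / 3" for l
  proof -
    have "log_smooth (Suc k) Z {0} (big_O Z {0} (\<lambda>z. z)) (\<lambda>v (s::real). G (l * (1 + v)) - G l)"
    proof (rule log_smooth_difference[where \<phi> = "\<lambda>v _. l * (1 + v)" and ?\<phi>0.0 = "\<lambda>_. l" and \<mu> = "\<lambda>v _. v / (1 + v)" and ?k1.0 = "1 / 4" and ?k2.0 = "3 / 4" and C = 1,
          OF smooth(1) open_greaterThanLessThan _ _ Z(1,3)])
      fix z assume z: "z \<in> Z"
      have "0 < l * z" "l * z \<le> 2 / 3 * z" using zb[OF z] l by auto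
      then have "1 / 4 < l * (1 + z)" "l * (1 + z) < 3 / 4" "l * (1 + z) - l \<le> z" "0 < l * (1 + z) - l"
        using zb[OF z] l unfolding distrib_left by linarith+
      then show "l * (1 + z) \<in> {1 / 4<..<3 / 4}" "\<bar>l * (1 + z) - l\<bar> \<le> 1 * z" by auto
      show "((\<lambda>v. l * (1 + v)) has_real_derivative l * (1 + z) * (z / (1 + z)) / z) (at z)"
        by (rule deriv_scaled_one_plus) (use zb[OF z] in auto)
    next
      have id: "log_smooth k Z {0} (big_O Z {0} (\<lambda>z. z)) (\<lambda>z s. z)"
        using Z by (intro log_smooth_id ObI[where C = 1]; force)
      have "log_smooth k Z {0} (big_O Z {0} (\<lambda>z. z)) (\<lambda>z s. z * (1 / (1 + z)))"
        by (rule log_smooth_mult[OF id log_smooth_inverse_one_plus[OF Z(2)] linear_class_Ob]) (use big_O_mult in fastforce)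
      then show "log_smooth k Z {0} (big_O Z {0} (\<lambda>z. z)) (\<lambda>z _. z / (1 + z))" by simp
    qed (use l in \<open>auto simp: split_def intro!: continuous_intros\<close>)
    from log_smooth_mono_set[OF log_smooth_SucD[OF this] _ _ big_O_id_le_powr[OF Z(3) sg(2)]] show ?thesis by simp
  qed
  have neg: "log_smooth k Z {0} (big_O Z {0} (\<lambda>z. z powr \<sigma>)) (\<lambda>v _. - h ((1 + e0) * v / (1 + v) ^ 1))"
    using log_smooth_scale[OF ray[of "1 + e0" 1] linear_class_Ob, of "-1"] e by (simp del: log_smooth.simps)
  have r: "0 < (1 + e0) / e0" "(1 + e0) / e0 \<le> 8" "0 < (1 + e0)\<^sup>2 / e0" "(1 + e0)\<^sup>2 / e0 \<le> 8" "0 < 1 / e0" "1 / e0 \<le> 8" "0 < e0" "e0 \<le> 8"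
  proof -
    have "(1 + e0)\<^sup>2 \<le> 2\<^sup>2" using e by (intro power_mono) auto
    then show "(1 + e0)\<^sup>2 / e0 \<le> 8" using e by (simp add: divide_le_eq)
  qed (use e in \<open>auto simp: divide_le_eq\<close>)
  have l: "1 / 3 \<le> e0 / (1 + e0)" "e0 / (1 + e0) \<le> 2 / 3" "1 / 3 \<le> 1 / (1 + e0)" "1 / (1 + e0) \<le> 2 / 3"
    using e by (auto simp: divide_le_eq le_divide_eq)
  have "log_smooth k Z {0} (big_O Z {0} (\<lambda>z. z powr \<sigma>)) (\<lambda>v _. hn v)"
  proof (rule log_smooth_cong[OF _ linear_class_Ob Z(1)])
    show "log_smooth k Z {0} (big_O Z {0} (\<lambda>z. z powr \<sigma>)) (\<lambda>v _. - h ((1 + e0) * v / (1 + v) ^ 1) - h ((1 + e0) / e0 * v / (1 + v) ^ 1) + 1 / 2 * h ((1 + e0)\<^sup>2 / e0 * v / (1 + v) ^ 2)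
      + 1 / 2 * h (e0 * v / (1 + v) ^ 0) + 1 / 2 * h (1 / e0 * v / (1 + v) ^ 0)
      - (G (e0 / (1 + e0) * (1 + v)) - G (e0 / (1 + e0))) - (G (1 / (1 + e0) * (1 + v)) - G (1 / (1 + e0))))"
      by (rule log_smooth_diff log_smooth_add log_smooth_scale neg linear_class_Ob ray lin r l)+
  qed (use N_small_centred zb in blast)
  then show ?thesis using d'(1) unfolding Z_def by blast
qed

text \<open>
  The equation in the original coordinates \<open>x = z\<close>, \<open>y = s\<close>. Five arguments are comparable to \<open>z\<close>; the other ones approach
  \<open>s\<close>, \<open>1 - s\<close> and \<open>1 - 1/s\<close>, whose contributions cancel by the reflection, up to differences of order \<open>z\<close>.
\<close>
lemma small_argument_equation:
  assumes z: "0 < z" "z < 1 / 8" and s: "s \<in> {1 / 4..1 / 2}"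
  shows "h z = 1 / 2 * h (z * (1 / s) / (1 - z) ^ 0) - h (z * (1 / s - 1) / (1 - z) ^ 1) + 1 / 2 * h (z * s / (1 - z) ^ 0)
    - hn (z * (1 - s) / (1 - z) ^ 1) + 1 / 2 * h (z * (1 / s - 2 + s) / (1 - z) ^ 2)
    - (G ((1 - s) / (1 - z)) - G (1 - s)) - (N ((1 - s) / s / (1 - z)) - N ((1 - s) / s))"
proof -
  have s': "0 < s" "s < e0" "z < s" "s \<noteq> 0" "1 - z \<noteq> 0" using s z half by auto
  have q: "z * (1 - s) / (s * (1 - z)) = z * (1 / s - 1) / (1 - z) ^ 1" "z * (1 - s) / (z - 1) = - (z * (1 - s) / (1 - z) ^ 1)"
    "(1 - s) / (s * (z - 1)) = - ((1 - s) / s / (1 - z))" "z * (1 - s)\<^sup>2 / (s * (1 - z)\<^sup>2) = z * (1 / s - 2 + s) / (1 - z) ^ 2"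
  proof -
    have m: "a / (z - 1) = - (a / (1 - z))" for a by (metis minus_diff_eq minus_divide_right)
    show "z * (1 - s) / (z - 1) = - (z * (1 - s) / (1 - z) ^ 1)" using m by simp
    show "(1 - s) / (s * (z - 1)) = - ((1 - s) / s / (1 - z))" using m[of "(1 - s) / s"] by simp
    have "(1 - s) / s = 1 / s - 1" using s' by (simp add: field_simps)
    moreover have "z * (1 - s) / (s * (1 - z)) = z * ((1 - s) / s) / (1 - z) ^ 1" by simp
    ultimately show "z * (1 - s) / (s * (1 - z)) = z * (1 / s - 1) / (1 - z) ^ 1" by (simp only:)
    have "(1 - s)\<^sup>2 / s = 1 / s - 2 + s" using s' by (simp add: field_simps power2_eq_square)
    moreover have "z * (1 - s)\<^sup>2 / (s * (1 - z)\<^sup>2) = z * ((1 - s)\<^sup>2 / s) / (1 - z) ^ 2" by simp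
    ultimately show "z * (1 - s)\<^sup>2 / (s * (1 - z)\<^sup>2) = z * (1 / s - 2 + s) / (1 - z) ^ 2" by (simp only:)
  qed
  have "2 * G z + 2 * G s - G (z * (1 / s) / (1 - z) ^ 0) + 2 * G ((1 - s) / (1 - z)) + 2 * G (z * (1 / s - 1) / (1 - z) ^ 1) - G (z * s / (1 - z) ^ 0)
    + 2 * N (z * (1 - s) / (1 - z) ^ 1) + 2 * N ((1 - s) / s / (1 - z)) - G (z * (1 / s - 2 + s) / (1 - z) ^ 2) = 0"
    using eq[OF z(1) s'(3,2)] unfolding q by (simp add: N_def)
  moreover have "a - c = 1 / 2 * (a1 - c) - (a2 - c) + 1 / 2 * (a3 - c) - (a4 - c) + 1 / 2 * (a5 - c) - (m - m') - (n - n')"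
    if "2 * a + 2 * b - a1 + 2 * m + 2 * a2 - a3 + 2 * a4 + 2 * n - a5 = 0" "2 * (b + m' + n') + 3 * c = 0"
    for a b c a1 a2 a3 a4 a5 m m' n n' :: real using that by argo
  ultimately show ?thesis using reflection[OF s'(1,2)] unfolding h_def hn_def by blast
qed

lemma near_difference:
  fixes g r :: "real \<Rightarrow> real"
  assumes sg: "\<sigma> \<le> 1" and g: "\<And>k. log_smooth k {0<..<u} {0} UNIV (\<lambda>v _. g v)"
    and r: "\<And>s. s \<in> {1 / 4..1 / 2} \<Longrightarrow> 1 / 2 \<le> r s \<and> r s \<le> 3 * q" "continuous_on {1 / 4..1 / 2} r" and q: "1 / 6 \<le> q" "4 * q \<le> u" "q \<le> 1"
  shows "log_smooth k {0<..<1 / 8} {0} (big_O {0<..<1 / 8} {0} (\<lambda>z. z powr \<sigma>)) (\<lambda>z _. integral {1 / 4..1 / 2} (\<lambda>s. g (r s / (1 - z)) - g (r s)))"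
    and "\<And>z. z \<in> {0<..<1 / 8} \<Longrightarrow> (\<lambda>s. g (r s / (1 - z)) - g (r s)) integrable_on {1 / 4..1 / 2}"
proof -
  define Z where "Z = {0<..<1 / 8 :: real}"
  have Z: "open Z" "Z \<subseteq> {0<..<1}" "0 \<notin> Z" "Z \<subseteq> {0<..1 / 2}" by (auto simp: Z_def)
  have zb: "0 < z" "z < 1 / 8" "1 - z \<noteq> 0" "0 < 1 - z" if "z \<in> Z" for z using that by (auto simp: Z_def)
  have bd: "1 / 2 \<le> r s / (1 - z)" "r s / (1 - z) < 7 / 2 * q" "\<bar>r s / (1 - z) - r s\<bar> \<le> 4 * z" if "z \<in> Z" "s \<in> {1 / 4..1 / 2}" for z s
  proof -
    note z = zb[OF that(1)] and rs = r(1)[OF that(2)]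
    define e where "e = z * r s / (1 - z)"
    have 1: "r s / (1 - z) = r s + e" using z by (simp add: e_def field_simps)
    have 2: "0 \<le> e" unfolding e_def using z rs by (intro divide_nonneg_pos mult_nonneg_nonneg) auto
    have "e \<le> z * (3 * q) / (7 / 8)" unfolding e_def using z rs by (intro frac_le mult_left_mono) auto
    then have 3: "e \<le> 24 / 7 * (z * q)" by simp
    have 4: "z * q \<le> 1 / 8 * q" "z * q \<le> z * 1" using z q by (intro mult_right_mono mult_left_mono; simp)+
    have "e \<le> 4 * z" "r s + e < 7 / 2 * q" "1 / 2 \<le> r s + e" using 2 3 4 rs z q by linarith+
    then show "1 / 2 \<le> r s / (1 - z)" "r s / (1 - z) < 7 / 2 * q" "\<bar>r s / (1 - z) - r s\<bar> \<le> 4 * z"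
      unfolding 1 using 2 by auto
  qed
  have K: "log_smooth (Suc k) Z {1 / 4..1 / 2} (big_O Z {1 / 4..1 / 2} (\<lambda>z. z)) (\<lambda>z s. g (r s / (1 - z)) - g (r s))"
  proof (rule log_smooth_difference[where \<phi> = "\<lambda>z s. r s / (1 - z)" and ?\<phi>0.0 = r and \<mu> = "\<lambda>z _. z / (1 - z)" and ?k1.0 = "1 / 4" and ?k2.0 = "7 / 2 * q" and C = 4,
        OF g open_greaterThanLessThan _ _ Z(1,2) _ _ _ _ r(2) _ log_smooth_quotient_one_minus[OF Z(4)]])
    show "{1 / 4..7 / 2 * q} \<subseteq> {0<..<u}" using q by auto
    fix z s :: real assume z: "z \<in> Z" and s: "s \<in> {1 / 4..1 / 2}"
    have "1 / 4 < r s / (1 - z)" using bd(1)[OF z s] by linarith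
    then show "r s / (1 - z) \<in> {1 / 4<..<7 / 2 * q}" using bd(2)[OF z s] by simp
    show "\<bar>r s / (1 - z) - r s\<bar> \<le> 4 * z" by (rule bd(3)[OF z s])
    show "((\<lambda>z. r s / (1 - z)) has_real_derivative r s / (1 - z) * (z / (1 - z)) / z) (at z)"
      using zb[OF z] by (auto intro!: derivative_eq_intros)
  next
    show "r s \<in> {1 / 4<..<7 / 2 * q}" if "s \<in> {1 / 4..1 / 2}" for s using r(1)[OF that] q by auto
    have "continuous_on (Z \<times> {1 / 4..1 / 2}) (\<lambda>x. r (snd x) / (1 - fst x))"
      by (intro continuous_intros continuous_on_compose2[OF r(2)]) (use zb in force)+
    then show "continuous_on (Z \<times> {1 / 4..1 / 2}) (\<lambda>(z, s). r s / (1 - z))" by (simp add: split_def)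
  qed simp
  have K': "log_smooth k Z {1 / 4..1 / 2} (big_O Z {1 / 4..1 / 2} (\<lambda>z. z powr \<sigma>)) (\<lambda>z s. g (r s / (1 - z)) - g (r s))"
    by (rule log_smooth_mono_set[OF log_smooth_SucD[OF K] _ _ big_O_id_le_powr[OF Z(2) sg]]) auto
  show "log_smooth k {0<..<1 / 8} {0} (big_O {0<..<1 / 8} {0} (\<lambda>z. z powr \<sigma>)) (\<lambda>z _. integral {1 / 4..1 / 2} (\<lambda>s. g (r s / (1 - z)) - g (r s)))"
    unfolding Z_def[symmetric] by (rule log_smooth_integral[OF K' Z(1,3) big_O_integral]) auto
  show "(\<lambda>s. g (r s / (1 - z)) - g (r s)) integrable_on {1 / 4..1 / 2}" if "z \<in> {0<..<1 / 8}" for z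
  proof (rule integrable_continuous_interval)
    have "continuous_on {1 / 4..1 / 2} (\<lambda>s. (\<lambda>(z, s). g (r s / (1 - z)) - g (r s)) (z, s))"
      by (rule continuous_on_compose2[OF conjunct1[OF log_smooth_base[OF K']]]) (use that in \<open>auto simp: Z_def intro!: continuous_intros\<close>)
    then show "continuous_on {1 / 4..1 / 2} (\<lambda>s. g (r s / (1 - z)) - g (r s))" by simp
  qed
qed

text \<open>
  Averaging over \<open>s\<close> between \<open>1/4\<close> and \<open>1/2\<close>, an interval on which the speeds of all five small arguments are bounded away
  from 0; for \<open>(1 - s)^2/s\<close> this excludes \<open>s = 1\<close>.
\<close>
lemma near_step:
  assumes sg: "0 \<le> \<sigma>" "\<sigma> \<le> 1" and del: "0 < \<delta>" "\<delta> \<le> 1"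
    and k: "log_smooth k {0<..<\<delta>} {0} (big_O {0<..<\<delta>} {0} (\<lambda>z. z powr \<sigma>)) (\<lambda>v _. h v)" "log_smooth k {0<..<\<delta>} {0} (big_O {0<..<\<delta>} {0} (\<lambda>z. z powr \<sigma>)) (\<lambda>v _. hn v)"
  shows "\<exists>\<delta>'>0. log_smooth (Suc k) {0<..<\<delta>'} {0} (big_O {0<..<\<delta>'} {0} (\<lambda>z. z powr \<sigma>)) (\<lambda>v _. h v)"
proof -
  have ch: "continuous_on {0..<\<delta>} h" "h 0 = 0"
  proof (intro continuous_at_imp_continuous_on ballI)
    fix v assume "v \<in> {0..<\<delta>}"
    then have "isCont G v" using isCont_G[of v] cont0 del by (cases "v = 0") auto
    then show "isCont h v" unfolding h_def[abs_def] by (intro continuous_intros)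
  qed (simp add: h_def)
  have chn: "continuous_on {0..<\<delta>} hn" "hn 0 = 0"
  proof (intro continuous_at_imp_continuous_on ballI)
    fix v assume v: "v \<in> {0..<\<delta>}"
    have "\<forall>v\<in>{0<..}. isCont N v" by (rule log_smooth_0_iff_isCont[OF open_greaterThan, THEN iffD1, OF smooth(2)])
    moreover have "isCont N 0" unfolding N_def[abs_def] by (rule isCont_o2[where g = G]) (use cont0 in auto)
    ultimately have "isCont N v" using v by (cases "v = 0") auto
    then show "isCont hn v" unfolding hn_def[abs_def] by (intro continuous_intros)
  qed (simp add: hn_def N_def)
  have ab: "1 / 4 \<le> (1 / 2 :: real)" by simp
  have pos: "0 < s" "s \<noteq> 0" "1 / 4 \<le> s" "s \<le> 1 / 2" "2 \<le> 1 / s" "1 / s \<le> 4" if "s \<in> {1 / 4..1 / 2}" for s :: real using that by (auto simp: le_divide_eq divide_le_eq)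
  have dinv: "((\<lambda>s. 1 / s + \<alpha> + \<beta> * s) has_real_derivative - (1 / s\<^sup>2) + \<beta>) (at s)" "((\<lambda>s. - (1 / s\<^sup>2) + \<beta>) has_real_derivative 2 / s ^ 3) (at s)"
    if "s \<in> {1 / 4..1 / 2}" for s \<alpha> \<beta> :: real
    using pos[OF that] by (auto intro!: derivative_eq_intros simp: power2_eq_square power3_eq_cube)
  have cinv: "continuous_on {1 / 4..1 / 2} (\<lambda>s::real. 2 / s ^ 3)" using pos by (intro continuous_intros) auto
  have dl: "- (1 / s\<^sup>2) + \<beta> \<noteq> 0" if "s \<in> {1 / 4..1 / 2}" "\<beta> \<le> 1" for s \<beta> :: real
  proof -
    have "2 * 2 \<le> 1 / s * (1 / s)" using pos[OF that(1)] by (intro mult_mono) auto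
    then show ?thesis using that(2) by (simp add: power2_eq_square)
  qed
  define S where "S H f j \<delta>' \<longleftrightarrow> log_smooth (Suc k) {0<..<\<delta>'} {0} (big_O {0<..<\<delta>'} {0} (\<lambda>z. z powr \<sigma>)) (\<lambda>z _. integral {1 / 4..1 / 2} (\<lambda>s. H (z * f s / (1 - z) ^ j)))
    \<and> (\<forall>z\<in>{0<..<\<delta>'}. (\<lambda>s. H (z * f s / (1 - z) ^ j)) integrable_on {1 / 4..1 / 2})" for H f :: "real \<Rightarrow> real" and j \<delta>'
  note sm = log_smooth_smoothing_near_0[OF sg(1) del(1) k(1) ch ab, where M = 10] and smn = log_smooth_smoothing_near_0[OF sg(1) del(1) k(2) chn ab, where M = 10]
  have hyp: "\<exists>\<delta>'>0. S h (\<lambda>s. 1 / s + \<alpha> + \<beta> * s) j \<delta>'" if "- 1 \<le> \<alpha> \<or> \<alpha> = - 2 \<and> \<beta> = 1" "\<alpha> \<le> 0" "0 \<le> \<beta>" "\<beta> \<le> 1" for \<alpha> \<beta> j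
    unfolding S_def
  proof (rule sm[where f' = "\<lambda>s. - (1 / s\<^sup>2) + \<beta>" and f'' = "\<lambda>s. 2 / s ^ 3"])
    fix s :: real assume s: "s \<in> {1 / 4..1 / 2}"
    have b: "0 \<le> \<beta> * s" "\<beta> * s \<le> 1 * 1" using that pos[OF s] by (simp, intro mult_mono) auto
    from that(1) have "0 < 1 / s + \<alpha> + \<beta> * s"
    proof (elim disjE conjE)
      assume "- 1 \<le> \<alpha>" then show ?thesis using b pos[OF s] by linarith
    next
      assume "\<alpha> = - 2" "\<beta> = 1" then show ?thesis using pos[OF s] by simp
    qed
    moreover have "1 / s + \<alpha> + \<beta> * s \<le> 10" using b that(2) pos(6)[OF s] by linarith
    ultimately show "0 < 1 / s + \<alpha> + \<beta> * s \<and> 1 / s + \<alpha> + \<beta> * s \<le> 10" by blast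
  qed (use dinv cinv dl that in auto)
  obtain d1 where d1: "0 < d1" "S h (\<lambda>s. 1 / s + 0 + 0 * s) 0 d1" using hyp[of 0 0 0] by auto
  obtain d2 where d2: "0 < d2" "S h (\<lambda>s. 1 / s + - 1 + 0 * s) 1 d2" using hyp[of "- 1" 0 1] by auto
  obtain d3 where d3: "0 < d3" "S h (\<lambda>s. 1 / s + - 2 + 1 * s) 2 d3" using hyp[of "- 2" 1 2] by auto
  have "\<exists>\<delta>'>0. S h (\<lambda>s. s) 0 \<delta>'" unfolding S_def
    by (rule sm[where f' = "\<lambda>s. 1" and f'' = "\<lambda>s. 0"]) (use pos in force)+
  then obtain d4 where d4: "0 < d4" "S h (\<lambda>s. s) 0 d4" by blast
  have "\<exists>\<delta>'>0. S hn (\<lambda>s. 1 - s) 1 \<delta>'" unfolding S_def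
    by (rule smn[where f' = "\<lambda>s. - 1" and f'' = "\<lambda>s. 0"]) (use pos in \<open>force intro!: derivative_eq_intros\<close>)+
  then obtain d5 where d5: "0 < d5" "S hn (\<lambda>s. 1 - s) 1 d5" by blast
  define d where "d = Min {d1, d2, d3, d4, d5, 1 / 8}"
  have d: "0 < d" "d \<le> d1" "d \<le> d2" "d \<le> d3" "d \<le> d4" "d \<le> d5" "d \<le> 1 / 8" using d1 d2 d3 d4 d5 by (auto simp: d_def)
  define Z where "Z = {0<..<d}"
  define W where "W = big_O Z {0} (\<lambda>z. z powr \<sigma>)"
  define J where "J H f j z = integral {1 / 4..1 / 2} (\<lambda>s. H (z * f s / (1 - z) ^ j))" for H f :: "real \<Rightarrow> real" and j z
  have W: "big_O Y {0} (\<lambda>z. z powr \<sigma>) \<subseteq> W" if "Z \<subseteq> Y" for Y using that unfolding W_def big_O_def by blast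
  have restrict: "log_smooth (Suc k) Z {0} W (\<lambda>z _. J H f j z)" "\<And>z. z \<in> Z \<Longrightarrow> ((\<lambda>s. H (z * f s / (1 - z) ^ j)) has_integral J H f j z) {1 / 4..1 / 2}"
    if "S H f j \<delta>'" "d \<le> \<delta>'" for H f j \<delta>'
  proof -
    have sub: "Z \<subseteq> {0<..<\<delta>'}" using that by (auto simp: Z_def)
    have "log_smooth (Suc k) {0<..<\<delta>'} {0} (big_O {0<..<\<delta>'} {0} (\<lambda>z. z powr \<sigma>)) (\<lambda>z _. J H f j z)" using that(1) unfolding S_def J_def by blast
    from log_smooth_mono_set[OF this sub order.refl W[OF sub]] show "log_smooth (Suc k) Z {0} W (\<lambda>z _. J H f j z)" .
    show "((\<lambda>s. H (z * f s / (1 - z) ^ j)) has_integral J H f j z) {1 / 4..1 / 2}" if "z \<in> Z" for z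
      using \<open>S H f j \<delta>'\<close> that sub unfolding S_def J_def by (intro integrable_integral) blast
  qed
  note r1 = restrict[OF d1(2) d(2)] and r2 = restrict[OF d2(2) d(3)] and r3 = restrict[OF d3(2) d(4)] and r4 = restrict[OF d4(2) d(5)] and r5 = restrict[OF d5(2) d(6)]
  have rb: "1 / 2 \<le> 1 - s \<and> 1 - s \<le> 3 * (1 / 4)" "1 / 2 \<le> (1 - s) / s \<and> (1 - s) / s \<le> 3 * 1" if "s \<in> {1 / 4..1 / 2}" for s :: real
    using that pos[OF that] by (auto simp: field_simps)
  have rc: "continuous_on {1 / 4..1 / 2} (\<lambda>s::real. 1 - s)" "continuous_on {1 / 4..1 / 2} (\<lambda>s::real. (1 - s) / s)"
    using pos by (auto intro!: continuous_intros)
  have N4: "log_smooth k {0<..<4} {0} UNIV (\<lambda>v _. N v)" for k by (rule log_smooth_mono_set[OF smooth(2)]) auto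
  note DG = near_difference[OF sg(2) smooth(1) rb(1) rc(1)] and DN = near_difference[OF sg(2) N4 rb(2) rc(2)]
  define A B where "A z = integral {1 / 4..1 / 2} (\<lambda>s. G ((1 - s) / (1 - z)) - G (1 - s))"
    and "B z = integral {1 / 4..1 / 2} (\<lambda>s. N ((1 - s) / s / (1 - z)) - N ((1 - s) / s))" for z
  have sub8: "Z \<subseteq> {0<..<1 / 8}" using d by (auto simp: Z_def)
  have "log_smooth (Suc k) {0<..<1 / 8} {0} (big_O {0<..<1 / 8} {0} (\<lambda>z. z powr \<sigma>)) (\<lambda>z _. A z)" unfolding A_def by (rule DG(1)) auto
  from log_smooth_mono_set[OF this sub8 order.refl W[OF sub8]] have KA: "log_smooth (Suc k) Z {0} W (\<lambda>z _. A z)" .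
  have "log_smooth (Suc k) {0<..<1 / 8} {0} (big_O {0<..<1 / 8} {0} (\<lambda>z. z powr \<sigma>)) (\<lambda>z _. B z)" unfolding B_def by (rule DN(1)) auto
  from log_smooth_mono_set[OF this sub8 order.refl W[OF sub8]] have KB: "log_smooth (Suc k) Z {0} W (\<lambda>z _. B z)" .
  define H where "H z = 1 / 2 * J h (\<lambda>s. 1 / s + 0 + 0 * s) 0 z - J h (\<lambda>s. 1 / s + - 1 + 0 * s) 1 z + 1 / 2 * J h (\<lambda>s. s) 0 z
    - J hn (\<lambda>s. 1 - s) 1 z + 1 / 2 * J h (\<lambda>s. 1 / s + - 2 + 1 * s) 2 z - A z - B z" for z
  have aW: "linear_class Z {0} W" unfolding W_def by (rule linear_class_Ob)
  have KH: "log_smooth (Suc k) Z {0} W (\<lambda>z _. H z)" unfolding H_def by (intro log_smooth_scale log_smooth_add log_smooth_diff r1(1) r2(1) r3(1) r4(1) r5(1) KA KB aW)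
  have GH: "h z = 4 * H z" if z: "z \<in> Z" for z
  proof -
    have z8: "z \<in> {0<..<1 / 8}" using z sub8 by blast
    have "((\<lambda>s. 1 / 2 * h (z * (1 / s + 0 + 0 * s) / (1 - z) ^ 0) - h (z * (1 / s + - 1 + 0 * s) / (1 - z) ^ 1) + 1 / 2 * h (z * s / (1 - z) ^ 0)
      - hn (z * (1 - s) / (1 - z) ^ 1) + 1 / 2 * h (z * (1 / s + - 2 + 1 * s) / (1 - z) ^ 2)
      - (G ((1 - s) / (1 - z)) - G (1 - s)) - (N ((1 - s) / s / (1 - z)) - N ((1 - s) / s))) has_integral H z) {1 / 4..1 / 2}"
      unfolding H_def A_def B_def
      by (intro has_integral_add has_integral_diff has_integral_mult_right r1(2) r2(2) r3(2) r4(2) r5(2) integrable_integral DG(2) DN(2) z z8) auto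
    then have "((\<lambda>s::real. h z) has_integral H z) {1 / 4..1 / 2}"
      by (rule has_integral_eq[rotated]) (use small_argument_equation[of z] z8 in simp)
    moreover have "((\<lambda>s::real. h z) has_integral 1 / 4 * h z) {1 / 4..1 / 2}"
      using has_integral_const_real[of "h z" "1 / 4" "1 / 2"] by simp
    ultimately have "H z = 1 / 4 * h z" by (rule has_integral_unique)
    then show ?thesis by simp
  qed
  have "log_smooth (Suc k) Z {0} W (\<lambda>z _. h z)" by (rule log_smooth_cong[OF log_smooth_scale[OF KH aW, of 4] aW]) (auto simp: Z_def GH)
  then show ?thesis using d(1) unfolding Z_def W_def by blast
qed

end

section \<open>Classification of the solutions\<close>

context kummer
begin

lemma near_all:
  assumes sg: "0 \<le> \<sigma>" "\<sigma> \<le> 1" and g: "growth h \<sigma>"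
  shows "\<exists>\<delta>>0. \<delta> \<le> 1 \<and> log_smooth k {0<..<\<delta>} {0} (big_O {0<..<\<delta>} {0} (\<lambda>z. z powr \<sigma>)) (\<lambda>v _. h v)
    \<and> log_smooth k {0<..<\<delta>} {0} (big_O {0<..<\<delta>} {0} (\<lambda>z. z powr \<sigma>)) (\<lambda>v _. hn v)"
proof -
  define B where "B k f \<delta> \<longleftrightarrow> log_smooth k {0<..<\<delta>} {0} (big_O {0<..<\<delta>} {0} (\<lambda>z. z powr \<sigma>)) (\<lambda>v _. f v)" for k f \<delta>
  have shrink: "B k f \<delta>'" if "B k f \<delta>" "\<delta>' \<le> \<delta>" for k f \<delta> \<delta>'
  proof -
    have sub: "{0<..<\<delta>'} \<subseteq> {0<..<\<delta>}" using that(2) by auto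
    then have ob: "big_O {0<..<\<delta>} {0} (\<lambda>z. z powr \<sigma>) \<subseteq> big_O {0<..<\<delta>'} {0} (\<lambda>z. z powr \<sigma>)" unfolding big_O_def by blast
    show ?thesis using log_smooth_mono_set[OF that(1)[unfolded B_def] sub order.refl ob] unfolding B_def .
  qed
  have both: "\<exists>\<delta>>0. \<delta> \<le> 1 \<and> B k h \<delta> \<and> B k hn \<delta>" if ex: "\<exists>\<delta>>0. B k h \<delta>" for k
  proof -
    obtain \<delta> where d: "0 < \<delta>" "B k h \<delta>" using ex by blast
    obtain \<delta>' where d': "0 < \<delta>'" "B k hn \<delta>'" using near_N[OF sg d(1)] d(2) unfolding B_def by blast
    have "B k h (min 1 (min \<delta> \<delta>'))" "B k hn (min 1 (min \<delta> \<delta>'))" by (rule shrink[OF d(2)], simp, rule shrink[OF d'(2)], simp)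
    then show ?thesis using d(1) d'(1) by (intro exI[of _ "min 1 (min \<delta> \<delta>')"]) simp
  qed
  have "\<exists>\<delta>>0. B k h \<delta>" for k
  proof (induction k)
    case 0
    obtain C z0 where z0: "0 < z0" and C: "\<And>z. 0 < z \<Longrightarrow> z < z0 \<Longrightarrow> \<bar>h z\<bar> \<le> C * z powr \<sigma>" using g unfolding growth_def by blast
    have "isCont h z" if "z \<in> {0<..<min z0 1}" for z
      unfolding h_def[abs_def] using that isCont_G[of z] by (intro continuous_intros) auto
    then have "log_smooth 0 {0<..<min z0 1} {0} UNIV (\<lambda>v _. h v)" by (intro log_smooth_0_iff_isCont[OF open_greaterThanLessThan, THEN iffD2] ballI)
    moreover have "(\<lambda>v _. h v) \<in> big_O {0<..<min z0 1} {0} (\<lambda>z. z powr \<sigma>)" by (rule ObI[where C = C]) (use C in auto)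
    ultimately have "B 0 h (min z0 1)" unfolding B_def by simp
    then show ?case using z0 by (intro exI[of _ "min z0 1"]) simp
  next
    case (Suc k)
    from both[OF this] obtain \<delta> where d: "0 < \<delta>" "\<delta> \<le> 1" "B k h \<delta>" "B k hn \<delta>" by blast
    then show ?case using near_step[OF sg d(1,2)] unfolding B_def by blast
  qed
  from both[OF this] show ?thesis unfolding B_def .
qed

lemma log_deriv_h: "(log_deriv ^^ Suc k) h = (log_deriv ^^ k) (log_deriv G)"
  unfolding h_def[abs_def] funpow_Suc_right o_def log_deriv_diff_const ..

lemma growth_derivatives:
  assumes sg: "0 \<le> \<sigma>" "\<sigma> \<le> 1" and g: "growth h \<sigma>"
  shows "growth ((log_deriv ^^ k) (log_deriv G)) \<sigma>"
proof -
  obtain \<delta> where d: "0 < \<delta>" "log_smooth (Suc k) {0<..<\<delta>} {0} (big_O {0<..<\<delta>} {0} (\<lambda>z. z powr \<sigma>)) (\<lambda>v _. h v)"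
    using near_all[OF assms, of "Suc k"] by (elim exE conjE) (rule that)
  have "log_smooth (Suc k + 0) {0<..<\<delta>} {0} (big_O {0<..<\<delta>} {0} (\<lambda>z. z powr \<sigma>)) (\<lambda>v _. h v)" using d(2) by (simp del: log_smooth.simps)
  from log_smooth_zd_funpow[OF this linear_class_Ob open_greaterThanLessThan]
  have "log_smooth 0 {0<..<\<delta>} {0} (big_O {0<..<\<delta>} {0} (\<lambda>z. z powr \<sigma>)) (\<lambda>z _. (log_deriv ^^ k) (log_deriv G) z)" unfolding log_deriv_h by (simp del: log_smooth.simps)
  from conjunct2[OF log_smooth_base[OF this]] obtain C where "\<forall>z\<in>{0<..<\<delta>}. \<bar>(log_deriv ^^ k) (log_deriv G) z\<bar> \<le> C * z powr \<sigma>" unfolding big_O_def by auto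
  then show ?thesis unfolding growth_def using d(1) by (intro exI[of _ C] exI[of _ \<delta>]) auto
qed

lemma log_deriv_deriv:
  assumes "0 < z" "z < 1"
  shows "((log_deriv ^^ k) (log_deriv G) has_real_derivative (log_deriv ^^ Suc k) (log_deriv G) z / z) (at z)"
proof -
  have "log_smooth (Suc k + Suc 0) {0<..<1} {0} UNIV (\<lambda>v _. G v)" by (rule smooth(1))
  from log_smooth_zd_funpow[OF this linear_class_UNIV open_greaterThanLessThan]
  have "log_smooth (Suc 0) {0<..<1} {0} UNIV (\<lambda>z _. (log_deriv ^^ k) (log_deriv G) z)" by (simp del: log_smooth.simps funpow.simps add: funpow_Suc_right)
  from log_smooth_zd(2)[OF this linear_class_UNIV open_greaterThanLessThan, of z] show ?thesis using assms by simp
qed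

lemma G_deriv: "0 < z \<Longrightarrow> z < 1 \<Longrightarrow> (G has_real_derivative log_deriv G z / z) (at z)"
  by (rule log_smooth_zd(2)[OF smooth(1) linear_class_UNIV open_greaterThanLessThan]) auto

lemma N_deriv: "0 < w \<Longrightarrow> (N has_real_derivative log_deriv N w / w) (at w)"
  by (rule log_smooth_zd(2)[OF smooth(2) linear_class_UNIV open_greaterThan]) auto

lemma G_deriv_neg:
  assumes "0 < w"
  shows "log_deriv G (- w) = log_deriv N w" "(G has_real_derivative log_deriv G (- w) / (- w)) (at (- w))"
proof -
  have "((\<lambda>v. N (- v)) has_real_derivative log_deriv N w / w * (- 1)) (at (- w))"
    by (rule DERIV_chain2[where f = N and g = uminus]) (use N_deriv[OF assms] in \<open>auto intro!: derivative_eq_intros\<close>)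
  then have d: "(G has_real_derivative log_deriv N w / w * (- 1)) (at (- w))" by (simp add: N_def)
  from DERIV_imp_deriv[OF d] show e: "log_deriv G (- w) = log_deriv N w" using assms by (simp add: log_deriv_def[of G])
  show "(G has_real_derivative log_deriv G (- w) / (- w)) (at (- w))" using d unfolding e by simp
qed

lemma h_tendsto_0: "(h \<longlongrightarrow> 0) (at_right 0)"
proof -
  have "(G \<longlongrightarrow> G 0) (at_right 0)" using cont0 unfolding isCont_def by (rule tendsto_within_subset) simp
  from tendsto_diff[OF this tendsto_const[of "G 0"]] show ?thesis by (simp add: h_def[abs_def])
qed

lemma growth_h_0: "growth h 0"
proof -
  have "eventually (\<lambda>z. \<bar>h z\<bar> < 1) (at_right 0)" using order_tendstoD(2)[OF tendsto_rabs[OF h_tendsto_0], of 1] by simp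
  then obtain b where "0 < b" "\<And>z. 0 < z \<Longrightarrow> z < b \<Longrightarrow> \<bar>h z\<bar> < 1" unfolding eventually_at_right_field by blast
  then show ?thesis unfolding growth_def by (intro exI[of _ 1] exI[of _ b]) (auto intro: less_imp_le)
qed

text \<open>
  Interpolation of Landau's type: \<open>h\<close> tends to 0 and its second logarithmic derivative is bounded, hence the first one tends to 0.
  The difference quotient with relative step \<open>\<eta>\<close> is within \<open>\<eta> M\<close> of the derivative.
\<close>
lemma log_deriv_G_tendsto_0: "(log_deriv G \<longlongrightarrow> 0) (at_right 0)"
proof (rule tendstoI)
  fix \<epsilon> :: real assume eps: "0 < \<epsilon>"
  have d2: "(log_deriv G has_real_derivative log_deriv (log_deriv G) z / z) (at z)" if "0 < z" "z < 1" for z using log_deriv_deriv[OF that, of 0] by simp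
  obtain M0 z0 where z0: "0 < z0" and M0: "\<And>z. 0 < z \<Longrightarrow> z < z0 \<Longrightarrow> \<bar>log_deriv (log_deriv G) z\<bar> \<le> M0 * z powr 0"
    using growth_derivatives[OF _ _ growth_h_0, of 1] unfolding growth_def by auto
  define M where "M = \<bar>M0\<bar> + 1"
  have M: "\<bar>log_deriv (log_deriv G) z\<bar> \<le> M" "1 \<le> M" if "0 < z" "z < z0" for z using M0[OF that] that by (auto simp: M_def)
  have M1: "1 \<le> M" by (simp add: M_def)
  \<comment> \<open>The step makes the variation of the derivative at most \<open>\<epsilon>/4\<close>; then \<open>\<kappa>\<close> does the same for the difference quotient.\<close>
  define \<eta> where "\<eta> = min 1 (\<epsilon> / (4 * M))"
  have et: "0 < \<eta>" "\<eta> \<le> 1" "\<eta> * M \<le> \<epsilon> / 4" using eps M1 unfolding \<eta>_def by (auto simp: min_def field_simps)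
  define \<kappa> where "\<kappa> = \<epsilon> * \<eta> / 16"
  have ka: "0 < \<kappa>" using eps et by (simp add: \<kappa>_def)
  have "eventually (\<lambda>z. \<bar>h z\<bar> < \<kappa>) (at_right 0)" using order_tendstoD(2)[OF tendsto_rabs[OF h_tendsto_0], of \<kappa>] ka by simp
  then obtain b where b: "0 < b" "\<And>z. 0 < z \<Longrightarrow> z < b \<Longrightarrow> \<bar>h z\<bar> < \<kappa>" unfolding eventually_at_right_field by blast
  have "\<bar>log_deriv G z\<bar> < \<epsilon>" if z: "0 < z" "z < min (min b z0) 1 / 2" for z
  proof -
    define z' where "z' = z + z * \<eta>"
    have ze: "0 < z * \<eta>" "z * \<eta> \<le> z" using z et by (auto intro: mult_left_le)
    have z': "z < z'" "z' \<le> 2 * z" "z' < b" "z' < z0" "z' < 1" using z ze by (auto simp: z'_def)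
    obtain \<xi> where x: "z < \<xi>" "\<xi> < z'" "G z' - G z = (z' - z) * (log_deriv G \<xi> / \<xi>)"
      using MVT2[OF z'(1), of G "\<lambda>x. log_deriv G x / x"] G_deriv z z' by force
    obtain \<tau> where t: "z < \<tau>" "\<tau> < \<xi>" "log_deriv G \<xi> - log_deriv G z = (\<xi> - z) * (log_deriv (log_deriv G) \<tau> / \<tau>)"
      using MVT2[OF x(1), of "log_deriv G" "\<lambda>x. log_deriv (log_deriv G) x / x"] d2 z z' x by force
    have "\<bar>log_deriv G \<xi> - log_deriv G z\<bar> \<le> \<epsilon> / 4"
    proof -
      have "\<bar>log_deriv G \<xi> - log_deriv G z\<bar> = (\<xi> - z) * (\<bar>log_deriv (log_deriv G) \<tau>\<bar> / \<tau>)" unfolding t(3) using x t z by (simp add: abs_mult)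
      also have "\<dots> \<le> (z * \<eta>) * (M / z)" using x t z M(1)[of \<tau>] z' M1 ze by (intro mult_mono frac_le) (auto simp: z'_def)
      also have "\<dots> = \<eta> * M" using z by simp
      finally show ?thesis using et by simp
    qed
    moreover have "\<bar>log_deriv G \<xi>\<bar> < \<epsilon> / 2"
    proof -
      have xi: "\<xi> / (z * \<eta>) \<le> 2 / \<eta>" "0 \<le> \<xi> / (z * \<eta>)" using x z' z et by (auto simp: field_simps)
      have e: "log_deriv G \<xi> = \<xi> / (z * \<eta>) * (G z' - G z)" unfolding x(3) using z x et by (simp add: z'_def)
      have g: "\<bar>G z' - G z\<bar> < 2 * \<kappa>" using b(2)[of z] b(2)[of z'] z z' by (simp add: h_def)
      have "\<bar>log_deriv G \<xi>\<bar> \<le> 2 / \<eta> * (2 * \<kappa>)"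
        unfolding e abs_mult abs_of_nonneg[OF xi(2)] using xi g et by (intro mult_mono) auto
      also have "\<dots> = \<epsilon> / 4" using et by (simp add: \<kappa>_def)
      finally show ?thesis using eps by simp
    qed
    ultimately show ?thesis using eps by linarith
  qed
  then show "eventually (\<lambda>z. dist (log_deriv G z) 0 < \<epsilon>) (at_right 0)"
    unfolding eventually_at_right_field using b(1) z0 by (intro exI[of _ "min (min b z0) 1 / 2"]) auto
qed

lemma growth_zd_imp_growth_h:
  assumes "0 \<le> \<sigma>" "growth (log_deriv G) \<sigma>"
  shows "growth h \<sigma>"
proof (cases "\<sigma> = 0")
  case True then show ?thesis using growth_h_0 by simp
next
  case False
  then have s: "0 < \<sigma>" using assms by simp
  obtain l where l: "growth (\<lambda>z. G z - l) \<sigma>"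
    by (rule growth_integrate[OF G_deriv zero_less_one assms(2) s])
  have "((\<lambda>z. h z - (G z - l)) \<longlongrightarrow> 0 - 0) (at_right 0)" by (intro tendsto_diff h_tendsto_0 growth_tendsto[OF l s])
  then have "((\<lambda>z. l - G 0) \<longlongrightarrow> 0) (at_right (0::real))" by (simp add: h_def)
  then have "l = G 0" using tendsto_unique[OF trivial_limit_at_right_real tendsto_const, of "l - G 0" 0 0] by simp
  then show ?thesis using l by (simp add: h_def[abs_def])
qed

text \<open>
  Differentiate the equation at \<open>(\<tau> t, \<tau> y)\<close> with respect to \<open>\<tau>\<close> at \<open>\<tau> = 1\<close>, where \<open>w\<close> becomes
  \<open>\<tau> (t + y) - 1\<close>, and multiply by \<open>w\<close>.
\<close>
lemma ray_form_log_deriv: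
  assumes y: "0 < y" "y < e0" and t: "0 < t" "t < 1" and ty: "1 < t + y"
  shows "ray_form (log_deriv G) t y = 0"
proof -
  define w where "w = t + y - 1"
  have w: "0 < w" "w \<noteq> 0" "y \<noteq> 0" "t \<noteq> 0" "y < 1" using assms golden by (auto simp: w_def)
  define f where "f \<tau> = 2 * G ((\<tau> * (t + y) - 1) / (\<tau> * t)) + 2 * G ((\<tau> * (t + y) - 1) / (\<tau> * y)) - G ((\<tau> * (t + y) - 1) / ((\<tau> * t) * (\<tau> * y)))
    - G (y * (\<tau> * (t + y) - 1) / t) - G (t * (\<tau> * (t + y) - 1) / y) + 2 * N (\<tau> * (t + y) - 1) + 2 * N (t / y) + 2 * G (\<tau> * y) + 2 * G (\<tau> * t)" for \<tau>
  note args = arguments_in_unit_interval[OF t y(1) w(5) ty, folded w_def]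
  have chain: "((\<lambda>\<tau>. G (\<phi> \<tau>)) has_real_derivative log_deriv G v / v * d) (at 1)" if "(\<phi> has_real_derivative d) (at 1)" "\<phi> 1 = v" "v \<in> {0<..<1}" for \<phi> d v
    by (rule DERIV_chain2[where f = G and g = \<phi>]) (use that G_deriv[of v] in auto)
  have "(f has_real_derivative 2 * (log_deriv G (w / t) / (w / t) * (1 / t)) + 2 * (log_deriv G (w / y) / (w / y) * (1 / y)) - log_deriv G (w / (t * y)) / (w / (t * y)) * ((1 - w) / (t * y))
    - log_deriv G (y * w / t) / (y * w / t) * (y * (1 + w) / t) - log_deriv G (t * w / y) / (t * w / y) * (t * (1 + w) / y) + 2 * (log_deriv N w / w * (1 + w)) + 0
    + 2 * (log_deriv G y / y * y) + 2 * (log_deriv G t / t * t)) (at 1)"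
    unfolding f_def[abs_def]
  proof (intro DERIV_add DERIV_diff DERIV_cmult chain DERIV_const)
    show "((\<lambda>\<tau>. (\<tau> * (t + y) - 1) / (\<tau> * t)) has_real_derivative 1 / t) (at 1)"
      using w by (auto intro!: derivative_eq_intros simp: field_simps)
    show "((\<lambda>\<tau>. (\<tau> * (t + y) - 1) / (\<tau> * y)) has_real_derivative 1 / y) (at 1)"
      using w by (auto intro!: derivative_eq_intros simp: field_simps)
    have "((\<lambda>\<tau>. (\<tau> * (t + y) - 1) / (\<tau> * \<tau>) / (t * y)) has_real_derivative (1 - w) / (t * y)) (at 1)"
      by (intro DERIV_cdivide) (auto intro!: derivative_eq_intros simp: w_def)
    then show "((\<lambda>\<tau>. (\<tau> * (t + y) - 1) / ((\<tau> * t) * (\<tau> * y))) has_real_derivative (1 - w) / (t * y)) (at 1)"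
      by (simp add: mult_ac)
    show "((\<lambda>\<tau>. y * (\<tau> * (t + y) - 1) / t) has_real_derivative y * (1 + w) / t) (at 1)"
      by (intro DERIV_cdivide DERIV_cmult) (auto intro!: derivative_eq_intros simp: w_def)
    show "((\<lambda>\<tau>. t * (\<tau> * (t + y) - 1) / y) has_real_derivative t * (1 + w) / y) (at 1)"
      by (intro DERIV_cdivide DERIV_cmult) (auto intro!: derivative_eq_intros simp: w_def)
    show "((\<lambda>\<tau>. N (\<tau> * (t + y) - 1)) has_real_derivative log_deriv N w / w * (1 + w)) (at 1)"
      by (rule DERIV_chain2[where f = N and g = "\<lambda>\<tau>. \<tau> * (t + y) - 1"]) (use N_deriv[OF w(1)] in \<open>auto intro!: derivative_eq_intros simp: w_def\<close>)
    show "((\<lambda>\<tau>. \<tau> * y) has_real_derivative y) (at 1)" "((\<lambda>\<tau>. \<tau> * t) has_real_derivative t) (at 1)" by (auto intro!: derivative_eq_intros)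
  qed (use args w y t in \<open>simp_all add: w_def\<close>)
  moreover have "(f has_real_derivative 0) (at 1)"
  proof (rule has_field_derivative_transform_within_open[OF DERIV_const[of 0]])
    define r where "r = max (1 / (t + y)) 0"
    show "open {1 / (t + y)<..<min (e0 / y) (1 / t)}" by simp
    show "1 \<in> {1 / (t + y)<..<min (e0 / y) (1 / t)}" using assms by (auto simp: less_divide_eq divide_less_eq)
    fix \<tau> assume "\<tau> \<in> {1 / (t + y)<..<min (e0 / y) (1 / t)}"
    then have \<tau>: "1 / (t + y) < \<tau>" "\<tau> * y < e0" "\<tau> * t < 1" using y t by (auto simp: less_divide_eq)
    have "0 < 1 / (t + y)" using y t by simp
    then have p: "0 < \<tau>" using \<tau> by linarith
    have s: "1 < \<tau> * t + \<tau> * y" using \<tau>(1) y t by (simp add: divide_less_eq algebra_simps)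
    have q: "\<tau> * y * (\<tau> * (t + y) - 1) / (\<tau> * t) = y * (\<tau> * (t + y) - 1) / t" "\<tau> * t * (\<tau> * (t + y) - 1) / (\<tau> * y) = t * (\<tau> * (t + y) - 1) / y"
      "\<tau> * t / (\<tau> * y) = t / y" "\<tau> * t + \<tau> * y - 1 = \<tau> * (t + y) - 1"
      using p by (auto simp: distrib_left mult.assoc)
    have "0 < \<tau> * y" "0 < \<tau> * t" using p y t by auto
    from eq_ty[OF this(1) \<tau>(2) this(2) \<tau>(3) s refl] show "0 = f \<tau>" unfolding q f_def by (rule sym)
  qed
  ultimately have "2 * (log_deriv G (w / t) / (w / t) * (1 / t)) + 2 * (log_deriv G (w / y) / (w / y) * (1 / y)) - log_deriv G (w / (t * y)) / (w / (t * y)) * ((1 - w) / (t * y))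
    - log_deriv G (y * w / t) / (y * w / t) * (y * (1 + w) / t) - log_deriv G (t * w / y) / (t * w / y) * (t * (1 + w) / y) + 2 * (log_deriv N w / w * (1 + w)) + 0
    + 2 * (log_deriv G y / y * y) + 2 * (log_deriv G t / t * t) = 0" by (rule DERIV_unique)
  moreover have "A / (w / t) * (1 / t) = A / w" "A / (w / y) * (1 / y) = A / w" "A / (w / (t * y)) * ((1 - w) / (t * y)) = A * (1 - w) / w"
    "A / (y * w / t) * (y * (1 + w) / t) = A * (1 + w) / w" "A / (t * w / y) * (t * (1 + w) / y) = A * (1 + w) / w" "A / w * (1 + w) = A * (1 + w) / w"
    "A / y * y = A" "A / t * t = A" for A using w by auto
  ultimately have e: "2 * (log_deriv G (w / t) / w) + 2 * (log_deriv G (w / y) / w) - log_deriv G (w / (t * y)) * (1 - w) / w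
    - log_deriv G (y * w / t) * (1 + w) / w - log_deriv G (t * w / y) * (1 + w) / w + 2 * (log_deriv N w * (1 + w) / w) + 2 * log_deriv G y + 2 * log_deriv G t = 0" by simp
  have "w * (2 * (a1 / w) + 2 * (a2 / w) - a3 * u / w - a4 * v / w - a5 * v / w + 2 * (a6 * v / w) + 2 * b + 2 * c)
    = 2 * a1 + 2 * a2 - u * a3 - v * (a4 + a5) + 2 * v * a6 + 2 * w * (c + b)" for a1 a2 a3 a4 a5 a6 b c u v
  proof -
    have "w * (a / w) = a" for a using w(2) by simp
    moreover have "w * (2 * (a1 / w) + 2 * (a2 / w) - a3 * u / w - a4 * v / w - a5 * v / w + 2 * (a6 * v / w) + 2 * b + 2 * c)
      = 2 * (w * (a1 / w)) + 2 * (w * (a2 / w)) - w * (a3 * u / w) - w * (a4 * v / w) - w * (a5 * v / w) + 2 * (w * (a6 * v / w)) + 2 * w * (c + b)"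
      by (simp only: distrib_left right_diff_distrib mult.left_commute mult.assoc)
    ultimately show ?thesis by (simp only: mult.commute distrib_left mult.left_commute mult.assoc)
  qed
  from this[of "log_deriv G (w / t)" "log_deriv G (w / y)" "log_deriv G (w / (t * y))" "1 - w" "log_deriv G (y * w / t)" "1 + w" "log_deriv G (t * w / y)" "log_deriv N w" "log_deriv G y" "log_deriv G t"]
  show ?thesis unfolding e unfolding ray_form_def Let_def w_def[symmetric] G_deriv_neg(1)[OF w(1)] by (simp add: mult.commute)
qed

lemma inversion_log_deriv:
  assumes y: "0 < y" "y < e0"
  shows "(1 - y) * log_deriv G y = y * log_deriv G (1 - y) + log_deriv G (1 - 1 / y)"
proof -
  have y1: "0 < 1 - y" "y \<noteq> 0" "1 - y \<noteq> 0" "y < 1" using y golden by auto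
  define u where "u = (1 - y) / y"
  have u: "0 < u" "- u = 1 - 1 / y" using y y1 by (auto simp: u_def field_simps)
  have 1: "((\<lambda>y. G (1 - y)) has_real_derivative log_deriv G (1 - y) / (1 - y) * (- 1)) (at y)"
    by (rule DERIV_chain2[where f = G and g = "\<lambda>y. 1 - y"]) (use G_deriv[of "1 - y"] y1 y in \<open>auto intro!: derivative_eq_intros\<close>)
  have 2: "((\<lambda>y. N ((1 - y) / y)) has_real_derivative log_deriv N u / u * (- (1 / (y * y)))) (at y)"
    by (rule DERIV_chain2[where f = N and g = "\<lambda>y. (1 - y) / y"]) (use N_deriv[OF u(1)] y1 y in \<open>auto simp: u_def field_simps intro!: derivative_eq_intros\<close>)
  have "((\<lambda>y. G y + G (1 - y) + N ((1 - y) / y)) has_real_derivative log_deriv G y / y + log_deriv G (1 - y) / (1 - y) * (- 1) + log_deriv N u / u * (- (1 / (y * y)))) (at y)"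
    by (intro DERIV_add G_deriv 1 2 y y1)
  moreover have "((\<lambda>y. G y + G (1 - y) + N ((1 - y) / y)) has_real_derivative 0) (at y)"
  proof (rule has_field_derivative_transform_within_open[OF DERIV_const[of "- 3 / 2 * G 0"]])
    show "- 3 / 2 * G 0 = G x + G (1 - x) + N ((1 - x) / x)" if "x \<in> {0<..<e0}" for x using reflection[of x] that by simp
  qed (use y in auto)
  ultimately have "log_deriv G y / y + log_deriv G (1 - y) / (1 - y) * (- 1) + log_deriv N u / u * (- (1 / (y * y))) = 0" by (rule DERIV_unique)
  then have "y * (1 - y) * (log_deriv G y / y + log_deriv G (1 - y) / (1 - y) * (- 1) + log_deriv N u / u * (- (1 / (y * y)))) = 0" by simp
  moreover have id: "y * (1 - y) * (a / y + b / (1 - y) * (- 1) + n / u * (- (1 / (y * y)))) = (1 - y) * a - y * b - n" for a b n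
  proof -
    have "y * (1 - y) * (a / y) = (1 - y) * a" "y * (1 - y) * (b / (1 - y)) = y * b" "y * (1 - y) * (n / u * (1 / (y * y))) = n"
      using y1 by (auto simp: u_def)
    then show ?thesis by (simp only: distrib_left mult_minus_right mult_1_right)
  qed
  ultimately have "(1 - y) * log_deriv G y - y * log_deriv G (1 - y) - log_deriv N u = 0" unfolding id by blast
  then show ?thesis using G_deriv_neg(1)[OF u(1)] unfolding u(2) by simp
qed

text \<open>
  The expansion at 0 determines \<open>\<alpha>\<close>; subtraction of \<open>\<alpha> P0\<close> leaves a residual, which vanishes. The bound \<open>1/10\<close> only has to keep
  \<open>d + w\<close> below \<open>e0\<close>.
\<close>
theorem log_deriv_G_multiple_of_P0:
  obtains \<alpha> where "\<forall>z<1. z \<noteq> 0 \<longrightarrow> log_deriv G z = \<alpha> * P0 z"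
proof -
  interpret C: corner "\<lambda>k. (log_deriv ^^ k) (log_deriv G)" "\<lambda>w. log_deriv G (- w)" "\<lambda>d. log_deriv G (1 - d)" "1 / 10"
  proof
    fix k z assume "0 < z" "z < 1 / (10 :: real)"
    then show "((log_deriv ^^ k) (log_deriv G) has_real_derivative (log_deriv ^^ Suc k) (log_deriv G) z / z) (at z)" by (intro log_deriv_deriv) auto
  next
    show "((log_deriv ^^ 0) (log_deriv G) \<longlongrightarrow> 0) (at_right 0)" using log_deriv_G_tendsto_0 by simp
  next
    fix w d :: real assume wd: "0 < w" "0 < d" "w < 1 / 10" "d < 1 / 10"
    have e: "1 - d + (d + w) - 1 = w" by simp
    have "ray_form (log_deriv G) (1 - d) (d + w) = 0" by (rule ray_form_log_deriv) (use wd half in auto)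
    then have r: "ray_form (log_deriv G) (1 - d) (d + w) = 0" .
    have z0: "(log_deriv ^^ 0) (log_deriv G) = log_deriv G" by simp
    show "2 * (log_deriv ^^ 0) (log_deriv G) (w / (1 - d)) + 2 * (log_deriv ^^ 0) (log_deriv G) (w / (d + w)) - (1 - w) * (log_deriv ^^ 0) (log_deriv G) (w / ((d + w) * (1 - d)))
      - (1 + w) * (log_deriv ^^ 0) (log_deriv G) (w * (d + w) / (1 - d)) - (1 + w) * (log_deriv ^^ 0) (log_deriv G) (w * (1 - d) / (d + w)) + 2 * (1 + w) * log_deriv G (- w)
      + 2 * w * log_deriv G (1 - d) + 2 * w * (log_deriv ^^ 0) (log_deriv G) (d + w) = 0"
      using r unfolding ray_form_def Let_def e z0 mult.commute[of "d + w" "1 - d"] by algebra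
  next
    fix \<sigma> k assume "0 \<le> \<sigma>" "\<sigma> \<le> 1" "growth ((log_deriv ^^ 0) (log_deriv G)) \<sigma>"
    then show "growth ((log_deriv ^^ k) (log_deriv G)) \<sigma>" by (intro growth_derivatives growth_zd_imp_growth_h) simp_all
  qed auto
  obtain \<alpha> \<beta> \<gamma> where "((\<lambda>z. (log_deriv ^^ 0) (log_deriv G) z / z - (\<alpha> * (ln z)\<^sup>2 + \<beta> * ln z + \<gamma>)) \<longlongrightarrow> 0) (at_right 0)"
    and "((\<lambda>z. (log_deriv ^^ 1) (log_deriv G) z / z - (\<alpha> * (ln z)\<^sup>2 + (\<beta> + 2 * \<alpha>) * ln z + (\<gamma> + \<beta>))) \<longlongrightarrow> 0) (at_right 0)"
    and "((log_deriv ^^ 2) (log_deriv G) \<longlongrightarrow> 0) (at_right 0)"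
    by (rule C.corner_expansion)
  then have a0: "((\<lambda>z. log_deriv G z / z - (\<alpha> * (ln z)\<^sup>2 + \<beta> * ln z + \<gamma>)) \<longlongrightarrow> 0) (at_right 0)"
    and a1: "((\<lambda>z. log_deriv (log_deriv G) z / z - (\<alpha> * (ln z)\<^sup>2 + (\<beta> + 2 * \<alpha>) * ln z + (\<gamma> + \<beta>))) \<longlongrightarrow> 0) (at_right 0)" by simp_all
  interpret H: residual e0 "\<lambda>z. log_deriv G z - \<alpha> * P0 z" "\<lambda>z. log_deriv (log_deriv G) z - \<alpha> * P01 z" "\<lambda>z. log_deriv (log_deriv (log_deriv G)) z - \<alpha> * P02 z" "\<beta> + \<alpha>" \<gamma>
  proof
    show "(sqrt 5 - 1) / 2 < e0" "e0 < 1" by (rule golden)+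
  next
    fix t y :: real assume ty: "0 < y" "y < e0" "0 < t" "t < 1" "1 < t + y"
    have "ray_form (\<lambda>z. log_deriv G z - \<alpha> * P0 z) t y = ray_form (log_deriv G) t y - \<alpha> * ray_form P0 t y"
      unfolding ray_form_def Let_def by algebra
    then show "ray_form (\<lambda>z. log_deriv G z - \<alpha> * P0 z) t y = 0"
      using ray_form_log_deriv[OF ty] ray_form_P0[of t y] ty golden by simp
  next
    fix y assume y: "0 < y" "y < e0"
    then have "y < 1" using golden by simp
    note i = inversion_log_deriv[OF y] inversion_P0[OF y(1) this]
    have "(1 - y) * (log_deriv G y - \<alpha> * P0 y) = (1 - y) * log_deriv G y - \<alpha> * ((1 - y) * P0 y)" by algebra
    also have "\<dots> = y * (log_deriv G (1 - y) - \<alpha> * P0 (1 - y)) + (log_deriv G (1 - 1 / y) - \<alpha> * P0 (1 - 1 / y))" unfolding i by algebra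
    finally show "(1 - y) * (log_deriv G y - \<alpha> * P0 y) = y * (log_deriv G (1 - y) - \<alpha> * P0 (1 - y)) + (log_deriv G (1 - 1 / y) - \<alpha> * P0 (1 - 1 / y))" .
  next
    fix z :: real assume z: "0 < z" "z < 1"
    show "((\<lambda>z. log_deriv G z - \<alpha> * P0 z) has_real_derivative (log_deriv (log_deriv G) z - \<alpha> * P01 z) / z) (at z)"
      using DERIV_diff[OF log_deriv_deriv[OF z, of 0] DERIV_cmult[OF P0_deriv[OF z], of \<alpha>]] by (simp add: diff_divide_distrib)
    show "((\<lambda>z. log_deriv (log_deriv G) z - \<alpha> * P01 z) has_real_derivative (log_deriv (log_deriv (log_deriv G)) z - \<alpha> * P02 z) / z) (at z)"
      using DERIV_diff[OF log_deriv_deriv[OF z, of 1] DERIV_cmult[OF P01_deriv[OF z], of \<alpha>]] by (simp add: diff_divide_distrib)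
  next
    have "((\<lambda>z. (log_deriv G z / z - (\<alpha> * (ln z)\<^sup>2 + \<beta> * ln z + \<gamma>)) - \<alpha> * (P0 z / z - ((ln z)\<^sup>2 - ln z))) \<longlongrightarrow> 0 - \<alpha> * 0) (at_right 0)"
      by (intro tendsto_diff tendsto_mult tendsto_const a0 P0_asymp)
    then show "((\<lambda>z. (log_deriv G z - \<alpha> * P0 z) / z - ((\<beta> + \<alpha>) * ln z + \<gamma>)) \<longlongrightarrow> 0) (at_right 0)" by (simp add: diff_divide_distrib algebra_simps)
    have "((\<lambda>z. (log_deriv (log_deriv G) z / z - (\<alpha> * (ln z)\<^sup>2 + (\<beta> + 2 * \<alpha>) * ln z + (\<gamma> + \<beta>))) - \<alpha> * (P01 z / z - ((ln z)\<^sup>2 + ln z - 1))) \<longlongrightarrow> 0 - \<alpha> * 0) (at_right 0)"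
      by (intro tendsto_diff tendsto_mult tendsto_const a1 P01_asymp)
    then show "((\<lambda>z. (log_deriv (log_deriv G) z - \<alpha> * P01 z) / z - ((\<beta> + \<alpha>) * ln z + (\<gamma> + (\<beta> + \<alpha>)))) \<longlongrightarrow> 0) (at_right 0)" by (simp add: diff_divide_distrib algebra_simps)
  qed
  have "log_deriv G z = \<alpha> * P0 z" if z: "z < 1" "z \<noteq> 0" for z
  proof (cases "0 < z")
    case True then show ?thesis using H.R_zero(1)[of z] z by simp
  next
    case False
    then have "0 < - z" using z by simp
    then have "log_deriv G (- (- z)) - \<alpha> * P0 (- (- z)) = 0"
      using H.R_zero(2)[of "- z"] H.R_zero(3)[of "- z"] e0_square(2) by (cases "- z < e0") auto
    then show ?thesis by simp
  qed
  then show ?thesis by (intro that) blast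
qed

text \<open>
  \<open>G - 3 \<alpha> L3\<close> has derivative zero off 0 and is continuous at 0, so it is a constant \<open>c\<close>. The reflection at \<open>1/2\<close> determines it.
\<close>
theorem solution:
  obtains a where "\<forall>z<1. G z = a * (L3r z - 2 / 9 * Li3_one)"
proof -
  obtain \<alpha> where al: "\<forall>z<1. z \<noteq> 0 \<longrightarrow> log_deriv G z = \<alpha> * P0 z" by (rule log_deriv_G_multiple_of_P0)
  have Gd: "(G has_real_derivative log_deriv G z / z) (at z)" if "z < 1" "z \<noteq> 0" for z
    using G_deriv[of z] G_deriv_neg(2)[of "- z"] that by (cases "0 < z") auto
  have d: "((\<lambda>z. G z - 3 * \<alpha> * L3r z) has_real_derivative 0) (at z)" if z: "z < 1" "z \<noteq> 0" for z
  proof -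
    have e: "log_deriv G z / z - 3 * \<alpha> * (P0 z / (3 * z)) = 0" using al z by simp
    show ?thesis using DERIV_diff[OF Gd[OF z] DERIV_cmult[OF L3r_deriv[OF z], of "3 * \<alpha>"]] unfolding e .
  qed
  have "\<exists>c. \<forall>z\<in>{..<1}. G z - 3 * \<alpha> * L3r z = c"
  proof -
    have "continuous_on {..<1} (\<lambda>z. G z - 3 * \<alpha> * L3r z)"
    proof (intro continuous_at_imp_continuous_on ballI)
      fix z :: real assume z: "z \<in> {..<1}"
      show "isCont (\<lambda>z. G z - 3 * \<alpha> * L3r z) z"
      proof (cases "z = 0")
        case True then show ?thesis using cont0 L3r_isCont_0 by (auto intro!: continuous_intros)
      next
        case False then show ?thesis using DERIV_isCont[OF d] z by auto
      qed
    qed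
    then obtain c where "\<And>z. z \<in> {..<1} \<Longrightarrow> G z - 3 * \<alpha> * L3r z = c"
      by (rule DERIV_zero_connected_constant[OF connected_Iio open_lessThan finite.insertI[OF finite.emptyI, of 0]]) (use d in auto)
    then show ?thesis by blast
  qed
  then obtain c where "\<forall>z\<in>{..<1}. G z - 3 * \<alpha> * L3r z = c" by blast
  then have c: "G z = c + 3 * \<alpha> * L3r z" if "z < 1" for z using that by (simp add: diff_eq_eq)
  have "L3r 0 = 0" by (simp add: L3r_def L3_def)
  then have c0: "G 0 = c" using c[of 0] by simp
  have "2 * (G (1 / 2) + G (1 - 1 / 2) + N ((1 - 1 / 2) / (1 / 2))) + 3 * G 0 = 0" by (rule reflection) (use half in auto)
  moreover have "L3r (1 / 2) + L3r (1 - 1 / 2) + L3r (1 - 1 / (1 / 2)) = Li3_one" by (rule L3r_three_term) auto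
  ultimately have L: "2 * L3r (1 / 2) + L3r (- 1) = Li3_one" and e: "2 * (2 * G (1 / 2) + G (- 1)) + 3 * G 0 = 0"
    unfolding N_def by simp_all
  have "9 * c + 6 * \<alpha> * (2 * L3r (1 / 2) + L3r (- 1)) = 2 * (2 * G (1 / 2) + G (- 1)) + 3 * G 0"
    using c[of "1 / 2"] c[of "- 1"] c0 by (simp add: algebra_simps)
  then have "9 * c + 6 * \<alpha> * Li3_one = 0" unfolding L e .
  then have "c = - 2 / 9 * (3 * \<alpha>) * Li3_one" by simp
  then have "\<forall>z<1. G z = 3 * \<alpha> * (L3r z - 2 / 9 * Li3_one)" using c by (simp add: algebra_simps)
  then show ?thesis by (rule that)
qed

end

text \<open>
  Dividing the difference quotient at 0 by \<open>ln^2 z\<close> makes a differentiable function vanish in the limit, but L3 tends to \<open>1/3\<close>.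
\<close>
lemma multiple_of_L3r_differentiable:
  assumes "\<forall>z<1. G z = a * (L3r z - c)" "G differentiable (at 0)"
  shows "a = 0"
proof -
  obtain D where "(G has_real_derivative D) (at 0)" using assms(2) by (auto simp: real_differentiable_def)
  then have "((\<lambda>z. (G z - G 0) / z) \<longlongrightarrow> D) (at 0)" by (simp add: has_field_derivative_iff)
  then have D: "((\<lambda>z. (G z - G 0) / z) \<longlongrightarrow> D) (at_right 0)" by (rule tendsto_within_subset) simp
  have l: "((\<lambda>z::real. 1 / (ln z)\<^sup>2) \<longlongrightarrow> 0) (at_right 0)" by real_asymp
  have "((\<lambda>z. (G z - G 0) / z * (1 / (ln z)\<^sup>2) - a * (L3r z / (z * (ln z)\<^sup>2))) \<longlongrightarrow> D * 0 - a * (1 / 3)) (at_right 0)"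
    by (intro tendsto_diff tendsto_mult tendsto_const D l L3r_steep)
  moreover have "eventually (\<lambda>z. (G z - G 0) / z * (1 / (ln z)\<^sup>2) - a * (L3r z / (z * (ln z)\<^sup>2)) = 0) (at_right 0)"
    unfolding eventually_at_right_field
  proof (intro exI[of _ 1] conjI allI impI)
    fix z :: real assume z: "0 < z" "z < 1"
    have "L3r 0 = 0" by (simp add: L3r_def L3_def)
    then have "G z - G 0 = a * L3r z" using assms(1)[rule_format, of z] assms(1)[rule_format, of 0] z by (simp add: right_diff_distrib)
    then show "(G z - G 0) / z * (1 / (ln z)\<^sup>2) - a * (L3r z / (z * (ln z)\<^sup>2)) = 0" by simp
  qed simp
  ultimately have "((\<lambda>z. 0) \<longlongrightarrow> D * 0 - a * (1 / 3)) (at_right (0::real))" by (rule Lim_transform_eventually)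
  then have "0 = D * 0 - a * (1 / 3)" by (intro tendsto_unique[OF trivial_limit_at_right_real tendsto_const])
  then show ?thesis by simp
qed

theorem proposition4:
  fixes eps0 :: real and F :: "real \<Rightarrow> real"
  assumes eps0: "(sqrt 5 - 1) / 2 < eps0" "eps0 < 1"
    and meas: "F \<in> borel_measurable (lebesgue_on {..<1})"
    and eq: "\<And>x y :: real. 0 < x \<Longrightarrow> x < y \<Longrightarrow> y < eps0 \<Longrightarrow>
      2 * F (U1 x y) + 2 * F (U2 x y) - F (U3 x y) + 2 * F (U4 x y) + 2 * F (U5 x y)
      - F (U6 x y) + 2 * F (U7 x y) + 2 * F (U8 x y) - F (U9 x y) = E3 x y"
  shows "(isCont F 0 \<longrightarrow>
            (\<exists>a::real. \<forall>z<1. F z = Li 3 z + a * (L3 (complex_of_real z) - 2 / 9 * Li3_one)))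
       \<and> (F differentiable (at 0) \<longrightarrow> (\<forall>z<1. F z = Li 3 z))"
proof -
  define G where "G z = F z - Li 3 z" for z
  have family: "\<exists>a. \<forall>z<1. G z = a * (L3r z - 2 / 9 * Li3_one)" if "isCont F 0"
  proof -
    interpret kummer eps0 G
    proof
      have "continuous_on {..<1} (Li 3)" using Li_isCont by (intro continuous_at_imp_continuous_on) auto
      then have "Li 3 \<in> borel_measurable (lebesgue_on {..<1})" by (rule continuous_imp_measurable_on_sets_lebesgue) simp
      then show "G \<in> borel_measurable (lebesgue_on {..<1})" unfolding G_def[abs_def] by (intro borel_measurable_diff meas)
      show "isCont G 0" unfolding G_def[abs_def] using that Li_isCont[of 0 3] by (intro continuous_intros) auto
      fix x y assume xy: "0 < x" "x < y" "y < eps0"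
      show "2 * G x + 2 * G y - G (x / y) + 2 * G ((1 - y) / (1 - x)) + 2 * G (x * (1 - y) / (y * (1 - x)))
        - G (x * y) + 2 * G (x * (1 - y) / (x - 1)) + 2 * G ((1 - y) / (y * (x - 1))) - G (x * (1 - y)\<^sup>2 / (y * (1 - x)\<^sup>2)) = 0"
        using eq[OF xy] spence_kummer[OF xy(1,2)] xy(3) eps0(2)
        unfolding G_def U1_def U2_def U3_def U4_def U5_def U6_def U7_def U8_def U9_def by (simp only: right_diff_distrib) linarith
    qed (rule eps0)+
    show ?thesis by (rule solution) blast
  qed
  show ?thesis
  proof (intro conjI impI)
    assume "isCont F 0"
    from family[OF this] obtain a where "\<forall>z<1. G z = a * (L3r z - 2 / 9 * Li3_one)" by blast
    then show "\<exists>a::real. \<forall>z<1. F z = Li 3 z + a * (L3 (complex_of_real z) - 2 / 9 * Li3_one)"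
      by (intro exI[of _ a] allI impI) (force simp: G_def L3r_def)
  next
    assume dF: "F differentiable (at 0)"
    then have "isCont F 0" by (rule differentiable_imp_continuous_within)
    from family[OF this] obtain a where a: "\<forall>z<1. G z = a * (L3r z - 2 / 9 * Li3_one)" by blast
    have "G differentiable (at 0)"
      unfolding G_def[abs_def] using dF Li_has_derivative_Re[of 0 3] by (intro differentiable_diff) (auto simp: real_differentiable_def)
    from multiple_of_L3r_differentiable[OF a this] show "\<forall>z<1. F z = Li 3 z" using a by (simp add: G_def)
  qed
qed

end
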